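(* Let $\pi:M\to B$ be a Riemannian submersion between complete Riemannian manifolds. Let $f:\mathbf R\to\mathbf R$ be a smooth strictly convex function that is strictly increasing on $\mathbf R_+$, and let $c_M=f\circ\operatorname{dist}_M$ on $M\times M$ and $c_B=f\circ\operatorname{dist}_B$ on $B\times B$, where $\operatorname{dist}$ denotes the Riemannian distance of the corresponding manifold. Assume $c_M$ and $c_B$ are of class $C^4$ and non-degenerate on $N_M:=M\times M\setminus\text{cut-locus}$ and $N_B:=B\times B\setminus\text{cut-locus}$ respectively, so that they induce pseudo-Riemannian metrics $h_M$ on $N_M$ and $h_B$ on $N_B$. Fix $(x,\bar x)\in N_B$ and let $(\tilde x,\tilde{\bar x})\in N_M$ be a horizontal lift of $(x,\bar x)$. Given $v\oplus\bar v\in T_{(x,\bar x)}N_B$, there exists $\tilde w\oplus\tilde{\bar w}\in T_{(\tilde x,\tilde{\bar x})}N_M$ with $d\pi_{\tilde x}(\tilde w)=v$ and $d\pi_{\tilde{\bar x}}(\tilde{\bar w})=\bar v$ such that $$h_B(v\oplus\bar v,v\oplus\bar v)=h_M(\tilde w\oplus\tilde{\bar w},\tilde w\oplus\tilde{\bar w})$$ and $$\operatorname{cross}^{(N_B,h_B)}_{(x,\bar x)}(v,\bar v)\ \ge\ \operatorname{cross}^{(N_M,h_M)}_{(\tilde x,\tilde{\bar x})}(\tilde w,\tilde{\bar w}).$$ For example, it suffices to take $\tilde w,\tilde{\bar w}$ such that $\tilde w^*=-\bar DDc_M(\tilde x,\tilde{\bar x})\tilde{\bar w}\in T^*_{\tilde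 x}M$ is the horizontal lift of $v^*=-\bar DDc_B(x,\bar x)\bar v\in T_x^*B$, and $\tilde{\bar w}^*=-D\bar Dc_M(\tilde x,\tilde{\bar x})\tilde w\in T^*_{\tilde{\bar x}}M$ is the horizontal lift of $\bar v^*=-D\bar Dc_B(x,\bar x)v\in T^*_{\bar x}B$.
   Context: Here $\text{cut-locus}$ denotes the set of pairs $(x,\bar x)$ with $\bar x$ in the cut locus of $x$. $D$, $\bar D$ are differentials in the first and second variable; e.g. $\bar DDc(x,\bar x)\bar v$ is the covector $p\mapsto c_{i\bar j}\,p^i\bar v^{\bar j}$ at $x$, and $D\bar Dc(x,\bar x)v$ is the covector $\bar p\mapsto c_{i\bar j}\,v^i\bar p^{\bar j}$ at $\bar x$, with subscripts denoting partial derivatives in local coordinates $x^i$ (first variable) and $x^{\bar j}$ (second variable). A cost $c$ is non-degenerate on an open set $N$ if $(c_{i\bar j})$ is invertible at every point of $N$. A non-degenerate cost $c\in C^4(N)$ induces the pseudo-Riemannian metric $$h=\begin{pmatrix}0&-\frac12\bar DDc\\-\frac12 D\bar Dc&0\end{pmatrix},\qquad\text{i.e. } h(p\oplus\bar p,p\oplus\bar p)=-c_{i\bar j}\,p^i\bar p^{\bar j},$$ and the cross-curvature $\operatorname{cross}^{(N,h)}_{(x,\bar x)}(p,\bar p)=R_h((p\oplus0)\wedge(0\oplus\bar p),(p\oplus0)\wedge(0\oplus\bar p))$, with $R_h$ the Riemann curvature operator of $h$, with sign and normalization such that $$\operatorname{cross}_{(x,\bar x)}(p,\bar p)=2\left(-c_{ij\bar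 k\bar l}+c_{ij\bar a}\,c^{\bar a b}\,c_{b\bar k\bar l}\right)p^ip^j\bar p^{\bar k}\bar p^{\bar l},$$ $(c^{\bar a b})$ being the inverse of $(c_{b\bar a})$. A Riemannian submersion is a surjective smooth map $\pi:M\to B$ such that each $d\pi_x$ is surjective and restricts to an isometry from the horizontal space $(\ker d\pi_x)^\perp$ onto $T_{\pi(x)}B$. The horizontal lift at $\tilde x\in\pi^{-1}(x)$ of $v\in T_xB$ is the unique horizontal $\tilde v\in T_{\tilde x}M$ with $d\pi(\tilde v)=v$; horizontal lifts of covectors are defined by identifying vectors and covectors via the Riemannian metrics. A horizontal lift of a curve $\gamma$ in $B$ is a curve $\tilde\gamma$ in $M$ with $\pi\circ\tilde\gamma=\gamma$ and horizontal velocity. For $(x,\bar x)\in N_B$, let $\gamma:[0,1]\to B$ be the unique minimizing geodesic from $x$ to $\bar x$ and $\tilde\gamma$ a horizontal lift of $\gamma$; then the pair $(\tilde x,\tilde{\bar x})=(\tilde\gamma(0),\tilde\gamma(1))$, which belongs to $N_M$, is called a horizontal lift of $(x,\bar x)$. *)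

theory Defs
  imports "HOL-Analysis.Analysis"
begin

section \<open>Functions of class $C^k$ on Euclidean spaces\<close>

fun C_k_on :: "nat \<Rightarrow> ('e::euclidean_space \<Rightarrow> 'f::euclidean_space) \<Rightarrow> 'e set \<Rightarrow> bool" where
  "C_k_on 0 F S \<longleftrightarrow> continuous_on S F"
| "C_k_on (Suc k) F S \<longleftrightarrow>
     (\<forall>s\<in>S. F differentiable (at s)) \<and>
     (\<forall>u. C_k_on k (\<lambda>s. frechet_derivative F (at s) u) S)"

definition smooth_on :: "('e::euclidean_space \<Rightarrow> 'f::euclidean_space) \<Rightarrow> 'e set \<Rightarrow> bool" where
  "smooth_on F S \<longleftrightarrow> (\<forall>k. C_k_on k F S)"

definition strictly_convex :: "(real \<Rightarrow> real) \<Rightarrow> bool" where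
  "strictly_convex f \<longleftrightarrow>
     (\<forall>x y t. x \<noteq> y \<and> 0 < t \<and> t < 1 \<longrightarrow> f ((1 - t) * x + t * y) < (1 - t) * f x + t * f y)"

section \<open>Smooth manifolds\<close>

text \<open>The underlying space of a manifold is a whole type \<open>'a\<close>, Hausdorff and second countable;
  it is modelled on the Euclidean space \<open>'e\<close>. A chart is its domain with the coordinate map; the
  values of the coordinate map outside the domain are irrelevant.\<close>

type_synonym ('a, 'e) chart = "'a set \<times> ('a \<Rightarrow> 'e)"

abbreviation chart_image :: "('a, 'e) chart \<Rightarrow> 'e set" where
  "chart_image \<kappa> \<equiv> snd \<kappa> ` fst \<kappa>"

definition chart_inv :: "('a, 'e) chart \<Rightarrow> 'e \<Rightarrow> 'a" where
  "chart_inv \<kappa> = inv_into (fst \<kappa>) (snd \<kappa>)"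

definition smooth_atlas ::
  "('a::{t2_space,second_countable_topology}, 'e::euclidean_space) chart set \<Rightarrow> bool" where
  "smooth_atlas A \<longleftrightarrow>
     (\<Union>\<kappa>\<in>A. fst \<kappa>) = UNIV \<and>
     (\<forall>\<kappa>\<in>A. open (fst \<kappa>) \<and> open (chart_image \<kappa>) \<and>
        homeomorphism (fst \<kappa>) (chart_image \<kappa>) (snd \<kappa>) (chart_inv \<kappa>)) \<and>
     (\<forall>\<kappa>\<in>A. \<forall>\<kappa>'\<in>A. smooth_on (snd \<kappa>' \<circ> chart_inv \<kappa>) (snd \<kappa> ` (fst \<kappa> \<inter> fst \<kappa>')))"

text \<open>A preferred chart is chosen at every point \<open>x\<close>, and the tangent space at \<open>x\<close> is the model
  space \<open>'e\<close>: a vector of \<open>'e\<close> stands for the tangent vector having these components in the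
  preferred chart at \<open>x\<close>. Covectors at \<open>x\<close> are functionals on \<open>'e\<close>. All the notions below are
  invariant under changes of charts, so that the choice is immaterial.\<close>

definition chart_at :: "('a, 'e) chart set \<Rightarrow> 'a \<Rightarrow> ('a, 'e) chart" where
  "chart_at A x = (SOME \<kappa>. \<kappa> \<in> A \<and> x \<in> fst \<kappa>)"

definition coords :: "('a, 'e) chart set \<Rightarrow> 'a \<Rightarrow> 'e" where
  "coords A x = snd (chart_at A x) x"

definition smooth_map ::
  "('a::topological_space, 'e::euclidean_space) chart set \<Rightarrow>
   ('b::topological_space, 'f::euclidean_space) chart set \<Rightarrow> ('a \<Rightarrow> 'b) \<Rightarrow> bool" where
  "smooth_map A B F \<longleftrightarrow>
     continuous_on UNIV F \<and>
     (\<forall>\<kappa>\<in>A. \<forall>\<kappa>'\<in>B. smooth_on (snd \<kappa>' \<circ> F \<circ> chart_inv \<kappa>) (snd \<kappa> ` (fst \<kappa> \<inter> F -` fst \<kappa>')))"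

definition differential ::
  "('a, 'e::euclidean_space) chart set \<Rightarrow> ('b, 'f::euclidean_space) chart set \<Rightarrow>
   ('a \<Rightarrow> 'b) \<Rightarrow> 'a \<Rightarrow> 'e \<Rightarrow> 'f" where
  "differential A B F x =
     frechet_derivative (snd (chart_at B (F x)) \<circ> F \<circ> chart_inv (chart_at A x)) (at (coords A x))"

section \<open>Levi-Civita connection and curvature in coordinates\<close>

text \<open>Here \<open>G z\<close> is the value at \<open>z\<close> of a pseudo-Riemannian metric on an open subset of a Euclidean
  space. \<open>christoffel G z u v\<close> is $\nabla_u v$ at \<open>z\<close> for constant vector fields
  \<open>u\<close>, \<open>v\<close>, characterized by the Koszul formula, and \<open>curvature G z u v w\<close> is
  $R(u,v)w=\nabla_u\nabla_v w-\nabla_v\nabla_u w$.\<close>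

definition christoffel ::
  "('f::euclidean_space \<Rightarrow> 'f \<Rightarrow> 'f \<Rightarrow> real) \<Rightarrow> 'f \<Rightarrow> 'f \<Rightarrow> 'f \<Rightarrow> 'f" where
  "christoffel G z u v = (THE w. \<forall>q. G z w q =
     (frechet_derivative (\<lambda>y. G y v q) (at z) u
      + frechet_derivative (\<lambda>y. G y u q) (at z) v
      - frechet_derivative (\<lambda>y. G y u v) (at z) q) / 2)"

definition curvature ::
  "('f::euclidean_space \<Rightarrow> 'f \<Rightarrow> 'f \<Rightarrow> real) \<Rightarrow> 'f \<Rightarrow> 'f \<Rightarrow> 'f \<Rightarrow> 'f \<Rightarrow> 'f" where
  "curvature G z u v w =
     frechet_derivative (\<lambda>y. christoffel G y v w) (at z) u
     - frechet_derivative (\<lambda>y. christoffel G y u w) (at z) v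
     + christoffel G z u (christoffel G z v w)
     - christoffel G z v (christoffel G z u w)"

text \<open>The curvature operator $R(u\wedge v,p\wedge q)$ is the full contraction of the curvature tensor
  with the bivectors $u\otimes v-v\otimes u$ and $p\otimes q-q\otimes p$; by antisymmetry this is four
  times the value of the tensor at \<open>u\<close>, \<open>v\<close>, \<open>p\<close>, \<open>q\<close>. The sign is the one for which
  $R(u\wedge v,u\wedge v)>0$ on round spheres. For the metric $h$ of a cost $c$ (defined below) the
  vectors $p\oplus 0$ and $0\oplus\bar p$ satisfy
  $h(R(p,\bar p)\bar p,p)=\frac12(-c_{ij\bar k\bar l}+c_{ij\bar a}c^{\bar a b}c_{b\bar k\bar l})
  p^ip^j\bar p^{\bar k}\bar p^{\bar l}$, so the factor 4 yields the customary
  normalization of the cross-curvature, with leading factor 2.\<close>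

definition curvature_operator ::
  "('f::euclidean_space \<Rightarrow> 'f \<Rightarrow> 'f \<Rightarrow> real) \<Rightarrow> 'f \<Rightarrow> 'f \<times> 'f \<Rightarrow> 'f \<times> 'f \<Rightarrow> real" where
  "curvature_operator G z = (\<lambda>(u, v) (p, q). 4 * G z (curvature G z u v q) p)"

section \<open>Riemannian manifolds\<close>

definition coord_metric ::
  "('a, 'e::euclidean_space) chart set \<Rightarrow> ('a \<Rightarrow> 'e \<Rightarrow> 'e \<Rightarrow> real) \<Rightarrow> ('a, 'e) chart \<Rightarrow>
   'e \<Rightarrow> 'e \<Rightarrow> 'e \<Rightarrow> real" where
  "coord_metric A g \<kappa> s u v =
     (let x = chart_inv \<kappa> s;
          D = frechet_derivative (snd (chart_at A x) \<circ> chart_inv \<kappa>) (at s)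
      in g x (D u) (D v))"

definition riemannian_metric ::
  "('a, 'e::euclidean_space) chart set \<Rightarrow> ('a \<Rightarrow> 'e \<Rightarrow> 'e \<Rightarrow> real) \<Rightarrow> bool" where
  "riemannian_metric A g \<longleftrightarrow>
     (\<forall>x. bilinear (g x) \<and> (\<forall>u v. g x u v = g x v u) \<and> (\<forall>u. u \<noteq> 0 \<longrightarrow> g x u u > 0)) \<and>
     (\<forall>\<kappa>\<in>A. \<forall>u v. smooth_on (\<lambda>s. coord_metric A g \<kappa> s u v) (chart_image \<kappa>))"

definition C1_curve_on ::
  "('a::topological_space, 'e::euclidean_space) chart set \<Rightarrow> real set \<Rightarrow> (real \<Rightarrow> 'a) \<Rightarrow> bool" where
  "C1_curve_on A I \<gamma> \<longleftrightarrow>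
     continuous_on I \<gamma> \<and>
     (\<forall>\<kappa>\<in>A. \<exists>y'. continuous_on {t\<in>I. \<gamma> t \<in> fst \<kappa>} y' \<and>
        (\<forall>t\<in>{t\<in>I. \<gamma> t \<in> fst \<kappa>}. (snd \<kappa> \<circ> \<gamma> has_vector_derivative y' t) (at t within I)))"

text \<open>One-sided derivatives exist at the break points, so the speed of a piecewise $C^1$ curve is
  bounded and integrable.\<close>

definition piecewise_C1_curve ::
  "('a::topological_space, 'e::euclidean_space) chart set \<Rightarrow> (real \<Rightarrow> 'a) \<Rightarrow> bool" where
  "piecewise_C1_curve A \<gamma> \<longleftrightarrow>
     continuous_on {0..1} \<gamma> \<and>
     (\<exists>P. finite P \<and>
        (\<forall>a b. 0 \<le> a \<and> a < b \<and> b \<le> 1 \<and> {a<..<b} \<inter> P = {} \<longrightarrow> C1_curve_on A {a..b} \<gamma>))"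

definition velocity ::
  "('a, 'e::euclidean_space) chart set \<Rightarrow> real set \<Rightarrow> (real \<Rightarrow> 'a) \<Rightarrow> real \<Rightarrow> 'e" where
  "velocity A I \<gamma> t = vector_derivative (snd (chart_at A (\<gamma> t)) \<circ> \<gamma>) (at t within I)"

definition curve_length ::
  "('a, 'e::euclidean_space) chart set \<Rightarrow> ('a \<Rightarrow> 'e \<Rightarrow> 'e \<Rightarrow> real) \<Rightarrow> (real \<Rightarrow> 'a) \<Rightarrow> real" where
  "curve_length A g \<gamma> =
     integral {0..1} (\<lambda>t. sqrt (g (\<gamma> t) (velocity A {0..1} \<gamma> t) (velocity A {0..1} \<gamma> t)))"

definition riemannian_dist ::
  "('a::topological_space, 'e::euclidean_space) chart set \<Rightarrow> ('a \<Rightarrow> 'e \<Rightarrow> 'e \<Rightarrow> real) \<Rightarrow>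
   'a \<Rightarrow> 'a \<Rightarrow> real" where
  "riemannian_dist A g x y =
     Inf {curve_length A g \<gamma> | \<gamma>. piecewise_C1_curve A \<gamma> \<and> \<gamma> 0 = x \<and> \<gamma> 1 = y}"

definition complete_riemannian_manifold ::
  "('a::{t2_space,second_countable_topology}, 'e::euclidean_space) chart set \<Rightarrow>
   ('a \<Rightarrow> 'e \<Rightarrow> 'e \<Rightarrow> real) \<Rightarrow> bool" where
  "complete_riemannian_manifold A g \<longleftrightarrow>
     smooth_atlas A \<and> riemannian_metric A g \<and> connected (UNIV :: 'a set) \<and>
     Metric_space.mcomplete UNIV (riemannian_dist A g)"

definition geodesic_on ::
  "('a::topological_space, 'e::euclidean_space) chart set \<Rightarrow> ('a \<Rightarrow> 'e \<Rightarrow> 'e \<Rightarrow> real) \<Rightarrow>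
   real set \<Rightarrow> (real \<Rightarrow> 'a) \<Rightarrow> bool" where
  "geodesic_on A g I \<gamma> \<longleftrightarrow>
     continuous_on I \<gamma> \<and>
     (\<forall>\<kappa>\<in>A. \<exists>y' y''. \<forall>t\<in>{t\<in>I. \<gamma> t \<in> fst \<kappa>}.
        (snd \<kappa> \<circ> \<gamma> has_vector_derivative y' t) (at t within I) \<and>
        (y' has_vector_derivative y'' t) (at t within I) \<and>
        y'' t + christoffel (coord_metric A g \<kappa>) (snd \<kappa> (\<gamma> t)) (y' t) (y' t) = 0)"

definition minimizing_geodesic ::
  "('a::topological_space, 'e::euclidean_space) chart set \<Rightarrow> ('a \<Rightarrow> 'e \<Rightarrow> 'e \<Rightarrow> real) \<Rightarrow>
   (real \<Rightarrow> 'a) \<Rightarrow> bool" where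
  "minimizing_geodesic A g \<gamma> \<longleftrightarrow>
     geodesic_on A g {0..1} \<gamma> \<and> curve_length A g \<gamma> = riemannian_dist A g (\<gamma> 0) (\<gamma> 1)"

text \<open>The pairs $(x,\gamma(t_0))$ for which $\gamma(t_0)$ is the cut point of $x=\gamma(0)$ along some
  unit speed geodesic ray $\gamma$, i.e. \<open>\<gamma>\<close> minimizes up to $t_0$ but not beyond.\<close>

definition cut_locus ::
  "('a::topological_space, 'e::euclidean_space) chart set \<Rightarrow> ('a \<Rightarrow> 'e \<Rightarrow> 'e \<Rightarrow> real) \<Rightarrow>
   ('a \<times> 'a) set" where
  "cut_locus A g = {(x, y). \<exists>\<gamma> t0.
     geodesic_on A g {0..} \<gamma> \<and>
     (\<forall>t\<ge>0. g (\<gamma> t) (velocity A {0..} \<gamma> t) (velocity A {0..} \<gamma> t) = 1) \<and>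
     \<gamma> 0 = x \<and> t0 > 0 \<and> \<gamma> t0 = y \<and>
     (\<forall>t\<in>{0..t0}. riemannian_dist A g x (\<gamma> t) = t) \<and>
     (\<forall>t>t0. riemannian_dist A g x (\<gamma> t) < t)}"

section \<open>Riemannian submersions and horizontal lifts\<close>

definition horizontal_space ::
  "('a, 'e::euclidean_space) chart set \<Rightarrow> ('a \<Rightarrow> 'e \<Rightarrow> 'e \<Rightarrow> real) \<Rightarrow>
   ('b, 'f::euclidean_space) chart set \<Rightarrow> ('a \<Rightarrow> 'b) \<Rightarrow> 'a \<Rightarrow> 'e set" where
  "horizontal_space A gA B \<pi> x = {u. \<forall>v. differential A B \<pi> x v = 0 \<longrightarrow> gA x u v = 0}"

definition riemannian_submersion ::
  "('a::topological_space, 'e::euclidean_space) chart set \<Rightarrow> ('a \<Rightarrow> 'e \<Rightarrow> 'e \<Rightarrow> real) \<Rightarrow>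
   ('b::topological_space, 'f::euclidean_space) chart set \<Rightarrow> ('b \<Rightarrow> 'f \<Rightarrow> 'f \<Rightarrow> real) \<Rightarrow>
   ('a \<Rightarrow> 'b) \<Rightarrow> bool" where
  "riemannian_submersion A gA B gB \<pi> \<longleftrightarrow>
     surj \<pi> \<and> smooth_map A B \<pi> \<and>
     (\<forall>x. surj (differential A B \<pi> x) \<and>
          bij_betw (differential A B \<pi> x) (horizontal_space A gA B \<pi> x) UNIV \<and>
          (\<forall>u\<in>horizontal_space A gA B \<pi> x. \<forall>v\<in>horizontal_space A gA B \<pi> x.
             gB (\<pi> x) (differential A B \<pi> x u) (differential A B \<pi> x v) = gA x u v))"

definition horizontal_lift_vector ::
  "('a, 'e::euclidean_space) chart set \<Rightarrow> ('a \<Rightarrow> 'e \<Rightarrow> 'e \<Rightarrow> real) \<Rightarrow>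
   ('b, 'f::euclidean_space) chart set \<Rightarrow> ('a \<Rightarrow> 'b) \<Rightarrow> 'a \<Rightarrow> 'f \<Rightarrow> 'e \<Rightarrow> bool" where
  "horizontal_lift_vector A gA B \<pi> x v u \<longleftrightarrow>
     u \<in> horizontal_space A gA B \<pi> x \<and> differential A B \<pi> x u = v"

definition horizontal_lift_covector ::
  "('a, 'e::euclidean_space) chart set \<Rightarrow> ('a \<Rightarrow> 'e \<Rightarrow> 'e \<Rightarrow> real) \<Rightarrow>
   ('b, 'f::euclidean_space) chart set \<Rightarrow> ('b \<Rightarrow> 'f \<Rightarrow> 'f \<Rightarrow> real) \<Rightarrow> ('a \<Rightarrow> 'b) \<Rightarrow> 'a \<Rightarrow>
   ('f \<Rightarrow> real) \<Rightarrow> ('e \<Rightarrow> real) \<Rightarrow> bool" where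
  "horizontal_lift_covector A gA B gB \<pi> x \<alpha> \<beta> \<longleftrightarrow>
     (\<exists>v u. \<alpha> = gB (\<pi> x) v \<and> \<beta> = gA x u \<and> horizontal_lift_vector A gA B \<pi> x v u)"

definition horizontal_lift_curve ::
  "('a::topological_space, 'e::euclidean_space) chart set \<Rightarrow> ('a \<Rightarrow> 'e \<Rightarrow> 'e \<Rightarrow> real) \<Rightarrow>
   ('b, 'f::euclidean_space) chart set \<Rightarrow> ('a \<Rightarrow> 'b) \<Rightarrow> (real \<Rightarrow> 'b) \<Rightarrow> (real \<Rightarrow> 'a) \<Rightarrow> bool" where
  "horizontal_lift_curve A gA B \<pi> \<gamma> \<eta> \<longleftrightarrow>
     C1_curve_on A {0..1} \<eta> \<and>
     (\<forall>t\<in>{0..1}. \<pi> (\<eta> t) = \<gamma> t \<and> velocity A {0..1} \<eta> t \<in> horizontal_space A gA B \<pi> (\<eta> t))"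

definition horizontal_lift_pair ::
  "('a::topological_space, 'e::euclidean_space) chart set \<Rightarrow> ('a \<Rightarrow> 'e \<Rightarrow> 'e \<Rightarrow> real) \<Rightarrow>
   ('b::topological_space, 'f::euclidean_space) chart set \<Rightarrow> ('b \<Rightarrow> 'f \<Rightarrow> 'f \<Rightarrow> real) \<Rightarrow>
   ('a \<Rightarrow> 'b) \<Rightarrow> 'b \<times> 'b \<Rightarrow> 'a \<times> 'a \<Rightarrow> bool" where
  "horizontal_lift_pair A gA B gB \<pi> X Y \<longleftrightarrow>
     (\<exists>\<gamma> \<eta>. minimizing_geodesic B gB \<gamma> \<and> \<gamma> 0 = fst X \<and> \<gamma> 1 = snd X \<and>
            horizontal_lift_curve A gA B \<pi> \<gamma> \<eta> \<and> \<eta> 0 = fst Y \<and> \<eta> 1 = snd Y)"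

section \<open>Costs, the induced pseudo-Riemannian metric and its cross-curvature\<close>

definition coord_cost ::
  "('a, 'e) chart \<Rightarrow> ('a, 'e) chart \<Rightarrow> ('a \<times> 'a \<Rightarrow> real) \<Rightarrow> 'e \<times> 'e \<Rightarrow> real" where
  "coord_cost \<kappa> \<kappa>' c = (\<lambda>(s, t). c (chart_inv \<kappa> s, chart_inv \<kappa>' t))"

definition C_k_cost ::
  "nat \<Rightarrow> ('a, 'e::euclidean_space) chart set \<Rightarrow> ('a \<times> 'a) set \<Rightarrow> ('a \<times> 'a \<Rightarrow> real) \<Rightarrow> bool" where
  "C_k_cost k A N c \<longleftrightarrow>
     (\<forall>\<kappa>\<in>A. \<forall>\<kappa>'\<in>A. C_k_on k (coord_cost \<kappa> \<kappa>' c)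
        (map_prod (snd \<kappa>) (snd \<kappa>') ` (N \<inter> fst \<kappa> \<times> fst \<kappa>')))"

text \<open>$c_{i\bar j}\,p^i\bar p^{\bar j}$ for a function $c$ of two Euclidean variables.\<close>

definition mixed_deriv ::
  "('e::euclidean_space \<times> 'e \<Rightarrow> real) \<Rightarrow> 'e \<times> 'e \<Rightarrow> 'e \<Rightarrow> 'e \<Rightarrow> real" where
  "mixed_deriv C z p pb =
     frechet_derivative (\<lambda>s. frechet_derivative (\<lambda>t. C (s, t)) (at (snd z)) pb) (at (fst z)) p"

definition mixed_form ::
  "('a, 'e::euclidean_space) chart set \<Rightarrow> ('a \<times> 'a \<Rightarrow> real) \<Rightarrow> 'a \<times> 'a \<Rightarrow> 'e \<Rightarrow> 'e \<Rightarrow> real" where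
  "mixed_form A c X =
     mixed_deriv (coord_cost (chart_at A (fst X)) (chart_at A (snd X)) c)
       (coords A (fst X), coords A (snd X))"

definition nondegenerate_cost ::
  "('a, 'e::euclidean_space) chart set \<Rightarrow> ('a \<times> 'a) set \<Rightarrow> ('a \<times> 'a \<Rightarrow> real) \<Rightarrow> bool" where
  "nondegenerate_cost A N c \<longleftrightarrow>
     (\<forall>X\<in>N. \<exists>d :: 'e \<Rightarrow> 'e \<Rightarrow> real. \<forall>i\<in>Basis. \<forall>j\<in>Basis.
        (\<Sum>k\<in>Basis. mixed_form A c X i k * d k j) = (if i = j then 1 else 0) \<and>
        (\<Sum>k\<in>Basis. d i k * mixed_form A c X k j) = (if i = j then 1 else 0))"

text \<open>\<open>DbarD\<close> is the covector $\bar DDc(x,\bar x)\bar v$ at $x$, and \<open>DDbar\<close> the covector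
  $D\bar Dc(x,\bar x)v$ at $\bar x$.\<close>

definition DbarD ::
  "('a, 'e::euclidean_space) chart set \<Rightarrow> ('a \<times> 'a \<Rightarrow> real) \<Rightarrow> 'a \<times> 'a \<Rightarrow> 'e \<Rightarrow> ('e \<Rightarrow> real)" where
  "DbarD A c X vb = (\<lambda>p. mixed_form A c X p vb)"

definition DDbar ::
  "('a, 'e::euclidean_space) chart set \<Rightarrow> ('a \<times> 'a \<Rightarrow> real) \<Rightarrow> 'a \<times> 'a \<Rightarrow> 'e \<Rightarrow> ('e \<Rightarrow> real)" where
  "DDbar A c X v = (\<lambda>pb. mixed_form A c X v pb)"

text \<open>The metric $h$ in product coordinates, as a metric on an open subset of \<open>'e \<times> 'e\<close>.\<close>

definition coord_h ::
  "('e::euclidean_space \<times> 'e \<Rightarrow> real) \<Rightarrow> 'e \<times> 'e \<Rightarrow> 'e \<times> 'e \<Rightarrow> 'e \<times> 'e \<Rightarrow> real" where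
  "coord_h C z = (\<lambda>(p, pb) (q, qb). - (mixed_deriv C z p qb + mixed_deriv C z q pb) / 2)"

definition cost_metric ::
  "('a, 'e::euclidean_space) chart set \<Rightarrow> ('a \<times> 'a \<Rightarrow> real) \<Rightarrow> 'a \<times> 'a \<Rightarrow>
   'e \<times> 'e \<Rightarrow> 'e \<times> 'e \<Rightarrow> real" where
  "cost_metric A c X =
     coord_h (coord_cost (chart_at A (fst X)) (chart_at A (snd X)) c)
       (coords A (fst X), coords A (snd X))"

definition cross_curvature ::
  "('a, 'e::euclidean_space) chart set \<Rightarrow> ('a \<times> 'a \<Rightarrow> real) \<Rightarrow> 'a \<times> 'a \<Rightarrow> 'e \<Rightarrow> 'e \<Rightarrow> real" where
  "cross_curvature A c X p pb =
     curvature_operator (coord_h (coord_cost (chart_at A (fst X)) (chart_at A (snd X)) c))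
       (coords A (fst X), coords A (snd X)) ((p, 0), (0, pb)) ((p, 0), (0, pb))"

definition dist_cost ::
  "('a::topological_space, 'e::euclidean_space) chart set \<Rightarrow> ('a \<Rightarrow> 'e \<Rightarrow> 'e \<Rightarrow> real) \<Rightarrow>
   (real \<Rightarrow> real) \<Rightarrow> 'a \<times> 'a \<Rightarrow> real" where
  "dist_cost A g f = (\<lambda>(x, y). f (riemannian_dist A g x y))"

end

theory Submission
  imports Defs
begin

text \<open>
  A Riemannian submersion does not increase distances, and through every point \<open>y\<close> over \<open>x\<close> and for
  every \<open>x'\<close> there is \<open>y'\<close> over \<open>x'\<close> with $d_M(y,y')=d_B(x,x')$. Hence $F=c_M-c_B\circ(\pi\times\pi)$ is
  nonnegative and vanishes at a horizontal lift $(\tilde x,\tilde{\bar x})$, as well as along sections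
  $x'\mapsto(\tilde x',\tilde{\bar x})$ and $\bar x'\mapsto(\tilde x,\tilde{\bar x}')$, which are continuous at
  the base point because minimizing geodesics do not branch before a point where $d_B(x,\cdot)$ is differentiable.

  The first order conditions for $F$ along these sections identify their derivatives with $v\mapsto\tilde w$ and
  $\bar v\mapsto\tilde{\bar w}$, given by the lift of covectors. The cross-curvature is $-2$ times the second
  derivative in $x$ along $v$ of $D^2_{\bar v\bar v}c-D_{b}c$, where $b$ makes the first derivative
  vanish. The second derivative of $F$ in the barred variable along $\tilde{\bar w}$ is nonnegative on the section and
  zero at the base point; it is the difference of the two such functions plus a linear term in $D_{\bar x}c_B$ that must
  vanish to first order, so its own second derivative yields the inequality.

  Differentiating $c$ near $(x,\bar x)$ requires the complement of the cut locus to be a neighbourhood of $(x,\bar x)$. This is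
  derived from compactness of unit speed rays: midpoints of broken minimizing segments are nondegenerate
  critical points of a sum of two costs, hence unique nearby.
\<close>

text \<open>The hypotheses give regularity of the costs only on a set that is not known to be open,
  and the distance only as an infimum of lengths. The exponential map is avoided altogether. The
  minimizing paths to be constructed are isometric embeddings of intervals, found by compactness of
  balls, and differentiability of the distance always comes from the cost by division by
  \<open>deriv f\<close>, which is positive at positive arguments. Nondegeneracy on the diagonal,
  through local injectivity of the derivative of c in one variable, is what forbids branching. To
  know that pairs near the diagonal avoid the cut locus, short rays must minimize uniformly; a
  calibration shows this. The geodesic equation serves this purpose and the passage to limits of
  rays. On the curvature side the sections are at first merely continuous. Their derivative is
  recovered from the first order conditions, and they are never differentiated twice; hence the
  final second order expansion runs along a direction that depends on the step, with linear terms
  that cancel exactly.\<close>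

abbreviation pd :: "('s::real_normed_vector => 't::real_normed_vector) => 's => 's => 't" where
 "pd F u \<equiv> \<lambda>z. frechet_derivative F (at z) u"

section \<open>Manifolds in charts\<close>

lemma smooth_on_has_derivative:
 assumes "smooth_on F S" "s \<in> S"
 shows "(F has_derivative frechet_derivative F (at s)) (at s)"
proof -
 have "C_k_on (Suc 0) F S" using assms(1) smooth_on_def by blast
 then show ?thesis using assms(2) by (simp add: frechet_derivative_works)
qed

lemma smooth_on_continuous_derivative:
 assumes "smooth_on F S"
 shows "continuous_on S (pd F u)"
proof -
 have "C_k_on (Suc 0) F S" using assms(1) smooth_on_def by blast
 then show ?thesis by simp
qed

lemma smooth_on_continuous: "smooth_on F S ==> continuous_on S F"
 unfolding smooth_on_def using C_k_on.simps(1) by blast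

section \<open>Continuous families of bilinear forms\<close>

lemma bilinear_expand:
 fixes h :: "'e::euclidean_space => 'f::euclidean_space => real"
 assumes "bilinear h"
 shows "h u v = (\<Sum>i\<in>Basis. \<Sum>j\<in>Basis. (u \<bullet> i) * (v \<bullet> j) * h i j)"
proof -
 have "h u v = h (\<Sum>i\<in>Basis. (u \<bullet> i) *\<^sub>R i) (\<Sum>j\<in>Basis. (v \<bullet> j) *\<^sub>R j)"
  by (simp add: euclidean_representation)
 also have "\<dots> = (\<Sum>(i,j)\<in>Basis \<times> Basis. h ((u \<bullet> i) *\<^sub>R i) ((v \<bullet> j) *\<^sub>R j))"
  using bilinear_sum[OF assms] by blast
 also have "\<dots> = (\<Sum>i\<in>Basis. \<Sum>j\<in>Basis. h ((u \<bullet> i) *\<^sub>R i) ((v \<bullet> j) *\<^sub>R j))"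
  by (simp add: sum.cartesian_product)
 finally show ?thesis
  by (simp add: bilinear_lmul[OF assms] bilinear_rmul[OF assms] algebra_simps)
qed

text \<open>In finite dimension the entries on a basis determine the form, so continuity for fixed
  vectors already gives joint continuity in the point and the vectors.\<close>

lemma bilinear_family_continuous:
 fixes G :: "'s::topological_space => 'e::euclidean_space => 'f::euclidean_space => real"
 assumes "!!s. s \<in> S ==> bilinear (G s)" "!!u v. continuous_on S (\<lambda>s. G s u v)"
 shows "continuous_on (S \<times> UNIV) (\<lambda>(s, u, v). G s u v)"
proof -
 have "continuous_on (S \<times> UNIV) (\<lambda>p. \<Sum>i\<in>Basis. \<Sum>j\<in>Basis.
   (fst (snd p) \<bullet> i) * (snd (snd p) \<bullet> j) * G (fst p) i j)"
  by (intro continuous_intros continuous_on_compose2[OF assms(2)]) auto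
 then show ?thesis
  by (rule continuous_on_eq) (auto simp: bilinear_expand[OF assms(1), symmetric])
qed

lemma posdef_lower_bound:
 fixes h :: "'e::euclidean_space => 'e => real"
 assumes "bilinear h" "!!u. u ~= 0 ==> h u u > 0"
 shows "\<exists>c>0. \<forall>u. c * (norm u)\<^sup>2 \<le> h u u"
proof -
 have "continuous_on UNIV (\<lambda>u. h u u)"
 proof -
  have "continuous_on UNIV (\<lambda>p. \<Sum>i\<in>Basis. \<Sum>j\<in>Basis. (p \<bullet> i) * (p \<bullet> j) * h i j)"
   by (intro continuous_intros)
  then show ?thesis by (simp add: bilinear_expand[OF assms(1), symmetric])
 qed
 then have "continuous_on (sphere 0 1) (\<lambda>u. h u u)" by (rule continuous_on_subset) simp
 moreover have "sphere (0::'e) 1 ~= {}" by simp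
 ultimately obtain w where w: "w \<in> sphere 0 1" "!!u. u \<in> sphere 0 1 ==> h w w \<le> h u u"
  using continuous_attains_inf[of "sphere 0 1" "\<lambda>u. h u u"] by auto
 have pos: "h w w > 0" using w(1) assms(2) by (metis mem_sphere_0 norm_zero zero_neq_one)
 have "h w w * (norm u)\<^sup>2 \<le> h u u" for u
 proof (cases "u = 0")
  case True then show ?thesis by (simp add: bilinear_lzero[OF assms(1)])
 next
  case False
  have "h w w \<le> h (u /\<^sub>R norm u) (u /\<^sub>R norm u)" by (rule w(2)) (use False in simp)
  also have "\<dots> = h u u / (norm u)\<^sup>2"
   by (simp add: bilinear_lmul[OF assms(1)] bilinear_rmul[OF assms(1)] power2_eq_square divide_simps)
  finally show ?thesis using False by (simp add: field_simps)
 qed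
 then show ?thesis using pos by blast
qed

text \<open>Positive definiteness at \<open>p\<close> turns additive closeness of the matrix entries
  into a multiplicative comparison of the forms. It is applied to metrics in a chart and, in
  \<open>N0_step\<close>, to Hessians, where it carries positivity from a limit configuration to
  nearby ones.\<close>

lemma bilinear_form_ratio:
 fixes G :: "'s::metric_space => 'e::euclidean_space => 'e => real"
 assumes "open S" "p \<in> S" "!!s. s \<in> S ==> bilinear (G s)" "!!u v. continuous_on S (\<lambda>s. G s u v)"
  and "!!u. u ~= 0 ==> G p u u > 0" "e > 0"
 shows "\<exists>r>0. ball p r \<subseteq> S \<and> (\<forall>s\<in>ball p r. \<forall>u. (1 - e) * G p u u \<le> G s u u \<and> G s u u \<le> (1 + e) * G p u u)"
proof -
 obtain c where c: "c > 0" "!!u. c * (norm u)\<^sup>2 \<le> G p u u"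
  using posdef_lower_bound[OF assms(3)[OF assms(2)] assms(5)] by blast
 \<comment> \<open>N counts the entries: an error below e c / N in each of them sums to at most e c
   |u|^2, which the lower bound of the form at p absorbs.\<close>
 define N where "N = real (DIM('e) * DIM('e))"
 have N: "N > 0" by (simp add: N_def)
 have "eventually (\<lambda>s. s \<in> S) (nhds p)" using assms(1,2) eventually_nhds by blast
 moreover have "eventually (\<lambda>s. \<forall>i\<in>Basis. \<forall>j\<in>Basis. \<bar>G s i j - G p i j\<bar> < e * c / N) (nhds p)"
 proof (intro eventually_ball_finite ballI finite_Basis)
  fix i j :: 'e
  have "((\<lambda>s. G s i j) \<longlongrightarrow> G p i j) (at p)"
   using assms(1,2,4) by (metis continuous_on_eq_continuous_at isCont_def)
  then have "\<forall>\<^sub>F s in at p. dist (G s i j) (G p i j) < e * c / N"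
   by (rule tendstoD) (use c N assms(6) in simp)
  then show "\<forall>\<^sub>F s in nhds p. \<bar>G s i j - G p i j\<bar> < e * c / N"
   using c N assms(6) by (auto simp: eventually_at_filter dist_real_def elim!: eventually_mono)
 qed
 ultimately have "eventually (\<lambda>s. s \<in> S \<and> (\<forall>i\<in>Basis. \<forall>j\<in>Basis. \<bar>G s i j - G p i j\<bar> < e * c / N)) (nhds p)"
  by (rule eventually_conj)
 then obtain r where r: "r > 0" "!!s. dist s p < r ==> s \<in> S \<and> (\<forall>i\<in>Basis. \<forall>j\<in>Basis. \<bar>G s i j - G p i j\<bar> < e * c / N)"
  unfolding eventually_nhds_metric by blast
 show ?thesis
 proof (intro exI[of _ r] conjI ballI allI)
  show "r > 0" "ball p r \<subseteq> S" using r by (auto simp: dist_commute)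
  fix s u assume "s \<in> ball p r"
  then have s: "s \<in> S" "!!i j. i \<in> Basis ==> j \<in> Basis ==> \<bar>G s i j - G p i j\<bar> < e * c / N"
   using r(2)[of s] by (auto simp: dist_commute)
  have "\<bar>G s u u - G p u u\<bar> = \<bar>\<Sum>i\<in>Basis. \<Sum>j\<in>Basis. (u \<bullet> i) * (u \<bullet> j) * (G s i j - G p i j)\<bar>"
   unfolding bilinear_expand[OF assms(3)[OF s(1)], of u u] bilinear_expand[OF assms(3)[OF assms(2)], of u u]
   by (simp add: sum_subtractf algebra_simps)
  also have "\<dots> \<le> (\<Sum>i\<in>(Basis::'e set). \<Sum>j\<in>(Basis::'e set). norm u * norm u * (e * c / N))"
  proof (intro order_trans[OF sum_abs] sum_mono)
   fix i j :: 'e assume ij: "i \<in> Basis" "j \<in> Basis"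
   show "\<bar>u \<bullet> i * (u \<bullet> j) * (G s i j - G p i j)\<bar> \<le> norm u * norm u * (e * c / N)"
    unfolding abs_mult
    by (intro mult_mono Basis_le_norm ij less_imp_le[OF s(2)]) auto
  qed
  also have "\<dots> = e * (c * (norm u)\<^sup>2)" using N by (simp add: N_def power2_eq_square)
  also have "\<dots> \<le> e * G p u u" using c(2) assms(6) by (simp add: mult_left_mono)
  finally have "\<bar>G s u u - G p u u\<bar> \<le> e * G p u u" .
  then show "(1 - e) * G p u u \<le> G s u u" "G s u u \<le> (1 + e) * G p u u"
   by (auto simp: algebra_simps abs_le_iff)
 qed
qed

section \<open>Charts, tangent vectors and the metric in coordinates\<close>

locale rmanifold =
 fixes A :: "('a::{t2_space,second_countable_topology}, 'e::euclidean_space) chart set"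
  and g :: "'a => 'e => 'e => real"
 assumes atlas: "smooth_atlas A" and metric: "riemannian_metric A g"
  and conn: "connected (UNIV :: 'a set)"
begin

lemma chart_open: "ka \<in> A ==> open (fst ka)" "ka \<in> A ==> open (chart_image ka)"
 using atlas unfolding smooth_atlas_def by blast+

lemma chart_homeo: "ka \<in> A ==> homeomorphism (fst ka) (chart_image ka) (snd ka) (chart_inv ka)"
 using atlas unfolding smooth_atlas_def by blast

lemma chart_inv_eq: "ka \<in> A ==> x \<in> fst ka ==> chart_inv ka (snd ka x) = x"
 using chart_homeo homeomorphism_apply1 by blast

lemma chart_eq: "ka \<in> A ==> s \<in> chart_image ka ==> snd ka (chart_inv ka s) = s"
 using chart_homeo homeomorphism_apply2 by blast

lemma chart_inv_in: "ka \<in> A ==> s \<in> chart_image ka ==> chart_inv ka s \<in> fst ka"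
 using chart_inv_eq by (metis imageE)

lemma chart_cont: "ka \<in> A ==> continuous_on (fst ka) (snd ka)"
 "ka \<in> A ==> continuous_on (chart_image ka) (chart_inv ka)"
 using chart_homeo homeomorphism_def by blast+

lemma chart_isCont: "ka \<in> A ==> x \<in> fst ka ==> isCont (snd ka) x"
 "ka \<in> A ==> s \<in> chart_image ka ==> isCont (chart_inv ka) s"
 using chart_cont chart_open continuous_on_eq_continuous_at by blast+

lemma chart_at: "chart_at A x \<in> A" "x \<in> fst (chart_at A x)"
proof -
 have "\<exists>ka. ka \<in> A \<and> x \<in> fst ka" using atlas unfolding smooth_atlas_def by blast
 then have "chart_at A x \<in> A \<and> x \<in> fst (chart_at A x)" unfolding chart_at_def by (rule someI_ex)
 then show "chart_at A x \<in> A" "x \<in> fst (chart_at A x)" by auto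
qed

lemma coords_in: "coords A x \<in> chart_image (chart_at A x)"
 unfolding coords_def using chart_at by blast

lemma transition_derivative:
 assumes "ka \<in> A" "ka' \<in> A" "x \<in> fst ka" "x \<in> fst ka'"
 shows "((snd ka' \<circ> chart_inv ka) has_derivative
   frechet_derivative (snd ka' \<circ> chart_inv ka) (at (snd ka x))) (at (snd ka x))"
proof -
 have "smooth_on (snd ka' \<circ> chart_inv ka) (snd ka ` (fst ka \<inter> fst ka'))"
  using atlas assms unfolding smooth_atlas_def by blast
 then show ?thesis by (rule smooth_on_has_derivative) (use assms in auto)
qed

lemma chart_image_open: "ka \<in> A ==> open U ==> U \<subseteq> fst ka ==> open (snd ka ` U)"
 using homeomorphism_imp_open_map[OF chart_homeo] chart_open openin_open_eq
 by (metis open_openin openin_subtopology_self openin_trans openin_open_eq)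

lemma chart_inv_image_open: "ka \<in> A ==> open U ==> U \<subseteq> chart_image ka ==> open (chart_inv ka ` U)"
 using homeomorphism_imp_open_map[OF homeomorphism_symD[OF chart_homeo]] chart_open
 by (metis openin_open_eq)

lemma transition_inverse:
 assumes "ka \<in> A" "ka' \<in> A" "x \<in> fst ka" "x \<in> fst ka'"
 shows "pd (snd ka \<circ> chart_inv ka') (pd (snd ka' \<circ> chart_inv ka) u (snd ka x)) (snd ka' x) = u"
proof -
 let ?D = "frechet_derivative (snd ka' \<circ> chart_inv ka) (at (snd ka x))"
 let ?D' = "frechet_derivative (snd ka \<circ> chart_inv ka') (at (snd ka' x))"
 have 1: "((snd ka' \<circ> chart_inv ka) has_derivative ?D) (at (snd ka x))"
  by (rule transition_derivative) fact+
 have 2: "((snd ka \<circ> chart_inv ka') has_derivative ?D') (at ((snd ka' \<circ> chart_inv ka) (snd ka x)))"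
  using transition_derivative[OF assms(2,1,4,3)] by (simp add: chart_inv_eq assms)
 have 3: "((snd ka \<circ> chart_inv ka') \<circ> (snd ka' \<circ> chart_inv ka) has_derivative ?D' \<circ> ?D) (at (snd ka x))"
  by (rule diff_chain_at[OF 1 2])
 have "((\<lambda>s. s) has_derivative ?D' \<circ> ?D) (at (snd ka x))"
 proof (rule has_derivative_transform_within_open[OF 3])
  show "open (snd ka ` (fst ka \<inter> fst ka'))"
   by (rule chart_image_open) (use assms chart_open(1)[of ka] chart_open(1)[of ka'] in auto)
  show "snd ka x \<in> snd ka ` (fst ka \<inter> fst ka')" using assms by auto
  show "((snd ka \<circ> chart_inv ka') \<circ> (snd ka' \<circ> chart_inv ka)) s = s"
   if "s \<in> snd ka ` (fst ka \<inter> fst ka')" for s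
   using that assms by (auto simp: chart_inv_eq)
 qed
 then have "?D' \<circ> ?D = (\<lambda>u. u)"
  using has_derivative_unique has_derivative_ident by blast
 then show ?thesis by (metis comp_apply)
qed

lemma g_bilinear: "bilinear (g x)" and g_sym: "g x u v = g x v u" and g_pos: "u ~= 0 ==> g x u u > 0"
 using metric unfolding riemannian_metric_def by blast+

lemma coord_metric_eq:
 assumes "ka \<in> A" "x \<in> fst ka"
 shows "coord_metric A g ka (snd ka x) u v =
  g x (pd (snd (chart_at A x) \<circ> chart_inv ka) u (snd ka x))
    (pd (snd (chart_at A x) \<circ> chart_inv ka) v (snd ka x))"
 unfolding coord_metric_def Let_def by (simp add: chart_inv_eq assms)

lemma coord_metric_props:
 assumes "ka \<in> A" "s \<in> chart_image ka"
 shows coord_metric_bilinear: "bilinear (coord_metric A g ka s)"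
  and coord_metric_sym: "coord_metric A g ka s u v = coord_metric A g ka s v u"
  and coord_metric_pos: "u ~= 0 ==> coord_metric A g ka s u u > 0"
proof -
 obtain x where x: "x \<in> fst ka" "s = snd ka x" using assms by auto
 let ?D = "frechet_derivative (snd (chart_at A x) \<circ> chart_inv ka) (at (snd ka x))"
 have lin: "linear ?D"
  using transition_derivative[OF assms(1) chart_at(1) x(1) chart_at(2)] has_derivative_linear by blast
 have eq: "coord_metric A g ka s = (\<lambda>u v. g x (?D u) (?D v))"
  using coord_metric_eq[OF assms(1) x(1)] x by auto
 show "bilinear (coord_metric A g ka s)"
  unfolding eq bilinear_def
  by (auto intro!: linearI simp: linear_add[OF lin] linear_scale[OF lin] bilinear_ladd[OF g_bilinear]
   bilinear_lmul[OF g_bilinear] bilinear_radd[OF g_bilinear] bilinear_rmul[OF g_bilinear])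
 show "coord_metric A g ka s u v = coord_metric A g ka s v u" unfolding eq by (rule g_sym)
 have "?D u ~= 0" if "u ~= 0"
  using transition_inverse[OF assms(1) chart_at(1) x(1) chart_at(2), of u] that
   linear_0[OF has_derivative_linear[OF transition_derivative[OF chart_at(1) assms(1) chart_at(2) x(1)]]]
  by metis
 then show "u ~= 0 ==> coord_metric A g ka s u u > 0" unfolding eq using g_pos by blast
qed

lemma coord_metric_nonneg: "ka \<in> A ==> s \<in> chart_image ka ==> coord_metric A g ka s u u \<ge> 0"
 using coord_metric_pos[of ka s u] bilinear_lzero[OF coord_metric_bilinear[of ka s]] by (cases "u = 0") auto

lemma coord_metric_smooth: "ka \<in> A ==> smooth_on (\<lambda>s. coord_metric A g ka s u v) (chart_image ka)"
 using metric unfolding riemannian_metric_def by blast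

lemma coord_metric_cont: "ka \<in> A ==> continuous_on (chart_image ka) (\<lambda>s. coord_metric A g ka s u v)"
 using coord_metric_smooth smooth_on_continuous by blast

lemma coord_metric_cont3: "ka \<in> A ==>
  continuous_on (chart_image ka \<times> UNIV) (\<lambda>(s, u, v). coord_metric A g ka s u v)"
 by (rule bilinear_family_continuous[OF coord_metric_bilinear coord_metric_cont])

lemma coord_metric_at: "coord_metric A g (chart_at A x) (coords A x) u v = g x u v"
proof -
 have "frechet_derivative (snd (chart_at A x) \<circ> chart_inv (chart_at A x)) (at (snd (chart_at A x) x)) = (\<lambda>u. u)"
 proof (rule frechet_derivative_at[symmetric], rule has_derivative_transform_within_open[of "\<lambda>s. s" "\<lambda>s. s"])
  show "open (chart_image (chart_at A x))" using chart_open chart_at by blast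
 qed (use chart_at chart_eq in \<open>auto intro: has_derivative_ident\<close>)
 then show ?thesis unfolding coords_def using coord_metric_eq[OF chart_at(1) chart_at(2)] by simp
qed

text \<open>The preferred chart may jump along a curve, so \<open>velocity\<close> cannot be handled
  as a continuous function of time. In one fixed chart the derivative of the coordinates represents
  the same vector, and its coordinate norm is the speed.\<close>

lemma velocity_coord:
 assumes "ka \<in> A" "ga t \<in> fst ka" "continuous (at t within I) ga" "t \<in> I"
  and "(snd ka \<circ> ga has_vector_derivative w) (at t within I)" "at t within I ~= bot"
 shows "velocity A I ga t = pd (snd (chart_at A (ga t)) \<circ> chart_inv ka) w (snd ka (ga t))"
  and "(snd (chart_at A (ga t)) \<circ> ga has_vector_derivative velocity A I ga t) (at t within I)"
  and "g (ga t) (velocity A I ga t) (velocity A I ga t) = coord_metric A g ka (snd ka (ga t)) w w"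
proof -
 let ?D = "frechet_derivative (snd (chart_at A (ga t)) \<circ> chart_inv ka) (at (snd ka (ga t)))"
 have 1: "((snd (chart_at A (ga t)) \<circ> chart_inv ka) has_derivative ?D) (at ((snd ka \<circ> ga) t) within (snd ka \<circ> ga) ` I)"
  using transition_derivative[OF assms(1) chart_at(1) assms(2) chart_at(2)]
  by (simp add: has_derivative_at_withinI)
 have 2: "((snd (chart_at A (ga t)) \<circ> chart_inv ka) \<circ> (snd ka \<circ> ga) has_vector_derivative ?D w) (at t within I)"
  using vector_derivative_diff_chain_within[OF assms(5) 1] .
 have "\<forall>\<^sub>F s in at t within I. ga s \<in> fst ka"
  using assms(2,3) chart_open(1)[OF assms(1)] unfolding continuous_within
  by (simp add: topological_tendstoD)
 then have ev: "\<forall>\<^sub>F s in at t within I. ((snd (chart_at A (ga t)) \<circ> chart_inv ka) \<circ> (snd ka \<circ> ga)) s = (snd (chart_at A (ga t)) \<circ> ga) s"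
  by eventually_elim (simp add: chart_inv_eq assms)
 have 3: "(snd (chart_at A (ga t)) \<circ> ga has_vector_derivative ?D w) (at t within I)"
  unfolding has_vector_derivative_def
  by (rule has_derivative_transform_eventually[OF 2[unfolded has_vector_derivative_def] ev])
   (use assms(1,2,4) in \<open>auto simp: chart_inv_eq\<close>)
 show eq: "velocity A I ga t = ?D w"
  unfolding velocity_def by (rule vector_derivative_within[OF assms(6) 3])
 show "(snd (chart_at A (ga t)) \<circ> ga has_vector_derivative velocity A I ga t) (at t within I)"
  unfolding eq by (rule 3)
 show "g (ga t) (velocity A I ga t) (velocity A I ga t) = coord_metric A g ka (snd ka (ga t)) w w"
  unfolding eq coord_metric_eq[OF assms(1,2)] ..
qed

end

section \<open>Piecewise smooth curves and the Riemannian distance\<close>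

context rmanifold
begin

text \<open>The derivative is two-sided, so the value does not depend on an interval of definition
  and lengths of subarcs add up; end points and break points do not affect the integral.\<close>

definition speed :: "(real => 'a) => real => real" where
 "speed ga t = sqrt (g (ga t) (velocity A UNIV ga t) (velocity A UNIV ga t))"

text \<open>Piecewise C1 curves on an arbitrary interval with the break points as a parameter, so
  that subarcs and reparametrized arcs stay in the class.\<close>

definition pw :: "real set => (real => 'a) => real => real => bool" where
 "pw P ga a b \<longleftrightarrow> continuous_on {a..b} ga \<and> finite P \<and>
   (\<forall>u v. a \<le> u \<and> u < v \<and> v \<le> b \<and> {u<..<v} \<inter> P = {} --> C1_curve_on A {u..v} ga)"

lemma piecewise_C1_curve_iff: "piecewise_C1_curve A ga \<longleftrightarrow> (\<exists>P. pw P ga 0 1)"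
 unfolding piecewise_C1_curve_def pw_def by auto

lemma pw_subinterval: "pw P ga a b ==> a \<le> u ==> v \<le> b ==> pw P ga u v"
 unfolding pw_def by (meson atLeastatMost_subset_iff continuous_on_subset order_trans)

lemma pw_continuous: "pw P ga a b ==> continuous_on {a..b} ga"
 unfolding pw_def by blast

lemma speed_nonneg: "speed ga t \<ge> 0"
 unfolding speed_def using g_pos[of "velocity A UNIV ga t" "ga t"] bilinear_lzero[OF g_bilinear]
 by (cases "velocity A UNIV ga t = 0") (auto intro: less_imp_le)

lemma C1_piece:
 assumes "C1_curve_on A {u..v} ga" "ka \<in> A" "ga ` {u..v} \<subseteq> fst ka"
 obtains y' where "continuous_on {u..v} y'"
  "!!t. t \<in> {u..v} ==> (snd ka \<circ> ga has_vector_derivative y' t) (at t within {u..v})"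
  "!!t. t \<in> {u<..<v} ==> speed ga t = sqrt (coord_metric A g ka (snd ka (ga t)) (y' t) (y' t))"
proof -
 have eq: "{t \<in> {u..v}. ga t \<in> fst ka} = {u..v}" using assms(3) by auto
 obtain y' where y': "continuous_on {u..v} y'"
  "!!t. t \<in> {u..v} ==> (snd ka \<circ> ga has_vector_derivative y' t) (at t within {u..v})"
  using assms(1,2) unfolding C1_curve_on_def using eq by force
 show ?thesis
 proof (rule that[OF y'])
  fix t assume t: "t \<in> {u<..<v}"
  have at: "at t within {u..v} = at t" using t by (simp add: at_within_Icc_at)
  have "continuous (at t within {u..v}) ga"
   using assms(1) t unfolding C1_curve_on_def by (simp add: continuous_on_eq_continuous_within)
  then have "g (ga t) (velocity A UNIV ga t) (velocity A UNIV ga t) = coord_metric A g ka (snd ka (ga t)) (y' t) (y' t)"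
   using velocity_coord(3)[of ka ga t UNIV "y' t"] y'(2)[of t] t assms(2) subsetD[OF assms(3), of "ga t"] by (auto simp: at)
  then show "speed ga t = sqrt (coord_metric A g ka (snd ka (ga t)) (y' t) (y' t))"
   unfolding speed_def by simp
 qed
qed

text \<open>Additive statements about subarcs are proved by bisection: around each time only arcs
  inside a neighbourhood of the curve point have to be treated, and these may be taken free of break
  points.\<close>

lemma pw_induct:
 assumes "pw P ga a b" "a \<le> b"
  and refl: "!!u. Q u u"
  and trans: "!!u v w. a \<le> u ==> u \<le> v ==> v \<le> w ==> w \<le> b ==> Q u v ==> Q v w ==> Q u w"
  and piece: "!!t. t \<in> {a..b} ==> \<exists>W. open W \<and> ga t \<in> W \<and>
    (\<forall>u v. a \<le> u \<and> u < v \<and> v \<le> b \<and> C1_curve_on A {u..v} ga \<and> ga ` {u..v} \<subseteq> W --> Q u v)"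
 shows "Q a b"
proof -
 have fin: "finite P" and cont: "continuous_on {a..b} ga" using assms(1) unfolding pw_def by auto
 have "a \<le> a --> b \<le> b --> Q a b"
 proof (rule Bolzano[OF assms(2), of "\<lambda>u v. a \<le> u --> v \<le> b --> Q u v"])
  show "a \<le> u --> w \<le> b --> Q u w" if "a \<le> u --> v \<le> b --> Q u v" "a \<le> v --> w \<le> b --> Q v w" "u \<le> v" "v \<le> w" for u v w
   using trans[of u v w] that by auto
  fix t assume t: "a \<le> t" "t \<le> b"
  obtain W where W: "open W" "ga t \<in> W" and
   Q: "!!u v. a \<le> u ==> u < v ==> v \<le> b ==> C1_curve_on A {u..v} ga ==> ga ` {u..v} \<subseteq> W ==> Q u v"
   using piece[of t] t by auto
  have "\<forall>\<^sub>F s in at t within {a..b}. ga s \<in> W"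
   using cont t W by (metis atLeastAtMost_iff continuous_on_def topological_tendstoD)
  then obtain d1 where d1: "d1 > 0" "!!s. s \<in> {a..b} ==> dist s t < d1 ==> ga s \<in> W"
   unfolding eventually_at using W(2) by (metis dist_self)
  obtain d2 where d2: "d2 > 0" "!!p. p \<in> P ==> p ~= t ==> d2 \<le> dist t p"
   using finite_set_avoid[OF fin, of t] by blast
  show "\<exists>d>0. \<forall>u v. u \<le> t \<and> t \<le> v \<and> v - u < d --> a \<le> u --> v \<le> b --> Q u v"
  proof (intro exI[of _ "min d1 d2"] conjI allI impI)
   show "min d1 d2 > 0" using d1 d2 by simp
   fix u v assume uv: "u \<le> t \<and> t \<le> v \<and> v - u < min d1 d2" "a \<le> u" "v \<le> b"
   \<comment> \<open>Arcs are cut at t, the only time in the chosen range that may be a break point;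
     each half then has no break point in its interior.\<close>
   have sub: "Q u' v'" if "a \<le> u'" "u' < v'" "v' \<le> b" "u' = t \<or> v' = t" "v' - u' < min d1 d2" for u' v'
   proof (rule Q)
    show "C1_curve_on A {u'..v'} ga"
    proof -
     have "{u'<..<v'} \<inter> P = {}"
      using d2(2) that by (force simp: dist_real_def)
     then show ?thesis using assms(1) that unfolding pw_def by blast
    qed
    show "ga ` {u'..v'} \<subseteq> W" using d1(2) that by (auto simp: dist_real_def)
   qed (use that in auto)
   have "Q u t" using sub[of u t] uv refl by (cases "u = t") auto
   moreover have "Q t v" using sub[of t v] uv refl by (cases "v = t") auto
   ultimately show "Q u v" using trans[of u t v] uv by auto
  qed
 qed
 then show ?thesis by simp
qed

lemma speed_piece_integral:
 assumes "C1_curve_on A {u..v} ga" "ka \<in> A" "ga ` {u..v} \<subseteq> fst ka" "u < v"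
  "continuous_on {u..v} y'"
  "!!t. t \<in> {u<..<v} ==> speed ga t = sqrt (coord_metric A g ka (snd ka (ga t)) (y' t) (y' t))"
 shows "(speed ga has_integral integral {u..v} (\<lambda>t. sqrt (coord_metric A g ka (snd ka (ga t)) (y' t) (y' t)))) {u..v}"
  "(\<lambda>t. sqrt (coord_metric A g ka (snd ka (ga t)) (y' t) (y' t))) integrable_on {u..v}"
proof -
 have c: "continuous_on {u..v} (\<lambda>t. snd ka (ga t))"
  using assms(1,3) chart_cont(1)[OF assms(2)] unfolding C1_curve_on_def
  by (auto intro: continuous_on_compose2)
 have "continuous_on {u..v} (\<lambda>t. (\<lambda>(s, u, v). coord_metric A g ka s u v) (snd ka (ga t), y' t, y' t))"
  by (rule continuous_on_compose2[OF coord_metric_cont3[OF assms(2)]])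
   (use assms(3) c assms(5) in \<open>auto intro!: continuous_intros\<close>)
 then have "continuous_on {u..v} (\<lambda>t. sqrt (coord_metric A g ka (snd ka (ga t)) (y' t) (y' t)))"
  by (auto intro: continuous_intros)
 then show *: "(\<lambda>t. sqrt (coord_metric A g ka (snd ka (ga t)) (y' t) (y' t))) integrable_on {u..v}"
  by (rule integrable_continuous_interval)
 show "(speed ga has_integral integral {u..v} (\<lambda>t. sqrt (coord_metric A g ka (snd ka (ga t)) (y' t) (y' t)))) {u..v}"
  by (rule has_integral_spike_finite[of "{u, v}", OF _ _ integrable_integral[OF *]]) (use assms(6) in auto)
qed

lemma speed_integrable: "pw P ga a b ==> a \<le> b ==> speed ga integrable_on {a..b}"
proof (rule pw_induct[of P ga a b "\<lambda>u v. speed ga integrable_on {u..v}"])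
 show "speed ga integrable_on {u..u}" for u using integrable_on_refl[of "speed ga" u] by (simp only: cbox_interval)
 show "speed ga integrable_on {u..w}" if "u \<le> v" "v \<le> w" "speed ga integrable_on {u..v}" "speed ga integrable_on {v..w}" for u v w
  by (rule Henstock_Kurzweil_Integration.integrable_combine[OF that])
 fix t
 show "\<exists>W. open W \<and> ga t \<in> W \<and>
    (\<forall>u v. a \<le> u \<and> u < v \<and> v \<le> b \<and> C1_curve_on A {u..v} ga \<and> ga ` {u..v} \<subseteq> W --> speed ga integrable_on {u..v})"
 proof (intro exI[of _ "fst (chart_at A (ga t))"] conjI allI impI)
  fix u v assume *: "a \<le> u \<and> u < v \<and> v \<le> b \<and> C1_curve_on A {u..v} ga \<and> ga ` {u..v} \<subseteq> fst (chart_at A (ga t))"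
  then obtain y' where "continuous_on {u..v} y'"
   "!!s. s \<in> {u<..<v} ==> speed ga s = sqrt (coord_metric A g (chart_at A (ga t)) (snd (chart_at A (ga t)) (ga s)) (y' s) (y' s))"
   using C1_piece[of u v ga "chart_at A (ga t)"] chart_at by metis
  from speed_piece_integral(1)[OF _ _ _ _ this] show "speed ga integrable_on {u..v}"
   using * chart_at by blast
 qed (use chart_at chart_open in auto)
qed auto

lemma curve_length_speed: "curve_length A g ga = integral {0..1} (speed ga)"
 unfolding curve_length_def
 by (rule integral_spike[of "{0, 1}"]) (auto simp: speed_def velocity_def at_within_Icc_at)

lemma pw_speed_velocity:
 assumes "pw P ga a b" "t \<in> {a<..<b} - P"
 shows "(snd (chart_at A (ga t)) \<circ> ga has_vector_derivative velocity A UNIV ga t) (at t)"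
proof -
 obtain d where d: "d > 0" "!!p. p \<in> P ==> p ~= t ==> d \<le> dist t p"
  using finite_set_avoid[of P t] assms(1) unfolding pw_def by blast
 define u where "u = max a (t - d/2)"
 define v where "v = min b (t + d/2)"
 have uv: "a \<le> u" "u < t" "t < v" "v \<le> b" using assms(2) d(1) by (auto simp: u_def v_def)
 have "{u<..<v} \<inter> P = {}"
  using d assms(2) by (force simp: u_def v_def dist_real_def)
 then have C1: "C1_curve_on A {u..v} ga" using assms(1) uv unfolding pw_def by (meson order_less_trans)
 have at: "at t within {u..v} = at t" using uv by (simp add: at_within_Icc_at)
 obtain w where w: "(snd (chart_at A (ga t)) \<circ> ga has_vector_derivative w) (at t within {u..v})"
  using C1 uv chart_at unfolding C1_curve_on_def by (metis (mono_tags, lifting) atLeastAtMost_iff less_imp_le mem_Collect_eq)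
 then have w: "(snd (chart_at A (ga t)) \<circ> ga has_vector_derivative w) (at t)" by (simp only: at)
 show ?thesis unfolding velocity_def vector_derivative_at[OF w] by (rule w)
qed

lemma C1_curve_affine:
 assumes "C1_curve_on A ((\<lambda>t. m * t + c) ` J) ga"
 shows "C1_curve_on A J (\<lambda>t. ga (m * t + c))"
 unfolding C1_curve_on_def
proof (intro conjI ballI)
 let ?I = "(\<lambda>t. m * t + c) ` J"
 show "continuous_on J (\<lambda>t. ga (m * t + c))"
  using assms unfolding C1_curve_on_def by (auto intro!: continuous_on_compose2[of ?I ga] continuous_intros)
 fix ka assume "ka \<in> A"
 then obtain y' where y': "continuous_on {t \<in> ?I. ga t \<in> fst ka} y'"
  "!!t. t \<in> ?I ==> ga t \<in> fst ka ==> (snd ka \<circ> ga has_vector_derivative y' t) (at t within ?I)"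
  using assms unfolding C1_curve_on_def by auto
 show "\<exists>y'. continuous_on {t \<in> J. ga (m * t + c) \<in> fst ka} y' \<and> (\<forall>t\<in>{t \<in> J. ga (m * t + c) \<in> fst ka}.
   (snd ka \<circ> (\<lambda>t. ga (m * t + c)) has_vector_derivative y' t) (at t within J))"
 proof (intro exI[of _ "\<lambda>t. m *\<^sub>R y' (m * t + c)"] conjI ballI)
  show "continuous_on {t \<in> J. ga (m * t + c) \<in> fst ka} (\<lambda>t. m *\<^sub>R y' (m * t + c))"
   by (intro continuous_intros continuous_on_compose2[OF y'(1)]) auto
  fix t assume t: "t \<in> {t \<in> J. ga (m * t + c) \<in> fst ka}"
  have "((\<lambda>t. m * t + c) has_vector_derivative m) (at t within J)"
   by (auto intro!: derivative_eq_intros simp: has_vector_derivative_def)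
  from vector_diff_chain_within[OF this y'(2)[of "m * t + c"]] t
  show "(snd ka \<circ> (\<lambda>t. ga (m * t + c)) has_vector_derivative m *\<^sub>R y' (m * t + c)) (at t within J)"
   by (auto simp: comp_def)
 qed
qed

text \<open>Negative factors are included, since m = -1 reverses a curve. The length is unchanged
  because the speed is multiplied by |m|.\<close>

lemma pw_affine:
 assumes pw: "pw P ga a b" and m: "m ~= 0" and im: "(\<lambda>t. m * t + c) ` {a'..b'} = {a..b}" and ab: "a \<le> b"
 shows "pw ((\<lambda>t. m * t + c) -` P) (\<lambda>t. ga (m * t + c)) a' b'"
  and "integral {a'..b'} (speed (\<lambda>t. ga (m * t + c))) = integral {a..b} (speed ga)"
proof -
 have inj: "inj_on (\<lambda>t. m * t + c) S" for S using m by (simp add: inj_on_def)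
 have fin: "finite ((\<lambda>t. m * t + c) -` P)"
  using pw finite_vimageI[OF _ inj] unfolding pw_def by blast
 have a'b': "a' \<le> b'" using im ab by (metis atLeastatMost_empty_iff image_is_empty)
 show pw': "pw ((\<lambda>t. m * t + c) -` P) (\<lambda>t. ga (m * t + c)) a' b'"
  unfolding pw_def
 proof (intro conjI allI impI fin)
  show "continuous_on {a'..b'} (\<lambda>t. ga (m * t + c))"
   by (rule continuous_on_compose2[OF pw_continuous[OF pw]]) (use im in \<open>auto intro!: continuous_intros\<close>)
  fix u v assume uv: "a' \<le> u \<and> u < v \<and> v \<le> b' \<and> {u<..<v} \<inter> (\<lambda>t. m * t + c) -` P = {}"
  have in': "m * u + c \<in> {a..b}" "m * v + c \<in> {a..b}" using uv im by (metis atLeastAtMost_iff imageI less_imp_le order_trans)+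
  show "C1_curve_on A {u..v} (\<lambda>t. ga (m * t + c))"
  proof (rule C1_curve_affine)
   show "C1_curve_on A ((\<lambda>t. m * t + c) ` {u..v}) ga"
   proof (cases "m > 0")
    case True
    then have eq: "(\<lambda>t. m * t + c) ` {u..v} = {m * u + c..m * v + c}" using uv by (simp add: image_affinity_atLeastAtMost)
    have "{m * u + c<..<m * v + c} \<inter> P = {}"
    proof (rule ccontr)
     assume "{m * u + c<..<m * v + c} \<inter> P ~= {}"
     then obtain p where p: "p \<in> P" "m * u + c < p" "p < m * v + c" by auto
     have "(p - c) / m \<in> {u<..<v} \<inter> (\<lambda>t. m * t + c) -` P" using p True by (simp add: field_simps)
     then show False using uv by blast
    qed
    then show ?thesis unfolding eq using pw in' True uv unfolding pw_def by simp
   next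
    case False
    then have m': "m < 0" using m by simp
    then have eq: "(\<lambda>t. m * t + c) ` {u..v} = {m * v + c..m * u + c}" using uv by (simp add: image_affinity_atLeastAtMost)
    have "{m * v + c<..<m * u + c} \<inter> P = {}"
    proof (rule ccontr)
     assume "{m * v + c<..<m * u + c} \<inter> P ~= {}"
     then obtain p where p: "p \<in> P" "m * v + c < p" "p < m * u + c" by auto
     have "(p - c) / m \<in> {u<..<v} \<inter> (\<lambda>t. m * t + c) -` P" using p m' by (simp add: field_simps)
     then show False using uv by blast
    qed
    then show ?thesis unfolding eq using pw in' m' uv unfolding pw_def by simp
   qed
  qed
 qed
 have sp: "speed (\<lambda>t. ga (m * t + c)) t = \<bar>m\<bar> * speed ga (m * t + c)" if t: "t \<in> {a'..b'} - ((\<lambda>t. m * t + c) -` (P \<union> {a, b}))" for t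
 proof -
  have "m * t + c \<in> {a<..<b} - P" using t im by fastforce
  from pw_speed_velocity[OF pw this]
  have 1: "(snd (chart_at A (ga (m * t + c))) \<circ> ga has_vector_derivative velocity A UNIV ga (m * t + c)) (at (m * t + c))" .
  have 2: "((\<lambda>t. m * t + c) has_vector_derivative m) (at t)"
   by (auto intro!: derivative_eq_intros simp: has_vector_derivative_def)
  have "velocity A UNIV (\<lambda>t. ga (m * t + c)) t = m *\<^sub>R velocity A UNIV ga (m * t + c)"
   unfolding velocity_def using vector_derivative_at[OF vector_diff_chain_at[OF 2 1]]
   by (simp add: comp_def velocity_def)
  then show ?thesis
   unfolding speed_def by (simp add: bilinear_lmul[OF g_bilinear] bilinear_rmul[OF g_bilinear] real_sqrt_mult flip: mult.assoc)
 qed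
 have "(speed ga has_integral integral {a..b} (speed ga)) (cbox a b)"
  using speed_integrable[OF pw ab] by (simp add: integrable_integral)
 from has_integral_affinity[OF this m, of c]
 have "((\<lambda>t. speed ga (m * t + c)) has_integral (1 / \<bar>m\<bar>) * integral {a..b} (speed ga)) ((\<lambda>x. (1 / m) * x + - ((1 / m) * c)) ` {a..b})"
  by simp
 moreover have "(\<lambda>x. (1 / m) * x + - ((1 / m) * c)) ` {a..b} = {a'..b'}"
  unfolding im[symmetric] image_image using m by (simp add: field_simps)
 ultimately have "((\<lambda>t. speed ga (m * t + c)) has_integral (1 / \<bar>m\<bar>) * integral {a..b} (speed ga)) {a'..b'}" by simp
 then have "((\<lambda>t. \<bar>m\<bar> * speed ga (m * t + c)) has_integral \<bar>m\<bar> * ((1 / \<bar>m\<bar>) * integral {a..b} (speed ga))) {a'..b'}"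
  by (rule has_integral_mult_right)
 then have "((\<lambda>t. \<bar>m\<bar> * speed ga (m * t + c)) has_integral integral {a..b} (speed ga)) {a'..b'}" using m by simp
 then have "(speed (\<lambda>t. ga (m * t + c)) has_integral integral {a..b} (speed ga)) {a'..b'}"
  by (rule has_integral_spike_finite[rotated 2, of _ _ _ "(\<lambda>t. m * t + c) -` (P \<union> {a, b})"])
   (use sp pw finite_vimageI[OF _ inj] in \<open>auto simp: pw_def\<close>)
 then show "integral {a'..b'} (speed (\<lambda>t. ga (m * t + c))) = integral {a..b} (speed ga)" by (rule integral_unique)
qed

end

section \<open>Coordinate norms and lower bounds for lengths\<close>

lemma form_Cauchy_Schwarz:
 fixes h :: "'e::euclidean_space => 'e => real"
 assumes b: "bilinear h" and s: "!!u v. h u v = h v u" and p: "!!u. h u u \<ge> 0"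
 shows "\<bar>h u v\<bar> \<le> sqrt (h u u) * sqrt (h v v)"
proof -
 have q: "h u u * t\<^sup>2 + 2 * h u v * t + h v v \<ge> 0" for t
 proof -
  have "0 \<le> h (t *\<^sub>R u + v) (t *\<^sub>R u + v)" by (rule p)
  also have "\<dots> = h u u * t\<^sup>2 + 2 * h u v * t + h v v"
   using s[of v u] by (simp add: bilinear_ladd[OF b] bilinear_radd[OF b] bilinear_lmul[OF b] bilinear_rmul[OF b] power2_eq_square algebra_simps)
  finally show ?thesis .
 qed
 have "(h u v)\<^sup>2 \<le> h u u * h v v"
 proof (cases "h u u = 0")
  \<comment> \<open>A vanishing leading coefficient leaves an affine function of t that is
    nonnegative everywhere; with nonzero slope it would take the value -1 at the chosen t.\<close>
  case True
  have "h u v = 0"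
  proof (rule ccontr)
   assume n: "h u v ~= 0"
   have "0 \<le> h u u * (- (h v v + 1) / (2 * h u v))\<^sup>2 + 2 * h u v * (- (h v v + 1) / (2 * h u v)) + h v v"
    by (rule q)
   also have "\<dots> = - 1" using n True by (simp add: field_simps)
   finally show False by simp
  qed
  then show ?thesis using True by simp
 next
  case False
  then have pos: "h u u > 0" using p[of u] by simp
  have "0 \<le> h u u * (h u u * (- h u v / h u u)\<^sup>2 + 2 * h u v * (- h u v / h u u) + h v v)"
   by (rule mult_nonneg_nonneg[OF less_imp_le[OF pos] q])
  also have "\<dots> = h u u * h v v - (h u v)\<^sup>2"
   using pos by (simp add: power2_eq_square field_simps)
  finally show ?thesis by simp
 qed
 then have "sqrt ((h u v)\<^sup>2) \<le> sqrt (h u u * h v v)" by (rule real_sqrt_le_mono)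
 then show ?thesis by (simp add: real_sqrt_mult)
qed

lemma form_triangle:
 fixes h :: "'e::euclidean_space => 'e => real"
 assumes b: "bilinear h" and s: "!!u v. h u v = h v u" and p: "!!u. h u u \<ge> 0"
 shows "sqrt (h (u + v) (u + v)) \<le> sqrt (h u u) + sqrt (h v v)"
proof (rule real_le_lsqrt)
 have "h (u + v) (u + v) = h u u + 2 * h u v + h v v"
  using s[of v u] by (simp add: bilinear_ladd[OF b] bilinear_radd[OF b])
 also have "\<dots> \<le> h u u + 2 * (sqrt (h u u) * sqrt (h v v)) + h v v"
  using form_Cauchy_Schwarz[OF assms, of u v] by linarith
 also have "\<dots> = (sqrt (h u u) + sqrt (h v v))\<^sup>2"
  using p by (simp add: power2_sum)
 finally show "h (u + v) (u + v) \<le> (sqrt (h u u) + sqrt (h v v))\<^sup>2" .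
qed (use p in simp)

context rmanifold
begin

abbreviation d where "d \<equiv> riemannian_dist A g"

definition cnorm :: "('a, 'e) chart => 'e => 'e => real" where
 "cnorm ka s u = sqrt (coord_metric A g ka s u u)"

lemma cnorm_props:
 assumes "ka \<in> A" "s \<in> chart_image ka"
 shows cnorm_nonneg: "cnorm ka s u \<ge> 0"
  and cnorm_zero: "cnorm ka s 0 = 0"
  and cnorm_scale: "cnorm ka s (m *\<^sub>R u) = \<bar>m\<bar> * cnorm ka s u"
  and cnorm_triangle: "cnorm ka s (u + v) \<le> cnorm ka s u + cnorm ka s v"
  and cnorm_Cauchy_Schwarz: "\<bar>coord_metric A g ka s u v\<bar> \<le> cnorm ka s u * cnorm ka s v"
  and cnorm_square: "(cnorm ka s u)\<^sup>2 = coord_metric A g ka s u u"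
proof -
 note b = coord_metric_bilinear[OF assms] and n = coord_metric_nonneg[OF assms] and s = coord_metric_sym[OF assms]
 show "cnorm ka s u \<ge> 0" "(cnorm ka s u)\<^sup>2 = coord_metric A g ka s u u" "cnorm ka s 0 = 0"
  using n by (simp_all add: cnorm_def bilinear_lzero[OF b])
 show "cnorm ka s (m *\<^sub>R u) = \<bar>m\<bar> * cnorm ka s u"
  by (simp add: cnorm_def bilinear_lmul[OF b] bilinear_rmul[OF b] real_sqrt_mult flip: mult.assoc)
 show "cnorm ka s (u + v) \<le> cnorm ka s u + cnorm ka s v"
  unfolding cnorm_def by (rule form_triangle[OF b s n])
 show "\<bar>coord_metric A g ka s u v\<bar> \<le> cnorm ka s u * cnorm ka s v"
  unfolding cnorm_def by (rule form_Cauchy_Schwarz[OF b s n])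
qed

lemma cnorm_bounds:
 assumes "ka \<in> A" "s \<in> chart_image ka"
 obtains c C where "c > 0" "C > 0" "!!u. c * norm u \<le> cnorm ka s u" "!!u. cnorm ka s u \<le> C * norm u"
proof -
 note b = coord_metric_bilinear[OF assms]
 obtain c where c: "c > 0" "!!u. c * (norm u)\<^sup>2 \<le> coord_metric A g ka s u u"
  using posdef_lower_bound[OF b coord_metric_pos[OF assms]] by blast
 obtain K where K: "K > 0" "!!u v. \<bar>coord_metric A g ka s u v\<bar> \<le> K * norm u * norm v"
  using bilinear_bounded_pos[OF b] by auto
 show ?thesis
 proof (rule that[of "sqrt c" "sqrt K"])
  fix u
  have "sqrt (c * (norm u)\<^sup>2) \<le> cnorm ka s u" unfolding cnorm_def using c by (intro real_sqrt_le_mono)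
  then show "sqrt c * norm u \<le> cnorm ka s u" by (simp add: real_sqrt_mult)
  have "cnorm ka s u \<le> sqrt (K * (norm u)\<^sup>2)" unfolding cnorm_def
   using K(2)[of u u] by (intro real_sqrt_le_mono) (simp add: power2_eq_square)
  then show "cnorm ka s u \<le> sqrt K * norm u" by (simp add: real_sqrt_mult)
 qed (use c K in auto)
qed

lemma cnorm_ratio:
 assumes "ka \<in> A" "s \<in> chart_image ka" "0 < e" "e < 1" "open U" "s \<in> U"
 obtains r where "r > 0" "ball s r \<subseteq> chart_image ka" "ball s r \<subseteq> U"
  "!!z u. z \<in> ball s r ==> (1 - e) * cnorm ka s u \<le> cnorm ka z u"
  "!!z u. z \<in> ball s r ==> cnorm ka z u \<le> (1 + e) * cnorm ka s u"
proof -
 obtain r where r: "r > 0" "ball s r \<subseteq> chart_image ka"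
  "!!z u. z \<in> ball s r ==> (1 - e) * coord_metric A g ka s u u \<le> coord_metric A g ka z u u"
  "!!z u. z \<in> ball s r ==> coord_metric A g ka z u u \<le> (1 + e) * coord_metric A g ka s u u"
  using bilinear_form_ratio[of "chart_image ka" s "coord_metric A g ka" e] chart_open(2)[OF assms(1)]
   coord_metric_bilinear coord_metric_cont coord_metric_pos assms by metis
 obtain r' where r': "r' > 0" "ball s r' \<subseteq> U" using assms(5,6) openE by blast
 have sq: "1 - e \<le> sqrt (1 - e)" "sqrt (1 + e) \<le> 1 + e"
 proof -
  have "(1 - e)\<^sup>2 \<le> 1 - e" using assms(3,4) by (simp add: power2_eq_square algebra_simps)
  then show "1 - e \<le> sqrt (1 - e)" using real_le_rsqrt by blast
  have "1 + e \<le> (1 + e)\<^sup>2" using assms(3,4) by (simp add: power2_eq_square algebra_simps)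
  then show "sqrt (1 + e) \<le> 1 + e" using assms(3) by (intro real_le_lsqrt) auto
 qed
 show ?thesis
 proof (rule that[of "min r r'"])
  fix z u assume z: "z \<in> ball s (min r r')"
  have "(1 - e) * cnorm ka s u \<le> sqrt (1 - e) * cnorm ka s u"
   using sq cnorm_nonneg[OF assms(1,2)] by (simp add: mult_right_mono)
  also have "\<dots> \<le> cnorm ka z u"
   unfolding cnorm_def real_sqrt_mult[symmetric] using r(3) z by (intro real_sqrt_le_mono) auto
  finally show "(1 - e) * cnorm ka s u \<le> cnorm ka z u" .
  have "cnorm ka z u \<le> sqrt (1 + e) * cnorm ka s u"
   unfolding cnorm_def real_sqrt_mult[symmetric] using r(4) z by (intro real_sqrt_le_mono) auto
  also have "\<dots> \<le> (1 + e) * cnorm ka s u"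
   using sq cnorm_nonneg[OF assms(1,2)] by (simp add: mult_right_mono)
  finally show "cnorm ka z u \<le> (1 + e) * cnorm ka s u" .
 qed (use r r' in auto)
qed

lemma dist_bdd: "bdd_below {curve_length A g ga | ga. piecewise_C1_curve A ga \<and> ga 0 = x \<and> ga 1 = y}"
 by (rule bdd_belowI[of _ 0])
  (auto simp: piecewise_C1_curve_iff curve_length_speed intro!: Henstock_Kurzweil_Integration.integral_nonneg speed_integrable speed_nonneg)

lemma dist_le_speed:
 assumes "pw P ga a b" "a < b"
 shows "d (ga a) (ga b) \<le> integral {a..b} (speed ga)"
proof -
 have im: "(\<lambda>t. (b - a) * t + a) ` {0..1} = {a..b}"
  using assms(2) by (simp add: image_affinity_atLeastAtMost)
 note * = pw_affine[OF assms(1) _ im]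
 show ?thesis
  unfolding riemannian_dist_def
 proof (rule cInf_lower[OF _ dist_bdd])
  show "integral {a..b} (speed ga) \<in> {curve_length A g ga' |ga'. piecewise_C1_curve A ga' \<and> ga' 0 = ga a \<and> ga' 1 = ga b}"
   using * assms(2) by (auto simp: curve_length_speed piecewise_C1_curve_iff intro!: exI[of _ "\<lambda>t. ga ((b - a) * t + a)"])
 qed
qed

text \<open>For the metric frozen at s a straight segment is shortest. The linear functional pairing
  a velocity with the total displacement \<open>?D\<close> is integrated, Cauchy-Schwarz is applied
  pointwise, and one factor, the norm of \<open>?D\<close>, is divided out at the end.\<close>

lemma piece_lower_bound:
 assumes "C1_curve_on A {u..v} ga" "u < v" "ka \<in> A" "s \<in> chart_image ka" "ga ` {u..v} \<subseteq> chart_inv ka ` B" "B \<subseteq> chart_image ka"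
  "!!z u. z \<in> B ==> (1 - e) * cnorm ka s u \<le> cnorm ka z u" "e < 1"
 shows "(1 - e) * cnorm ka s (snd ka (ga v) - snd ka (ga u)) \<le> integral {u..v} (speed ga)"
proof -
 let ?G = "coord_metric A g ka s"
 let ?D = "snd ka (ga v) - snd ka (ga u)"
 have inB: "snd ka (ga t) \<in> B \<and> ga t \<in> fst ka" if t: "t \<in> {u..v}" for t
 proof -
  obtain w where w: "w \<in> B" "ga t = chart_inv ka w" using subsetD[OF assms(5) imageI[OF t]] by (rule imageE) (rule that)
  have w': "w \<in> chart_image ka" by (rule subsetD[OF assms(6) w(1)])
  show ?thesis unfolding w(2) chart_eq[OF assms(3) w'] by (rule conjI[OF w(1) chart_inv_in[OF assms(3) w']])
 qed
 then have sub: "ga ` {u..v} \<subseteq> fst ka" by blast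
 obtain y' where y': "continuous_on {u..v} y'"
  "!!t. t \<in> {u..v} ==> (snd ka \<circ> ga has_vector_derivative y' t) (at t within {u..v})"
  "!!t. t \<in> {u<..<v} ==> speed ga t = sqrt (coord_metric A g ka (snd ka (ga t)) (y' t) (y' t))"
  using C1_piece[OF assms(1,3) sub] by metis
 note sp = speed_piece_integral[OF assms(1,3) sub assms(2) y'(1,3)]
 note b = coord_metric_bilinear[OF assms(3,4)]
 have bl: "bounded_linear (\<lambda>w. ?G w ?D)"
  using b by (simp add: bilinear_def linear_conv_bounded_linear)
 have "((\<lambda>t. ?G (y' t) ?D) has_integral (?G ((snd ka \<circ> ga) v) ?D - ?G ((snd ka \<circ> ga) u) ?D)) {u..v}"
  by (rule fundamental_theorem_of_calculus)
   (use assms(2) bounded_linear.has_vector_derivative[OF bl y'(2)] in auto)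
 then have I: "((\<lambda>t. (1 - e) * ?G (y' t) ?D) has_integral (1 - e) * ?G ?D ?D) {u..v}"
  by (intro has_integral_mult_right) (simp add: bilinear_lsub[OF b])
 have J: "((\<lambda>t. cnorm ka (snd ka (ga t)) (y' t) * cnorm ka s ?D) has_integral integral {u..v} (speed ga) * cnorm ka s ?D) {u..v}"
  using has_integral_mult_left[OF integrable_integral[OF sp(2)], of "cnorm ka s ?D"] integral_unique[OF sp(1)]
  by (simp add: cnorm_def)
 have "(1 - e) * ?G ?D ?D \<le> integral {u..v} (speed ga) * cnorm ka s ?D"
 proof (rule has_integral_le[OF I J])
  fix t assume t: "t \<in> {u..v}"
  have "(1 - e) * ?G (y' t) ?D \<le> (1 - e) * (cnorm ka s (y' t) * cnorm ka s ?D)"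
   using cnorm_Cauchy_Schwarz[OF assms(3,4), of "y' t" ?D] assms(8) by (intro mult_left_mono) auto
  also have "\<dots> \<le> cnorm ka (snd ka (ga t)) (y' t) * cnorm ka s ?D"
   using mult_right_mono[OF assms(7)[OF conjunct1[OF inB[OF t]], of "y' t"] cnorm_nonneg[OF assms(3,4), of ?D]] by simp
  finally show "(1 - e) * ?G (y' t) ?D \<le> cnorm ka (snd ka (ga t)) (y' t) * cnorm ka s ?D" .
 qed
 then have *: "((1 - e) * cnorm ka s ?D) * cnorm ka s ?D \<le> integral {u..v} (speed ga) * cnorm ka s ?D"
  by (simp only: cnorm_square[OF assms(3,4), of ?D, symmetric] power2_eq_square mult.assoc)
 show ?thesis
 proof (cases "cnorm ka s ?D = 0")
  case True
  have "0 \<le> integral {u..v} (speed ga)" using sp(1) has_integral_nonneg speed_nonneg by (metis integral_unique)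
  then show ?thesis using True by simp
 next
  case False
  then have "cnorm ka s ?D > 0" using cnorm_nonneg[OF assms(3,4), of ?D] by simp
  with * show ?thesis by (simp only: mult_le_cancel_right)
 qed
qed

text \<open>The coordinate distance to z, truncated at rh, extends by the constant rh outside the
  chart. A curve pays for every increase of this function while it is in the chart, and the function
  is constant near the points outside, so curves that leave the chart are controlled as
  well.\<close>

lemma barrier:
 assumes ka: "ka \<in> A" "s \<in> chart_image ka" and B: "open B" "B \<subseteq> chart_image ka"
  "!!z u. z \<in> B ==> (1 - e) * cnorm ka s u \<le> cnorm ka z u" "e < 1"
  and rh: "rh > 0" "{w. cnorm ka s (w - z) \<le> rh} \<subseteq> B"
  and pw: "pw P ga a b" "a \<le> b" "ga a = chart_inv ka z"
 shows "(1 - e) * (if ga b \<in> chart_inv ka ` B then min (cnorm ka s (snd ka (ga b) - z)) rh else rh) \<le> integral {a..b} (speed ga)"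
proof -
 let ?K = "{w. cnorm ka s (w - z) \<le> rh}"
 define U where "U q = (if q \<in> chart_inv ka ` B then min (cnorm ka s (snd ka q - z)) rh else rh)" for q
 obtain c where c: "c > 0" "!!u. c * norm u \<le> cnorm ka s u" using cnorm_bounds[OF ka] by metis
 have contn: "continuous_on UNIV (\<lambda>w. cnorm ka s (w - z))"
 proof -
  have "continuous_on UNIV (\<lambda>w. sqrt ((\<lambda>(s, u, v). coord_metric A g ka s u v) (s, w - z, w - z)))"
   by (intro continuous_intros continuous_on_compose2[OF coord_metric_cont3[OF ka(1)]]) (use ka(2) in auto)
  then show ?thesis by (simp add: cnorm_def)
 qed
 have "compact ?K"
 proof (rule compact_eq_bounded_closed[THEN iffD2], rule conjI)
  have "?K \<subseteq> cball z (rh / c)"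
  proof
   fix w assume "w \<in> ?K"
   then have "c * norm (w - z) \<le> rh" using c(2)[of "w - z"] by simp
   then show "w \<in> cball z (rh / c)" using c(1) by (simp add: dist_norm norm_minus_commute field_simps)
  qed
  then show "bounded ?K" by (rule bounded_subset[OF bounded_cball])
  show "closed ?K" using closed_Collect_le[OF contn continuous_on_const] by simp
 qed
 then have "compact (chart_inv ka ` ?K)"
  using rh(2) B(2) chart_cont(2)[OF ka(1)] by (meson compact_continuous_image continuous_on_subset order_trans)
 \<comment> \<open>The Hausdorff property enters here: the sublevel set is compact in the chart,
   hence closed in the manifold, and its complement is a neighbourhood of every point outside the
   image of B.\<close>
 then have clK: "closed (chart_inv ka ` ?K)" by (rule compact_imp_closed)
 have opB: "open (chart_inv ka ` B)" by (rule chart_inv_image_open) fact+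
 have "(1 - e) * (U (ga b) - U (ga a)) \<le> integral {a..b} (speed ga)"
 proof (rule pw_induct[OF pw(1,2), of "\<lambda>u v. (1 - e) * (U (ga v) - U (ga u)) \<le> integral {u..v} (speed ga)"])
  show "(1 - e) * (U (ga u) - U (ga u)) \<le> integral {u..u} (speed ga)" for u by simp
  show "(1 - e) * (U (ga w) - U (ga u)) \<le> integral {u..w} (speed ga)"
   if *: "a \<le> u" "u \<le> v" "v \<le> w" "w \<le> b" "(1 - e) * (U (ga v) - U (ga u)) \<le> integral {u..v} (speed ga)"
    "(1 - e) * (U (ga w) - U (ga v)) \<le> integral {v..w} (speed ga)" for u v w
  proof -
   have "speed ga integrable_on {u..w}" using speed_integrable pw_subinterval[OF pw(1)] * by force
   from Henstock_Kurzweil_Integration.integral_combine[OF *(2,3) this] show ?thesis using * by (simp add: algebra_simps)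
  qed
  fix t assume t: "t \<in> {a..b}"
  show "\<exists>W. open W \<and> ga t \<in> W \<and> (\<forall>u v. a \<le> u \<and> u < v \<and> v \<le> b \<and> C1_curve_on A {u..v} ga \<and> ga ` {u..v} \<subseteq> W -->
       (1 - e) * (U (ga v) - U (ga u)) \<le> integral {u..v} (speed ga))"
  proof (cases "ga t \<in> chart_inv ka ` B")
   case True
   show ?thesis
   proof (intro exI[of _ "chart_inv ka ` B"] conjI allI impI True opB)
    fix u v assume uv: "a \<le> u \<and> u < v \<and> v \<le> b \<and> C1_curve_on A {u..v} ga \<and> ga ` {u..v} \<subseteq> chart_inv ka ` B"
    then have in': "ga u \<in> chart_inv ka ` B" "ga v \<in> chart_inv ka ` B" by auto
    have "cnorm ka s (snd ka (ga v) - z) \<le> cnorm ka s (snd ka (ga v) - snd ka (ga u)) + cnorm ka s (snd ka (ga u) - z)"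
     using cnorm_triangle[OF ka, of "snd ka (ga v) - snd ka (ga u)" "snd ka (ga u) - z"] by simp
    then have "U (ga v) - U (ga u) \<le> cnorm ka s (snd ka (ga v) - snd ka (ga u))"
     unfolding U_def using in' cnorm_nonneg[OF ka, of "snd ka (ga v) - snd ka (ga u)"] by (auto simp: min_def)
    then have "(1 - e) * (U (ga v) - U (ga u)) \<le> (1 - e) * cnorm ka s (snd ka (ga v) - snd ka (ga u))"
     using B(4) by (intro mult_left_mono) auto
    also have "\<dots> \<le> integral {u..v} (speed ga)"
     using uv by (intro piece_lower_bound[OF _ _ ka _ B(2,3,4)]) auto
    finally show "(1 - e) * (U (ga v) - U (ga u)) \<le> integral {u..v} (speed ga)" .
   qed
  next
   case False
   show ?thesis
   proof (intro exI[of _ "- chart_inv ka ` ?K"] conjI allI impI)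
    show "open (- chart_inv ka ` ?K)" using clK by auto
    show "ga t \<in> - chart_inv ka ` ?K" using False rh(2) by blast
    fix u v assume uv: "a \<le> u \<and> u < v \<and> v \<le> b \<and> C1_curve_on A {u..v} ga \<and> ga ` {u..v} \<subseteq> - chart_inv ka ` ?K"
    have U: "U q = rh" if "q \<notin> chart_inv ka ` ?K" for q
    proof (cases "q \<in> chart_inv ka ` B")
     case True
     then obtain w where w: "w \<in> B" "q = chart_inv ka w" by blast
     then have "cnorm ka s (w - z) > rh" using that by force
     then show ?thesis unfolding U_def using w B(2) chart_eq[OF ka(1)] by (auto simp: min_def)
    qed (simp add: U_def)
    have "0 \<le> integral {u..v} (speed ga)"
     by (intro Henstock_Kurzweil_Integration.integral_nonneg speed_integrable[OF pw_subinterval[OF pw(1)]] speed_nonneg) (use uv in auto)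
    moreover have "U (ga v) = rh" "U (ga u) = rh" using uv by (auto intro!: U simp: image_subset_iff)
    ultimately show "(1 - e) * (U (ga v) - U (ga u)) \<le> integral {u..v} (speed ga)" by simp
   qed
  qed
 qed
 moreover have "U (ga a) = 0"
 proof -
  have "z \<in> B" using rh cnorm_zero[OF ka] by auto
  then show ?thesis unfolding U_def pw(3) using chart_eq[OF ka(1), of z] B(2) rh(1) cnorm_zero[OF ka] by auto
 qed
 ultimately show ?thesis unfolding U_def by simp
qed

end

section \<open>Joining curves, and the distance as a metric for the manifold topology\<close>

context rmanifold
begin

lemma C1_curve_cong:
 assumes "!!t. t \<in> I ==> ga t = de t" "C1_curve_on A I de"
 shows "C1_curve_on A I ga"
 unfolding C1_curve_on_def
proof (intro conjI ballI)
 show "continuous_on I ga" using assms continuous_on_cong unfolding C1_curve_on_def by metis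
 fix ka assume "ka \<in> A"
 have eq: "{t \<in> I. ga t \<in> fst ka} = {t \<in> I. de t \<in> fst ka}" using assms(1) by auto
 obtain y' where "continuous_on {t \<in> I. de t \<in> fst ka} y'"
  "!!t. t \<in> {t \<in> I. de t \<in> fst ka} ==> (snd ka \<circ> de has_vector_derivative y' t) (at t within I)"
  using assms(2) \<open>ka \<in> A\<close> unfolding C1_curve_on_def by meson
 then show "\<exists>y'. continuous_on {t \<in> I. ga t \<in> fst ka} y' \<and> (\<forall>t\<in>{t \<in> I. ga t \<in> fst ka}.
   (snd ka \<circ> ga has_vector_derivative y' t) (at t within I))"
  unfolding eq using assms(1)
  by (intro exI[of _ y'] conjI ballI has_vector_derivative_transform[of _ I "snd ka \<circ> ga" "snd ka \<circ> de"]) auto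
qed

lemma segment_C1:
 assumes ka: "ka \<in> A" and seg: "!!t. t \<in> I ==> z + t *\<^sub>R w \<in> chart_image ka"
 shows "C1_curve_on A I (\<lambda>t. chart_inv ka (z + t *\<^sub>R w))"
 unfolding C1_curve_on_def
proof (intro conjI ballI)
 show "continuous_on I (\<lambda>t. chart_inv ka (z + t *\<^sub>R w))"
  by (rule continuous_on_compose2[OF chart_cont(2)[OF ka]]) (use seg in \<open>auto intro!: continuous_intros\<close>)
 fix ka' assume ka': "ka' \<in> A"
 let ?F = "snd ka' \<circ> chart_inv ka"
 let ?J = "{t \<in> I. chart_inv ka (z + t *\<^sub>R w) \<in> fst ka'}"
 have sm: "smooth_on ?F (snd ka ` (fst ka \<inter> fst ka'))"
  using atlas ka ka' unfolding smooth_atlas_def by blast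
 have in': "z + t *\<^sub>R w \<in> snd ka ` (fst ka \<inter> fst ka')" if t: "t \<in> ?J" for t
  using seg[of t] t chart_eq[OF ka] chart_inv_in[OF ka] by (metis (no_types, lifting) IntI imageI mem_Collect_eq)
 show "\<exists>y'. continuous_on ?J y' \<and> (\<forall>t\<in>?J. (snd ka' \<circ> (\<lambda>t. chart_inv ka (z + t *\<^sub>R w)) has_vector_derivative y' t) (at t within I))"
 proof (intro exI[of _ "\<lambda>t. pd ?F w (z + t *\<^sub>R w)"] conjI ballI)
  show "continuous_on ?J (\<lambda>t. pd ?F w (z + t *\<^sub>R w))"
   by (rule continuous_on_compose2[OF smooth_on_continuous_derivative[OF sm]]) (use in' in \<open>auto intro!: continuous_intros\<close>)
  fix t assume t: "t \<in> ?J"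
  have "((\<lambda>t. z + t *\<^sub>R w) has_vector_derivative w) (at t within I)"
   by (auto intro!: derivative_eq_intros simp: has_vector_derivative_def)
  from vector_derivative_diff_chain_within[OF this has_derivative_at_withinI[OF smooth_on_has_derivative[OF sm in'[OF t]]]]
  show "(snd ka' \<circ> (\<lambda>t. chart_inv ka (z + t *\<^sub>R w)) has_vector_derivative pd ?F w (z + t *\<^sub>R w)) (at t within I)"
   by (simp add: comp_def)
 qed
qed

lemma segment_pw:
 assumes ka: "ka \<in> A" and seg: "!!t. t \<in> {0..1} ==> z + t *\<^sub>R w \<in> chart_image ka"
 shows "pw {} (\<lambda>t. chart_inv ka (z + t *\<^sub>R w)) 0 1"
  "t \<in> {0<..<1} ==> speed (\<lambda>t. chart_inv ka (z + t *\<^sub>R w)) t = cnorm ka (z + t *\<^sub>R w) w"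
proof -
 have C1: "C1_curve_on A {u..v} (\<lambda>t. chart_inv ka (z + t *\<^sub>R w))" if "0 \<le> u" "v \<le> 1" for u v
  by (rule segment_C1[OF ka seg]) (use that in auto)
 then show "pw {} (\<lambda>t. chart_inv ka (z + t *\<^sub>R w)) 0 1"
  unfolding pw_def using C1[of 0 1] by (auto simp: C1_curve_on_def[of A "{0..1}"])
 assume t: "t \<in> {0<..<1}"
 have z: "z + t *\<^sub>R w \<in> chart_image ka" using seg t by simp
 have e: "\<forall>\<^sub>F s in nhds t. z + s *\<^sub>R w \<in> chart_image ka"
  by (rule eventually_nhds[THEN iffD2]) (use t seg in \<open>auto intro!: exI[of _ "{0<..<1}"]\<close>)
 have "((\<lambda>t. z + t *\<^sub>R w) has_vector_derivative w) (at t)"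
  by (auto intro!: derivative_eq_intros simp: has_vector_derivative_def)
 then have "(snd ka \<circ> (\<lambda>t. chart_inv ka (z + t *\<^sub>R w)) has_vector_derivative w) (at t)"
  unfolding has_vector_derivative_def
  by (rule has_derivative_transform_eventually)
   (use eventually_mono[OF filter_leD[OF at_within_le_nhds e]] z chart_eq[OF ka] in \<open>simp_all add: comp_def\<close>)
 moreover have "isCont (\<lambda>t. chart_inv ka (z + t *\<^sub>R w)) t"
  by (rule isCont_o2[OF _ chart_isCont(2)[OF ka]]) (use z in \<open>auto intro!: continuous_intros\<close>)
 ultimately show "speed (\<lambda>t. chart_inv ka (z + t *\<^sub>R w)) t = cnorm ka (z + t *\<^sub>R w) w"
  unfolding speed_def cnorm_def
  using velocity_coord(3)[OF ka, of "\<lambda>t. chart_inv ka (z + t *\<^sub>R w)" t UNIV w] chart_inv_in[OF ka z] chart_eq[OF ka z]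
  by simp
qed

lemma speed_cong:
 assumes "\<forall>\<^sub>F s in nhds t. ga s = de s"
 shows "speed ga t = speed de t"
proof -
 have t: "ga t = de t" using eventually_nhds_x_imp_x[OF assms] .
 have "velocity A UNIV ga t = velocity A UNIV de t"
  unfolding velocity_def t
  by (rule vector_derivative_cong_eq) (use assms in \<open>auto elim: eventually_mono\<close>)
 then show ?thesis unfolding speed_def t by simp
qed

text \<open>The junction time becomes a break point. The curve stays on {0..2}, so that both halves
  keep parameter intervals of length 1; \<open>pw_join\<close> rescales it.\<close>

lemma pw_concat:
 assumes p: "pw P ga 0 1" and q: "pw Q de 0 1" and eq: "ga 1 = de 0"
 defines "et \<equiv> \<lambda>t. if t \<le> 1 then ga t else de (t - 1)"
 shows "\<exists>R. pw R et 0 2" "integral {0..2} (speed et) = integral {0..1} (speed ga) + integral {0..1} (speed de)"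
proof -
 define de' where "de' = (\<lambda>t. de (1 * t + (-1)))"
 note q' = pw_affine[OF q, of 1 "-1" 1 2, simplified, folded de'_def[simplified]]
 have im: "(\<lambda>t::real. t - 1) ` {1..2} = {0..1}" using image_add_atLeastAtMost'[of "-1::real" 1 2] by simp
 have q1: "pw ((\<lambda>t. t - 1) -` Q) de' 1 2" "integral {1..2} (speed de') = integral {0..1} (speed de)"
  using pw_affine[OF q, of 1 "-1" 1 2] im unfolding de'_def by auto
 have e1: "et t = ga t" if "t \<le> 1" for t using that unfolding et_def by simp
 have e2: "et t = de' t" if "t \<ge> 1" for t using that eq unfolding et_def de'_def by auto
 have "continuous_on {0..1} et" by (rule continuous_on_eq[OF pw_continuous[OF p]]) (simp add: e1)
 moreover have "continuous_on {1..2} et" by (rule continuous_on_eq[OF pw_continuous[OF q1(1)]]) (simp add: e2)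
 ultimately have "continuous_on ({0..1} \<union> {1..2}) et" by (intro continuous_on_closed_Un) auto
 moreover have "{0..1} \<union> {1..2} = {0..2::real}" by auto
 ultimately have cont: "continuous_on {0..2} et" by simp
 have pw: "pw (insert 1 (P \<union> (\<lambda>t. t - 1) -` Q)) et 0 2"
  unfolding pw_def
 proof (intro conjI allI impI cont)
  show "finite (insert 1 (P \<union> (\<lambda>t. t - 1) -` Q))" using p q1 unfolding pw_def by simp
  fix u v :: real assume uv: "0 \<le> u \<and> u < v \<and> v \<le> 2 \<and> {u<..<v} \<inter> insert 1 (P \<union> (\<lambda>t. t - 1) -` Q) = {}"
  then consider "v \<le> 1" | "u \<ge> 1" by force
  then show "C1_curve_on A {u..v} et"
  proof cases
   case 1
   have D: "{u<..<v} \<inter> P = {}" using uv by blast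
   show ?thesis by (rule C1_curve_cong[of _ _ ga]) (use D 1 e1 uv p in \<open>auto simp: pw_def\<close>)
  next
   case 2
   have D: "{u<..<v} \<inter> (\<lambda>t. t - 1) -` Q = {}" using uv by blast
   show ?thesis by (rule C1_curve_cong[of _ _ de']) (use D 2 e2 uv q1(1) in \<open>auto simp: pw_def\<close>)
  qed
 qed
 then show "\<exists>R. pw R et 0 2" by blast
 have i: "speed et integrable_on {0..2}" by (rule speed_integrable[OF pw]) simp
 have "integral {0..1} (speed et) = integral {0..1} (speed ga)"
 proof (rule integral_spike[of "{1}"])
  fix t :: real assume "t \<in> {0..1} - {1}"
  then have "\<forall>\<^sub>F s in nhds t. s < 1" by (intro eventually_nhds[THEN iffD2] exI[of _ "{..<1}"]) auto
  then show "speed ga t = speed et t" by (intro speed_cong) (auto elim!: eventually_mono simp: e1)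
 qed simp
 moreover have "integral {1..2} (speed et) = integral {1..2} (speed de')"
 proof (rule integral_spike[of "{1}"])
  fix t :: real assume "t \<in> {1..2} - {1}"
  then have "\<forall>\<^sub>F s in nhds t. s > 1" by (intro eventually_nhds[THEN iffD2] exI[of _ "{1<..}"]) auto
  then show "speed de' t = speed et t" by (intro speed_cong) (auto elim!: eventually_mono simp: e2)
 qed simp
 ultimately show "integral {0..2} (speed et) = integral {0..1} (speed ga) + integral {0..1} (speed de)"
  using Henstock_Kurzweil_Integration.integral_combine[of 0 1 2 "speed et"] i q1(2) by simp
qed

lemma pw_join:
 assumes p: "pw P ga 0 1" and q: "pw Q de 0 1" and eq: "ga 1 = de 0"
 shows "\<exists>R et. pw R et 0 1 \<and> et 0 = ga 0 \<and> et 1 = de 1 \<and>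
  integral {0..1} (speed et) = integral {0..1} (speed ga) + integral {0..1} (speed de)"
proof -
 obtain R where R: "pw R (\<lambda>t. if t \<le> 1 then ga t else de (t - 1)) 0 2" using pw_concat(1)[OF assms] by blast
 have im: "(\<lambda>t::real. 2 * t + 0) ` {0..1} = {0..2}" using image_mult_atLeastAtMost[of "2::real" 0 1] by simp
 note pw_affine[OF R _ im]
 then show ?thesis using pw_concat(2)[OF assms]
  by (intro exI[of _ "(\<lambda>t. 2 * t + 0) -` R"] exI[of _ "\<lambda>t. if 2 * t + 0 \<le> 1 then ga (2 * t + 0) else de (2 * t + 0 - 1)"]) auto
qed

lemma pw_reverse:
 assumes p: "pw P ga 0 1"
 shows "\<exists>R et. pw R et 0 1 \<and> et 0 = ga 1 \<and> et 1 = ga 0 \<and> integral {0..1} (speed et) = integral {0..1} (speed ga)"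
proof -
 have im: "(\<lambda>t::real. (-1) * t + 1) ` {0..1} = {0..1}" by (simp add: image_affinity_atLeastAtMost)
 note pw_affine[OF p _ im]
 then show ?thesis
  by (intro exI[of _ "(\<lambda>t. (-1) * t + 1) -` P"] exI[of _ "\<lambda>t. ga ((-1) * t + 1)"]) auto
qed

text \<open>It keeps the infimum that defines the distance from running over an empty set.
  Reachability by piecewise C1 curves is an equivalence relation with open classes, so connectedness
  leaves a single class.\<close>

lemma curve_exists: "\<exists>P ga. pw P ga 0 1 \<and> ga 0 = x \<and> ga 1 = y"
proof -
 define R where "R x y \<longleftrightarrow> (\<exists>P ga. pw P ga 0 1 \<and> ga 0 = x \<and> ga 1 = y)" for x y
 have trans: "R x z" if "R x y" "R y z" for x y z using that pw_join unfolding R_def by metis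
 have sym: "R y x" if "R x y" for x y using that pw_reverse unfolding R_def by metis
 have loc: "\<exists>W. open W \<and> y \<in> W \<and> (\<forall>q\<in>W. R y q)" for y
 proof -
  let ?ka = "chart_at A y"
  obtain r where r: "r > 0" "ball (snd ?ka y) r \<subseteq> chart_image ?ka"
   using chart_open(2)[OF chart_at(1)[of y]] chart_at(2)[of y] by (meson imageI openE)
  show ?thesis
  proof (intro exI[of _ "chart_inv ?ka ` ball (snd ?ka y) r"] conjI ballI)
   show "open (chart_inv ?ka ` ball (snd ?ka y) r)"
    by (rule chart_inv_image_open[OF chart_at(1)]) (use r in auto)
   show "y \<in> chart_inv ?ka ` ball (snd ?ka y) r"
    using r(1) chart_inv_eq[OF chart_at(1) chart_at(2)] by (metis centre_in_ball imageI)
   fix q assume "q \<in> chart_inv ?ka ` ball (snd ?ka y) r"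
   then obtain z where z: "z \<in> ball (snd ?ka y) r" "q = chart_inv ?ka z" by blast
   have "pw {} (\<lambda>t. chart_inv ?ka (snd ?ka y + t *\<^sub>R (z - snd ?ka y))) 0 1"
   proof (rule segment_pw(1)[OF chart_at(1)])
    fix t :: real assume t: "t \<in> {0..1}"
    have "norm (t *\<^sub>R (z - snd ?ka y)) \<le> 1 * norm (z - snd ?ka y)"
     unfolding norm_scaleR using t by (intro mult_right_mono) auto
    then have "snd ?ka y + t *\<^sub>R (z - snd ?ka y) \<in> ball (snd ?ka y) r" using z by (simp add: dist_norm norm_minus_commute)
    then show "snd ?ka y + t *\<^sub>R (z - snd ?ka y) \<in> chart_image ?ka" using r by blast
   qed
   then show "R y q" unfolding R_def z(2)
    using chart_inv_eq[OF chart_at(1) chart_at(2), of y]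
    by (intro exI[of _ "{}"] exI[of _ "\<lambda>t. chart_inv ?ka (snd ?ka y + t *\<^sub>R (z - snd ?ka y))"] conjI) auto
  qed
 qed
 have "open {y. R x y}"
 proof (subst open_subopen, intro ballI)
  fix y assume y: "y \<in> {y. R x y}"
  obtain W where "open W" "y \<in> W" "\<forall>q\<in>W. R y q" using loc by blast
  then show "\<exists>T. open T \<and> y \<in> T \<and> T \<subseteq> {y. R x y}" using y trans by (intro exI[of _ W]) blast
 qed
 moreover have "open (- {y. R x y})"
 proof (subst open_subopen, intro ballI)
  fix y assume y: "y \<in> - {y. R x y}"
  obtain W where "open W" "y \<in> W" "\<forall>q\<in>W. R y q" using loc by blast
  then show "\<exists>T. open T \<and> y \<in> T \<and> T \<subseteq> - {y. R x y}" using y trans sym by (intro exI[of _ W]) blast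
 qed
 moreover have "x \<in> {y. R x y}" using loc[of x] by auto
 ultimately have "{y. R x y} = UNIV"
  using conn unfolding connected_clopen by (auto simp: closed_def)
 then show ?thesis unfolding R_def by blast
qed

lemma dist_geI:
 assumes "!!P ga. pw P ga 0 1 ==> ga 0 = x ==> ga 1 = y ==> L \<le> integral {0..1} (speed ga)"
 shows "L \<le> d x y"
 unfolding riemannian_dist_def
proof (rule cInf_greatest)
 show "{curve_length A g ga |ga. piecewise_C1_curve A ga \<and> ga 0 = x \<and> ga 1 = y} ~= {}"
  using curve_exists unfolding piecewise_C1_curve_iff by blast
qed (use assms in \<open>auto simp: piecewise_C1_curve_iff curve_length_speed\<close>)

lemma dist_approx:
 assumes "e > 0"
 obtains P ga where "pw P ga 0 1" "ga 0 = x" "ga 1 = y" "integral {0..1} (speed ga) < d x y + e"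
proof -
 have "\<exists>l\<in>{curve_length A g ga |ga. piecewise_C1_curve A ga \<and> ga 0 = x \<and> ga 1 = y}. l < d x y + e"
  unfolding riemannian_dist_def
 proof (rule cInf_lessD)
  show "{curve_length A g ga |ga. piecewise_C1_curve A ga \<and> ga 0 = x \<and> ga 1 = y} ~= {}"
   using curve_exists unfolding piecewise_C1_curve_iff by blast
 qed (use assms in simp)
 then show ?thesis using that by (auto simp: piecewise_C1_curve_iff curve_length_speed)
qed

lemma d_nonneg: "d x y \<ge> 0"
 by (rule dist_geI) (auto intro!: Henstock_Kurzweil_Integration.integral_nonneg speed_integrable speed_nonneg)

lemma d_sym_le: "d x y \<le> d y x"
proof (rule dist_geI)
 fix P ga assume *: "pw P ga 0 1" "ga 0 = y" "ga 1 = x"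
 obtain R et where "pw R et 0 1" "et 0 = ga 1" "et 1 = ga 0" "integral {0..1} (speed et) = integral {0..1} (speed ga)"
  using pw_reverse[OF *(1)] by blast
 then show "d x y \<le> integral {0..1} (speed ga)" using dist_le_speed[of R et 0 1] * by simp
qed

lemma d_sym: "d x y = d y x"
 using d_sym_le[of x y] d_sym_le[of y x] by simp

lemma d_triangle: "d x z \<le> d x y + d y z"
proof (rule field_le_epsilon)
 fix e :: real assume "e > 0"
 then have "e / 2 > 0" by simp
 obtain P ga where p: "pw P ga 0 1" "ga 0 = x" "ga 1 = y" "integral {0..1} (speed ga) < d x y + e/2" using dist_approx[OF \<open>e/2 > 0\<close>] by metis
 obtain Q de where q: "pw Q de 0 1" "de 0 = y" "de 1 = z" "integral {0..1} (speed de) < d y z + e/2" using dist_approx[OF \<open>e/2 > 0\<close>] by metis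
 obtain R et where "pw R et 0 1" "et 0 = x" "et 1 = z" "integral {0..1} (speed et) = integral {0..1} (speed ga) + integral {0..1} (speed de)"
  using pw_join[OF p(1) q(1)] p q by auto
 then show "d x z \<le> d x y + d y z + e" using dist_le_speed[of R et 0 1] p q by simp
qed

lemma dist_barrier:
 assumes ka: "ka \<in> A" "s \<in> chart_image ka" and B: "open B" "B \<subseteq> chart_image ka"
  "!!z u. z \<in> B ==> (1 - e) * cnorm ka s u \<le> cnorm ka z u" "e < 1"
  and rh: "rh > 0" "{w. cnorm ka s (w - z) \<le> rh} \<subseteq> B"
 shows "(1 - e) * (if q \<in> chart_inv ka ` B then min (cnorm ka s (snd ka q - z)) rh else rh) \<le> d (chart_inv ka z) q"
 by (rule dist_geI) (use barrier[OF assms] in fastforce)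

text \<open>Near \<open>x\<close> the distance agrees, up to a factor close to 1, with the norm of
  the metric frozen at \<open>x\<close>; the last clause places small metric balls inside the chart.
  Local estimates of distances below rest on this comparison.\<close>

lemma asy:
 assumes ka: "ka \<in> A" "x \<in> fst ka" and e: "0 < e" "e < 1" and U: "open U" "x \<in> U"
 obtains r de where "r > 0" "de > 0" "ball (snd ka x) r \<subseteq> chart_image ka"
  "chart_inv ka ` ball (snd ka x) r \<subseteq> U"
  "!!z z'. z \<in> ball (snd ka x) r ==> z' \<in> ball (snd ka x) r ==> (1 - e) * cnorm ka (snd ka x) (z' - z) \<le> d (chart_inv ka z) (chart_inv ka z')"
  "!!z z'. z \<in> ball (snd ka x) r ==> z' \<in> ball (snd ka x) r ==> d (chart_inv ka z) (chart_inv ka z') \<le> (1 + e) * cnorm ka (snd ka x) (z' - z)"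
  "!!z u. z \<in> ball (snd ka x) r ==> (1 - e) * cnorm ka (snd ka x) u \<le> cnorm ka z u"
  "!!z u. z \<in> ball (snd ka x) r ==> cnorm ka z u \<le> (1 + e) * cnorm ka (snd ka x) u"
  "!!q. d x q < de ==> q \<in> chart_inv ka ` ball (snd ka x) r"
proof -
 let ?s = "snd ka x"
 have s: "?s \<in> chart_image ka" using ka(2) by blast
 have U': "open (snd ka ` (fst ka \<inter> U))" by (rule chart_image_open[OF ka(1)]) (use U(1) chart_open(1)[OF ka(1)] in auto)
 have s': "?s \<in> snd ka ` (fst ka \<inter> U)" using ka U by auto
 obtain R where R: "R > 0" "ball ?s R \<subseteq> chart_image ka" "ball ?s R \<subseteq> snd ka ` (fst ka \<inter> U)"
  "!!z u. z \<in> ball ?s R ==> (1 - e) * cnorm ka ?s u \<le> cnorm ka z u"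
  "!!z u. z \<in> ball ?s R ==> cnorm ka z u \<le> (1 + e) * cnorm ka ?s u"
  using cnorm_ratio[OF ka(1) s e U' s'] by metis
 obtain c C where c: "c > 0" "C > 0" "!!u. c * norm u \<le> cnorm ka ?s u" "!!u. cnorm ka ?s u \<le> C * norm u"
  using cnorm_bounds[OF ka(1) s] by metis
 \<comment> \<open>The lower bound c keeps the norm ball of radius rh around any z of the small ball
   inside the ball of radius R, as the barrier needs. The second bound on r keeps differences of two
   such points below rh, where the truncation is inactive.\<close>
 define rh where "rh = c * R / 2"
 define r where "r = min (R / 4) (rh / (2 * C))"
 have rh: "rh > 0" using c R by (simp add: rh_def)
 have r: "r > 0" "r \<le> R / 4" "r \<le> rh / (2 * C)" using c R rh by (auto simp: r_def)
 have K: "{w. cnorm ka ?s (w - z) \<le> rh} \<subseteq> ball ?s R" if z: "z \<in> ball ?s r" for z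
 proof
  fix w assume "w \<in> {w. cnorm ka ?s (w - z) \<le> rh}"
  then have "c * norm (w - z) \<le> c * R / 2" using c(3)[of "w - z"] by (simp add: rh_def)
  then have "norm (w - z) \<le> R / 2" using c(1) by (simp add: field_simps)
  then show "w \<in> ball ?s R" using z r(2) R(1) norm_triangle_ineq[of "?s - z" "z - w"]
   by (simp add: dist_norm norm_minus_commute)
 qed
 have bar: "(1 - e) * (if q \<in> chart_inv ka ` ball ?s R then min (cnorm ka ?s (snd ka q - z)) rh else rh) \<le> d (chart_inv ka z) q"
  if "z \<in> ball ?s r" for z q
  by (rule dist_barrier[OF ka(1) s open_ball R(2) _ e(2) rh K[OF that]]) (rule R(4))
 show ?thesis
 proof (rule that[of r "min ((1 - e) * rh) ((1 - e) * c * r)"])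
  show "r > 0" by fact
  show "min ((1 - e) * rh) ((1 - e) * c * r) > 0" using rh e c r by simp
  have sub: "ball ?s r \<subseteq> ball ?s R" using r R by auto
  then show "ball ?s r \<subseteq> chart_image ka" using R by blast
  show "chart_inv ka ` ball ?s r \<subseteq> U" using sub R(3) chart_inv_eq[OF ka(1)] by fastforce
  show "(1 - e) * cnorm ka ?s u \<le> cnorm ka z u" "cnorm ka z u \<le> (1 + e) * cnorm ka ?s u" if "z \<in> ball ?s r" for z u
   using R(4,5) sub that by blast+
  show "(1 - e) * cnorm ka ?s (z' - z) \<le> d (chart_inv ka z) (chart_inv ka z')" if z: "z \<in> ball ?s r" "z' \<in> ball ?s r" for z z'
  proof -
   have z': "z' \<in> ball ?s R" "z' \<in> chart_image ka" using z sub R(2) by auto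
   have "norm (z' - z) \<le> 2 * r" using z norm_triangle_ineq[of "z' - ?s" "?s - z"] by (simp add: dist_norm norm_minus_commute)
   then have "C * norm (z' - z) \<le> C * (2 * r)" using c by (intro mult_left_mono) auto
   also have "\<dots> \<le> rh" using r(3) c by (simp add: field_simps)
   finally have "cnorm ka ?s (z' - z) \<le> rh" using c(4)[of "z' - z"] by simp
   then show ?thesis using bar[OF z(1), of "chart_inv ka z'"] z' chart_eq[OF ka(1)] by (auto simp: min_def)
  qed
  show "d (chart_inv ka z) (chart_inv ka z') \<le> (1 + e) * cnorm ka ?s (z' - z)" if z: "z \<in> ball ?s r" "z' \<in> ball ?s r" for z z'
  proof -
   have seg: "z + t *\<^sub>R (z' - z) \<in> ball ?s r" if "t \<in> {0..1}" for t
    using convexD_alt[OF convex_ball z, of t] that by (simp add: algebra_simps)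
   then have seg': "z + t *\<^sub>R (z' - z) \<in> chart_image ka" if "t \<in> {0..1}" for t using that sub R(2) by blast
   note pw = segment_pw[OF ka(1) seg']
   let ?ga = "\<lambda>t. chart_inv ka (z + t *\<^sub>R (z' - z))"
   have "d (?ga 0) (?ga 1) \<le> integral {0..1} (speed ?ga)" by (rule dist_le_speed[OF pw(1)]) auto
   also have "\<dots> = integral {0..1} (\<lambda>t. if t \<in> {0,1} then 0 else speed ?ga t)"
    by (rule integral_spike[of "{0, 1}"]) auto
   also have "\<dots> \<le> integral {0..1} (\<lambda>t::real. (1 + e) * cnorm ka ?s (z' - z))"
   proof (rule integral_le)
    show "(\<lambda>t. if t \<in> {0,1} then 0 else speed ?ga t) integrable_on {0..1}"
     by (rule integrable_spike_finite[of "{0,1}", OF _ _ speed_integrable[OF pw(1)]]) auto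
    fix t :: real assume t: "t \<in> {0..1}"
    show "(if t \<in> {0,1} then 0 else speed ?ga t) \<le> (1 + e) * cnorm ka ?s (z' - z)"
     using t pw(2)[of t] R(5)[of "z + t *\<^sub>R (z' - z)" "z' - z"] seg[OF t] sub cnorm_nonneg[OF ka(1) s] e
     by auto
   qed auto
   finally show ?thesis by simp
  qed
  fix q assume q: "d x q < min ((1 - e) * rh) ((1 - e) * c * r)"
  have x: "chart_inv ka ?s = x" by (rule chart_inv_eq[OF ka])
  have b: "(1 - e) * (if q \<in> chart_inv ka ` ball ?s R then min (cnorm ka ?s (snd ka q - ?s)) rh else rh) \<le> d x q"
   using bar[of ?s q] r(1) x by simp
  have q': "d x q < (1 - e) * rh" "d x q < (1 - e) * (c * r)" using q by (auto simp: mult.assoc)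
  have "q \<in> chart_inv ka ` ball ?s R" using b q' by (auto split: if_splits)
  then obtain w where w: "w \<in> ball ?s R" "q = chart_inv ka w" by blast
  have qw: "snd ka q = w" using w R(2) chart_eq[OF ka(1)] by auto
  have "(1 - e) * min (cnorm ka ?s (w - ?s)) rh \<le> d x q" using b w qw by auto
  then have "(1 - e) * cnorm ka ?s (w - ?s) \<le> d x q" using q'(1) e by (auto simp: min_def split: if_splits)
  then have "(1 - e) * cnorm ka ?s (w - ?s) < (1 - e) * (c * r)" using q' by simp
  then have "cnorm ka ?s (w - ?s) < c * r" using e by simp
  then have "c * norm (w - ?s) < c * r" using c(3)[of "w - ?s"] by simp
  then have "w \<in> ball ?s r" using c(1) by (simp add: dist_norm norm_minus_commute)
  then show "q \<in> chart_inv ka ` ball ?s r" using w by blast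
 qed
qed

lemma d_self [simp]: "d x x = 0"
proof -
 let ?ka = "chart_at A x"
 obtain r where r: "r > 0" "!!z z'. z \<in> ball (snd ?ka x) r ==> z' \<in> ball (snd ?ka x) r ==> d (chart_inv ?ka z) (chart_inv ?ka z') \<le> (1 + 1/2) * cnorm ?ka (snd ?ka x) (z' - z)"
  by (rule asy[OF chart_at(1,2), of "1/2" UNIV]) auto
 have "d x x \<le> 0"
  using r(2)[of "snd ?ka x" "snd ?ka x"] r(1) chart_inv_eq[OF chart_at(1,2)] cnorm_zero[OF chart_at(1) imageI[OF chart_at(2)]] by simp
 then show ?thesis using d_nonneg[of x x] by simp
qed

lemma d_near_open:
 assumes "open U" "x \<in> U"
 obtains de where "de > 0" "!!q. d x q < de ==> q \<in> U"
proof -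
 obtain r de where *: "de > 0" "chart_inv (chart_at A x) ` ball (snd (chart_at A x) x) r \<subseteq> U"
  "!!q. d x q < de ==> q \<in> chart_inv (chart_at A x) ` ball (snd (chart_at A x) x) r"
  by (rule asy[OF chart_at(1,2), of "1/2" U x]) (use assms in simp_all)
 show ?thesis by (rule that[OF *(1) subsetD[OF *(2) *(3)]])
qed

lemma open_d_near:
 assumes "e > 0"
 obtains U where "open U" "x \<in> U" "!!q. q \<in> U ==> d x q < e"
proof -
 let ?ka = "chart_at A x"
 have s: "snd ?ka x \<in> chart_image ?ka" using chart_at by blast
 obtain r de where r: "r > 0" "ball (snd ?ka x) r \<subseteq> chart_image ?ka" "!!z z'. z \<in> ball (snd ?ka x) r ==> z' \<in> ball (snd ?ka x) r ==> d (chart_inv ?ka z) (chart_inv ?ka z') \<le> (1 + 1/2) * cnorm ?ka (snd ?ka x) (z' - z)"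
  by (rule asy[OF chart_at(1,2), of "1/2" UNIV]) auto
 obtain c C where c: "C > 0" "!!u. cnorm ?ka (snd ?ka x) u \<le> C * norm u"
  using cnorm_bounds[OF chart_at(1) s] by metis
 define r' where "r' = min r (e / (2 * C))"
 have r': "r' > 0" "r' \<le> r" "r' \<le> e / (2 * C)" using r c assms by (auto simp: r'_def)
 have sub: "ball (snd ?ka x) r' \<subseteq> ball (snd ?ka x) r" using r' by auto
 show ?thesis
 proof (rule that[of "chart_inv ?ka ` ball (snd ?ka x) r'"])
  show "open (chart_inv ?ka ` ball (snd ?ka x) r')"
   by (rule chart_inv_image_open[OF chart_at(1)]) (use r sub in auto)
  show "x \<in> chart_inv ?ka ` ball (snd ?ka x) r'"
   using r'(1) chart_inv_eq[OF chart_at(1,2)] by (metis centre_in_ball imageI)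
  fix q assume "q \<in> chart_inv ?ka ` ball (snd ?ka x) r'"
  then obtain z where z: "z \<in> ball (snd ?ka x) r'" "q = chart_inv ?ka z" by blast
  have "d x q \<le> (1 + 1/2) * cnorm ?ka (snd ?ka x) (z - snd ?ka x)"
   using r(3)[of "snd ?ka x" z] z sub r(1) chart_inv_eq[OF chart_at(1,2)] by auto
  also have "\<dots> \<le> (1 + 1/2) * (C * norm (z - snd ?ka x))" using c(2) by (intro mult_left_mono) auto
  also have "\<dots> < 2 * (C * r')"
  proof -
   have "norm (z - snd ?ka x) < r'" using z by (simp add: dist_norm norm_minus_commute)
   then have "C * norm (z - snd ?ka x) < C * r'" using c by simp
   moreover have "0 \<le> C * norm (z - snd ?ka x)" using c by simp
   ultimately show ?thesis by (simp add: mult.assoc)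
  qed
  also have "\<dots> \<le> e" using r'(3) c by (simp add: field_simps)
  finally show "d x q < e" .
 qed
qed

lemma d_eq_0_iff: "d x y = 0 \<longleftrightarrow> x = y"
proof
 assume 0: "d x y = 0"
 show "x = y"
 proof (rule ccontr)
  assume "x ~= y"
  then have "open (- {y})" "x \<in> - {y}" by auto
  then obtain de where "de > 0" "!!q. d x q < de ==> q \<in> - {y}" using d_near_open by metis
  then show False using 0 by force
 qed
qed simp

text \<open>A nearly minimizing curve is cut by the intermediate value theorem. This almost exact
  intermediate point is what \<open>compact_cb\<close> uses before exact ones are available.\<close>

lemma d_length:
 assumes "0 \<le> s" "s \<le> d x y" "e > 0"
 shows "\<exists>m. d x m = s \<and> d m y < d x y - s + e"
proof -
 obtain P ga where p: "pw P ga 0 1" "ga 0 = x" "ga 1 = y" "integral {0..1} (speed ga) < d x y + e"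
  using dist_approx[OF assms(3)] by metis
 have "continuous_on {0..1} (\<lambda>t. d x (ga t))"
 proof (unfold continuous_on_iff, intro ballI allI impI)
  fix t e :: real assume t: "t \<in> {0..1}" and "e > 0"
  obtain U where U: "open U" "ga t \<in> U" "!!q. q \<in> U ==> d (ga t) q < e" using open_d_near[OF \<open>e > 0\<close>] by metis
  have "\<forall>\<^sub>F s in at t within {0..1}. ga s \<in> U"
   using pw_continuous[OF p(1)] t U by (metis continuous_on_def topological_tendstoD)
  then obtain r where r: "r > 0" "!!s. s \<in> {0..1} ==> s ~= t ==> dist s t < r ==> ga s \<in> U"
   unfolding eventually_at by auto
  show "\<exists>r>0. \<forall>s\<in>{0..1}. dist s t < r --> dist (d x (ga s)) (d x (ga t)) < e"
  proof (intro exI[of _ r] conjI ballI impI)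
   fix s assume "s \<in> {0..1}" "dist s t < r"
   then have "d (ga t) (ga s) < e" using r U \<open>e > 0\<close> by (cases "s = t") auto
   then show "dist (d x (ga s)) (d x (ga t)) < e"
    using d_triangle[of x "ga s" "ga t"] d_triangle[of x "ga t" "ga s"] d_sym[of "ga t" "ga s"]
    by (auto simp: dist_real_def abs_less_iff)
  qed (rule r)
 qed
 then obtain t where t: "0 \<le> t" "t \<le> 1" "d x (ga t) = s"
  using IVT'[of "\<lambda>t. d x (ga t)" 0 s 1] assms p by auto
 have i: "integral {0..t} (speed ga) + integral {t..1} (speed ga) = integral {0..1} (speed ga)"
  using Henstock_Kurzweil_Integration.integral_combine[OF t(1,2) speed_integrable[OF p(1)]] by simp
 have "d x (ga t) \<le> integral {0..t} (speed ga)"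
  using dist_le_speed[OF pw_subinterval[OF p(1), of 0 t]] t p(2) by (cases "t = 0") auto
 moreover have "d (ga t) y \<le> integral {t..1} (speed ga)"
  using dist_le_speed[OF pw_subinterval[OF p(1), of t 1]] t p(3) by (cases "t = 1") auto
 ultimately show ?thesis using i p(4) t(3) by (intro exI[of _ "ga t"]) auto
qed

sublocale ms: Metric_space UNIV d
 by unfold_locales (auto simp: d_nonneg d_sym d_eq_0_iff intro: d_triangle)

lemma open_iff_d: "open U \<longleftrightarrow> (\<forall>x\<in>U. \<exists>e>0. \<forall>y. d x y < e --> y \<in> U)"
proof
 assume "open U" then show "\<forall>x\<in>U. \<exists>e>0. \<forall>y. d x y < e --> y \<in> U" using d_near_open by metis
next
 assume *: "\<forall>x\<in>U. \<exists>e>0. \<forall>y. d x y < e --> y \<in> U"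
 show "open U"
 proof (subst open_subopen, intro ballI)
  fix x assume "x \<in> U"
  then obtain e where e: "e > 0" "!!y. d x y < e ==> y \<in> U" using * by blast
  obtain V where "open V" "x \<in> V" "!!q. q \<in> V ==> d x q < e" using open_d_near[OF e(1)] by metis
  then show "\<exists>T. open T \<and> x \<in> T \<and> T \<subseteq> U" using e by blast
 qed
qed

lemma tendsto_iff_d: "(h \<longlongrightarrow> l) F \<longleftrightarrow> ((\<lambda>n. d (h n) l) \<longlongrightarrow> 0) F"
proof
 assume h: "(h \<longlongrightarrow> l) F"
 show "((\<lambda>n. d (h n) l) \<longlongrightarrow> 0) F"
 proof (rule tendstoI)
  fix e :: real assume "e > 0"
  then obtain U where "open U" "l \<in> U" "!!q. q \<in> U ==> d l q < e" using open_d_near by metis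
  then show "\<forall>\<^sub>F n in F. dist (d (h n) l) 0 < e"
   using topological_tendstoD[OF h, of U] by (auto elim!: eventually_mono simp: d_sym[of _ l] d_nonneg)
 qed
next
 assume h: "((\<lambda>n. d (h n) l) \<longlongrightarrow> 0) F"
 show "(h \<longlongrightarrow> l) F"
 proof (rule topological_tendstoI)
  fix S assume "open S" "l \<in> S"
  then obtain e where e: "e > 0" "!!q. d l q < e ==> q \<in> S" using d_near_open by metis
  have "\<forall>\<^sub>F n in F. dist (d (h n) l) 0 < e" using tendstoD[OF h e(1)] .
  then show "\<forall>\<^sub>F n in F. h n \<in> S" by eventually_elim (auto simp: d_sym[of _ l] d_nonneg intro!: e(2))
 qed
qed

lemma tendsto_d:
 assumes "(h \<longlongrightarrow> l) F" "(k \<longlongrightarrow> m) F"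
 shows "((\<lambda>n. d (h n) (k n)) \<longlongrightarrow> d l m) F"
proof (rule Lim_null_comparison[THEN LIM_zero_cancel])
 have 1: "((\<lambda>n. d (h n) l) \<longlongrightarrow> 0) F" "((\<lambda>n. d (k n) m) \<longlongrightarrow> 0) F" using assms tendsto_iff_d by blast+
 show "((\<lambda>n. d (h n) l + d (k n) m) \<longlongrightarrow> 0) F" using tendsto_add[OF 1] by simp
 show "\<forall>\<^sub>F n in F. norm (d (h n) (k n) - d l m) \<le> d (h n) l + d (k n) m"
 proof (intro always_eventually allI)
  fix n
  show "norm (d (h n) (k n) - d l m) \<le> d (h n) l + d (k n) m"
   using d_triangle[of "h n" "k n" l] d_triangle[of l "k n" m] d_triangle[of l m "h n"] d_triangle[of "h n" m "k n"] d_sym[of m "k n"] d_sym[of l "h n"]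
   by (auto simp: abs_le_iff)
 qed
qed

text \<open>Completeness is stated for the abstract metric space and compactness for the topology of
  the type; this equality moves results between the two.\<close>

lemma mtopology_eq: "ms.mtopology = euclidean"
proof -
 have "openin ms.mtopology U \<longleftrightarrow> openin euclidean U" for U
  unfolding ms.openin_mtopology open_openin[symmetric] open_iff_d by (auto simp: ms.mball_def subset_iff)
 then show ?thesis by (simp add: topology_eq)
qed

end

section \<open>Complete manifolds and metric geodesics\<close>

lemma compact_Pi_UNIV:
 fixes K :: "'i => 'a::topological_space set"
 assumes "!!t. compact (K t)"
 shows "compact (Pi UNIV K)"
proof -
 have "compactin (product_topology (\<lambda>_. euclidean) UNIV) (PiE UNIV K)"
  using assms by (simp add: compactin_PiE)
 then show ?thesis by (simp add: euclidean_product_topology PiE_UNIV_domain)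
qed

text \<open>Tychonoff for functions on an arbitrary index set. Such a product need not be
  sequentially compact, so the limit is taken along a filter finer than \<open>sequentially\<close>
  instead of a subsequence.\<close>

lemma pointwise_cluster:
 fixes h :: "nat => 'i => 'a::topological_space"
 assumes "!!t. compact (K t)" "!!n t. h n t \<in> K t"
 obtains G l where "G ~= bot" "G \<le> sequentially" "!!t. ((\<lambda>n. h n t) \<longlongrightarrow> l t) G"
proof -
 have "\<exists>l\<in>Pi UNIV K. inf (nhds l) (filtermap h sequentially) ~= bot"
  using compact_Pi_UNIV[OF assms(1), unfolded compact_filter, rule_format, of "filtermap h sequentially"] assms(2)
  by (auto simp: eventually_filtermap filtermap_bot_iff)
 then obtain l where l: "inf (nhds l) (filtermap h sequentially) ~= bot" by blast
 define G where "G = inf sequentially (filtercomap h (nhds l))"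
 have "G ~= bot"
 proof
  assume "G = bot"
  then have "eventually (\<lambda>_. False) G" by simp
  then obtain P Q where P: "eventually P sequentially" "eventually Q (filtercomap h (nhds l))" "!!n. P n ==> Q n ==> False"
   unfolding G_def eventually_inf by blast
  obtain R where R: "eventually R (nhds l)" "!!n. R (h n) ==> Q n" using P(2) unfolding eventually_filtercomap by blast
  have "eventually (\<lambda>y. \<exists>n. P n \<and> h n = y) (filtermap h sequentially)"
   unfolding eventually_filtermap using P(1) by (rule eventually_mono) blast
  then have "eventually (\<lambda>_. False) (inf (nhds l) (filtermap h sequentially))"
   unfolding eventually_inf using R P(3) by blast
  then show False using l by (simp add: eventually_False)
 qed
 moreover have "G \<le> sequentially" unfolding G_def by simp
 moreover have "((\<lambda>n. h n t) \<longlongrightarrow> l t) G" for t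
 proof -
  have "filterlim h (nhds l) G"
   unfolding G_def filterlim_iff_le_filtercomap by simp
  moreover have "((\<lambda>si. si t) \<longlongrightarrow> l t) (nhds l)"
  proof -
   have "continuous_on UNIV (\<lambda>si::'i => 'a. si t)" by (rule continuous_on_product_coordinates)
   then have op: "open ((\<lambda>si::'i => 'a. si t) -` S)" if "open S" for S by (rule open_vimage[OF that])
   show ?thesis
   proof (rule topological_tendstoI)
    fix S :: "'a set" assume "open S" "l t \<in> S"
    then show "\<forall>\<^sub>F si in nhds l. si t \<in> S"
     unfolding eventually_nhds using op by (intro exI[of _ "(\<lambda>si. si t) -` S"]) auto
   qed
  qed
  ultimately show ?thesis by (rule filterlim_compose[rotated])
 qed
 ultimately show ?thesis using that by blast
qed

locale cmanifold = rmanifold A g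
 for A :: "('a::{t2_space,second_countable_topology}, 'e::euclidean_space) chart set"
  and g :: "'a => 'e => 'e => real" +
 assumes complete: "Metric_space.mcomplete UNIV (riemannian_dist A g)"

context rmanifold
begin

lemma continuous_on_d:
 "continuous_on S h ==> continuous_on S k ==> continuous_on S (\<lambda>t. d (h t) (k t))"
 unfolding continuous_on_def using tendsto_d by blast

definition cb :: "'a => real => 'a set" where "cb x r = {y. d x y \<le> r}"

lemma closed_cb: "closed (cb x r)"
 unfolding cb_def by (intro closed_Collect_le continuous_on_d continuous_intros)

lemma cb_local_compact: "\<exists>r>0. compact (cb x r)"
proof -
 let ?ka = "chart_at A x"
 obtain r where r: "r > 0" "ball (snd ?ka x) r \<subseteq> chart_image ?ka"
  using chart_open(2)[OF chart_at(1)[of x]] chart_at(2)[of x] by (meson imageI openE)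
 have sub: "cball (snd ?ka x) (r/2) \<subseteq> chart_image ?ka" "ball (snd ?ka x) (r/2) \<subseteq> chart_image ?ka"
  using r by (force intro: subset_trans[OF _ r(2)])+
 have U: "open (chart_inv ?ka ` ball (snd ?ka x) (r/2))"
  by (rule chart_inv_image_open[OF chart_at(1)]) (use sub in auto)
 have x: "x \<in> chart_inv ?ka ` ball (snd ?ka x) (r/2)"
  using r(1) chart_inv_eq[OF chart_at(1,2), of x] by (intro image_eqI[of _ _ "snd ?ka x"]) auto
 obtain de where de: "de > 0" "!!q. d x q < de ==> q \<in> chart_inv ?ka ` ball (snd ?ka x) (r/2)"
  using d_near_open[OF U x] by metis
 have "compact (chart_inv ?ka ` cball (snd ?ka x) (r/2))"
  by (rule compact_continuous_image[OF continuous_on_subset[OF chart_cont(2)[OF chart_at(1)] sub(1)] compact_cball])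
 moreover have "cb x (de/2) \<subseteq> chart_inv ?ka ` cball (snd ?ka x) (r/2)"
 proof
  fix q assume "q \<in> cb x (de/2)"
  then have "q \<in> chart_inv ?ka ` ball (snd ?ka x) (r/2)" using de by (auto simp: cb_def)
  then show "q \<in> chart_inv ?ka ` cball (snd ?ka x) (r/2)" by (meson ball_subset_cball image_mono subsetD)
 qed
 ultimately have "compact (cb x (de/2))" using closed_cb compact_Int_closed by (metis inf.absorb_iff2)
 then show ?thesis using de(1) half_gt_zero by blast
qed

end

section \<open>Compact balls and minimizing paths in complete manifolds\<close>

context cmanifold
begin

text \<open>The Hopf-Rinow argument for length spaces: at the supremum R of the radii with compact
  balls the ball is totally bounded, hence compact by completeness, and a finite cover by small
  compact balls pushes the radius beyond R.\<close>

lemma compact_cb: "compact (cb x r)"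
proof (rule ccontr)
 assume nc: "\<not> compact (cb x r)"
 define S where "S = {r. r \<ge> 0 \<and> compact (cb x r)}"
 have mono: "compact (cb x a)" if "a \<le> b" "compact (cb x b)" for a b
 proof -
  have "cb x a \<subseteq> cb x b" using that unfolding cb_def by auto
  then show ?thesis using closed_cb[of x a] that(2) compact_Int_closed by (metis inf.absorb_iff2)
 qed
 have bdd: "s \<le> r" if "s \<in> S" for s using that nc mono[of r s] unfolding S_def by force
 then have bdd': "bdd_above S" by (meson bdd_aboveI)
 have "y \<in> cb x 0 \<longleftrightarrow> d x y = 0" for y unfolding cb_def mem_Collect_eq using d_nonneg[of x y] by (intro iffI) linarith+
 then have "y \<in> cb x 0 \<longleftrightarrow> x = y" for y by (simp only: d_eq_0_iff)
 then have "cb x 0 = {x}" by auto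
 then have S0: "0 \<in> S" unfolding S_def by simp
 define R where "R = Sup S"
 have R0: "R \<ge> 0" unfolding R_def using S0 bdd' by (rule cSup_upper)
 \<comment> \<open>A finite e/3-net of a slightly smaller compact ball is an e-net of the ball of
   radius R, since by \<open>d_length\<close> each point of the latter is within 2e/3 of the
   former.\<close>
 have "ms.mtotally_bounded (cb x R)"
  unfolding ms.mtotally_bounded_def
 proof (intro allI impI)
  fix e :: real assume e: "e > 0"
  then have "R - e/3 < Sup S" unfolding R_def by simp
  then obtain s where s: "s \<in> S" "R - e/3 < s" using less_cSup_iff[of S "R - e/3", OF _ bdd'] S0 by auto
  have sR: "s \<le> R" unfolding R_def using s(1) bdd' by (rule cSup_upper)
  have s0: "s \<ge> 0" using s(1) unfolding S_def by simp
  have "compactin ms.mtopology (cb x s)" using s(1) unfolding S_def mtopology_eq by simp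
  then have "ms.mtotally_bounded (cb x s)" by (rule ms.compactin_imp_mtotally_bounded)
  then obtain K where K: "finite K" "K \<subseteq> cb x s" "cb x s \<subseteq> (\<Union>k\<in>K. ms.mball k (e/3))"
   unfolding ms.mtotally_bounded_def using e by (meson divide_pos_pos zero_less_numeral)
  have "cb x R \<subseteq> (\<Union>k\<in>K. ms.mball k e)"
  proof
   fix y assume y: "y \<in> cb x R"
   obtain m where m: "m \<in> cb x s" "d m y < 2 * e / 3"
   proof (cases "d x y \<le> s")
    case True then show ?thesis using that[of y] e by (simp add: cb_def)
   next
    case False
    then obtain m where "d x m = s" "d m y < d x y - s + e/3" using d_length[of s x y "e/3"] s0 e by auto
    then show ?thesis using that[of m] y s(2) by (auto simp: cb_def)
   qed
   then obtain k where k: "k \<in> K" "d k m < e/3" using K(3) by (auto simp: ms.mball_def)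
   then have "d k y < e" using m(2) d_triangle[of k y m] by simp
   then show "y \<in> (\<Union>k\<in>K. ms.mball k e)" using k(1) by (auto simp: ms.mball_def)
  qed
  moreover have "cb x s \<subseteq> cb x R" using sR by (auto simp: cb_def)
  ultimately show "\<exists>K. finite K \<and> K \<subseteq> cb x R \<and> cb x R \<subseteq> (\<Union>k\<in>K. ms.mball k e)" using K by blast
 qed
 then have "compactin ms.mtopology (ms.mtopology closure_of (cb x R))"
  using ms.mtotally_bounded_eq_compact_closure_of[OF complete] by blast
 then have cR: "compact (cb x R)" unfolding mtopology_eq using closed_cb by (simp add: closure_of_eq)
 obtain rh where rh: "!!y. rh y > 0" "!!y. compact (cb y (rh y))" using cb_local_compact by metis
 have op: "open (ms.mball y (rh y / 2))" for y using ms.openin_mball unfolding mtopology_eq by simp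
 obtain Y where Y: "Y \<subseteq> cb x R" "finite Y" "cb x R \<subseteq> (\<Union>y\<in>Y. ms.mball y (rh y / 2))"
 proof (rule compactE_image[OF cR, of "cb x R" "\<lambda>y. ms.mball y (rh y / 2)"])
  show "cb x R \<subseteq> (\<Union>y\<in>cb x R. ms.mball y (rh y / 2))" using rh(1) by (auto simp: ms.mball_def)
 qed (use op in auto)
 define de where "de = Min ((\<lambda>y. rh y / 2) ` Y)"
 have "x \<in> cb x R" using R0 by (simp add: cb_def)
 then have Yne: "Y ~= {}" using Y(3) by blast
 have de: "de > 0" unfolding de_def using Y(2) Yne rh(1) by simp
 have de': "de \<le> rh y / 2" if "y \<in> Y" for y unfolding de_def by (rule Min_le) (use Y(2) that in auto)
 have "cb x (R + de/2) \<subseteq> (\<Union>y\<in>Y. cb y (rh y))"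
 proof
  fix z assume z: "z \<in> cb x (R + de/2)"
  obtain m where m: "m \<in> cb x R" "d m z < de"
  proof (cases "d x z \<le> R")
   case True then show ?thesis using that[of z] de by (simp add: cb_def)
  next
   case False
   then obtain m where "d x m = R" "d m z < d x z - R + de/2" using d_length[of R x z "de/2"] R0 de by auto
   then show ?thesis using that[of m] z by (auto simp: cb_def)
  qed
  then obtain y where y: "y \<in> Y" "d y m < rh y / 2" using Y(3) by (auto simp: ms.mball_def)
  then have "d y z \<le> rh y" using m(2) de'[OF y(1)] d_triangle[of y z m] by simp
  then show "z \<in> (\<Union>y\<in>Y. cb y (rh y))" using y(1) by (auto simp: cb_def)
 qed
 moreover have "compact (\<Union>y\<in>Y. cb y (rh y))" using Y(2) rh(2) by (intro compact_UN) auto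
 ultimately have "compact (cb x (R + de/2))" using closed_cb[of x "R + de/2"] compact_Int_closed by (metis inf.absorb_iff2)
 then have "R + de/2 \<in> S" unfolding S_def using R0 de by simp
 then have "R + de/2 \<le> R" unfolding R_def using bdd' by (rule cSup_upper)
 then show False using de by simp
qed

text \<open>Compactness removes the error term of \<open>d_length\<close>: a point of the ball
  around x that is closest to y lies exactly between.\<close>

lemma between_point:
 assumes "0 \<le> s" "s \<le> d x y"
 obtains m where "d x m = s" "d m y = d x y - s"
proof -
 have "x \<in> cb x s" using assms by (simp add: cb_def)
 then obtain m where m: "m \<in> cb x s" "!!m'. m' \<in> cb x s ==> d m y \<le> d m' y"
  using continuous_attains_inf[OF compact_cb, of x s "\<lambda>m. d m y"]
   continuous_on_d[OF continuous_on_id continuous_on_const] by blast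
 have "d m y \<le> d x y - s"
 proof (rule field_le_epsilon)
  fix e :: real assume "e > 0"
  then obtain m' where "d x m' = s" "d m' y < d x y - s + e" using d_length[OF assms] by blast
  then show "d m y \<le> d x y - s + e" using m(2)[of m'] by (simp add: cb_def)
 qed
 moreover have "d x m \<le> s" using m(1) by (simp add: cb_def)
 ultimately show ?thesis using that[of m] d_triangle[of x y m] by simp
qed

text \<open>A new parameter is placed between its neighbours \<open>lo\<close> and
  \<open>hi\<close>; the distances to all other points of the chain are then forced by the triangle
  inequality, because the chain is already isometric. Values at the remaining parameters only have
  to stay in a compact ball.\<close>

lemma finite_chain:
 assumes "finite F" "F \<subseteq> {0..d x y}"
 shows "\<exists>si. si 0 = x \<and> si (d x y) = y \<and> (\<forall>t. si t \<in> cb x (d x y)) \<and>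
  (\<forall>s\<in>F \<union> {0, d x y}. \<forall>t\<in>F \<union> {0, d x y}. d (si s) (si t) = \<bar>s - t\<bar>)"
 using assms
proof (induction F rule: finite_induct)
 case empty
 show ?case
  by (rule exI[of _ "\<lambda>t. if t = d x y then y else x"]) (use d_eq_0_iff[of x y] d_nonneg[of x y] in \<open>auto simp: cb_def d_sym[of y x]\<close>)
next
 case (insert t F)
 let ?L = "d x y"
 let ?G = "F \<union> {0, ?L}"
 obtain si where si: "si 0 = x" "si ?L = y" "!!t. si t \<in> cb x ?L" "!!s t. s \<in> ?G ==> t \<in> ?G ==> d (si s) (si t) = \<bar>s - t\<bar>"
 proof -
  have "F \<subseteq> {0..?L}" using insert.prems by blast
  from insert.IH[OF this] show ?thesis using that by blast
 qed
 show ?case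
 proof (cases "t \<in> ?G")
  case True
  then have "insert t F \<union> {0, ?L} = ?G" by auto
  then show ?thesis using si by metis
 next
  case False
  have fG: "finite ?G" using insert by simp
  have tL: "0 < t" "t < ?L" using False insert(4) by auto
  define lo where "lo = Max {s \<in> ?G. s < t}"
  define hi where "hi = Min {s \<in> ?G. t < s}"
  have "lo \<in> {s \<in> ?G. s < t}" unfolding lo_def using tL fG by (intro Max_in) auto
  then have lo: "lo \<in> ?G" "lo < t" by auto
  have "hi \<in> {s \<in> ?G. t < s}" unfolding hi_def using tL fG by (intro Min_in) auto
  then have hi: "hi \<in> ?G" "t < hi" by auto
  have split: "s \<le> lo \<or> hi \<le> s" if "s \<in> ?G" for s
  proof (cases "s < t")
   case True then have "s \<le> lo" unfolding lo_def using fG that by (intro Max_ge) auto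
   then show ?thesis by simp
  next
   case False2: False
   then have "t < s" using that False by (metis linorder_neqE_linordered_idom)
   then have "hi \<le> s" unfolding hi_def using fG that by (intro Min_le) auto
   then show ?thesis by simp
  qed
  have dlh: "d (si lo) (si hi) = hi - lo" using si(4)[OF lo(1) hi(1)] lo hi by simp
  obtain m where m: "d (si lo) m = t - lo" "d m (si hi) = hi - t"
   using between_point[of "t - lo" "si lo" "si hi"] dlh lo hi by auto
  have dm: "d (si s) m = \<bar>s - t\<bar>" if s: "s \<in> ?G" for s
  proof (cases "s \<le> lo")
   case True
   have "d (si s) (si lo) = lo - s" "d (si s) (si hi) = hi - s" using si(4)[OF s lo(1)] si(4)[OF s hi(1)] True lo hi by auto
   then show ?thesis using m d_triangle[of "si s" m "si lo"] d_triangle[of "si s" "si hi" m] True lo by simp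
  next
   case F: False
   then have h: "hi \<le> s" using split[OF s] by simp
   have "d (si s) (si lo) = s - lo" "d (si s) (si hi) = s - hi" using si(4)[OF s lo(1)] si(4)[OF s hi(1)] h lo hi by auto
   then show ?thesis using m d_triangle[of "si s" m "si hi"] d_triangle[of "si s" "si lo" m] h hi
    d_sym[of m "si hi"] d_sym[of m "si lo"] by simp
  qed
  show ?thesis
  proof (intro exI[of _ "si(t := m)"] conjI allI ballI)
   show "(si(t := m)) 0 = x" "(si(t := m)) ?L = y" using si False by auto
   show "(si(t := m)) s \<in> cb x ?L" for s
    using si(1,3) dm[of 0] tL by (auto simp: cb_def)
   fix s s' assume s: "s \<in> insert t F \<union> {0, ?L}" "s' \<in> insert t F \<union> {0, ?L}"
   then show "d ((si(t := m)) s) ((si(t := m)) s') = \<bar>s - s'\<bar>"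
    using dm[of s] dm[of s'] si(4)[of s s'] False d_sym[of m "si s'"] by (cases "s = t"; cases "s' = t") auto
  qed
 qed
qed

text \<open>Each isometry condition on two parameters is closed in the product topology, and any
  finitely many are met by a chain; the finite intersection property in a product of compact balls
  meets all of them at once.\<close>

lemma metric_geodesic_exists:
 obtains si where "si 0 = x" "si (d x y) = y"
  "!!s t. s \<in> {0..d x y} ==> t \<in> {0..d x y} ==> d (si s) (si t) = \<bar>s - t\<bar>"
proof -
 let ?L = "d x y"
 let ?K = "Pi UNIV (\<lambda>_. cb x ?L) :: (real => 'a) set"
 let ?C = "\<lambda>p. {si. si 0 = x \<and> si ?L = y \<and> d (si (fst p)) (si (snd p)) = \<bar>fst p - snd p\<bar>}"
 have "?K \<inter> (\<Inter>p\<in>{0..?L} \<times> {0..?L}. ?C p) ~= {}"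
 proof (rule compact_imp_fip_image)
  show "compact ?K" by (rule compact_Pi_UNIV) (rule compact_cb)
  show "closed (?C p)" for p
   by (intro closed_Collect_conj closed_Collect_eq continuous_on_d continuous_on_product_coordinates continuous_on_const)
  fix I assume I: "finite I" "I \<subseteq> {0..?L} \<times> {0..?L}"
  define F where "F = fst ` I \<union> snd ` I"
  have "finite F" "F \<subseteq> {0..?L}" using I unfolding F_def by auto
  then obtain si where si: "si 0 = x" "si ?L = y" "!!t. si t \<in> cb x ?L" "!!s t. s \<in> F ==> t \<in> F ==> d (si s) (si t) = \<bar>s - t\<bar>"
   using finite_chain by (metis UnI1)
  then have "si \<in> ?K \<inter> (\<Inter>p\<in>I. ?C p)" unfolding F_def by auto
  then show "?K \<inter> (\<Inter>p\<in>I. ?C p) ~= {}" by blast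
 qed
 then obtain si where si: "si \<in> (\<Inter>p\<in>{0..?L} \<times> {0..?L}. ?C p)" by blast
 have *: "si \<in> ?C (s, t)" if "s \<in> {0..?L}" "t \<in> {0..?L}" for s t using si that by blast
 show ?thesis
  by (rule that[of si]) (use *[of 0 0] * d_nonneg in auto)
qed

end

section \<open>Unit speed geodesic rays\<close>

lemma linear_expand:
 fixes l :: "'f::euclidean_space => real"
 assumes "linear l"
 shows "l q = (\<Sum>i\<in>Basis. (q \<bullet> i) * l i)"
proof -
 have "l q = l (\<Sum>i\<in>Basis. (q \<bullet> i) *\<^sub>R i)" by (simp add: euclidean_representation)
 then show ?thesis by (simp add: linear_sum[OF assms] linear_scale[OF assms])
qed

lemma sum_Basis_inner:
 fixes f :: "'f::euclidean_space => real"
 assumes "i \<in> Basis"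
 shows "(\<Sum>j\<in>Basis. (i \<bullet> j) * f j) = f i"
proof -
 have "(\<Sum>j\<in>Basis. (i \<bullet> j) * f j) = (\<Sum>j\<in>Basis. if i = j then f j else 0)"
  by (rule sum.cong) (use assms in \<open>auto simp: inner_Basis\<close>)
 then show ?thesis using assms by simp
qed

lemma form_represent:
 fixes h :: "'f::euclidean_space => 'f => real"
 assumes b: "bilinear h" and nd: "!!u. (!!q. h u q = 0) ==> u = 0" and l: "linear l"
 shows "\<exists>!w. \<forall>q. h w q = l q"
proof -
 define T where "T w = (\<Sum>i\<in>Basis. h w i *\<^sub>R i)" for w
 have T: "T w \<bullet> q = h w q" for w q
 proof -
  have "h w q = (\<Sum>i\<in>Basis. (q \<bullet> i) * h w i)"
   by (rule linear_expand) (use b in \<open>simp add: bilinear_def\<close>)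
  then show ?thesis
   unfolding T_def inner_sum_left inner_scaleR_left by (simp add: inner_commute mult.commute)
 qed
 have lT: "linear T"
  unfolding T_def by (rule linearI) (simp_all add: bilinear_ladd[OF b] bilinear_lmul[OF b] scaleR_add_left sum.distrib scaleR_sum_right)
 have inj: "inj T"
 proof (rule linear_injective_0[OF lT, THEN iffD2], intro allI impI)
  fix w assume "T w = 0"
  then have "h w q = 0" for q using T[of w q] by simp
  then show "w = 0" by (rule nd)
 qed
 have "surj T" by (rule linear_inj_imp_surj[OF lT inj])
 then obtain w where w: "T w = (\<Sum>i\<in>Basis. l i *\<^sub>R i)" by (metis surjD)
 have "h w q = l q" for q
 proof -
  have "l q = (\<Sum>i\<in>Basis. (q \<bullet> i) * l i)" by (rule linear_expand[OF l])
  also have "\<dots> = T w \<bullet> q" unfolding w inner_sum_left inner_scaleR_left by (simp add: inner_commute mult.commute)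
  finally show ?thesis using T by simp
 qed
 moreover have "w' = w" if "\<forall>q. h w' q = l q" for w'
 proof -
  have "h (w' - w) q = 0" for q using that calculation by (simp add: bilinear_lsub[OF b])
  then have "w' - w = 0" by (rule nd)
  then show ?thesis by simp
 qed
 ultimately show ?thesis by blast
qed

text \<open>Nondegeneracy is an open condition, with a uniform bound of the inverse near
  \<open>z0\<close>: entries that move by less than \<open>et\<close> cost at most half of the lower
  bound at \<open>z0\<close>.\<close>

lemma form_lower_bound:
 fixes B :: "'s::metric_space => 'f::euclidean_space => 'f => real"
 assumes "\<forall>\<^sub>F z in nhds z0. bilinear (B z)" "!!u v. ((\<lambda>z. B z u v) \<longlongrightarrow> B z0 u v) (nhds z0)"
  and nd: "!!u. (!!q. B z0 u q = 0) ==> u = 0"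
 shows "\<exists>K>0. \<forall>\<^sub>F z in nhds z0. \<forall>w. norm w \<le> K * (\<Sum>i\<in>Basis. \<bar>B z w i\<bar>)"
proof -
 have b0: "bilinear (B z0)" using eventually_nhds_x_imp_x[OF assms(1)] .
 define T where "T w = (\<Sum>i\<in>Basis. B z0 w i *\<^sub>R i)" for w
 have lT: "linear T"
  unfolding T_def by (rule linearI) (simp_all add: bilinear_ladd[OF b0] bilinear_lmul[OF b0] scaleR_add_left sum.distrib scaleR_sum_right)
 have Ti: "T w \<bullet> i = B z0 w i" if "i \<in> Basis" for w i
  unfolding T_def using that by (simp add: inner_sum_left inner_Basis if_distrib sum.delta cong: if_cong)
 have inj: "inj T"
 proof (rule linear_injective_0[OF lT, THEN iffD2], intro allI impI)
  fix w assume 0: "T w = 0"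
  have "B z0 w q = 0" for q
  proof -
   have "B z0 w q = (\<Sum>i\<in>Basis. (q \<bullet> i) * B z0 w i)" by (rule linear_expand) (use b0 in \<open>simp add: bilinear_def\<close>)
   also have "\<dots> = 0" using Ti[of _ w] 0 by simp
   finally show ?thesis .
  qed
  then show "w = 0" by (rule nd)
 qed
 obtain c where c: "c > 0" "!!w. c * norm w \<le> norm (T w)"
  using linear_inj_bounded_below_pos[OF lT inj] by (metis mult.commute)
 have Tn: "norm (T w) \<le> (\<Sum>i\<in>Basis. \<bar>B z0 w i\<bar>)" for w
  unfolding T_def by (rule order_trans[OF norm_sum]) simp
 define N where "N = real (DIM('f) * DIM('f))"
 have N: "N > 0" by (simp add: N_def)
 define et where "et = c / (2 * N)"
 have et: "et > 0" using c N by (simp add: et_def)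
 have "\<forall>\<^sub>F z in nhds z0. \<forall>j\<in>Basis. \<forall>i\<in>Basis. \<bar>B z j i - B z0 j i\<bar> < et"
 proof (intro eventually_ball_finite ballI finite_Basis)
  fix i j :: 'f
  show "\<forall>\<^sub>F z in nhds z0. \<bar>B z j i - B z0 j i\<bar> < et"
   using tendstoD[OF assms(2) et, of j i] by (simp add: dist_real_def)
 qed
 with assms(1) have "\<forall>\<^sub>F z in nhds z0. \<forall>w. norm w \<le> (2 / c) * (\<Sum>i\<in>Basis. \<bar>B z w i\<bar>)"
 proof eventually_elim
  fix z assume bz: "bilinear (B z)" and close: "\<forall>j\<in>Basis. \<forall>i\<in>Basis. \<bar>B z j i - B z0 j i\<bar> < et"
  show "\<forall>w. norm w \<le> (2 / c) * (\<Sum>i\<in>Basis. \<bar>B z w i\<bar>)"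
  proof
   fix w
   have diff: "\<bar>B z w i - B z0 w i\<bar> \<le> real DIM('f) * (norm w * et)" if i: "i \<in> Basis" for i
   proof -
    have "B z w i - B z0 w i = (\<Sum>j\<in>Basis. (w \<bullet> j) * (B z j i - B z0 j i))"
    proof -
     have e: "h w i = (\<Sum>j\<in>Basis. (w \<bullet> j) * h j i)" if "bilinear h" for h :: "'f => 'f => real"
      by (rule linear_expand) (use that in \<open>simp add: bilinear_def\<close>)
     show ?thesis unfolding e[OF bz] e[OF b0] by (simp add: sum_subtractf right_diff_distrib)
    qed
    also have "\<bar>\<dots>\<bar> \<le> (\<Sum>j\<in>(Basis::'f set). norm w * et)"
    proof (intro order_trans[OF sum_abs] sum_mono)
     fix j :: 'f assume j: "j \<in> Basis"
     show "\<bar>(w \<bullet> j) * (B z j i - B z0 j i)\<bar> \<le> norm w * et"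
      unfolding abs_mult using close i j by (intro mult_mono Basis_le_norm) (auto intro: less_imp_le)
    qed
    also have "\<dots> = real DIM('f) * (norm w * et)" by simp
    finally show ?thesis .
   qed
   have "c * norm w \<le> (\<Sum>i\<in>Basis. \<bar>B z0 w i\<bar>)" using c(2)[of w] Tn[of w] by simp
   also have "\<dots> \<le> (\<Sum>i\<in>Basis. \<bar>B z w i\<bar> + real DIM('f) * (norm w * et))"
    using diff by (intro sum_mono) (smt (verit))
   also have "\<dots> = (\<Sum>i\<in>Basis. \<bar>B z w i\<bar>) + N * et * norm w" by (simp add: sum.distrib N_def)
   also have "N * et = c / 2" using N by (simp add: et_def)
   finally have "c / 2 * norm w \<le> (\<Sum>i\<in>Basis. \<bar>B z w i\<bar>)" by simp
   then show "norm w \<le> (2 / c) * (\<Sum>i\<in>Basis. \<bar>B z w i\<bar>)" using c(1) by (simp add: field_simps)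
  qed
 qed
 then show ?thesis using c(1) by (intro exI[of _ "2 / c"]) auto
qed

lemma form_solution_tendsto:
 fixes B :: "'s::metric_space => 'f::euclidean_space => 'f => real"
 assumes b: "\<forall>\<^sub>F z in nhds z0. bilinear (B z)" and B: "!!u v. ((\<lambda>z. B z u v) \<longlongrightarrow> B z0 u v) (nhds z0)"
  and nd: "!!u. (!!q. B z0 u q = 0) ==> u = 0"
  and sol: "\<forall>\<^sub>F z in nhds z0. \<forall>q. B z (w z) q = l z q"
  and l: "!!q. ((\<lambda>z. l z q) \<longlongrightarrow> l z0 q) (nhds z0)"
 shows "(w \<longlongrightarrow> w z0) (nhds z0)"
proof -
 obtain K where K: "\<forall>\<^sub>F z in nhds z0. \<forall>w. norm w \<le> K * (\<Sum>i\<in>Basis. \<bar>B z w i\<bar>)"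
  using form_lower_bound[OF b B nd] by blast
 have s0: "B z0 (w z0) q = l z0 q" for q using eventually_nhds_x_imp_x[OF sol] by blast
 have "((\<lambda>z. K * (\<Sum>i\<in>Basis. \<bar>l z i - B z (w z0) i\<bar>)) \<longlongrightarrow> K * (\<Sum>i\<in>Basis. \<bar>l z0 i - B z0 (w z0) i\<bar>)) (nhds z0)"
  by (intro tendsto_intros l B)
 then have "((\<lambda>z. K * (\<Sum>i\<in>Basis. \<bar>l z i - B z (w z0) i\<bar>)) \<longlongrightarrow> 0) (nhds z0)" by (simp add: s0)
 moreover have "\<forall>\<^sub>F z in nhds z0. norm (w z - w z0) \<le> K * (\<Sum>i\<in>Basis. \<bar>l z i - B z (w z0) i\<bar>)"
  using K sol b
 proof eventually_elim
  fix z assume *: "\<forall>w. norm w \<le> K * (\<Sum>i\<in>Basis. \<bar>B z w i\<bar>)" "\<forall>q. B z (w z) q = l z q" "bilinear (B z)"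
  then show "norm (w z - w z0) \<le> K * (\<Sum>i\<in>Basis. \<bar>l z i - B z (w z0) i\<bar>)"
   using *(1)[rule_format, of "w z - w z0"] by (simp add: bilinear_lsub)
 qed
 ultimately have "((\<lambda>z. w z - w z0) \<longlongrightarrow> 0) (nhds z0)" by (rule Lim_null_comparison[rotated])
 then show ?thesis by (simp add: LIM_zero_iff)
qed

text \<open>Implicit differentiation of the linear system that determines \<open>w z\<close>. A
  Christoffel symbol is given as the solution of such a system, and
  \<open>cross_curvature_formula\<close> has to differentiate one.\<close>

lemma form_solution_differentiable:
 fixes B :: "'s::real_normed_vector => 'f::euclidean_space => 'f => real"
 assumes b: "\<forall>\<^sub>F z in nhds z0. bilinear (B z)" and B: "!!u v. (\<lambda>z. B z u v) differentiable (at z0)"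
  and nd: "!!u. (!!q. B z0 u q = 0) ==> u = 0"
  and sol: "\<forall>\<^sub>F z in nhds z0. \<forall>q. B z (w z) q = l z q"
  and l: "!!q. (\<lambda>z. l z q) differentiable (at z0)"
 shows "w differentiable (at z0)"
proof -
 have b0: "bilinear (B z0)" using eventually_nhds_x_imp_x[OF b] .
 have Bt: "((\<lambda>z. B z u v) \<longlongrightarrow> B z0 u v) (nhds z0)" for u v
  using differentiable_imp_continuous_within[OF B[of u v]] tendsto_at_iff_tendsto_nhds[of "\<lambda>z. B z u v" z0]
  unfolding continuous_within by blast
 obtain K where K: "K > 0" "\<forall>\<^sub>F z in nhds z0. \<forall>w. norm w \<le> K * (\<Sum>i\<in>Basis. \<bar>B z w i\<bar>)"
  using form_lower_bound[OF b Bt nd] by blast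
 \<comment> \<open>The residual of the solution frozen at \<open>z0\<close>: it vanishes there, it
   equals the form applied to \<open>w z - w z0\<close> nearby, and its derivative is the right hand
   side of the system for the candidate derivative \<open>W\<close>.\<close>
 define r where "r i z = l z i - B z (w z0) i" for i z
 have s0: "B z0 (w z0) q = l z0 q" for q using eventually_nhds_x_imp_x[OF sol] by blast
 have r0: "r i z0 = 0" for i unfolding r_def by (simp add: s0)
 have rd: "r i differentiable (at z0)" for i
  unfolding r_def by (intro differentiable_diff l B)
 define r' where "r' i = frechet_derivative (r i) (at z0)" for i
 have r': "(r i has_derivative r' i) (at z0)" for i
  using rd unfolding r'_def by (simp add: frechet_derivative_works)
 have lr': "linear (r' i)" for i using r' has_derivative_linear by blast
 define W where "W de = (THE u. \<forall>q. B z0 u q = (\<Sum>i\<in>Basis. (q \<bullet> i) * r' i de))" for de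
 have W: "B z0 (W de) q = (\<Sum>i\<in>Basis. (q \<bullet> i) * r' i de)" for de q
 proof -
  have "linear (\<lambda>q::'f. \<Sum>i\<in>Basis. (q \<bullet> i) * r' i de)"
   by (rule linearI) (simp_all add: inner_add_left algebra_simps sum.distrib sum_distrib_left)
  from theI'[OF form_represent[OF b0 nd this]] show ?thesis unfolding W_def by blast
 qed
 have Wi: "B z0 (W de) i = r' i de" if "i \<in> Basis" for i de
  unfolding W by (rule sum_Basis_inner[OF that])
 have uniq: "u = u'" if "!!q. B z0 u q = B z0 u' q" for u u'
  using nd[of "u - u'"] that by (simp add: bilinear_lsub[OF b0])
 have lW: "linear W"
 proof (rule linearI)
  show "W (x + y) = W x + W y" for x y
   by (rule uniq) (simp add: bilinear_ladd[OF b0] W linear_add[OF lr'] algebra_simps sum.distrib)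
  show "W (a *\<^sub>R x) = a *\<^sub>R W x" for a x
   by (rule uniq) (simp add: bilinear_lmul[OF b0] W linear_scale[OF lr'] algebra_simps sum_distrib_left)
 qed
 have "\<exists>C>0. \<forall>de. norm (r' i de) \<le> norm de * C" for i
  by (rule bounded_linear.pos_bounded[OF has_derivative_bounded_linear[OF r']])
 then obtain C where C: "!!i de. norm (r' i de) \<le> norm de * C i" "!!i. C i > 0"
  by metis
 have Wn: "norm (W de) \<le> (K * (\<Sum>i\<in>Basis. C i)) * norm de" for de
 proof -
  have "norm (W de) \<le> K * (\<Sum>i\<in>Basis. \<bar>B z0 (W de) i\<bar>)" using eventually_nhds_x_imp_x[OF K(2)] by blast
  also have "(\<Sum>i\<in>Basis. \<bar>B z0 (W de) i\<bar>) \<le> (\<Sum>i\<in>Basis. norm de * C i)"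
   using C(1) by (intro sum_mono) (simp add: Wi)
  finally show ?thesis using K(1) by (simp add: sum_distrib_left mult_left_mono algebra_simps)
 qed
 have blW: "bounded_linear W"
  by (rule bounded_linear_intro[of _ "K * (\<Sum>i\<in>Basis. C i)"])
   (use linear_add[OF lW] linear_scale[OF lW] Wn in \<open>auto simp: mult.commute\<close>)
 define M where "M = K * (\<Sum>i\<in>Basis. C i)"
 define err where "err z = (\<Sum>i\<in>Basis. norm (r i z - r i z0 - r' i (z - z0)) / norm (z - z0)) +
   (\<Sum>i\<in>Basis. \<Sum>j\<in>Basis. \<bar>B z j i - B z0 j i\<bar> * M)" for z
 have "((\<lambda>z. K * err z) \<longlongrightarrow> K * ((\<Sum>i\<in>(Basis::'f set). 0) + (\<Sum>i\<in>Basis. \<Sum>j\<in>Basis. \<bar>B z0 j i - B z0 j i\<bar> * M))) (at z0)"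
  unfolding err_def
  by (intro tendsto_intros tendsto_at_iff_tendsto_nhds[THEN iffD2] Bt) (use r' in \<open>simp_all add: has_derivative_at2 has_derivative_iff_norm\<close>)
 then have errlim: "((\<lambda>z. K * err z) \<longlongrightarrow> 0) (at z0)" by simp
 have "((\<lambda>z. norm (w z - w z0 - W (z - z0)) / norm (z - z0)) \<longlongrightarrow> 0) (at z0)"
 proof (rule Lim_null_comparison[OF _ errlim])
  have "\<forall>\<^sub>F z in at z0. z ~= z0" by (simp add: eventually_at_filter)
  moreover have "\<forall>\<^sub>F z in at z0. \<forall>w. norm w \<le> K * (\<Sum>i\<in>Basis. \<bar>B z w i\<bar>)" "\<forall>\<^sub>F z in at z0. \<forall>q. B z (w z) q = l z q" "\<forall>\<^sub>F z in at z0. bilinear (B z)"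
   using K(2) sol b by (auto intro: filter_leD[OF at_within_le_nhds])
  ultimately show "\<forall>\<^sub>F z in at z0. norm (norm (w z - w z0 - W (z - z0)) / norm (z - z0)) \<le> K * err z"
  proof eventually_elim
   fix z assume z: "z ~= z0" and Kz: "\<forall>w. norm w \<le> K * (\<Sum>i\<in>Basis. \<bar>B z w i\<bar>)"
    and sz: "\<forall>q. B z (w z) q = l z q" and bz: "bilinear (B z)"
   let ?de = "z - z0"
   have "\<bar>B z (w z - w z0 - W ?de) i\<bar> \<le> norm (r i z - r i z0 - r' i ?de) + (\<Sum>j\<in>Basis. \<bar>B z j i - B z0 j i\<bar> * M) * norm ?de" if i: "i \<in> Basis" for i
   proof -
    have "B z (w z - w z0 - W ?de) i = (r i z - r i z0 - r' i ?de) - (B z (W ?de) i - B z0 (W ?de) i)"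
     unfolding r0 Wi[OF i] using sz by (simp add: bilinear_lsub[OF bz] r_def)
    also have "\<bar>\<dots>\<bar> \<le> \<bar>r i z - r i z0 - r' i ?de\<bar> + \<bar>B z (W ?de) i - B z0 (W ?de) i\<bar>" by simp
    also have "\<bar>B z (W ?de) i - B z0 (W ?de) i\<bar> \<le> (\<Sum>j\<in>Basis. \<bar>B z j i - B z0 j i\<bar> * M) * norm ?de"
    proof -
     have e: "h (W ?de) i = (\<Sum>j\<in>Basis. (W ?de \<bullet> j) * h j i)" if "bilinear h" for h :: "'f => 'f => real"
      by (rule linear_expand) (use that in \<open>simp add: bilinear_def\<close>)
     have "B z (W ?de) i - B z0 (W ?de) i = (\<Sum>j\<in>Basis. (W ?de \<bullet> j) * (B z j i - B z0 j i))"
      unfolding e[OF bz] e[OF b0] by (simp add: sum_subtractf right_diff_distrib)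
     also have "\<bar>\<dots>\<bar> \<le> (\<Sum>j\<in>Basis. (M * norm ?de) * \<bar>B z j i - B z0 j i\<bar>)"
     proof (intro order_trans[OF sum_abs] sum_mono)
      fix j :: 'f assume "j \<in> Basis"
      then have "\<bar>W ?de \<bullet> j\<bar> \<le> M * norm ?de" using Basis_le_norm[of j "W ?de"] Wn[of ?de] unfolding M_def by simp
      then show "\<bar>(W ?de \<bullet> j) * (B z j i - B z0 j i)\<bar> \<le> (M * norm ?de) * \<bar>B z j i - B z0 j i\<bar>"
       unfolding abs_mult by (intro mult_right_mono) auto
     qed
     finally show ?thesis by (simp add: sum_distrib_right sum_distrib_left algebra_simps)
    qed
    finally show ?thesis by simp
   qed
   then have "(\<Sum>i\<in>Basis. \<bar>B z (w z - w z0 - W ?de) i\<bar>) \<le> (\<Sum>i\<in>Basis. norm (r i z - r i z0 - r' i ?de) + (\<Sum>j\<in>Basis. \<bar>B z j i - B z0 j i\<bar> * M) * norm ?de)"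
    by (rule sum_mono)
   also have "\<dots> = err z * norm ?de"
    using z unfolding err_def by (simp add: sum.distrib distrib_right sum_divide_distrib[symmetric] sum_distrib_right[symmetric])
   finally have "norm (w z - w z0 - W ?de) \<le> K * (err z * norm ?de)"
    using Kz[rule_format, of "w z - w z0 - W ?de"] K(1) by (meson mult_left_mono order_trans less_imp_le)
   then show "norm (norm (w z - w z0 - W ?de) / norm ?de) \<le> K * err z"
    using z by (simp add: field_simps)
  qed
 qed
 then have "(w has_derivative W) (at z0)"
  using blW by (simp add: has_derivative_iff_norm)
 then show ?thesis unfolding differentiable_def by blast
qed

lemma frechet_derivative_linear_param:
 fixes F :: "'q::real_vector => 's::real_normed_vector => real"
 assumes "open S" "z \<in> S" "!!y. y \<in> S ==> linear (\<lambda>q. F q y)" "!!q. F q differentiable (at z)"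
 shows "linear (\<lambda>q. pd (F q) u z)"
proof (rule linearI)
 have D: "(F q has_derivative frechet_derivative (F q) (at z)) (at z)" for q
  using assms(4) by (simp add: frechet_derivative_works)
 fix q q' :: 'q and a :: real
 have "(F (q + q') has_derivative (\<lambda>u. pd (F q) u z + pd (F q') u z)) (at z)"
  by (rule has_derivative_transform_within_open[OF has_derivative_add[OF D D] assms(1,2)])
   (simp add: linear_add[OF assms(3)])
 then show "pd (F (q + q')) u z = pd (F q) u z + pd (F q') u z"
  by (metis frechet_derivative_at)
 have "(F (a *\<^sub>R q) has_derivative (\<lambda>u. a *\<^sub>R pd (F q) u z)) (at z)"
  by (rule has_derivative_transform_within_open[OF has_derivative_scaleR_right[OF D] assms(1,2)])
   (simp add: linear_scale[OF assms(3)])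
 then show "pd (F (a *\<^sub>R q)) u z = a *\<^sub>R pd (F q) u z"
  by (metis frechet_derivative_at)
qed

text \<open>The right hand side of the Koszul formula is linear in q, so nondegeneracy gives the
  definite description in \<open>christoffel\<close> exactly one solution.\<close>

lemma christoffel_eq:
 fixes G :: "'f::euclidean_space => 'f => 'f => real"
 assumes "open S" "z \<in> S" "!!y. y \<in> S ==> bilinear (G y)" "!!u v. (\<lambda>y. G y u v) differentiable (at z)"
  and nd: "!!u. (!!q. G z u q = 0) ==> u = 0"
 shows "G z (christoffel G z u v) q = (pd (\<lambda>y. G y v q) u z
   + pd (\<lambda>y. G y u q) v z - pd (\<lambda>y. G y u v) q z) / 2"
proof -
 have lin: "linear (\<lambda>q. pd (\<lambda>y. G y v q) u z)" for u v
  by (rule frechet_derivative_linear_param[OF assms(1,2) _ assms(4)]) (use assms(3) in \<open>simp add: bilinear_def\<close>)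
 have lin': "linear (frechet_derivative (\<lambda>y. G y u v) (at z))" for u v
  by (rule linear_frechet_derivative[OF assms(4)])
 have "linear (\<lambda>q. (pd (\<lambda>y. G y v q) u z
   + pd (\<lambda>y. G y u q) v z - pd (\<lambda>y. G y u v) q z) / 2)"
  by (rule linearI) (simp_all add: linear_add[OF lin] linear_scale[OF lin] linear_add[OF lin'] linear_scale[OF lin'] field_simps)
 from theI'[OF form_represent[OF assms(3)[OF assms(2)] nd this]]
 show ?thesis unfolding christoffel_def by blast
qed

text \<open>The constants are uniform on a compact convex set because the derivatives in the
  finitely many basis directions are bounded there. Through \<open>metric_Taylor\<close> they give
  the calibration constants that do not depend on the ray.\<close>

lemma C2_Taylor_bounds:
 fixes F :: "'e::euclidean_space => real"
 assumes F: "C_k_on 2 F S" and K: "compact K" "convex K" "K \<subseteq> S"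
 shows "\<exists>C\<ge>0. \<forall>z\<in>K. \<forall>z'\<in>K. \<bar>F z' - F z\<bar> \<le> C * norm (z' - z) \<and>
  \<bar>F z' - F z - pd F (z' - z) z\<bar> \<le> C * (norm (z' - z))\<^sup>2"
proof -
 have lip: "\<exists>C\<ge>0. \<forall>z\<in>K. \<forall>z'\<in>K. \<bar>H z' - H z\<bar> \<le> C * norm (z' - z)"
  if H: "!!s. s \<in> S ==> H differentiable (at s)" "!!u. continuous_on S (pd H u)" for H :: "'e => real"
 proof -
  have "\<exists>C\<ge>0. \<forall>z\<in>K. \<bar>pd H i z\<bar> \<le> C" for i
  proof -
   have "compact ((pd H i) ` K)"
    by (rule compact_continuous_image[OF continuous_on_subset[OF H(2) K(3)] K(1)])
   then obtain C where "\<forall>x\<in>(pd H i) ` K. norm x \<le> C"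
    using compact_imp_bounded bounded_iff by metis
   then show ?thesis by (intro exI[of _ "max C 0"]) force
  qed
  then obtain C where C: "!!i. C i \<ge> 0" "!!i z. z \<in> K ==> \<bar>pd H i z\<bar> \<le> C i" by metis
  have on: "onorm (frechet_derivative H (at z)) \<le> (\<Sum>i\<in>Basis. C i)" if z: "z \<in> K" for z
  proof (rule onorm_le)
   fix u :: 'e
   have lin: "linear (frechet_derivative H (at z))" using H(1) K(3) z by (intro linear_frechet_derivative) auto
   have "pd H u z = pd H (\<Sum>i\<in>Basis. (u \<bullet> i) *\<^sub>R i) z" by (simp add: euclidean_representation)
   also have "\<dots> = (\<Sum>i\<in>Basis. (u \<bullet> i) * pd H i z)" by (simp add: linear_sum[OF lin] linear_scale[OF lin])
   also have "norm \<dots> \<le> (\<Sum>i\<in>Basis. norm u * C i)"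
    unfolding real_norm_def
    by (intro order_trans[OF sum_abs] sum_mono) (auto simp: abs_mult intro!: mult_mono Basis_le_norm C z)
   finally show "norm (pd H u z) \<le> (\<Sum>i\<in>Basis. C i) * norm u" by (simp add: sum_distrib_left mult.commute)
  qed
  have "\<bar>H z' - H z\<bar> \<le> (\<Sum>i\<in>Basis. C i) * norm (z' - z)" if "z \<in> K" "z' \<in> K" for z z'
  proof -
   have "norm (H z' - H z) \<le> (\<Sum>i\<in>Basis. C i) * norm (z' - z)"
   proof (rule differentiable_bound[OF K(2) _ on])
    show "(H has_derivative frechet_derivative H (at x)) (at x within K)" if "x \<in> K" for x
     using H(1)[of x] that K(3) by (auto simp: frechet_derivative_works intro: has_derivative_at_withinI)
   qed (use that in auto)
   then show ?thesis by simp
  qed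
  then show ?thesis using C(1) by (intro exI[of _ "\<Sum>i\<in>Basis. C i"]) (auto intro: sum_nonneg)
 qed
 have d1: "!!s. s \<in> S ==> F differentiable (at s)" and
  d2: "!!u s. s \<in> S ==> (pd F u) differentiable (at s)" and
  d3: "!!u u'. continuous_on S (pd (pd F u) u')"
  using F by (simp_all add: numeral_2_eq_2)
 have c1: "continuous_on S (pd F u)" for u
  using d2 by (meson continuous_at_imp_continuous_on differentiable_imp_continuous_within)
 obtain C0 where C0: "C0 \<ge> 0" "!!z z'. z \<in> K ==> z' \<in> K ==> \<bar>F z' - F z\<bar> \<le> C0 * norm (z' - z)"
  using lip[OF d1 c1] by blast
 have "\<exists>C\<ge>0. \<forall>z\<in>K. \<forall>z'\<in>K. \<bar>pd F u z' - pd F u z\<bar> \<le> C * norm (z' - z)" for u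
  using lip[OF d2 d3] by blast
 then obtain C where C: "!!u. C u \<ge> 0" "!!u z z'. z \<in> K ==> z' \<in> K ==> \<bar>pd F u z' - pd F u z\<bar> \<le> C u * norm (z' - z)"
  by metis
 define C1 where "C1 = (\<Sum>i\<in>Basis. C i)"
 have C1: "C1 \<ge> 0" unfolding C1_def by (intro sum_nonneg C)
 have T: "\<bar>F z' - F z - pd F (z' - z) z\<bar> \<le> C1 * (norm (z' - z))\<^sup>2" if z: "z \<in> K" "z' \<in> K" for z z'
 proof -
  have seg: "z + t *\<^sub>R (z' - z) \<in> K" if "t \<in> {0..1}" for t
   using convexD_alt[OF K(2) z, of t] that by (simp add: algebra_simps)
  have "norm (F z' - F z - pd F (z' - z) z) \<le> norm (z' - z) * (C1 * norm (z' - z))"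
  proof (rule differentiable_bound_linearization[where S = "(\<lambda>t. z + t *\<^sub>R (z' - z)) ` {0..1}"])
   show "(F has_derivative frechet_derivative F (at x)) (at x within (\<lambda>t. z + t *\<^sub>R (z' - z)) ` {0..1})" if "x \<in> (\<lambda>t. z + t *\<^sub>R (z' - z)) ` {0..1}" for x
   proof (rule has_derivative_at_withinI)
    have "x \<in> S" using that seg K(3) by blast
    then show "(F has_derivative frechet_derivative F (at x)) (at x)" using d1 by (simp add: frechet_derivative_works)
   qed
   show "z \<in> (\<lambda>t. z + t *\<^sub>R (z' - z)) ` {0..1}" by (rule image_eqI[of _ _ 0]) auto
   fix x assume "x \<in> (\<lambda>t. z + t *\<^sub>R (z' - z)) ` {0..1}"
   then obtain t where t: "t \<in> {0..1}" and x: "x = z + t *\<^sub>R (z' - z)" by blast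
   show "onorm (frechet_derivative F (at x) - frechet_derivative F (at z)) \<le> C1 * norm (z' - z)"
    unfolding x fun_diff_def
   proof (rule onorm_le)
    fix u :: 'e
    let ?D = "\<lambda>u. pd F u (z + t *\<^sub>R (z' - z)) - pd F u z"
    have lin: "linear ?D"
     using seg[OF t] z K(3) d1 by (intro linear_compose_sub linear_frechet_derivative) auto
    have n: "norm (z + t *\<^sub>R (z' - z) - z) \<le> norm (z' - z)" using t by (simp add: mult_left_le_one_le)
    have "?D u = ?D (\<Sum>i\<in>Basis. (u \<bullet> i) *\<^sub>R i)" by (simp add: euclidean_representation)
    also have "\<dots> = (\<Sum>i\<in>Basis. (u \<bullet> i) * ?D i)" by (subst linear_sum[OF lin]) (simp add: linear_scale[OF lin])
    also have "norm \<dots> \<le> (\<Sum>i\<in>Basis. norm u * (C i * norm (z' - z)))"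
     unfolding real_norm_def
    proof (intro order_trans[OF sum_abs] sum_mono)
     fix i :: 'e assume i: "i \<in> Basis"
     have "\<bar>?D i\<bar> \<le> C i * norm (z' - z)"
      using C(2)[OF z(1) seg[OF t], of i] mult_left_mono[OF n C(1)[of i]] by linarith
     then show "\<bar>u \<bullet> i * ?D i\<bar> \<le> norm u * (C i * norm (z' - z))"
      unfolding abs_mult using i by (intro mult_mono Basis_le_norm) auto
    qed
    finally show "norm (?D u) \<le> C1 * norm (z' - z) * norm u"
     by (simp add: C1_def sum_distrib_left sum_distrib_right algebra_simps)
   qed
  qed auto
  then show ?thesis by (simp add: power2_eq_square algebra_simps)
 qed
 show ?thesis
 proof (intro exI[of _ "max C0 C1"] conjI ballI)
  fix z z' assume z: "z \<in> K" "z' \<in> K"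
  show "\<bar>F z' - F z\<bar> \<le> max C0 C1 * norm (z' - z)"
   using C0(2)[OF z] mult_right_mono[of C0 "max C0 C1" "norm (z' - z)"] by simp
  show "\<bar>F z' - F z - pd F (z' - z) z\<bar> \<le> max C0 C1 * (norm (z' - z))\<^sup>2"
   using T[OF z] mult_right_mono[of C1 "max C0 C1" "(norm (z' - z))\<^sup>2"] by simp
 qed (use C0 C1 in simp)
qed

lemma at_within_atLeast_neq_bot: "t \<ge> 0 ==> at t within {0::real..} ~= bot"
proof
 assume "t \<ge> 0" "at t within {0..} = bot"
 moreover have "at t within {t<..} \<le> at t within {0..}" by (rule at_le) (use \<open>t \<ge> 0\<close> in auto)
 ultimately have "at_right t = bot" by (simp add: bot_unique)
 then show False by simp
qed

lemma filter_Cauchy_convergent: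
 fixes f :: "'i => 'e::euclidean_space"
 assumes "G ~= bot" "!!e. e > 0 ==> \<exists>v. \<forall>\<^sub>F n in G. dist (f n) v < e"
 shows "\<exists>l. (f \<longlongrightarrow> l) G"
proof -
 have "cauchy_filter (filtermap f G)"
  unfolding cauchy_filter_metric_filtermap
 proof (intro allI impI)
  fix e :: real assume "e > 0"
  then obtain v where v: "\<forall>\<^sub>F n in G. dist (f n) v < e/2" using assms(2)[of "e/2"] by auto
  show "\<exists>P. eventually P G \<and> (\<forall>x y. P x \<and> P y --> dist (f x) (f y) < e)"
   using v by (intro exI[of _ "\<lambda>n. dist (f n) v < e/2"]) (auto intro: dist_triangle_half_l)
 qed
 moreover have "filtermap f G ~= bot" using assms(1) by (simp add: filtermap_bot_iff)
 ultimately have "\<exists>l\<in>UNIV. filtermap f G \<le> nhds l"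
  using complete_UNIV[where 'a='e] unfolding complete_uniform by auto
 then show ?thesis by (auto simp: filterlim_def)
qed

text \<open>Bounded velocities over a compact set bound the second derivatives, so the Taylor
  remainder \<open>quad\<close> is uniform in n. Hence pointwise convergence of the solutions alone
  forces convergence of the velocities and the equation for the limit.\<close>

lemma ode_limit:
 fixes y :: "nat => real => 'e::euclidean_space"
 assumes G: "G ~= bot" and ab: "a < b"
  and ev: "\<forall>\<^sub>F n in G. \<forall>t\<in>{a..b}. (y n has_vector_derivative y1 n t) (at t within {a..b}) \<and>
    (y1 n has_vector_derivative Q (y n t) (y1 n t)) (at t within {a..b}) \<and> y n t \<in> K \<and> norm (y1 n t) \<le> C"
  and K: "compact K" and Q: "continuous_on (K \<times> UNIV) (\<lambda>(z, w). Q z w)"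
  and lim: "!!t. t \<in> {a..b} ==> ((\<lambda>n. y n t) \<longlongrightarrow> z t) G"
 shows "\<exists>z1. \<forall>t\<in>{a..b}. ((\<lambda>n. y1 n t) \<longlongrightarrow> z1 t) G \<and> (z has_vector_derivative z1 t) (at t within {a..b}) \<and>
  (z1 has_vector_derivative Q (z t) (z1 t)) (at t within {a..b})"
proof -
 let ?J = "{a..b}"
 define D where "D = K \<times> cball (0::'e) C"
 have cD: "compact D" unfolding D_def by (intro compact_Times K compact_cball)
 have QD: "continuous_on D (\<lambda>(z, w). Q z w)" by (rule continuous_on_subset[OF Q]) (auto simp: D_def)
 obtain M where M: "M > 0" "!!z w. (z, w) \<in> D ==> norm (Q z w) \<le> M"
 proof -
  have "bounded ((\<lambda>(z, w). Q z w) ` D)" by (rule compact_imp_bounded[OF compact_continuous_image[OF QD cD]])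
  then obtain M where "M > 0" "\<forall>x\<in>(\<lambda>(z, w). Q z w) ` D. norm x \<le> M" using bounded_pos by metis
  then show ?thesis by (intro that[of M]) force+
 qed
 have C0: "C \<ge> 0"
 proof -
  obtain n where "\<forall>t\<in>{a..b}. norm (y1 n t) \<le> C" using eventually_happens'[OF G ev] by blast
  then have "norm (y1 n a) \<le> C" using ab by auto
  then show ?thesis using norm_ge_zero order_trans by blast
 qed
 have seg: "closed_segment s t \<subseteq> ?J" if "s \<in> ?J" "t \<in> ?J" for s t
  using that by (simp add: closed_segment_subset)
 have sd: "norm (x - t) \<le> norm (s - t)" if "x \<in> closed_segment t s" for x s t :: real
  using segment_bound1[OF that] .
 have lip1: "norm (y1 n s - y1 n t) \<le> M * norm (s - t)" and lip0: "norm (y n s - y n t) \<le> C * norm (s - t)"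
  if n: "\<forall>t\<in>{a..b}. (y n has_vector_derivative y1 n t) (at t within {a..b}) \<and>
    (y1 n has_vector_derivative Q (y n t) (y1 n t)) (at t within {a..b}) \<and> y n t \<in> K \<and> norm (y1 n t) \<le> C"
   and st: "s \<in> ?J" "t \<in> ?J" for n s t
 proof -
  have inD: "(y n x, y1 n x) \<in> D" if "x \<in> ?J" for x using n that unfolding D_def by auto
  show "norm (y1 n s - y1 n t) \<le> M * norm (s - t)"
  proof (rule differentiable_bound[of "{a..b}" "y1 n" "\<lambda>x h. h *\<^sub>R Q (y n x) (y1 n x)"])
   show "onorm (\<lambda>h. h *\<^sub>R Q (y n x) (y1 n x)) \<le> M" if "x \<in> {a..b}" for x
    using M(2)[OF inD[OF that]] by (intro onorm_le) (auto simp: mult.commute[of M] intro!: mult_left_mono)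
  qed (use n st in \<open>auto simp: has_vector_derivative_def\<close>)
  show "norm (y n s - y n t) \<le> C * norm (s - t)"
  proof (rule differentiable_bound[of "{a..b}" "y n" "\<lambda>x h. h *\<^sub>R y1 n x"])
   show "onorm (\<lambda>h. h *\<^sub>R y1 n x) \<le> C" if "x \<in> {a..b}" for x
    using n that by (intro onorm_le) (auto simp: mult.commute[of C] intro!: mult_left_mono)
  qed (use n st in \<open>auto simp: has_vector_derivative_def\<close>)
 qed
 have quad: "norm (y n s - y n t - (s - t) *\<^sub>R y1 n t) \<le> norm (s - t) * (M * norm (s - t))"
  if n: "\<forall>t\<in>{a..b}. (y n has_vector_derivative y1 n t) (at t within {a..b}) \<and>
    (y1 n has_vector_derivative Q (y n t) (y1 n t)) (at t within {a..b}) \<and> y n t \<in> K \<and> norm (y1 n t) \<le> C"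
   and st: "s \<in> ?J" "t \<in> ?J" for n s t
 proof (rule vector_differentiable_bound_linearization[where S = "closed_segment t s"])
  show "(y n has_vector_derivative y1 n x) (at x within closed_segment t s)" if "x \<in> closed_segment t s" for x
   using n seg[OF st(2,1)] that by (blast intro: has_vector_derivative_within_subset)
  show "norm (y1 n x - y1 n t) \<le> M * norm (s - t)" if "x \<in> closed_segment t s" for x
  proof -
   have "x \<in> ?J" using seg[OF st(2,1)] that by blast
   from lip1[OF n this st(2)] show ?thesis using sd[OF that] M(1) by (meson mult_left_mono order_trans less_imp_le)
  qed
 qed auto
 have "\<exists>l. ((\<lambda>n. y1 n t) \<longlongrightarrow> l) G" if t: "t \<in> ?J" for t
 proof (rule filter_Cauchy_convergent[OF G])
  fix e :: real assume e: "e > 0"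
  \<comment> \<open>At this s the difference quotient approximates the velocity at t up to e/4 for
    all n under consideration. The quotients converge, so the velocities are Cauchy along G.\<close>
  obtain s where s: "s \<in> ?J" "s ~= t" "norm (s - t) \<le> e / (4 * M)"
  proof -
   define h where "h = min (b - a) (e / (4 * M)) / 2"
   have h: "h > 0" "h \<le> e / (4 * M)" "h \<le> (b - a) / 2" using ab e M(1) by (auto simp: h_def min_def field_simps)
   show ?thesis
   proof (cases "t + h \<le> b")
    case True then show ?thesis using that[of "t + h"] t h by auto
   next
    case False then show ?thesis using that[of "t - h"] t h ab by auto
   qed
  qed
  let ?v = "(1 / (s - t)) *\<^sub>R (z s - z t)"
  have "((\<lambda>n. (1 / (s - t)) *\<^sub>R (y n s - y n t)) \<longlongrightarrow> ?v) G"
   by (intro tendsto_intros lim s t)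
  then have "\<forall>\<^sub>F n in G. dist ((1 / (s - t)) *\<^sub>R (y n s - y n t)) ?v < e/2" by (rule tendstoD) (use e in simp)
  with ev have "\<forall>\<^sub>F n in G. dist (y1 n t) ?v < e"
  proof eventually_elim
   case (elim n)
   have "norm (y n s - y n t - (s - t) *\<^sub>R y1 n t) \<le> norm (s - t) * (M * norm (s - t))"
    by (rule quad[OF elim(1) s(1) t])
   moreover have "y n s - y n t - (s - t) *\<^sub>R y1 n t = (s - t) *\<^sub>R ((1 / (s - t)) *\<^sub>R (y n s - y n t) - y1 n t)"
    using s(2) by (simp add: scaleR_diff_right)
   ultimately have "norm (s - t) * norm ((1 / (s - t)) *\<^sub>R (y n s - y n t) - y1 n t) \<le> norm (s - t) * (M * norm (s - t))"
    by simp
   then have "norm ((1 / (s - t)) *\<^sub>R (y n s - y n t) - y1 n t) \<le> M * norm (s - t)" using s(2) by simp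
   also have "\<dots> \<le> M * (e / (4 * M))" using s(3) M(1) by (intro mult_left_mono) auto
   also have "\<dots> = e/4" using M(1) by simp
   finally have "dist (y1 n t) ((1 / (s - t)) *\<^sub>R (y n s - y n t)) \<le> e/4" by (simp add: dist_norm norm_minus_commute)
   then show ?case using elim(2) e dist_triangle[of "y1 n t" ?v "(1 / (s - t)) *\<^sub>R (y n s - y n t)"] by simp
  qed
  then show "\<exists>v. \<forall>\<^sub>F n in G. dist (y1 n t) v < e" by blast
 qed
 then obtain z1 where z1: "!!t. t \<in> ?J ==> ((\<lambda>n. y1 n t) \<longlongrightarrow> z1 t) G" by metis
 have d1: "(z has_vector_derivative z1 t) (at t within ?J)" if t: "t \<in> ?J" for t
  unfolding has_vector_derivative_def has_derivative_within_alt
 proof (intro conjI allI impI)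
  show "bounded_linear (\<lambda>x. x *\<^sub>R z1 t)" by (rule bounded_linear_scaleR_left)
  fix e :: real assume e: "e > 0"
  show "\<exists>d>0. \<forall>s\<in>?J. norm (s - t) < d --> norm (z s - z t - (s - t) *\<^sub>R z1 t) \<le> e * norm (s - t)"
  proof (intro exI[of _ "e / M"] conjI ballI impI)
   fix s assume s: "s \<in> ?J" "norm (s - t) < e / M"
   have "((\<lambda>n. norm (y n s - y n t - (s - t) *\<^sub>R y1 n t)) \<longlongrightarrow> norm (z s - z t - (s - t) *\<^sub>R z1 t)) G"
    by (intro tendsto_intros lim z1 s t)
   moreover have "\<forall>\<^sub>F n in G. norm (y n s - y n t - (s - t) *\<^sub>R y1 n t) \<le> norm (s - t) * (M * norm (s - t))"
    using ev by eventually_elim (rule quad[OF _ s(1) t])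
   ultimately have "norm (z s - z t - (s - t) *\<^sub>R z1 t) \<le> norm (s - t) * (M * norm (s - t))"
    using G by (rule tendsto_upperbound)
   also have "norm (s - t) * (M * norm (s - t)) \<le> norm (s - t) * e"
    using s(2) M(1) by (intro mult_left_mono) (auto simp: field_simps)
   finally show "norm (z s - z t - (s - t) *\<^sub>R z1 t) \<le> e * norm (s - t)" by (simp add: mult.commute)
  qed (use e M in simp)
 qed
 have zK: "(z t, z1 t) \<in> D" if t: "t \<in> ?J" for t
 proof -
  have cl: "closed D" using cD by (rule compact_imp_closed)
  have 1: "((\<lambda>n. (y n t, y1 n t)) \<longlongrightarrow> (z t, z1 t)) G" by (intro tendsto_intros lim z1 t)
  have 2: "\<forall>\<^sub>F n in G. (y n t, y1 n t) \<in> D" using ev by eventually_elim (use t in \<open>auto simp: D_def\<close>)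
  show ?thesis by (rule Lim_in_closed_set[OF cl 2 G 1])
 qed
 have limQ: "((\<lambda>n. Q (y n t) (y1 n t)) \<longlongrightarrow> Q (z t) (z1 t)) G" if t: "t \<in> ?J" for t
 proof -
  have "((\<lambda>n. (\<lambda>(z, w). Q z w) (y n t, y1 n t)) \<longlongrightarrow> (\<lambda>(z, w). Q z w) (z t, z1 t)) G"
  proof (rule continuous_on_tendsto_compose[OF QD _ zK[OF t]])
   show "((\<lambda>n. (y n t, y1 n t)) \<longlongrightarrow> (z t, z1 t)) G" by (intro tendsto_intros lim z1 t)
   show "\<forall>\<^sub>F n in G. (y n t, y1 n t) \<in> D" using ev by eventually_elim (use t in \<open>auto simp: D_def\<close>)
  qed
  then show ?thesis by simp
 qed
 \<comment> \<open>The modulus of continuity of Q on the compact set \<open>D\<close> does not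
   depend on n; together with the uniform Lipschitz bounds it makes the linearization of the
   velocities survive the limit.\<close>
 have uc: "uniformly_continuous_on D (\<lambda>(z, w). Q z w)" by (rule compact_uniformly_continuous[OF QD cD])
 have d2: "(z1 has_vector_derivative Q (z t) (z1 t)) (at t within ?J)" if t: "t \<in> ?J" for t
  unfolding has_vector_derivative_def has_derivative_within_alt
 proof (intro conjI allI impI)
  show "bounded_linear (\<lambda>x. x *\<^sub>R Q (z t) (z1 t))" by (rule bounded_linear_scaleR_left)
  fix e :: real assume e: "e > 0"
  obtain de where de: "de > 0" "!!p q. p \<in> D ==> q \<in> D ==> dist q p < de ==> dist ((\<lambda>(z, w). Q z w) q) ((\<lambda>(z, w). Q z w) p) < e"
   using uc e unfolding uniformly_continuous_on_def by metis
  show "\<exists>d>0. \<forall>s\<in>?J. norm (s - t) < d --> norm (z1 s - z1 t - (s - t) *\<^sub>R Q (z t) (z1 t)) \<le> e * norm (s - t)"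
  proof (intro exI[of _ "de / (C + M)"] conjI ballI impI)
   fix s assume s: "s \<in> ?J" "norm (s - t) < de / (C + M)"
   have "((\<lambda>n. norm (y1 n s - y1 n t - (s - t) *\<^sub>R Q (y n t) (y1 n t))) \<longlongrightarrow> norm (z1 s - z1 t - (s - t) *\<^sub>R Q (z t) (z1 t))) G"
    by (intro tendsto_intros z1 limQ s t)
   moreover have "\<forall>\<^sub>F n in G. norm (y1 n s - y1 n t - (s - t) *\<^sub>R Q (y n t) (y1 n t)) \<le> norm (s - t) * e"
    using ev
   proof eventually_elim
    case (elim n)
    show ?case
    proof (rule vector_differentiable_bound_linearization[where S = "closed_segment t s" and f' = "\<lambda>x. Q (y n x) (y1 n x)"])
     show "(y1 n has_vector_derivative Q (y n x) (y1 n x)) (at x within closed_segment t s)" if "x \<in> closed_segment t s" for x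
      using elim seg[OF t s(1)] that by (blast intro: has_vector_derivative_within_subset)
     fix x assume x: "x \<in> closed_segment t s"
     have xJ: "x \<in> ?J" using seg[OF t s(1)] x by blast
     have "dist (y n x, y1 n x) (y n t, y1 n t) \<le> norm (y n x - y n t) + norm (y1 n x - y1 n t)"
      unfolding dist_Pair_Pair dist_norm[symmetric] by (rule sqrt_sum_squares_le_sum) auto
     also have "\<dots> \<le> (C + M) * norm (x - t)"
      using lip0[OF elim xJ t] lip1[OF elim xJ t] by (simp add: distrib_right)
     also have "\<dots> \<le> (C + M) * norm (s - t)" using sd[OF x] C0 M(1) by (intro mult_left_mono) auto
     also have "\<dots> < de" using s(2) C0 M(1) by (simp add: field_simps)
     finally have "dist (y n x, y1 n x) (y n t, y1 n t) < de" .
     moreover have "(y n x, y1 n x) \<in> D" "(y n t, y1 n t) \<in> D" using elim xJ t by (auto simp: D_def)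
     ultimately show "norm (Q (y n x) (y1 n x) - Q (y n t) (y1 n t)) \<le> e"
      using de(2) by (fastforce simp: dist_norm)
    qed auto
   qed
   ultimately have "norm (z1 s - z1 t - (s - t) *\<^sub>R Q (z t) (z1 t)) \<le> norm (s - t) * e"
    using G by (rule tendsto_upperbound)
   then show "norm (z1 s - z1 t - (s - t) *\<^sub>R Q (z t) (z1 t)) \<le> e * norm (s - t)" by (simp add: mult.commute)
  qed (use de C0 M in simp)
 qed
 show ?thesis using z1 d1 d2 by blast
qed

context rmanifold
begin

text \<open>The rays over which \<open>cut_locus\<close> quantifies, separated from the minimization
  conditions.\<close>

definition uray :: "(real => 'a) => bool" where
 "uray ga \<longleftrightarrow> geodesic_on A g {0..} ga \<and>
   (\<forall>t\<ge>0. g (ga t) (velocity A {0..} ga t) (velocity A {0..} ga t) = 1)"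

lemma coord_metric_differentiable:
 "ka \<in> A ==> z \<in> chart_image ka ==> (\<lambda>y. coord_metric A g ka y u v) differentiable (at z)"
 using smooth_on_has_derivative[OF coord_metric_smooth] unfolding differentiable_def by blast

lemma coord_christoffel_eq:
 assumes "ka \<in> A" "z \<in> chart_image ka"
 shows "coord_metric A g ka z (christoffel (coord_metric A g ka) z u v) q =
   (pd (\<lambda>y. coord_metric A g ka y v q) u z
   + pd (\<lambda>y. coord_metric A g ka y u q) v z
   - pd (\<lambda>y. coord_metric A g ka y u v) q z) / 2"
proof (rule christoffel_eq[OF chart_open(2)[OF assms(1)] assms(2) coord_metric_bilinear[OF assms(1)] coord_metric_differentiable[OF assms]])
 show "u = 0" if "!!q. coord_metric A g ka z u q = 0" for u
  using coord_metric_pos[OF assms, of u] that[of u] by force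
qed

text \<open>The symbol solves a linear system whose form and right hand side are jointly continuous
  in the point and the velocity; this is the continuity of the geodesic equation that
  \<open>ode_limit\<close> asks for.\<close>

lemma christoffel_continuous:
 assumes ka: "ka \<in> A"
 shows "continuous_on (chart_image ka \<times> UNIV) (\<lambda>(z, w). christoffel (coord_metric A g ka) z w w)"
proof -
 let ?G = "coord_metric A g ka"
 let ?O = "chart_image ka \<times> (UNIV :: 'e set)"
 have op: "open ?O" by (intro open_Times chart_open ka open_UNIV)
 have "isCont (\<lambda>(z, w). christoffel ?G z w w) p0" if p0: "p0 \<in> ?O" for p0
 proof -
  have ev: "\<forall>\<^sub>F p in nhds p0. p \<in> ?O" using op p0 eventually_nhds by blast
  have lin1: "linear (\<lambda>v. pd (\<lambda>y. ?G y v q) u z)" "linear (\<lambda>v. pd (\<lambda>y. ?G y q v) u z)"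
   if "z \<in> chart_image ka" for q z u
   by (rule frechet_derivative_linear_param[OF chart_open(2)[OF ka] that _ coord_metric_differentiable[OF ka that]],
    use coord_metric_bilinear[OF ka] in \<open>simp add: bilinear_def\<close>)+
  have lin2: "linear (frechet_derivative (\<lambda>y. ?G y u v) (at z))" if "z \<in> chart_image ka" for u v z
   by (rule linear_frechet_derivative[OF coord_metric_differentiable[OF ka that]])
  have c1: "continuous_on ?O (\<lambda>p. pd (\<lambda>y. ?G y (snd p) q) (snd p) (fst p))" for q
  proof -
   have "continuous_on (chart_image ka \<times> UNIV) (\<lambda>(z, u, v). pd (\<lambda>y. ?G y v q) u z)"
    by (rule bilinear_family_continuous)
     (auto simp: bilinear_def lin1 lin2 intro: smooth_on_continuous_derivative[OF coord_metric_smooth[OF ka]])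
   then have "continuous_on ?O (\<lambda>p. (\<lambda>(z, u, v). pd (\<lambda>y. ?G y v q) u z) (fst p, snd p, snd p))"
    by (rule continuous_on_compose2) (auto intro!: continuous_intros)
   then show ?thesis by simp
  qed
  have c2: "continuous_on ?O (\<lambda>p. pd (\<lambda>y. ?G y (snd p) (snd p)) q (fst p))" for q
  proof -
   have "continuous_on (chart_image ka \<times> UNIV) (\<lambda>(z, u, v). pd (\<lambda>y. ?G y u v) q z)"
    by (rule bilinear_family_continuous)
     (auto simp: bilinear_def lin1 intro: smooth_on_continuous_derivative[OF coord_metric_smooth[OF ka]])
   then have "continuous_on ?O (\<lambda>p. (\<lambda>(z, u, v). pd (\<lambda>y. ?G y u v) q z) (fst p, snd p, snd p))"
    by (rule continuous_on_compose2) (auto intro!: continuous_intros)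
   then show ?thesis by simp
  qed
  have tn: "(h \<longlongrightarrow> h p0) (nhds p0)" if "continuous_on ?O h" for h :: "'e \<times> 'e => real"
  proof -
   have "isCont h p0" using continuous_on_eq_continuous_at[OF op, THEN iffD1, OF that] p0 by (rule bspec)
   then show ?thesis using tendsto_at_iff_tendsto_nhds[of h p0] by (simp add: isCont_def)
  qed
  have "((\<lambda>p. christoffel ?G (fst p) (snd p) (snd p)) \<longlongrightarrow> christoffel ?G (fst p0) (snd p0) (snd p0)) (nhds p0)"
  proof (rule form_solution_tendsto[where B = "\<lambda>p. ?G (fst p)" and l = "\<lambda>p q. (pd (\<lambda>y. ?G y (snd p) q) (snd p) (fst p)
     + pd (\<lambda>y. ?G y (snd p) q) (snd p) (fst p) - pd (\<lambda>y. ?G y (snd p) (snd p)) q (fst p)) / 2"])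
   show "\<forall>\<^sub>F p in nhds p0. bilinear (?G (fst p))"
    using ev by eventually_elim (auto intro: coord_metric_bilinear[OF ka])
   show "((\<lambda>p. ?G (fst p) u v) \<longlongrightarrow> ?G (fst p0) u v) (nhds p0)" for u v
    by (rule tn) (rule continuous_on_compose2[OF coord_metric_cont[OF ka]], auto intro!: continuous_intros)
   show "u = 0" if "!!q. ?G (fst p0) u q = 0" for u
    using coord_metric_pos[OF ka, of "fst p0" u] that[of u] p0 by force
   show "\<forall>\<^sub>F p in nhds p0. \<forall>q. ?G (fst p) (christoffel ?G (fst p) (snd p) (snd p)) q = (pd (\<lambda>y. ?G y (snd p) q) (snd p) (fst p)
     + pd (\<lambda>y. ?G y (snd p) q) (snd p) (fst p) - pd (\<lambda>y. ?G y (snd p) (snd p)) q (fst p)) / 2"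
    using ev by eventually_elim (auto simp: coord_christoffel_eq[OF ka])
  qed (intro tn continuous_intros c1 c2, simp)
  then show ?thesis
   using tendsto_at_iff_tendsto_nhds[of "\<lambda>(z, w). christoffel ?G z w w" p0] by (simp add: isCont_def case_prod_beta')
 qed
 then show ?thesis by (simp add: continuous_at_imp_continuous_on)
qed

end

section \<open>Unit speed rays and their limits\<close>

context rmanifold
begin

lemma uray_cont: "uray ga ==> continuous_on {0..} ga"
 unfolding uray_def geodesic_on_def by blast

lemma uray_chart:
 assumes "uray ga" "ka \<in> A"
 obtains y' where
  "!!t. t \<ge> 0 ==> ga t \<in> fst ka ==> (snd ka \<circ> ga has_vector_derivative y' t) (at t within {0..})"
  "!!t. t \<ge> 0 ==> ga t \<in> fst ka ==> (y' has_vector_derivative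
    - christoffel (coord_metric A g ka) (snd ka (ga t)) (y' t) (y' t)) (at t within {0..})"
  "!!t. t \<ge> 0 ==> ga t \<in> fst ka ==> coord_metric A g ka (snd ka (ga t)) (y' t) (y' t) = 1"
proof -
 obtain y' y'' where y: "!!t. t \<in> {t \<in> {0..}. ga t \<in> fst ka} ==> (snd ka \<circ> ga has_vector_derivative y' t) (at t within {0..}) \<and>
    (y' has_vector_derivative y'' t) (at t within {0..}) \<and>
    y'' t + christoffel (coord_metric A g ka) (snd ka (ga t)) (y' t) (y' t) = 0"
  using assms unfolding uray_def geodesic_on_def by meson
 show ?thesis
 proof (rule that[of y'])
  fix t :: real assume t: "t \<ge> 0" "ga t \<in> fst ka"
  then have y: "(snd ka \<circ> ga has_vector_derivative y' t) (at t within {0..})"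
    "(y' has_vector_derivative y'' t) (at t within {0..})"
    "y'' t = - christoffel (coord_metric A g ka) (snd ka (ga t)) (y' t) (y' t)"
   using y[of t] by (auto simp: eq_neg_iff_add_eq_0)
  show "(snd ka \<circ> ga has_vector_derivative y' t) (at t within {0..})" by fact
  show "(y' has_vector_derivative - christoffel (coord_metric A g ka) (snd ka (ga t)) (y' t) (y' t)) (at t within {0..})"
   using y(2,3) by simp
  have "continuous (at t within {0..}) ga"
   using uray_cont[OF assms(1)] t(1) by (simp add: continuous_on_eq_continuous_within)
  from velocity_coord(3)[OF assms(2) t(2) this _ y(1) at_within_atLeast_neq_bot[OF t(1)]] t(1) assms(1)
  show "coord_metric A g ka (snd ka (ga t)) (y' t) (y' t) = 1" unfolding uray_def by auto
 qed
qed

lemma cnorm_eq_1: "coord_metric A g ka z u u = 1 ==> cnorm ka z u = 1"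
 unfolding cnorm_def by simp

text \<open>To first order the displacement over a time h has norm h in the metric frozen at the
  point, and the distance is at most 1 + e times that norm; bisection adds up the local
  estimates.\<close>

lemma uray_lipschitz:
 assumes "uray ga" "0 \<le> a" "a \<le> b"
 shows "d (ga a) (ga b) \<le> b - a"
proof (rule field_le_mult_one_interval)
 fix q :: real assume q: "0 < q" "q < 1"
 \<comment> \<open>With this choice (1 + e)^2 q is at most (1 + 3 e) q, which is at most 1.\<close>
 define e where "e = (1 - q) / 4"
 have e: "0 < e" "e < 1" "(1 + e) * (1 + e) * q \<le> 1"
 proof -
  show "0 < e" "e < 1" using q by (auto simp: e_def)
  have "(1 + e) * (1 + e) \<le> 1 + 3 * e" using \<open>0 < e\<close> \<open>e < 1\<close> by (simp add: algebra_simps)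
  then have "(1 + e) * (1 + e) * q \<le> (1 + 3 * e) * q" using q by (intro mult_right_mono) auto
  also have "\<dots> \<le> 1" using q unfolding e_def
  proof -
   have "(1 + 3 * ((1 - q) / 4)) * q = 1 - (1 - q) * (1 - 3 * q / 4)" by (simp add: field_simps)
   moreover have "(1 - q) * (1 - 3 * q / 4) \<ge> 0" using q by (intro mult_nonneg_nonneg) auto
   ultimately show "(1 + 3 * ((1 - q) / 4)) * q \<le> 1" by simp
  qed
  finally show "(1 + e) * (1 + e) * q \<le> 1" .
 qed
 have "0 \<le> a --> d (ga a) (ga b) \<le> (1 + e) * (1 + e) * (b - a)"
 proof (rule Bolzano[OF assms(3), of "\<lambda>u v. 0 \<le> u --> d (ga u) (ga v) \<le> (1 + e) * (1 + e) * (v - u)"])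
  show "0 \<le> u --> d (ga u) (ga w) \<le> (1 + e) * (1 + e) * (w - u)"
   if "0 \<le> u --> d (ga u) (ga v) \<le> (1 + e) * (1 + e) * (v - u)" "0 \<le> v --> d (ga v) (ga w) \<le> (1 + e) * (1 + e) * (w - v)" "u \<le> v" "v \<le> w" for u v w
   using that d_triangle[of "ga u" "ga w" "ga v"] by (auto simp: algebra_simps)
  fix x assume x: "a \<le> x" "x \<le> b"
  then have x0: "x \<ge> 0" using assms by simp
  let ?ka = "chart_at A (ga x)"
  let ?s = "snd ?ka (ga x)"
  have s: "?s \<in> chart_image ?ka" using chart_at by blast
  obtain y' where y': "(snd ?ka \<circ> ga has_vector_derivative y') (at x within {0..})" "coord_metric A g ?ka ?s y' y' = 1"
   using uray_chart[OF assms(1) chart_at(1)] x0 chart_at(2) by metis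
  obtain r de where r: "r > 0" "de > 0" "ball ?s r \<subseteq> chart_image ?ka"
   "!!z z'. z \<in> ball ?s r ==> z' \<in> ball ?s r ==> d (chart_inv ?ka z) (chart_inv ?ka z') \<le> (1 + e) * cnorm ?ka ?s (z' - z)"
   "!!q. d (ga x) q < de ==> q \<in> chart_inv ?ka ` ball ?s r"
   by (rule asy[OF chart_at(1,2) e(1,2), of UNIV]) auto
  obtain c C where C: "C > 0" "!!u. cnorm ?ka ?s u \<le> C * norm u" using cnorm_bounds[OF chart_at(1) s] by metis
  have ev1: "\<forall>\<^sub>F t in at x within {0..}. ga t \<in> chart_inv ?ka ` ball ?s r"
  proof -
   have "open (chart_inv ?ka ` ball ?s r)" by (rule chart_inv_image_open[OF chart_at(1) open_ball r(3)])
   moreover have "ga x \<in> chart_inv ?ka ` ball ?s r" using r(5)[of "ga x"] r(2) by simp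
   ultimately show ?thesis using uray_cont[OF assms(1)] x0 by (metis atLeast_iff continuous_on_def topological_tendstoD)
  qed
  obtain d2 where d2: "d2 > 0" "!!t. t \<in> {0..} ==> norm (t - x) < d2 ==>
    norm ((snd ?ka \<circ> ga) t - (snd ?ka \<circ> ga) x - (t - x) *\<^sub>R y') \<le> (e / C) * norm (t - x)"
   using y'(1)[unfolded has_vector_derivative_def has_derivative_within_alt, THEN conjunct2, rule_format, OF divide_pos_pos[OF e(1) C(1)]] by blast
  obtain d1 where d1: "d1 > 0" "!!t. t \<in> {0..} ==> t ~= x ==> dist t x < d1 ==> ga t \<in> chart_inv ?ka ` ball ?s r"
   using ev1 unfolding eventually_at by auto
  have near: "d (ga x) (ga t) \<le> (1 + e) * (1 + e) * \<bar>t - x\<bar>" if t: "t \<ge> 0" "\<bar>t - x\<bar> < min d1 d2" for t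
  proof (cases "t = x")
   case False
   then have "ga t \<in> chart_inv ?ka ` ball ?s r" using d1(2)[of t] t by (auto simp: dist_real_def)
   then obtain z where z: "z \<in> ball ?s r" "ga t = chart_inv ?ka z" by blast
   have zt: "snd ?ka (ga t) = z" unfolding z(2) using chart_eq[OF chart_at(1)] z(1) r(3) by blast
   have 1: "d (ga x) (ga t) \<le> (1 + e) * cnorm ?ka ?s (z - ?s)"
    using r(4)[of ?s z] z r(1) chart_inv_eq[OF chart_at(1,2), of "ga x"] by simp
   have "cnorm ?ka ?s (z - ?s) \<le> cnorm ?ka ?s ((t - x) *\<^sub>R y') + cnorm ?ka ?s (z - ?s - (t - x) *\<^sub>R y')"
    using cnorm_triangle[OF chart_at(1) s, of "(t - x) *\<^sub>R y'" "z - ?s - (t - x) *\<^sub>R y'"] by simp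
   moreover have "cnorm ?ka ?s ((t - x) *\<^sub>R y') = \<bar>t - x\<bar>"
    by (simp add: cnorm_scale[OF chart_at(1) s] cnorm_eq_1[OF y'(2)])
   moreover have "cnorm ?ka ?s (z - ?s - (t - x) *\<^sub>R y') \<le> C * ((e / C) * \<bar>t - x\<bar>)"
    using d2(2)[of t] t zt by (intro order_trans[OF C(2)] mult_left_mono) (auto intro: less_imp_le C)
   moreover have "C * ((e / C) * \<bar>t - x\<bar>) = e * \<bar>t - x\<bar>" using C(1) by simp
   ultimately have "cnorm ?ka ?s (z - ?s) \<le> (1 + e) * \<bar>t - x\<bar>" by (simp add: algebra_simps)
   then have "(1 + e) * cnorm ?ka ?s (z - ?s) \<le> (1 + e) * ((1 + e) * \<bar>t - x\<bar>)" using e by (intro mult_left_mono) auto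
   then show ?thesis using 1 by (simp add: mult.assoc)
  qed simp
  show "\<exists>dd>0. \<forall>u v. u \<le> x \<and> x \<le> v \<and> v - u < dd --> 0 \<le> u --> d (ga u) (ga v) \<le> (1 + e) * (1 + e) * (v - u)"
  proof (intro exI[of _ "min d1 d2"] conjI allI impI)
   fix u v assume uv: "u \<le> x \<and> x \<le> v \<and> v - u < min d1 d2" "0 \<le> u"
   have "d (ga u) (ga v) \<le> d (ga x) (ga u) + d (ga x) (ga v)" using d_triangle[of "ga u" "ga v" "ga x"] d_sym[of "ga u" "ga x"] by simp
   also have "\<dots> \<le> (1 + e) * (1 + e) * \<bar>u - x\<bar> + (1 + e) * (1 + e) * \<bar>v - x\<bar>"
    using near[of u] near[of v] uv by (intro add_mono) auto
   also have "\<dots> = (1 + e) * (1 + e) * (v - u)" using uv by (simp add: algebra_simps)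
   finally show "d (ga u) (ga v) \<le> (1 + e) * (1 + e) * (v - u)" .
  qed (use d1 d2 in simp)
 qed
 then have "q * d (ga a) (ga b) \<le> q * ((1 + e) * (1 + e) * (b - a))" using q assms(2) by (intro mult_left_mono) auto
 also have "\<dots> = ((1 + e) * (1 + e) * q) * (b - a)" by (simp add: algebra_simps)
 also have "\<dots> \<le> 1 * (b - a)" using e(3) assms by (intro mult_right_mono) auto
 finally show "q * d (ga a) (ga b) \<le> b - a" by simp
qed

lemma uray_lipschitz_abs: "uray ga ==> 0 \<le> s ==> 0 \<le> t ==> d (ga s) (ga t) \<le> \<bar>s - t\<bar>"
 using uray_lipschitz[of ga s t] uray_lipschitz[of ga t s] d_sym[of "ga s" "ga t"] by (cases "s \<le> t") auto

text \<open>The rays are 1-Lipschitz, so for a short time around \<open>t0\<close> the approximating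
  rays stay in one compact part of the chart. There unit speed bounds the coordinate velocities and
  \<open>ode_limit\<close> applies; since the velocities converge, unit speed passes to the
  limit.\<close>

lemma uray_limit_local:
 fixes gas :: "nat => real => 'a"
 assumes rays: "!!n. uray (gas n)" and G: "G ~= bot" and lim: "!!t. t \<ge> 0 ==> ((\<lambda>n. gas n t) \<longlongrightarrow> ga t) G"
  and ka: "ka \<in> A" and t0: "t0 \<ge> 0" "ga t0 \<in> fst ka"
 shows "\<exists>z1 h. h > 0 \<and> (\<forall>t\<ge>0. \<bar>t - t0\<bar> < h --> ga t \<in> fst ka \<and>
   (snd ka \<circ> ga has_vector_derivative z1 t) (at t within {0..}) \<and>
   (z1 has_vector_derivative - christoffel (coord_metric A g ka) (snd ka (ga t)) (z1 t) (z1 t)) (at t within {0..}) \<and>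
   coord_metric A g ka (snd ka (ga t)) (z1 t) (z1 t) = 1)"
proof -
 let ?s = "snd ka (ga t0)"
 have s: "?s \<in> chart_image ka" using t0 by blast
 obtain r where r: "r > 0" "ball ?s r \<subseteq> chart_image ka"
  "!!z u. z \<in> ball ?s r ==> (1 - 1/2) * cnorm ka ?s u \<le> cnorm ka z u"
  by (rule asy[OF ka t0(2), of "1/2" UNIV]) auto
 obtain c C where c: "c > 0" "!!u. c * norm u \<le> cnorm ka ?s u" using cnorm_bounds[OF ka s] by metis
 define K where "K = cball ?s (r/2)"
 have K: "compact K" "K \<subseteq> ball ?s r" using r(1) by (auto simp: K_def)
 have KI: "K \<subseteq> chart_image ka" using K r by blast
 have sub: "ball ?s (r/2) \<subseteq> K" "ball ?s (r/2) \<subseteq> chart_image ka" using KI by (auto simp: K_def)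
 have op: "open (chart_inv ka ` ball ?s (r/2))" by (rule chart_inv_image_open[OF ka open_ball sub(2)])
 have in0: "ga t0 \<in> chart_inv ka ` ball ?s (r/2)"
  using chart_inv_eq[OF ka t0(2)] r(1) by (intro image_eqI[of _ _ ?s]) auto
 obtain de where de: "de > 0" "!!q. d (ga t0) q < de ==> q \<in> chart_inv ka ` ball ?s (r/2)"
  using d_near_open[OF op in0] by metis
 have near: "q \<in> fst ka \<and> snd ka q \<in> K" if dq: "d (ga t0) q < de" for q
 proof -
  obtain z where z: "z \<in> ball ?s (r/2)" "q = chart_inv ka z" using de(2)[OF dq] by blast
  have "z \<in> chart_image ka" "z \<in> K" using z(1) sub by auto
  then show ?thesis using z(2) chart_eq[OF ka] chart_inv_in[OF ka] by simp
 qed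
 \<comment> \<open>One quarter of \<open>de\<close> for the distance of an approximating ray from
   the limit at \<open>t0\<close> and one quarter for its motion during time h keep it within
   \<open>de\<close> of \<open>ga t0\<close>.\<close>
 define h where "h = de / 4"
 define a where "a = max 0 (t0 - h)"
 define b where "b = t0 + h"
 have h: "h > 0" using de by (simp add: h_def)
 have ab: "a < b" "0 \<le> a" using h t0 by (auto simp: a_def b_def)
 have J: "\<bar>t - t0\<bar> \<le> h" "t \<ge> 0" if "t \<in> {a..b}" for t using that by (auto simp: a_def b_def)
 have lip: "d (ga s) (ga t) \<le> \<bar>s - t\<bar>" if "s \<ge> 0" "t \<ge> 0" for s t
 proof (rule tendsto_upperbound[OF tendsto_d[OF lim lim] _ G])
  show "\<forall>\<^sub>F n in G. d (gas n s) (gas n t) \<le> \<bar>s - t\<bar>"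
   using uray_lipschitz_abs[OF rays] that by (intro always_eventually) blast
 qed (use that in auto)
 have inK: "ga t \<in> fst ka \<and> snd ka (ga t) \<in> K" if "t \<in> {a..b}" for t
 proof -
  have "d (ga t0) (ga t) \<le> \<bar>t0 - t\<bar>" using lip[of t0 t] t0(1) J(2)[OF that] by simp
  also have "\<dots> < de" using J(1)[OF that] de(1) by (simp add: h_def abs_minus_commute)
  finally show ?thesis by (rule near)
 qed
 have "\<exists>y'. \<forall>t\<ge>0. gas n t \<in> fst ka --> (snd ka \<circ> gas n has_vector_derivative y' t) (at t within {0..}) \<and>
  (y' has_vector_derivative - christoffel (coord_metric A g ka) (snd ka (gas n t)) (y' t) (y' t)) (at t within {0..}) \<and>
  coord_metric A g ka (snd ka (gas n t)) (y' t) (y' t) = 1" for n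
  by (rule uray_chart[OF rays ka]) blast
 then obtain y1 where y1: "!!n t. t \<ge> 0 ==> gas n t \<in> fst ka ==> (snd ka \<circ> gas n has_vector_derivative y1 n t) (at t within {0..}) \<and>
  (y1 n has_vector_derivative - christoffel (coord_metric A g ka) (snd ka (gas n t)) (y1 n t) (y1 n t)) (at t within {0..}) \<and>
  coord_metric A g ka (snd ka (gas n t)) (y1 n t) (y1 n t) = 1" by metis
 have "\<forall>\<^sub>F n in G. d (gas n t0) (ga t0) < de/4"
  using order_tendstoD(2)[OF lim[OF t0(1), THEN tendsto_iff_d[THEN iffD1]], of "de/4"] de(1) by simp
 then have evK: "\<forall>\<^sub>F n in G. \<forall>t\<in>{a..b}. gas n t \<in> fst ka \<and> snd ka (gas n t) \<in> K"
 proof eventually_elim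
  case (elim n)
  show ?case
  proof
   fix t assume t: "t \<in> {a..b}"
   have "d (gas n t0) (gas n t) \<le> de/4" using uray_lipschitz_abs[OF rays, of t0 t n] t0(1) J[OF t] abs_minus_commute[of t0 t] by (auto simp: h_def)
   then show "gas n t \<in> fst ka \<and> snd ka (gas n t) \<in> K"
    using elim d_triangle[of "ga t0" "gas n t" "gas n t0"] d_sym[of "ga t0" "gas n t0"] de(1) by (intro near) auto
  qed
 qed
 let ?Q = "\<lambda>z w. - christoffel (coord_metric A g ka) z w w"
 have "\<exists>z1. \<forall>t\<in>{a..b}. ((\<lambda>n. y1 n t) \<longlongrightarrow> z1 t) G \<and> (snd ka \<circ> ga has_vector_derivative z1 t) (at t within {a..b}) \<and>
  (z1 has_vector_derivative ?Q ((snd ka \<circ> ga) t) (z1 t)) (at t within {a..b})"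
 proof (rule ode_limit[where y = "\<lambda>n. snd ka \<circ> gas n" and ?y1.0 = y1 and Q = ?Q and C = "2 / c" and z = "snd ka \<circ> ga" and K = K and G = G and a = a and b = b])
  show "G ~= bot" "a < b" "compact K" by fact+
  show "\<forall>\<^sub>F n in G. \<forall>t\<in>{a..b}. (snd ka \<circ> gas n has_vector_derivative y1 n t) (at t within {a..b}) \<and>
    (y1 n has_vector_derivative ?Q ((snd ka \<circ> gas n) t) (y1 n t)) (at t within {a..b}) \<and> (snd ka \<circ> gas n) t \<in> K \<and> norm (y1 n t) \<le> 2 / c"
   using evK
  proof eventually_elim
   case (elim n)
   show ?case
   proof
    fix t assume t: "t \<in> {a..b}"
    note k = elim[rule_format, OF t]
    note y = y1[OF J(2)[OF t] conjunct1[OF k]]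
    have "cnorm ka (snd ka (gas n t)) (y1 n t) = 1" using y cnorm_eq_1 by blast
    then have "(1 - 1/2) * cnorm ka ?s (y1 n t) \<le> 1" using r(3)[of "snd ka (gas n t)" "y1 n t"] k K(2) by auto
    then have "c * norm (y1 n t) \<le> 2" using c(2)[of "y1 n t"] by simp
    then have "norm (y1 n t) \<le> 2 / c" using c(1) by (simp add: field_simps)
    moreover have "{a..b} \<subseteq> {0..}" using ab by auto
    ultimately show "(snd ka \<circ> gas n has_vector_derivative y1 n t) (at t within {a..b}) \<and>
     (y1 n has_vector_derivative ?Q ((snd ka \<circ> gas n) t) (y1 n t)) (at t within {a..b}) \<and> (snd ka \<circ> gas n) t \<in> K \<and> norm (y1 n t) \<le> 2 / c"
     using y k by (auto intro: has_vector_derivative_within_subset)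
   qed
  qed
  have "continuous_on (K \<times> UNIV) (\<lambda>p. - (\<lambda>(z, w). christoffel (coord_metric A g ka) z w w) p)"
   by (intro continuous_intros continuous_on_subset[OF christoffel_continuous[OF ka]]) (use KI in auto)
  then show "continuous_on (K \<times> UNIV) (\<lambda>(z, w). ?Q z w)" by (simp add: case_prod_beta')
  show "((\<lambda>n. (snd ka \<circ> gas n) t) \<longlongrightarrow> (snd ka \<circ> ga) t) G" if t: "t \<in> {a..b}" for t
   using isCont_tendsto_compose[OF chart_isCont(1)[OF ka] lim[OF J(2)[OF t]]] inK[OF t] by simp
 qed
 then obtain z1 where z1': "\<forall>t\<in>{a..b}. ((\<lambda>n. y1 n t) \<longlongrightarrow> z1 t) G \<and> (snd ka \<circ> ga has_vector_derivative z1 t) (at t within {a..b}) \<and>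
  (z1 has_vector_derivative ?Q ((snd ka \<circ> ga) t) (z1 t)) (at t within {a..b})" by (rule exE)
 have z1: "((\<lambda>n. y1 n t) \<longlongrightarrow> z1 t) G"
  "(snd ka \<circ> ga has_vector_derivative z1 t) (at t within {a..b})"
  "(z1 has_vector_derivative ?Q (snd ka (ga t)) (z1 t)) (at t within {a..b})" if "t \<in> {a..b}" for t
  using bspec[OF z1' that] by simp_all
 show ?thesis
 proof (intro exI[of _ z1] exI[of _ h] conjI allI impI h)
  fix t assume t: "t \<ge> 0" "\<bar>t - t0\<bar> < h"
  then have tJ: "t \<in> {a..b}" by (auto simp: a_def b_def)
  have at: "at t within {a..b} = at t within {0..}"
   by (rule at_within_nhd[of _ "{t0 - h<..<t0 + h}"]) (use t in \<open>auto simp: a_def b_def\<close>)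
  show "ga t \<in> fst ka" using inK[OF tJ] by blast
  show "(snd ka \<circ> ga has_vector_derivative z1 t) (at t within {0..})" using z1(2)[OF tJ] unfolding at .
  show "(z1 has_vector_derivative ?Q (snd ka (ga t)) (z1 t)) (at t within {0..})" using z1(3)[OF tJ] unfolding at .
  have "((\<lambda>n. (\<lambda>(z, u, v). coord_metric A g ka z u v) (snd ka (gas n t), y1 n t, y1 n t)) \<longlongrightarrow>
    (\<lambda>(z, u, v). coord_metric A g ka z u v) (snd ka (ga t), z1 t, z1 t)) G"
  proof (rule continuous_on_tendsto_compose[OF coord_metric_cont3[OF ka]])
   show "((\<lambda>n. (snd ka (gas n t), y1 n t, y1 n t)) \<longlongrightarrow> (snd ka (ga t), z1 t, z1 t)) G"
    using isCont_tendsto_compose[OF chart_isCont(1)[OF ka] lim[OF t(1)]] inK[OF tJ] z1(1)[OF tJ] by (intro tendsto_intros) auto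
   show "(snd ka (ga t), z1 t, z1 t) \<in> chart_image ka \<times> UNIV" using inK[OF tJ] by blast
   show "\<forall>\<^sub>F n in G. (snd ka (gas n t), y1 n t, y1 n t) \<in> chart_image ka \<times> UNIV"
    using evK by eventually_elim (use tJ in auto)
  qed
  moreover have "\<forall>\<^sub>F n in G. (\<lambda>(z, u, v). coord_metric A g ka z u v) (snd ka (gas n t), y1 n t, y1 n t) = 1"
   using evK by eventually_elim (use tJ t y1 in auto)
  ultimately have "((\<lambda>n. 1) \<longlongrightarrow> (\<lambda>(z, u, v). coord_metric A g ka z u v) (snd ka (ga t), z1 t, z1 t)) G"
   by (rule Lim_transform_eventually)
  from tendsto_unique[OF G this tendsto_const]
  show "coord_metric A g ka (snd ka (ga t)) (z1 t) (z1 t) = 1" by simp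
 qed
qed

lemma uray_limit:
 fixes gas :: "nat => real => 'a"
 assumes rays: "!!n. uray (gas n)" and G: "G ~= bot" and lim: "!!t. t \<ge> 0 ==> ((\<lambda>n. gas n t) \<longlongrightarrow> ga t) G"
 shows "uray ga"
proof -
 have lip: "d (ga s) (ga t) \<le> \<bar>s - t\<bar>" if "s \<ge> 0" "t \<ge> 0" for s t
 proof (rule tendsto_upperbound[OF tendsto_d[OF lim lim] _ G])
  show "\<forall>\<^sub>F n in G. d (gas n s) (gas n t) \<le> \<bar>s - t\<bar>"
   using uray_lipschitz_abs[OF rays] that by (intro always_eventually) blast
 qed (use that in auto)
 have cont: "continuous_on {0..} ga"
  unfolding continuous_on_def
 proof
  fix t :: real assume t: "t \<in> {0..}"
  have "((\<lambda>s. d (ga s) (ga t)) \<longlongrightarrow> 0) (at t within {0..})"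
  proof (rule Lim_null_comparison)
   show "\<forall>\<^sub>F s in at t within {0..}. norm (d (ga s) (ga t)) \<le> \<bar>s - t\<bar>"
    unfolding eventually_at_filter using lip t by (intro always_eventually) (auto simp: d_nonneg)
   have "((\<lambda>s. \<bar>s - t\<bar>) \<longlongrightarrow> \<bar>t - t\<bar>) (at t within {0..})" by (intro tendsto_intros)
   then show "((\<lambda>s. \<bar>s - t\<bar>) \<longlongrightarrow> 0) (at t within {0..})" by simp
  qed
  then show "(ga \<longlongrightarrow> ga t) (at t within {0..})" using tendsto_iff_d by blast
 qed
 \<comment> \<open>\<open>geodesic_on\<close> asks for one velocity function per chart that serves
   all times in that chart. The function given by \<open>vector_derivative\<close> agrees with each
   locally constructed \<open>z1\<close>, so it glues them.\<close>
 have local: "(snd ka \<circ> ga has_vector_derivative vector_derivative (snd ka \<circ> ga) (at t within {0..})) (at t within {0..}) \<and>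
  ((\<lambda>t. vector_derivative (snd ka \<circ> ga) (at t within {0..})) has_vector_derivative
    - christoffel (coord_metric A g ka) (snd ka (ga t)) (vector_derivative (snd ka \<circ> ga) (at t within {0..})) (vector_derivative (snd ka \<circ> ga) (at t within {0..}))) (at t within {0..}) \<and>
  g (ga t) (velocity A {0..} ga t) (velocity A {0..} ga t) = 1"
  if ka: "ka \<in> A" and t: "t \<ge> 0" "ga t \<in> fst ka" for ka t
 proof -
  obtain z1 h where h: "h > 0" and z1: "!!s. s \<ge> 0 ==> \<bar>s - t\<bar> < h ==> ga s \<in> fst ka \<and>
   (snd ka \<circ> ga has_vector_derivative z1 s) (at s within {0..}) \<and>
   (z1 has_vector_derivative - christoffel (coord_metric A g ka) (snd ka (ga s)) (z1 s) (z1 s)) (at s within {0..}) \<and>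
   coord_metric A g ka (snd ka (ga s)) (z1 s) (z1 s) = 1"
   using uray_limit_local[OF rays G lim ka t] by blast
  have vd: "vector_derivative (snd ka \<circ> ga) (at s within {0..}) = z1 s" if "s \<ge> 0" "\<bar>s - t\<bar> < h" for s
   using z1[OF that] vector_derivative_within[OF at_within_atLeast_neq_bot[OF that(1)]] by blast
  note zt = z1[OF t(1), simplified, OF h]
  have "((\<lambda>t. vector_derivative (snd ka \<circ> ga) (at t within {0..})) has_vector_derivative
    - christoffel (coord_metric A g ka) (snd ka (ga t)) (z1 t) (z1 t)) (at t within {0..})"
   unfolding has_vector_derivative_def
  proof (rule has_derivative_transform_within[of z1 _ t "{0..}" h])
   show "(z1 has_derivative (\<lambda>x. x *\<^sub>R - christoffel (coord_metric A g ka) (snd ka (ga t)) (z1 t) (z1 t))) (at t within {0..})"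
    using zt by (simp add: has_vector_derivative_def)
  qed (use h t vd in \<open>auto simp: dist_real_def\<close>)
  moreover have "continuous (at t within {0..}) ga"
   using cont t(1) by (simp add: continuous_on_eq_continuous_within)
  ultimately show ?thesis
   using velocity_coord(3)[of ka ga t "{0..}" "z1 t"] ka t(2) zt t(1) at_within_atLeast_neq_bot[OF t(1)] vd[OF t(1)] h by auto
 qed
 have "geodesic_on A g {0..} ga"
  unfolding geodesic_on_def
 proof (intro conjI cont ballI)
  fix ka assume "ka \<in> A"
  then show "\<exists>y' y''. \<forall>t\<in>{t \<in> {0..}. ga t \<in> fst ka}. (snd ka \<circ> ga has_vector_derivative y' t) (at t within {0..}) \<and>
    (y' has_vector_derivative y'' t) (at t within {0..}) \<and> y'' t + christoffel (coord_metric A g ka) (snd ka (ga t)) (y' t) (y' t) = 0"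
   using local by (intro exI[of _ "\<lambda>t. vector_derivative (snd ka \<circ> ga) (at t within {0..})"]
    exI[of _ "\<lambda>t. - christoffel (coord_metric A g ka) (snd ka (ga t)) (vector_derivative (snd ka \<circ> ga) (at t within {0..})) (vector_derivative (snd ka \<circ> ga) (at t within {0..}))"]) auto
 qed
 then show ?thesis unfolding uray_def using local chart_at by blast
qed

end

section \<open>Short unit speed geodesics minimize, uniformly near a point\<close>

lemma bilinear_basis_bound:
 fixes B :: "'e::euclidean_space => 'e => real"
 assumes "bilinear B" "!!i j. i \<in> Basis ==> j \<in> Basis ==> \<bar>B i j\<bar> \<le> a i j * m"
 shows "\<bar>B u v\<bar> \<le> (\<Sum>i\<in>Basis. \<Sum>j\<in>Basis. a i j) * m * norm u * norm v"
proof -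
 have "\<bar>B u v\<bar> \<le> (\<Sum>i\<in>Basis. \<Sum>j\<in>Basis. (norm u * norm v) * (a i j * m))"
  unfolding bilinear_expand[OF assms(1), of u v]
 proof (intro order_trans[OF sum_abs] sum_mono)
  fix i j :: 'e assume "i \<in> Basis" "j \<in> Basis"
  then show "\<bar>u \<bullet> i * (v \<bullet> j) * B i j\<bar> \<le> norm u * norm v * (a i j * m)"
   unfolding abs_mult using assms(2) by (intro mult_mono Basis_le_norm) auto
 qed
 then show ?thesis by (simp add: sum_distrib_left sum_distrib_right algebra_simps)
qed

text \<open>The space-time calibration \<open>V(t, z) = \<langle>y', z - y\<rangle> - K t |z - y|\<^sup>2\<close> along a unit speed geodesic \<open>y\<close>
 satisfies the Hamilton--Jacobi inequality \<open>V\<^sub>t + V\<^sub>z xs \<le> |xs|\<^sup>2/2 - 1/2\<close>, here with \<open>w = z - y\<close> and \<open>ta = K t\<close>.\<close>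

lemma calibration_inequality:
 fixes Gy Gz :: "'e::euclidean_space => 'e => real"
 assumes bz: "bilinear Gz" "!!u v. Gz u v = Gz v u" and one: "Gy v v = 1"
  and h1: "\<bar>Gz v v - Gy v v - D\<bar> <= C3 * (norm w)\<^sup>2" and h2: "\<bar>Gz v (xs - v) - Gy v (xs - v)\<bar> <= C2 * norm w * norm (xs - v)"
  and c: "c > 0" "c * (norm (xs - v))\<^sup>2 <= Gz (xs - v) (xs - v)"
  and ta: "0 <= ta" "ta <= 1" and K: "K \<ge> C3 / 2 + (C2 + 2)\<^sup>2 / (2 * c)"
 shows "D / 2 + Gy v (xs - v) - K * (norm w)\<^sup>2 - 2 * ta * (w \<bullet> (xs - v)) <= Gz xs xs / 2 - 1 / 2"
proof -
 define et where "et = xs - v"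
 let ?m = "norm w" and ?n = "norm et"
 have "Gz xs xs = Gz (v + et) (v + et)" by (simp add: et_def)
 also have "\<dots> = Gz v v + 2 * Gz v et + Gz et et"
  using bz(2)[of et v] by (simp add: bilinear_ladd[OF bz(1)] bilinear_radd[OF bz(1)])
 finally have e: "Gz xs xs = Gz v v + 2 * Gz v et + Gz et et" .
 have cs: "ta * (w \<bullet> et) \<ge> - (?m * ?n)"
 proof -
  have "\<bar>ta * (w \<bullet> et)\<bar> <= 1 * (?m * ?n)"
   unfolding abs_mult using ta Cauchy_Schwarz_ineq2[of w et] by (intro mult_mono) auto
  then show ?thesis by simp
 qed
 \<comment> \<open>Completing this square fixes the size of K: C2 comes from the change of the
   metric between y and z, and the summand 2 from the gradient of the quadratic penalty.\<close>
 have "0 <= c / 2 * (?n - (C2 + 2) / c * ?m)\<^sup>2" using c by simp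
 also have "\<dots> = c / 2 * ?n\<^sup>2 - (C2 + 2) * ?m * ?n + (C2 + 2)\<^sup>2 / (2 * c) * ?m\<^sup>2"
  using c(1) by (simp add: power2_eq_square field_simps)
 also have "(C2 + 2)\<^sup>2 / (2 * c) * ?m\<^sup>2 <= (K - C3 / 2) * ?m\<^sup>2" using K by (intro mult_right_mono) auto
 finally have q: "0 <= c / 2 * ?n\<^sup>2 - (C2 + 2) * ?m * ?n + (K - C3 / 2) * ?m\<^sup>2" by simp
 have "(Gz v v - 1 - D) \<ge> - (C3 * ?m\<^sup>2)" "Gz v et - Gy v et \<ge> - (C2 * ?m * ?n)" "Gz et et \<ge> c * ?n\<^sup>2"
  using h1 h2 c one by (auto simp: et_def abs_le_iff)
 then show ?thesis using q cs e unfolding et_def[symmetric] by (simp add: algebra_simps)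
qed

context rmanifold
begin

lemma frechet_metric_bilinear:
 assumes "ka \<in> A" "z \<in> chart_image ka"
 shows "bilinear (\<lambda>u v. pd (\<lambda>y. coord_metric A g ka y u v) w z)"
 unfolding bilinear_def
 by (intro conjI allI frechet_derivative_linear_param[OF chart_open(2)[OF assms(1)] assms(2) _ coord_metric_differentiable[OF assms]];
  use coord_metric_bilinear[OF assms(1)] in \<open>simp add: bilinear_def\<close>)

lemma metric_Taylor:
 assumes ka: "ka \<in> A" and K: "compact K" "convex K" "K \<subseteq> chart_image ka"
 obtains T where "T \<ge> 0"
  "!!y z u v. y \<in> K ==> z \<in> K ==> \<bar>coord_metric A g ka z u v - coord_metric A g ka y u v\<bar> <= T * norm (z - y) * norm u * norm v"
  "!!y z u v. y \<in> K ==> z \<in> K ==> \<bar>coord_metric A g ka z u v - coord_metric A g ka y u v -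
    pd (\<lambda>y. coord_metric A g ka y u v) (z - y) y\<bar> <= T * (norm (z - y))\<^sup>2 * norm u * norm v"
proof -
 let ?G = "coord_metric A g ka"
 have "\<exists>C\<ge>0. \<forall>z\<in>K. \<forall>z'\<in>K. \<bar>?G z' i j - ?G z i j\<bar> <= C * norm (z' - z) \<and>
  \<bar>?G z' i j - ?G z i j - pd (\<lambda>y. ?G y i j) (z' - z) z\<bar> <= C * (norm (z' - z))\<^sup>2" for i j
  using coord_metric_smooth[OF ka, of i j] unfolding smooth_on_def by (intro C2_Taylor_bounds[OF _ K]) blast
 then obtain C where C: "!!i j. C i j \<ge> 0" "!!i j z z'. z \<in> K ==> z' \<in> K ==> \<bar>?G z' i j - ?G z i j\<bar> <= C i j * norm (z' - z) \<and>
  \<bar>?G z' i j - ?G z i j - pd (\<lambda>y. ?G y i j) (z' - z) z\<bar> <= C i j * (norm (z' - z))\<^sup>2" by metis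
 have bsub: "bilinear (\<lambda>u v. h u v - h' u v)" if "bilinear h" "bilinear h'" for h h' :: "'e => 'e => real"
  using that unfolding bilinear_def by (auto intro: linear_compose_sub)
 show ?thesis
 proof (rule that[of "\<Sum>i\<in>Basis. \<Sum>j\<in>Basis. C i j"])
  show "0 <= (\<Sum>i\<in>Basis. \<Sum>j\<in>Basis. C i j)" by (intro sum_nonneg C)
  fix y z u v assume yz: "y \<in> K" "z \<in> K"
  note b = coord_metric_bilinear[OF ka subsetD[OF K(3)]]
  show "\<bar>?G z u v - ?G y u v\<bar> <= (\<Sum>i\<in>Basis. \<Sum>j\<in>Basis. C i j) * norm (z - y) * norm u * norm v"
   by (rule bilinear_basis_bound[OF bsub[OF b b]]) (use yz C in auto)
  show "\<bar>?G z u v - ?G y u v - pd (\<lambda>y. ?G y u v) (z - y) y\<bar> <= (\<Sum>i\<in>Basis. \<Sum>j\<in>Basis. C i j) * (norm (z - y))\<^sup>2 * norm u * norm v"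
   by (rule bilinear_basis_bound[OF bsub[OF bsub[OF b b] frechet_metric_bilinear[OF ka subsetD[OF K(3)]]]]) (use yz C in auto)
 qed
qed

text \<open>Hamilton's equation: for the covector of the velocity the Christoffel terms collapse to
  half the derivative of the metric. This keeps the derivative of the calibration free of
  Christoffel symbols.\<close>

lemma momentum_derivative:
 assumes ka: "ka \<in> A" and J: "!!t. t \<in> J ==> y t \<in> chart_image ka" and t: "t \<in> J"
  and y: "(y has_vector_derivative v t) (at t within J)"
  and v: "(v has_vector_derivative - christoffel (coord_metric A g ka) (y t) (v t) (v t)) (at t within J)"
 shows "((\<lambda>t. coord_metric A g ka (y t) (v t) j) has_vector_derivative
  pd (\<lambda>y. coord_metric A g ka y (v t) (v t)) j (y t) / 2) (at t within J)"
proof -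
 let ?G = "coord_metric A g ka"
 let ?a = "- christoffel ?G (y t) (v t) (v t)"
 note yt = J[OF t]
 note b = coord_metric_bilinear[OF ka J]
 have lin: "linear (\<lambda>w. ?G (y s) w j)" if "s \<in> J" for s using b[OF that] by (simp add: bilinear_def)
 have dG: "((\<lambda>s. ?G (y s) i j) has_vector_derivative pd (\<lambda>y. ?G y i j) (v t) (y t)) (at t within J)" for i
 proof -
  have "((\<lambda>y. ?G y i j) has_derivative frechet_derivative (\<lambda>y. ?G y i j) (at (y t))) (at (y t) within y ` J)"
   using coord_metric_differentiable[OF ka yt, of i j] by (simp add: frechet_derivative_works has_derivative_at_withinI)
  from vector_derivative_diff_chain_within[OF y this] show ?thesis by (simp add: comp_def)
 qed
 have dv: "((\<lambda>s. v s \<bullet> i) has_vector_derivative ?a \<bullet> i) (at t within J)" for i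
  by (rule bounded_linear.has_vector_derivative[OF bounded_linear_inner_left v])
 have D: "((\<lambda>s. \<Sum>i\<in>Basis. (v s \<bullet> i) * ?G (y s) i j) has_vector_derivative
   (\<Sum>i\<in>Basis. (v t \<bullet> i) * pd (\<lambda>y. ?G y i j) (v t) (y t) + (?a \<bullet> i) * ?G (y t) i j)) (at t within J)"
  by (intro has_vector_derivative_sum has_vector_derivative_mult dv dG)
 have e1: "(\<Sum>i\<in>Basis. (v t \<bullet> i) * pd (\<lambda>y. ?G y i j) (v t) (y t) + (?a \<bullet> i) * ?G (y t) i j)
   = pd (\<lambda>y. ?G y (v t) j) (v t) (y t) + ?G (y t) ?a j"
 proof -
  have "linear (\<lambda>w. pd (\<lambda>y. ?G y w j) (v t) (y t))"
   using frechet_metric_bilinear[OF ka yt, of "v t"] by (simp add: bilinear_def)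
  from linear_expand[OF this, of "v t"] show ?thesis
   by (simp only: sum.distrib linear_expand[OF lin[OF t], of ?a])
 qed
 have e2: "pd (\<lambda>y. ?G y (v t) j) (v t) (y t) + ?G (y t) ?a j
   = pd (\<lambda>y. ?G y (v t) (v t)) j (y t) / 2"
  by (simp add: bilinear_lneg[OF b[OF t]] coord_christoffel_eq[OF ka yt] field_simps)
 have "((\<lambda>s. \<Sum>i\<in>Basis. (v s \<bullet> i) * ?G (y s) i j) has_vector_derivative
   pd (\<lambda>y. ?G y (v t) (v t)) j (y t) / 2) (at t within J)"
  using D unfolding e1 e2 .
 then show ?thesis
  unfolding has_vector_derivative_def
  by (rule has_derivative_transform[OF t, rotated]) (rule linear_expand[OF lin])
qed

end

context cmanifold
begin

text \<open>If an arc of length s had end points at distance below s, a minimizing path run at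
  constant speed less than 1 would share its ends. The calibration decreases strictly along that
  path although it vanishes at both ends. The path need not be differentiable, so increments are
  added up by bisection. The radii are fixed before the ray is chosen.\<close>

lemma uray_locally_minimizing:
 "\<exists>rh>0. \<exists>r>0. \<forall>ga t s. uray ga \<and> t \<ge> 0 \<and> d p (ga t) < rh \<and> 0 <= s \<and> s <= r --> d (ga t) (ga (t + s)) = s"
proof -
 define ka where "ka = chart_at A p"
 have ka: "ka \<in> A" "p \<in> fst ka" using chart_at unfolding ka_def by auto
 let ?G = "coord_metric A g ka"
 define s0 where "s0 = snd ka p"
 have s0: "s0 \<in> chart_image ka" using ka unfolding s0_def by blast
 obtain r1 where r1: "r1 > 0" "ball s0 r1 \<subseteq> chart_image ka"
  "!!z u. z \<in> ball s0 r1 ==> (1 - 1/2) * cnorm ka s0 u <= cnorm ka z u"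
  unfolding s0_def by (rule asy[OF ka, of "1/2" UNIV]) auto
 obtain c0 where c0: "c0 > 0" "!!u. c0 * norm u <= cnorm ka s0 u" using cnorm_bounds[OF ka(1) s0] by metis
 define c1 where "c1 = c0 / 2"
 have c1: "c1 > 0" "!!z u. z \<in> ball s0 r1 ==> c1 * norm u <= cnorm ka z u"
 proof -
  show "c1 > 0" using c0 by (simp add: c1_def)
  fix z u assume "z \<in> ball s0 r1"
  from r1(3)[OF this, of u] c0(2)[of u] show "c1 * norm u <= cnorm ka z u" by (simp add: c1_def)
 qed
 define K0 where "K0 = cball s0 (r1/2)"
 have K0: "compact K0" "convex K0" "K0 \<subseteq> ball s0 r1" "K0 \<subseteq> chart_image ka"
  using r1 by (auto simp: K0_def intro: subsetD[OF r1(2)])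
 obtain T where T: "T \<ge> 0"
  "!!y z u v. y \<in> K0 ==> z \<in> K0 ==> \<bar>?G z u v - ?G y u v\<bar> <= T * norm (z - y) * norm u * norm v"
  "!!y z u v. y \<in> K0 ==> z \<in> K0 ==> \<bar>?G z u v - ?G y u v - pd (\<lambda>y. ?G y u v) (z - y) y\<bar> <= T * (norm (z - y))\<^sup>2 * norm u * norm v"
  using metric_Taylor[OF ka(1) K0(1,2,4)] by blast
 \<comment> \<open>On \<open>K0\<close> a vector of unit length has coordinate norm at most 1 / c1;
   C2 and C3 are the Taylor constants of the metric with such a velocity inserted once and
   twice.\<close>
 define C2 where "C2 = T * (1 / c1)"
 define C3 where "C3 = T * (1 / c1)\<^sup>2"
 define K where "K = C3 / 2 + (C2 + 2)\<^sup>2 / (2 * c1\<^sup>2)"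
 have Kpos: "K > 0" unfolding K_def C3_def C2_def using T(1) c1(1) by (intro add_nonneg_pos divide_pos_pos zero_less_power) (auto intro: add_nonneg_pos)
 have sub: "ball s0 (r1/2) \<subseteq> K0" "ball s0 (r1/2) \<subseteq> chart_image ka" using K0(4) by (auto simp: K0_def)
 have op: "open (chart_inv ka ` ball s0 (r1/2))" by (rule chart_inv_image_open[OF ka(1) open_ball sub(2)])
 have in0: "p \<in> chart_inv ka ` ball s0 (r1/2)"
  using chart_inv_eq[OF ka] r1(1) by (intro image_eqI[of _ _ s0]) (auto simp: s0_def)
 obtain de where de: "de > 0" "!!q. d p q < de ==> q \<in> chart_inv ka ` ball s0 (r1/2)"
  using d_near_open[OF op in0] by metis
 have near: "q \<in> fst ka \<and> snd ka q \<in> K0" if dq: "d p q < de" for q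
 proof -
  obtain z where z: "z \<in> ball s0 (r1/2)" "q = chart_inv ka z" using de(2)[OF dq] by blast
  have "z \<in> chart_image ka" "z \<in> K0" using z(1) sub by auto
  then show ?thesis using z(2) chart_eq[OF ka(1)] chart_inv_in[OF ka(1)] by simp
 qed
 \<comment> \<open>The first bound keeps both the ray and the competing path in the chart; the
   second makes the coefficient K (t - t0) of the penalty at most 1, as the calibration inequality
   requires.\<close>
 define r where "r = min (de / 4) (1 / K)"
 have r: "r > 0" "r <= de / 4" "r * K <= 1" using de(1) Kpos by (auto simp: r_def min_def field_simps)
 have "d (ga t0) (ga (t0 + s)) = s" if ga: "uray ga" "t0 \<ge> 0" "d p (ga t0) < de / 4" and s: "0 <= s" "s <= r" for ga t0 s
 proof (rule ccontr)
  assume ne: "d (ga t0) (ga (t0 + s)) ~= s"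
  define \<l> where "\<l> = d (ga t0) (ga (t0 + s))"
  have ls: "0 <= \<l>" "\<l> < s" using ne uray_lipschitz[OF ga(1), of t0 "t0 + s"] ga(2) s unfolding \<l>_def by (auto simp: d_nonneg)
  then have spos: "s > 0" by simp
  \<comment> \<open>\<open>be\<close> is the speed of the competitor. The larger number
    \<open>mv\<close>, still below 1, leaves room for the distortion between distance and coordinate
    norm.\<close>
  define be where "be = \<l> / s"
  define mv where "mv = (1 + be) / 2"
  have lam: "0 <= be" "be < 1" "be * s = \<l>" using ls spos by (auto simp: be_def)
  have mu: "0 < mv" "mv < 1" "be < mv" using lam by (auto simp: mv_def)
  obtain si where si: "si 0 = ga t0" "si \<l> = ga (t0 + s)" "!!a b. a \<in> {0..\<l>} ==> b \<in> {0..\<l>} ==> d (si a) (si b) = \<bar>a - b\<bar>"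
   using metric_geodesic_exists[of "ga t0" "ga (t0 + s)"] unfolding \<l>_def by metis
  let ?J = "{t0..t0 + s}"
  define og where "og t = si (be * (t - t0))" for t
  have lt: "be * (t - t0) \<in> {0..\<l>}" if "t \<in> ?J" for t
   using that lam spos mult_left_mono[of "t - t0" s be] by auto
  have dog: "d (og a) (og b) = be * \<bar>a - b\<bar>" if "a \<in> ?J" "b \<in> ?J" for a b
  proof -
   have "d (og a) (og b) = \<bar>be * (a - t0) - be * (b - t0)\<bar>" unfolding og_def by (rule si(3)[OF lt lt]) fact+
   also have "be * (a - t0) - be * (b - t0) = be * (a - b)" by (simp add: algebra_simps)
   finally show ?thesis using lam by (simp add: abs_mult)
  qed
  have ganear: "ga t \<in> fst ka \<and> snd ka (ga t) \<in> K0" if t: "t \<in> ?J" for t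
  proof (rule near)
   have "d (ga t0) (ga t) <= t - t0" using uray_lipschitz[OF ga(1,2), of t] t by simp
   then show "d p (ga t) < de" using d_triangle[of p "ga t" "ga t0"] ga(3) t s r(2) by simp
  qed
  have ognear: "og t \<in> fst ka \<and> snd ka (og t) \<in> K0" if t: "t \<in> ?J" for t
  proof (rule near)
   have "d (og t0) (og t) <= 1 * (t - t0)" unfolding dog[of t0 t, OF _ t, simplified, OF less_imp_le[OF spos]]
    using lam t by (intro mult_mono) auto
   moreover have "og t0 = ga t0" by (simp add: og_def si)
   ultimately show "d p (og t) < de" using d_triangle[of p "og t" "og t0"] ga(3) t s r(2) by simp
  qed
  define y where "y t = snd ka (ga t)" for t
  define z where "z t = snd ka (og t)" for t
  obtain v where v0: "!!t. t \<ge> 0 ==> ga t \<in> fst ka ==> (snd ka \<circ> ga has_vector_derivative v t) (at t within {0..})"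
   "!!t. t \<ge> 0 ==> ga t \<in> fst ka ==> (v has_vector_derivative - christoffel ?G (snd ka (ga t)) (v t) (v t)) (at t within {0..})"
   "!!t. t \<ge> 0 ==> ga t \<in> fst ka ==> ?G (snd ka (ga t)) (v t) (v t) = 1"
   using uray_chart[OF ga(1) ka(1)] by metis
  have Jsub: "?J \<subseteq> {0..}" using ga(2) by auto
  have yeq: "snd ka \<circ> ga = y" by (simp add: fun_eq_iff y_def)
  have v: "(y has_vector_derivative v t) (at t within ?J)" "(v has_vector_derivative - christoffel ?G (y t) (v t) (v t)) (at t within ?J)" "?G (y t) (v t) (v t) = 1"
   if t: "t \<in> ?J" for t
  proof -
   have "t \<ge> 0" "ga t \<in> fst ka" using t ga(2) ganear[OF t] by auto
   from v0(1)[OF this] v0(2)[OF this] v0(3)[OF this]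
   show "(y has_vector_derivative v t) (at t within ?J)" "(v has_vector_derivative - christoffel ?G (y t) (v t) (v t)) (at t within ?J)" "?G (y t) (v t) (v t) = 1"
    unfolding yeq by (auto simp: y_def[symmetric] intro: has_vector_derivative_within_subset[OF _ Jsub])
  qed
  have yK: "y t \<in> K0" and zK: "z t \<in> K0" if "t \<in> ?J" for t using ganear[OF that] ognear[OF that] by (auto simp: y_def z_def)
  have yI: "y t \<in> chart_image ka" if "t \<in> ?J" for t using yK[OF that] K0(4) by blast
  define P where "P t = (\<Sum>j\<in>Basis. ?G (y t) (v t) j *\<^sub>R j)" for t
  define P' where "P' t = (\<Sum>j\<in>Basis. (pd (\<lambda>y. ?G y (v t) (v t)) j (y t) / 2) *\<^sub>R j)" for t
  have P: "P t \<bullet> q = ?G (y t) (v t) q" if "t \<in> ?J" for t q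
  proof -
   have "linear (?G (y t) (v t))" using coord_metric_bilinear[OF ka(1) yI[OF that]] by (simp add: bilinear_def)
   from linear_expand[OF this, of q] show ?thesis unfolding P_def inner_sum_left inner_scaleR_left by (simp add: inner_commute mult.commute)
  qed
  have P': "P' t \<bullet> q = pd (\<lambda>y. ?G y (v t) (v t)) q (y t) / 2" if "t \<in> ?J" for t q
  proof -
   have "linear (frechet_derivative (\<lambda>y. ?G y (v t) (v t)) (at (y t)))"
    by (rule linear_frechet_derivative[OF coord_metric_differentiable[OF ka(1) yI[OF that]]])
   from linear_expand[OF this, of q] show ?thesis
    unfolding P'_def inner_sum_left inner_scaleR_left by (simp add: inner_commute mult.commute sum_divide_distrib)
  qed
  have dP: "(P has_vector_derivative P' t) (at t within ?J)" if t: "t \<in> ?J" for t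
   unfolding P_def P'_def
   by (intro has_vector_derivative_sum bounded_linear.has_vector_derivative[OF bounded_linear_scaleR_left]
    momentum_derivative[OF ka(1) yI t v(1,2)[OF t]]) auto
  define V where "V q = P (fst q) \<bullet> (snd q - y (fst q)) - K * (fst q - t0) * ((snd q - y (fst q)) \<bullet> (snd q - y (fst q)))" for q
  define Lx where "Lx x ta zz = ta * (P' x \<bullet> (z x - y x)) + P x \<bullet> (zz - ta *\<^sub>R v x)
    - K * (ta * ((z x - y x) \<bullet> (z x - y x)) + (x - t0) * (2 * ((z x - y x) \<bullet> (zz - ta *\<^sub>R v x))))" for x ta zz
  have dV: "(V has_derivative (\<lambda>q. Lx x (fst q) (snd q))) (at (x, z x) within ?J \<times> UNIV)" if x: "x \<in> ?J" for x
  proof -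
   have f: "((\<lambda>q::real \<times> 'e. fst q) has_derivative fst) (at (x, z x) within ?J \<times> UNIV)"
    by (rule bounded_linear_imp_has_derivative[OF bounded_linear_fst])
   have im: "fst ` (?J \<times> (UNIV::'e set)) = ?J" by auto
   have dy: "((\<lambda>q. y (fst q)) has_derivative (\<lambda>q. fst q *\<^sub>R v x)) (at (x, z x) within ?J \<times> UNIV)"
    using has_derivative_in_compose[OF f, of y "\<lambda>h. h *\<^sub>R v x"] v(1)[OF x] by (simp add: im has_vector_derivative_def)
   have dP': "((\<lambda>q. P (fst q)) has_derivative (\<lambda>q. fst q *\<^sub>R P' x)) (at (x, z x) within ?J \<times> UNIV)"
    using has_derivative_in_compose[OF f, of P "\<lambda>h. h *\<^sub>R P' x"] dP[OF x] by (simp add: im has_vector_derivative_def)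
   show ?thesis
    unfolding V_def
    by (rule has_derivative_eq_rhs, (rule derivative_intros dy dP' f bounded_linear_imp_has_derivative[OF bounded_linear_snd])+)
     (auto simp: Lx_def fun_eq_iff algebra_simps inner_simps inner_commute)
  qed
  \<comment> \<open>At speed at most mv the calibration changes at a rate of at most (mv^2 - 1) / 2
    = - 2 et; one et is spent on the linearization error of V.\<close>
  define et where "et = (1 - mv\<^sup>2) / 4"
  have eta: "et > 0" using mu by (simp add: et_def power_less_one_iff)
  have key: "Lx x 1 xs <= ?G (z x) xs xs / 2 - 1 / 2" if x: "x \<in> ?J" for x xs
  proof -
   note zk = zK[OF x] and yk = yK[OF x]
   have zI: "z x \<in> chart_image ka" using zk K0(4) by blast
   have vn: "norm (v x) <= 1 / c1"
    using c1(2)[of "y x" "v x"] subsetD[OF K0(3) yk] cnorm_eq_1[OF v(3)[OF x]] c1(1) by (simp add: field_simps)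
   let ?w = "z x - y x"
   have "pd (\<lambda>y. ?G y (v x) (v x)) ?w (y x) / 2 + ?G (y x) (v x) (xs - v x) - K * (norm ?w)\<^sup>2 - 2 * (K * (x - t0)) * (?w \<bullet> (xs - v x))
    <= ?G (z x) xs xs / 2 - 1 / 2"
   proof (rule calibration_inequality[where ?C2.0 = C2 and ?C3.0 = C3 and c = "c1\<^sup>2" and Gy = "?G (y x)" and Gz = "?G (z x)" and v = "v x" and K = K and ta = "K * (x - t0)"])
    show "bilinear (?G (z x))" by (rule coord_metric_bilinear[OF ka(1) zI])
    show "?G (z x) u u' = ?G (z x) u' u" for u u' by (rule coord_metric_sym[OF ka(1) zI])
    show "?G (y x) (v x) (v x) = 1" by (rule v(3)[OF x])
    have "T * (norm ?w)\<^sup>2 * norm (v x) * norm (v x) <= T * (norm ?w)\<^sup>2 * (1 / c1) * (1 / c1)"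
     using T(1) vn c1(1) by (intro mult_mono) auto
    then show "\<bar>?G (z x) (v x) (v x) - ?G (y x) (v x) (v x) - pd (\<lambda>y. ?G y (v x) (v x)) ?w (y x)\<bar> <= C3 * (norm ?w)\<^sup>2"
     using T(3)[OF yk zk, of "v x" "v x"] by (simp add: C3_def power2_eq_square algebra_simps)
    have "T * norm ?w * norm (v x) * norm (xs - v x) <= T * norm ?w * (1 / c1) * norm (xs - v x)"
     using T(1) vn c1(1) by (intro mult_mono) auto
    then show "\<bar>?G (z x) (v x) (xs - v x) - ?G (y x) (v x) (xs - v x)\<bar> <= C2 * norm ?w * norm (xs - v x)"
     using T(2)[OF yk zk, of "v x" "xs - v x"] by (simp add: C2_def algebra_simps)
    have "(c1 * norm (xs - v x))\<^sup>2 <= (cnorm ka (z x) (xs - v x))\<^sup>2"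
     using c1(2)[OF subsetD[OF K0(3) zk], of "xs - v x"] c1(1) by (intro power_mono) auto
    then show "c1\<^sup>2 * (norm (xs - v x))\<^sup>2 <= ?G (z x) (xs - v x) (xs - v x)"
     unfolding cnorm_square[OF ka(1) zI] by (simp add: power_mult_distrib)
    show "0 <= K * (x - t0)" using Kpos x by simp
    have "K * (x - t0) <= K * r" using Kpos x s by (intro mult_left_mono) auto
    then show "K * (x - t0) <= 1" using r(3) by (simp add: mult.commute)
   qed (use c1 in \<open>auto simp: K_def\<close>)
   then show ?thesis
    unfolding Lx_def P'[OF x] P[OF x] by (simp add: power2_norm_eq_inner algebra_simps)
  qed
  have "t0 <= t0 + s" using s by simp
  then have "t0 \<in> ?J --> t0 + s \<in> ?J --> V (t0 + s, z (t0 + s)) - V (t0, z t0) <= - et * (t0 + s - t0)"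
  proof (rule Bolzano[where P = "\<lambda>a b. a \<in> ?J --> b \<in> ?J --> V (b, z b) - V (a, z a) <= - et * (b - a)"])
   show "a \<in> ?J --> c \<in> ?J --> V (c, z c) - V (a, z a) <= - et * (c - a)"
    if "a \<in> ?J --> b \<in> ?J --> V (b, z b) - V (a, z a) <= - et * (b - a)" "b \<in> ?J --> c \<in> ?J --> V (c, z c) - V (b, z b) <= - et * (c - b)" "a <= b" "b <= c" for a b c
    using that by (auto simp: algebra_simps)
   fix x assume "t0 <= x" "x <= t0 + s"
   then have x: "x \<in> ?J" by simp
   have zI: "z x \<in> chart_image ka" using zK[OF x] K0(4) by blast
   \<comment> \<open>Chosen so that mv (1 - e) is the mean of be and mv, hence at least be.\<close>
   define e where "e = (1 - be / mv) / 2"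
   have e: "0 < e" "e < 1" "be <= mv * (1 - e)"
    using mu lam by (auto simp: e_def field_simps)
   obtain r2 de2 where r2: "r2 > 0" "de2 > 0" "ball (z x) r2 \<subseteq> chart_image ka"
    "!!z1 z2. z1 \<in> ball (z x) r2 ==> z2 \<in> ball (z x) r2 ==> (1 - e) * cnorm ka (z x) (z2 - z1) <= d (chart_inv ka z1) (chart_inv ka z2)"
    "!!q. d (og x) q < de2 ==> q \<in> chart_inv ka ` ball (z x) r2"
    unfolding z_def by (rule asy[OF ka(1) conjunct1[OF ognear[OF x]] e(1,2), of UNIV]) auto
   have De: "cnorm ka (z x) (z b - z a) <= mv * \<bar>b - a\<bar>" if ab: "a \<in> ?J" "b \<in> ?J" "\<bar>a - x\<bar> < de2" "\<bar>b - x\<bar> < de2" for a b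
   proof -
    have in2: "z t \<in> ball (z x) r2 \<and> chart_inv ka (z t) = og t" if t: "t \<in> ?J" "\<bar>t - x\<bar> < de2" for t
    proof -
     have "d (og x) (og t) <= 1 * \<bar>x - t\<bar>" unfolding dog[OF x t(1)] using lam by (intro mult_right_mono) auto
     then have "og t \<in> chart_inv ka ` ball (z x) r2" using t(2) by (intro r2(5)) simp
     then obtain w where w: "w \<in> ball (z x) r2" "og t = chart_inv ka w" by blast
     have "z t = w" unfolding z_def w(2) using w(1) r2(3) chart_eq[OF ka(1)] by blast
     then show ?thesis using w by simp
    qed
    have "(1 - e) * cnorm ka (z x) (z b - z a) <= d (og a) (og b)"
     using r2(4)[of "z a" "z b"] in2[OF ab(1,3)] in2[OF ab(2,4)] by simp
    also have "\<dots> = be * \<bar>b - a\<bar>" using dog[OF ab(1,2)] by (simp add: abs_minus_commute)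
    also have "\<dots> <= mv * (1 - e) * \<bar>b - a\<bar>" using e(3) by (intro mult_right_mono) auto
    finally have "(1 - e) * cnorm ka (z x) (z b - z a) <= (1 - e) * (mv * \<bar>b - a\<bar>)" by (simp add: algebra_simps)
    then show ?thesis using e(2) by simp
   qed
   define ep where "ep = et / (1 + 1 / c1)"
   have c1': "1 + 1 / c1 > 0" using c1(1) by (simp add: add_pos_pos)
   then have eps: "ep > 0" "ep * (1 + 1 / c1) = et" using eta by (auto simp: ep_def)
   obtain d1 where d1: "d1 > 0" "!!q. q \<in> ?J \<times> UNIV ==> norm (q - (x, z x)) < d1 ==>
     norm (V q - V (x, z x) - Lx x (fst (q - (x, z x))) (snd (q - (x, z x)))) <= ep * norm (q - (x, z x))"
    using dV[OF x] eps(1) unfolding has_derivative_within_alt by meson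
   define dd where "dd = min de2 (d1 / (1 + 1 / c1))"
   have dd: "dd > 0" "dd <= de2" "dd * (1 + 1 / c1) <= d1"
   proof -
    have "1 + 1 / c1 > 0" using c1(1) by (simp add: add_pos_pos)
    moreover have "dd <= d1 / (1 + 1 / c1)" by (simp add: dd_def)
    ultimately show "dd * (1 + 1 / c1) <= d1" by (simp add: pos_le_divide_eq)
    show "dd > 0" "dd <= de2" using r2(2) d1(1) \<open>1 + 1 / c1 > 0\<close> by (auto simp: dd_def)
   qed
   have err: "norm (V (t, z t) - V (x, z x) - Lx x (t - x) (z t - z x)) <= et * \<bar>t - x\<bar>" if t: "t \<in> ?J" "\<bar>t - x\<bar> < dd" for t
   proof -
    have "c1 * norm (z t - z x) <= cnorm ka (z x) (z t - z x)" using c1(2)[OF subsetD[OF K0(3) zK[OF x]]] .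
    also have "\<dots> <= mv * \<bar>t - x\<bar>" using De[OF x t(1)] t(2) dd(2) r2(2) by simp
    also have "\<dots> <= 1 * \<bar>t - x\<bar>" using mu by (intro mult_right_mono) auto
    finally have "norm (z t - z x) <= 1 / c1 * \<bar>t - x\<bar>" using c1(1) by (simp add: field_simps)
    then have n: "norm ((t, z t) - (x, z x)) <= (1 + 1 / c1) * \<bar>t - x\<bar>"
     using norm_Pair_le[of "t - x" "z t - z x"] by (simp add: algebra_simps)
    also have "\<dots> < (1 + 1 / c1) * dd" using t(2) c1' by (intro mult_strict_left_mono) auto
    finally have "norm ((t, z t) - (x, z x)) < d1" using dd(3) by (simp add: mult.commute)
    from d1(2)[OF _ this] t(1) have "norm (V (t, z t) - V (x, z x) - Lx x (t - x) (z t - z x)) <= ep * norm ((t, z t) - (x, z x))" by simp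
    also have "\<dots> <= ep * ((1 + 1 / c1) * \<bar>t - x\<bar>)" using n eps(1) by (intro mult_left_mono) auto
    finally show ?thesis using eps(2) by (simp add: mult.assoc[symmetric])
   qed
   show "\<exists>dd>0. \<forall>a b. a <= x \<and> x <= b \<and> b - a < dd --> a \<in> ?J --> b \<in> ?J --> V (b, z b) - V (a, z a) <= - et * (b - a)"
   proof (intro exI[of _ dd] conjI allI impI dd)
    fix a b assume ab: "a <= x \<and> x <= b \<and> b - a < dd" "a \<in> ?J" "b \<in> ?J"
    show "V (b, z b) - V (a, z a) <= - et * (b - a)"
    proof (cases "a = b")
     case False
     then have pos: "b - a > 0" using ab by simp
     define xs where "xs = (1 / (b - a)) *\<^sub>R (z b - z a)"
     have xi: "(b - a) *\<^sub>R xs = z b - z a" using pos by (simp add: xs_def)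
     have "cnorm ka (z x) xs = (1 / (b - a)) * cnorm ka (z x) (z b - z a)" unfolding xs_def using pos by (simp add: cnorm_scale[OF ka(1) zI])
     also have "\<dots> <= (1 / (b - a)) * (mv * \<bar>b - a\<bar>)" using De[OF ab(2,3)] ab dd(2) pos by (intro mult_left_mono) auto
     also have "\<dots> = mv" using pos by simp
     finally have "(cnorm ka (z x) xs)\<^sup>2 <= mv\<^sup>2" using cnorm_nonneg[OF ka(1) zI] by (intro power_mono) auto
     then have G: "?G (z x) xs xs <= mv\<^sup>2" unfolding cnorm_square[OF ka(1) zI] .
     have L1: "Lx x (b - x) (z b - z x) - Lx x (a - x) (z a - z x) = Lx x (b - a) (z b - z a)"
      by (simp add: Lx_def algebra_simps inner_simps)
     have L2: "Lx x (b - a) (z b - z a) = (b - a) * Lx x 1 xs"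
      unfolding xi[symmetric] by (simp add: Lx_def algebra_simps inner_simps)
     have "V (b, z b) - V (a, z a) <= Lx x (b - x) (z b - z x) - Lx x (a - x) (z a - z x) + et * \<bar>b - x\<bar> + et * \<bar>a - x\<bar>"
      using err[of b] err[of a] ab by (auto simp: abs_le_iff)
     also have "\<dots> = (b - a) * Lx x 1 xs + et * (b - a)" using ab unfolding L1 L2 by (simp add: algebra_simps)
     also have "\<dots> <= (b - a) * (mv\<^sup>2 / 2 - 1 / 2) + et * (b - a)"
      using key[OF x, of xs] G pos by (intro add_right_mono mult_left_mono) auto
     also have "\<dots> = - et * (b - a)" by (simp add: et_def field_simps)
     finally show ?thesis .
    qed simp
   qed
  qed
  moreover have "V (t0 + s, z (t0 + s)) = 0" "V (t0, z t0) = 0"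
   using lam si by (auto simp: V_def z_def y_def og_def)
  ultimately have "et * s <= 0" using s by simp
  with mult_pos_pos[OF eta spos] show False by linarith
 qed
 then show ?thesis using de(1) r(1) by (intro exI[of _ "de / 4"] exI[of _ r] conjI) auto
qed

lemma cut_locus_iff: "(x, y) \<in> cut_locus A g \<longleftrightarrow> (\<exists>ga t0. uray ga \<and> ga 0 = x \<and> t0 > 0 \<and> ga t0 = y \<and>
   (\<forall>t\<in>{0..t0}. d x (ga t) = t) \<and> (\<forall>t>t0. d x (ga t) < t))"
 unfolding cut_locus_def uray_def by auto

text \<open>Rays starting near p minimize for a time r that exceeds the distance of any two points
  near p, so their cut points come later than that distance.\<close>

lemma near_diagonal_not_cut:
 "\<exists>rh>0. \<forall>x y. d p x < rh \<and> d p y < rh --> (x, y) \<notin> cut_locus A g"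
proof -
 obtain rh r where rh: "rh > 0" "r > 0" "!!ga t s. uray ga ==> t \<ge> 0 ==> d p (ga t) < rh ==> 0 <= s ==> s <= r ==> d (ga t) (ga (t + s)) = s"
  using uray_locally_minimizing[of p] by blast
 show ?thesis
 proof (intro exI[of _ "min rh (r / 2)"] conjI allI impI notI)
  fix x y assume xy: "d p x < min rh (r / 2) \<and> d p y < min rh (r / 2)" "(x, y) \<in> cut_locus A g"
  then obtain ga t0 where ga: "uray ga" "ga 0 = x" "t0 > 0" "ga t0 = y" "!!t. t \<in> {0..t0} ==> d x (ga t) = t" "!!t. t > t0 ==> d x (ga t) < t"
   unfolding cut_locus_iff by blast
  have "t0 < r" using ga(3,4) ga(5)[of t0] d_triangle[of x y p] d_sym[of x p] xy(1) by simp
  then show False using rh(3)[OF ga(1), of 0 r] rh(2) ga(2) ga(6)[of r] xy(1) by simp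
 qed (use rh in simp)
qed

end

section \<open>Functions of class $C^2$\<close>

lemma C_k_on_subset: "C_k_on k F S ==> T \<subseteq> S ==> C_k_on k F T"
 by (induction k arbitrary: F) (auto intro: continuous_on_subset)

lemma C_k_on_has_derivative:
 "C_k_on (Suc k) F S ==> s \<in> S ==> (F has_derivative frechet_derivative F (at s)) (at s)"
 by (simp add: frechet_derivative_works)

lemma C_k_on_frechet: "C_k_on (Suc k) F S ==> C_k_on k (pd F u) S"
 by simp

lemma C_k_on_Suc_imp: "C_k_on (Suc k) F S ==> C_k_on k F S"
proof (induction k arbitrary: F)
 case 0
 then show ?case by (auto intro!: continuous_at_imp_continuous_on differentiable_imp_continuous_within)
next
 case (Suc k)
 then show ?case by simp
qed

lemma C_k_on_le: "C_k_on k F S ==> j <= k ==> C_k_on j F S"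
proof (induction "k - j" arbitrary: j)
 case (Suc n)
 have "n = k - Suc j" "Suc j <= k" using Suc.hyps(2) by auto
 from C_k_on_Suc_imp[OF Suc.hyps(1)[OF this(1) Suc.prems(1) this(2)]] show ?case .
qed simp

lemma C_k_on_continuous: "C_k_on k F S ==> continuous_on S F"
 using C_k_on_le[of k F S 0] by simp

lemma has_derivative_along_line:
 fixes F :: "'s::real_normed_vector => real"
 assumes "(F has_derivative F') (at (z + ta *\<^sub>R u))"
 shows "((\<lambda>t. F (z + t *\<^sub>R u)) has_real_derivative F' u) (at ta)"
proof -
 have "((\<lambda>t. z + t *\<^sub>R u) has_derivative (\<lambda>h. h *\<^sub>R u)) (at ta)" by (auto intro!: derivative_eq_intros)
 from has_derivative_compose[OF this assms]
 have "((\<lambda>t. F (z + t *\<^sub>R u)) has_derivative (\<lambda>h. F' (h *\<^sub>R u))) (at ta)" .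
 moreover have "(\<lambda>h. F' (h *\<^sub>R u)) = (*) (F' u)"
  using linear_scale[OF has_derivative_linear[OF assms]] by (auto simp: fun_eq_iff mult.commute)
 ultimately show ?thesis by (simp add: has_field_derivative_def)
qed

lemma second_derivative_at_min:
 fixes h h' :: "real => real"
 assumes "de > 0" "!!t. \<bar>t\<bar> < de ==> (h has_real_derivative h' t) (at t)" "(h' has_real_derivative a) (at 0)"
  and min: "!!t. \<bar>t\<bar> < de ==> h t \<ge> h 0"
 shows "h' 0 = 0" "a \<ge> 0"
proof -
 show h0: "h' 0 = 0"
  by (rule DERIV_local_min[OF assms(2)[of 0] assms(1)]) (use assms(1) min in auto)
 show "a \<ge> 0"
 proof (rule ccontr)
  assume "\<not> a \<ge> 0"
  then have "a < 0" by simp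
  from DERIV_neg_dec_right[OF assms(3) this] obtain e where e: "e > 0" "!!t. t > 0 ==> t < e ==> h' t < 0" using h0 by auto
  define t where "t = min de e / 2"
  have t: "0 < t" "t < de" "t < e" using assms(1) e(1) by (auto simp: t_def min_def)
  have "\<exists>z>0. z < t \<and> h t - h 0 = (t - 0) * h' z"
   by (rule MVT2[OF t(1)]) (use t assms(2) in auto)
  then obtain z where z: "0 < z" "z < t" "h t - h 0 = t * h' z" by auto
  then have "h t - h 0 < 0" using e(2)[of z] t by (simp add: mult_pos_neg)
  then show False using min[of t] t by simp
 qed
qed

text \<open>The quotient is symmetric in u and v, so both orders of differentiation are limits of
  the same expression, as \<open>frechet_derivative_commute\<close> exploits. The mean value theorem
  is applied to the increment in direction v as a function of the step along u.\<close>

lemma second_difference_quotient: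
 fixes F :: "'s::real_normed_vector => real"
 assumes S: "open S" "z \<in> S" and F: "!!s. s \<in> S ==> (F has_derivative F' s) (at s)"
  and F'': "((\<lambda>s. F' s u) has_derivative L) (at z)"
 shows "((\<lambda>h. (F (z + h *\<^sub>R u + h *\<^sub>R v) - F (z + h *\<^sub>R u) - F (z + h *\<^sub>R v) + F z) / h\<^sup>2) \<longlongrightarrow> L v) (at_right 0)"
proof (rule tendstoI)
 fix e :: real assume e: "e > 0"
 obtain r where r: "r > 0" "ball z r \<subseteq> S" using S openE by blast
 define N where "N = 2 * (norm u + norm v) + 1"
 have N: "N > 0" by (simp add: N_def add_nonneg_pos)
 define e' where "e' = e / (2 * N)"
 have e': "e' > 0" using e N by (simp add: e'_def)
 obtain d where d: "d > 0" "!!y. norm (y - z) < d ==> norm (F' y u - F' z u - L (y - z)) <= e' * norm (y - z)"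
  using F'' e' unfolding has_derivative_at_alt by blast
 have bl: "linear L" using has_derivative_linear[OF F''] .
 define h0 where "h0 = min r d / N"
 have h0: "h0 > 0" using r d N by (simp add: h0_def)
 have main: "dist ((F (z + h *\<^sub>R u + h *\<^sub>R v) - F (z + h *\<^sub>R u) - F (z + h *\<^sub>R v) + F z) / h\<^sup>2) (L v) < e"
  if h: "0 < h" "h < h0" for h
 proof -
  have hN: "h * N < min r d" using h N by (simp add: h0_def field_simps)
  have nb: "norm (a *\<^sub>R u + b *\<^sub>R v) <= h * (norm u + norm v)" if "0 <= a" "a <= h" "0 <= b" "b <= h" for a b
  proof -
   have "norm (a *\<^sub>R u + b *\<^sub>R v) <= norm (a *\<^sub>R u) + norm (b *\<^sub>R v)" by (rule norm_triangle_ineq)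
   also have "\<dots> <= h * norm u + h * norm v" using that by (simp add: add_mono mult_right_mono)
   finally show ?thesis by (simp add: algebra_simps)
  qed
  have lt: "h * (norm u + norm v) < min r d"
  proof -
   have "h * (norm u + norm v) <= h * N" using h by (intro mult_left_mono) (auto simp: N_def)
   then show ?thesis using hN by simp
  qed
  define ph where "ph t = F (z + h *\<^sub>R v + t *\<^sub>R u) - F (z + t *\<^sub>R u)" for t
  have dph: "(ph has_real_derivative (F' (z + h *\<^sub>R v + t *\<^sub>R u) u - F' (z + t *\<^sub>R u) u)) (at t)" if t: "0 <= t" "t <= h" for t
  proof -
   have inS: "z + x \<in> S" if "norm x <= h * (norm u + norm v)" for x
    by (rule subsetD[OF r(2)]) (use that lt in \<open>simp add: dist_norm\<close>)
   have "z + (t *\<^sub>R u + h *\<^sub>R v) \<in> S" "z + (t *\<^sub>R u + 0 *\<^sub>R v) \<in> S"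
    using inS[OF nb[of t h]] inS[OF nb[of t 0]] t h by auto
   then have "(F has_derivative F' (z + h *\<^sub>R v + t *\<^sub>R u)) (at (z + h *\<^sub>R v + t *\<^sub>R u))" "(F has_derivative F' (z + t *\<^sub>R u)) (at (z + t *\<^sub>R u))"
    using F by (simp_all add: add_ac)
   from this[THEN has_derivative_along_line] show ?thesis unfolding ph_def by (intro DERIV_diff)
  qed
  have "\<exists>t>0. t < h \<and> ph h - ph 0 = (h - 0) * (F' (z + h *\<^sub>R v + t *\<^sub>R u) u - F' (z + t *\<^sub>R u) u)"
   by (rule MVT2[OF h(1)]) (use dph in auto)
  then obtain t where t: "0 < t" "t < h" "ph h - ph 0 = h * (F' (z + h *\<^sub>R v + t *\<^sub>R u) u - F' (z + t *\<^sub>R u) u)" by auto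
  let ?p = "h *\<^sub>R v + t *\<^sub>R u" and ?q = "t *\<^sub>R u"
  have np: "norm ?p <= h * (norm u + norm v)" "norm ?q <= h * (norm u + norm v)"
   using nb[of t h] nb[of t 0] t h by (simp_all add: add.commute)
  have 1: "norm (F' (z + ?p) u - F' z u - L ?p) <= e' * norm ?p" "norm (F' (z + ?q) u - F' z u - L ?q) <= e' * norm ?q"
   using d(2)[of "z + ?p"] d(2)[of "z + ?q"] np lt by auto
  have 2: "L ?p - L ?q = h * L v" by (simp add: linear_add[OF bl] linear_scale[OF bl])
  have "\<bar>(F' (z + ?p) u - F' (z + ?q) u) - h * L v\<bar> <= e' * norm ?p + e' * norm ?q"
   using 1 2 by (simp add: abs_le_iff)
  also have "\<dots> <= e' * (h * (norm u + norm v)) + e' * (h * (norm u + norm v))" using np e' by (intro add_mono mult_left_mono) auto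
  also have "\<dots> = h * (e' * (2 * (norm u + norm v)))" by (simp add: algebra_simps)
  also have "\<dots> <= h * (e' * N)" using h e' by (intro mult_left_mono) (auto simp: N_def)
  also have "\<dots> = h * (e / 2)" using N by (simp add: e'_def)
  finally have 3: "\<bar>(F' (z + ?p) u - F' (z + ?q) u) - h * L v\<bar> <= h * (e / 2)" .
  have eq: "(F (z + h *\<^sub>R u + h *\<^sub>R v) - F (z + h *\<^sub>R u) - F (z + h *\<^sub>R v) + F z) / h\<^sup>2 - L v = ((F' (z + ?p) u - F' (z + ?q) u) - h * L v) / h"
  proof -
   have "F (z + h *\<^sub>R u + h *\<^sub>R v) - F (z + h *\<^sub>R u) - F (z + h *\<^sub>R v) + F z = ph h - ph 0" by (simp add: ph_def add_ac)
   also have "\<dots> = h * (F' (z + ?p) u - F' (z + ?q) u)" using t(3) by (simp add: add_ac)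
   finally have X: "F (z + h *\<^sub>R u + h *\<^sub>R v) - F (z + h *\<^sub>R u) - F (z + h *\<^sub>R v) + F z = h * (F' (z + ?p) u - F' (z + ?q) u)" .
   have "h * W / h\<^sup>2 - l = (W - h * l) / h" for W l :: real using h(1) by (simp add: power2_eq_square field_simps)
   then show ?thesis unfolding X .
  qed
  have "\<bar>((F' (z + ?p) u - F' (z + ?q) u) - h * L v) / h\<bar> <= e / 2" using 3 h(1) by (simp add: abs_divide field_simps)
  then show ?thesis unfolding dist_real_def eq by (rule le_less_trans) (use e in simp)
 qed
 show "\<forall>\<^sub>F h in at_right 0. dist ((F (z + h *\<^sub>R u + h *\<^sub>R v) - F (z + h *\<^sub>R u) - F (z + h *\<^sub>R v) + F z) / h\<^sup>2) (L v) < e"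
  using eventually_at_right_less[of 0] eventually_at_right_real[OF h0] by eventually_elim (use main in auto)
qed

lemma frechet_derivative_commute:
 fixes F :: "'s::euclidean_space => real"
 assumes F: "C_k_on 2 F S" and S: "open S" "z \<in> S"
 shows "pd (pd F u) v z = pd (pd F v) u z"
proof -
 have F': "(F has_derivative frechet_derivative F (at s)) (at s)" if "s \<in> S" for s
  using F that by (simp add: numeral_2_eq_2 frechet_derivative_works)
 have F'': "(pd F u has_derivative frechet_derivative (pd F u) (at z)) (at z)" for u
  using F S by (simp add: numeral_2_eq_2 frechet_derivative_works)
 note l = second_difference_quotient[OF S F' F'']
 have "((\<lambda>h. (F (z + h *\<^sub>R u + h *\<^sub>R v) - F (z + h *\<^sub>R u) - F (z + h *\<^sub>R v) + F z) / h\<^sup>2)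
   \<longlongrightarrow> pd (pd F v) u z) (at_right 0)"
  using l[of v u] by (simp add: algebra_simps)
 from tendsto_unique[OF _ l[of u v] this] show ?thesis by simp
qed

lemma frechet_second_bilinear:
 fixes F :: "'s::euclidean_space => real"
 assumes F: "C_k_on 2 F S" and S: "open S" "z \<in> S"
 shows "bilinear (\<lambda>u v. pd (pd F u) v z)"
proof -
 have F': "F differentiable (at s)" if "s \<in> S" for s using F that by (simp add: numeral_2_eq_2)
 have F'': "(pd F u) differentiable (at z)" for u
  using F S by (simp add: numeral_2_eq_2)
 show ?thesis unfolding bilinear_def
  by (intro conjI allI linear_frechet_derivative F'' frechet_derivative_linear_param[OF S linear_frechet_derivative[OF F']])
qed

text \<open>This reads the derivative of the distance off that of the cost. Instead of inverting f,
  its Caratheodory slope at \<open>U z0\<close> is divided out; composed with U, the slope tends to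
  \<open>f'\<close>, which is nonzero.\<close>

lemma differentiable_of_comp:
 fixes U :: "'s::real_normed_vector => real"
 assumes fU: "((\<lambda>z. f (U z)) has_derivative D) (at z0)" and f: "(f has_real_derivative f') (at (U z0))" "f' ~= 0"
  and U: "isCont U z0"
 shows "(U has_derivative (\<lambda>h. D h / f')) (at z0)"
proof -
 obtain ph where ph: "!!b. f b - f (U z0) = ph b * (b - U z0)" "isCont ph (U z0)" "ph (U z0) = f'"
  using f(1) unfolding DERIV_caratheodory_within[of f f' "U z0" UNIV] by auto
 have lph: "((\<lambda>z. ph (U z)) \<longlongrightarrow> f') (at z0)"
  using isCont_o2[OF U ph(2)] ph(3) by (simp add: isCont_def)
 have bl: "bounded_linear D" using fU has_derivative_bounded_linear by blast
 obtain K where K: "!!h. norm (D h) <= norm h * K" "K > 0" using bounded_linear.pos_bounded[OF bl] by blast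
 have "((\<lambda>z. norm (U z - U z0 - D (z - z0) / f') / norm (z - z0)) \<longlongrightarrow> 0) (at z0)"
 proof (rule Lim_null_comparison)
  have 1: "((\<lambda>z. norm (f (U z) - f (U z0) - D (z - z0)) / norm (z - z0)) \<longlongrightarrow> 0) (at z0)"
   using fU by (simp add: has_derivative_iff_norm)
  have "((\<lambda>z. norm (f (U z) - f (U z0) - D (z - z0)) / norm (z - z0) * inverse \<bar>ph (U z)\<bar> + K * \<bar>inverse (ph (U z)) - inverse f'\<bar>)
    \<longlongrightarrow> 0 * inverse \<bar>f'\<bar> + K * \<bar>inverse f' - inverse f'\<bar>) (at z0)"
   by (intro tendsto_intros 1 lph) (use f(2) in auto)
  then show "((\<lambda>z. norm (f (U z) - f (U z0) - D (z - z0)) / norm (z - z0) * inverse \<bar>ph (U z)\<bar> + K * \<bar>inverse (ph (U z)) - inverse f'\<bar>) \<longlongrightarrow> 0) (at z0)"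
   by simp
  have "\<forall>\<^sub>F z in at z0. ph (U z) ~= 0" using tendsto_imp_eventually_ne[OF lph f(2)] .
  moreover have "\<forall>\<^sub>F z in at z0. z ~= z0" by (simp add: eventually_at_filter)
  ultimately show "\<forall>\<^sub>F z in at z0. norm (norm (U z - U z0 - D (z - z0) / f') / norm (z - z0)) <=
    norm (f (U z) - f (U z0) - D (z - z0)) / norm (z - z0) * inverse \<bar>ph (U z)\<bar> + K * \<bar>inverse (ph (U z)) - inverse f'\<bar>"
  proof eventually_elim
   fix z assume nz: "ph (U z) ~= 0" and z: "z ~= z0"
   have "U z - U z0 = (f (U z) - f (U z0)) * inverse (ph (U z))" using ph(1)[of "U z"] nz by (simp add: field_simps)
   then have "U z - U z0 - D (z - z0) / f' = (f (U z) - f (U z0) - D (z - z0)) * inverse (ph (U z)) + D (z - z0) * (inverse (ph (U z)) - inverse f')"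
    by (simp add: algebra_simps divide_inverse)
   also have "\<bar>\<dots>\<bar> <= \<bar>f (U z) - f (U z0) - D (z - z0)\<bar> * inverse \<bar>ph (U z)\<bar> + (norm (z - z0) * K) * \<bar>inverse (ph (U z)) - inverse f'\<bar>"
    using K(1)[of "z - z0"] by (intro order_trans[OF abs_triangle_ineq] add_mono) (auto simp: abs_mult abs_inverse intro: mult_right_mono)
   finally have "\<bar>U z - U z0 - D (z - z0) / f'\<bar> / norm (z - z0) <=
     (\<bar>f (U z) - f (U z0) - D (z - z0)\<bar> * inverse \<bar>ph (U z)\<bar> + (norm (z - z0) * K) * \<bar>inverse (ph (U z)) - inverse f'\<bar>) / norm (z - z0)"
    by (intro divide_right_mono) auto
   also have "\<dots> = norm (f (U z) - f (U z0) - D (z - z0)) / norm (z - z0) * inverse \<bar>ph (U z)\<bar> + K * \<bar>inverse (ph (U z)) - inverse f'\<bar>"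
    using z by (simp add: add_divide_distrib)
   finally show "norm (norm (U z - U z0 - D (z - z0) / f') / norm (z - z0)) <=
    norm (f (U z) - f (U z0) - D (z - z0)) / norm (z - z0) * inverse \<bar>ph (U z)\<bar> + K * \<bar>inverse (ph (U z)) - inverse f'\<bar>" by simp
  qed
 qed
 moreover have "bounded_linear (\<lambda>h. D h / f')" using bl by (rule bounded_linear_divide[THEN bounded_linear_compose])
 ultimately show ?thesis by (simp add: has_derivative_iff_norm)
qed

lemma partial_has_derivative:
 fixes C :: "'e::euclidean_space \<times> 'f::euclidean_space => real"
 assumes "(C has_derivative D) (at (s, t))"
 shows "((\<lambda>t. C (s, t)) has_derivative (\<lambda>h. D (0, h))) (at t)"
  and "((\<lambda>s. C (s, t)) has_derivative (\<lambda>h. D (h, 0))) (at s)"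
proof -
 have 1: "((\<lambda>t. (s, t)) has_derivative (\<lambda>h. (0, h))) (at t)" "((\<lambda>s. (s, t)) has_derivative (\<lambda>h. (h, 0))) (at s)"
  by (auto intro!: derivative_eq_intros)
 show "((\<lambda>t. C (s, t)) has_derivative (\<lambda>h. D (0, h))) (at t)"
  "((\<lambda>s. C (s, t)) has_derivative (\<lambda>h. D (h, 0))) (at s)"
  using has_derivative_compose[OF 1(1) assms] has_derivative_compose[OF 1(2) assms] by auto
qed

text \<open>The iterated partial derivative of the definition becomes a second total derivative, for
  which symmetry and bilinearity are available.\<close>

lemma mixed_deriv_eq:
 fixes C :: "'e::euclidean_space \<times> 'e => real"
 assumes C: "C_k_on 2 C S" and S: "open S" "z \<in> S"
 shows "mixed_deriv C z p pb = pd (pd C (0, pb)) (p, 0) z"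
proof -
 obtain s0 t0 where z: "z = (s0, t0)" by fastforce
 have D: "(C has_derivative frechet_derivative C (at z)) (at z)" if "z \<in> S" for z
  using C that by (simp add: numeral_2_eq_2 frechet_derivative_works)
 have D2: "(pd C (0, pb) has_derivative frechet_derivative (pd C (0, pb)) (at z)) (at z)"
  using C S by (simp add: numeral_2_eq_2 frechet_derivative_works)
 define O1 where "O1 = (\<lambda>s. (s, t0)) -` S"
 have O1: "open O1" "s0 \<in> O1" unfolding O1_def
  using S z by (auto intro!: open_vimage continuous_intros)
 have in1: "pd (\<lambda>t. C (s, t)) pb t0 = pd C (0, pb) (s, t0)" if "s \<in> O1" for s
  using frechet_derivative_at[OF partial_has_derivative(1)[OF D[of "(s, t0)"]]] that by (simp add: O1_def) metis
 have "((\<lambda>s. pd C (0, pb) (s, t0)) has_derivative (\<lambda>h. pd (pd C (0, pb)) (h, 0) z)) (at s0)"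
  using partial_has_derivative(2)[of "\<lambda>z. pd C (0, pb) z" _ s0 t0] D2 z by simp
 then have "((\<lambda>s. pd (\<lambda>t. C (s, t)) pb t0) has_derivative (\<lambda>h. pd (pd C (0, pb)) (h, 0) z)) (at s0)"
  by (rule has_derivative_transform_within_open[OF _ O1]) (simp add: in1)
 from frechet_derivative_at[OF this] show ?thesis unfolding mixed_deriv_def z by (metis fst_conv snd_conv)
qed

text \<open>If the covectors agree, the mean value theorem makes the mixed form vanish on the
  difference w against each basis vector, at intermediate points that vary with that vector.
  Comparing with the form at the centre gives |w| \<le> |w| / 2; the constant \<open>et\<close> is
  chosen for this factor.\<close>

lemma twist_injective:
 fixes C :: "'e::euclidean_space \<times> 'e => real"
 assumes C: "C_k_on 2 C S" and S: "open S" "(s0, t0) \<in> S"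
  and nd: "!!u. (!!v. mixed_deriv C (s0, t0) u v = 0) ==> u = 0"
 shows "\<exists>r>0. ball s0 r \<times> ball t0 r \<subseteq> S \<and> (\<forall>s\<in>ball s0 r. \<forall>s'\<in>ball s0 r. \<forall>t\<in>ball t0 r.
   (\<forall>v. pd C (0, v) (s, t) = pd C (0, v) (s', t)) --> s = s') \<and>
   (\<forall>s\<in>ball s0 r. \<forall>t\<in>ball t0 r. \<forall>u. (\<forall>v. mixed_deriv C (s, t) u v = 0) --> u = 0)"
proof -
 have C1: "!!z. z \<in> S ==> (pd C w has_derivative frechet_derivative (pd C w) (at z)) (at z)"
  and C2: "!!u. continuous_on S (pd (pd C w) u)" for w
 proof -
  have C': "C_k_on (Suc (Suc 0)) C S" using C by (simp only: numeral_2_eq_2)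
  show "!!z. z \<in> S ==> (pd C w has_derivative frechet_derivative (pd C w) (at z)) (at z)"
   by (rule C_k_on_has_derivative[OF C_k_on_frechet[OF C']])
  show "!!u. continuous_on S (pd (pd C w) u)"
   by (rule C_k_on_continuous[OF C_k_on_frechet[OF C_k_on_frechet[OF C']]])
 qed
 define B where "B z u v = pd (pd C (0, v)) (u, 0) z" for z and u v :: 'e
 have BM: "mixed_deriv C z u v = B z u v" if "z \<in> S" for z u v unfolding B_def by (rule mixed_deriv_eq[OF C S(1) that])
 have bil: "bilinear (B z)" if z: "z \<in> S" for z
 proof -
  note b = frechet_second_bilinear[OF C S(1) z]
  show ?thesis unfolding B_def bilinear_def
  proof (intro conjI allI linearI)
   fix x a b :: 'e and r :: real
   show "pd (pd C (0, a + b)) (x, 0) z = pd (pd C (0, a)) (x, 0) z + pd (pd C (0, b)) (x, 0) z"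
    using bilinear_ladd[OF b, of "(0, a)" "(0, b)" "(x, 0)"] by simp
   show "pd (pd C (0, r *\<^sub>R a)) (x, 0) z = r *\<^sub>R pd (pd C (0, a)) (x, 0) z"
    using bilinear_lmul[OF b, of r "(0, a)" "(x, 0)"] by simp
   show "pd (pd C (0, x)) (a + b, 0) z = pd (pd C (0, x)) (a, 0) z + pd (pd C (0, x)) (b, 0) z"
    using bilinear_radd[OF b, of "(0, x)" "(a, 0)" "(b, 0)"] by simp
   show "pd (pd C (0, x)) (r *\<^sub>R a, 0) z = r *\<^sub>R pd (pd C (0, x)) (a, 0) z"
    using bilinear_rmul[OF b, of "(0, x)" r "(a, 0)"] by simp
  qed
 qed
 have evS: "\<forall>\<^sub>F z in nhds (s0, t0). z \<in> S" using S eventually_nhds by blast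
 have Bt: "((\<lambda>z. B z u v) \<longlongrightarrow> B (s0, t0) u v) (nhds (s0, t0))" for u v
 proof -
  have "isCont (\<lambda>z. B z u v) (s0, t0)" unfolding B_def using C2 S by (simp add: continuous_on_eq_continuous_at)
  then show ?thesis using tendsto_at_iff_tendsto_nhds[of "\<lambda>z. B z u v" "(s0, t0)"] by (simp add: isCont_def)
 qed
 have nd0: "u = 0" if "!!v. B (s0, t0) u v = 0" for u using nd[of u] that BM[OF S(2)] by simp
 obtain K where K: "K > 0" "\<forall>\<^sub>F z in nhds (s0, t0). \<forall>w. norm w <= K * (\<Sum>i\<in>Basis. \<bar>B z w i\<bar>)"
  using form_lower_bound[of B "(s0, t0)", OF _ Bt nd0] evS bil by (metis (mono_tags, lifting) eventually_mono)
 define N where "N = real DIM('e)"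
 have N: "N > 0" by (simp add: N_def)
 define et where "et = 1 / (2 * K * N * N)"
 have et: "et > 0" using K N by (simp add: et_def)
 have "\<forall>\<^sub>F z in nhds (s0, t0). \<forall>i\<in>Basis. \<forall>j\<in>Basis. \<bar>B z i j - B (s0, t0) i j\<bar> < et"
 proof (intro eventually_ball_finite ballI finite_Basis)
  fix i j :: 'e
  show "\<forall>\<^sub>F z in nhds (s0, t0). \<bar>B z i j - B (s0, t0) i j\<bar> < et" using tendstoD[OF Bt et, of i j] by (simp add: dist_real_def)
 qed
 from eventually_conj[OF evS eventually_conj[OF K(2) this]]
 obtain ep where ep: "ep > 0" "!!z. dist z (s0, t0) < ep ==> z \<in> S \<and> (\<forall>w. norm w <= K * (\<Sum>i\<in>Basis. \<bar>B z w i\<bar>)) \<and> (\<forall>i\<in>Basis. \<forall>j\<in>Basis. \<bar>B z i j - B (s0, t0) i j\<bar> < et)"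
  unfolding eventually_nhds_metric by blast
 define r where "r = ep / 2"
 have r: "r > 0" using ep by (simp add: r_def)
 have near: "dist (s, t) (s0, t0) < ep" if "s \<in> ball s0 r" "t \<in> ball t0 r" for s t
 proof -
  have "dist (s, t) (s0, t0) <= dist s s0 + dist t t0" unfolding dist_Pair_Pair by (rule sqrt_sum_squares_le_sum) auto
  then show ?thesis using that by (auto simp: r_def dist_commute)
 qed
 have inj: "s = s'" if s: "s \<in> ball s0 r" "s' \<in> ball s0 r" "t \<in> ball t0 r"
  and eq: "!!v. pd C (0, v) (s, t) = pd C (0, v) (s', t)" for s s' t
 proof -
  define w where "w = s' - s"
  have seg: "s + ta *\<^sub>R w \<in> ball s0 r" if "0 <= ta" "ta <= 1" for ta
   using convexD_alt[OF convex_ball s(1,2), of ta] that by (simp add: w_def algebra_simps)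
  have Bj: "\<bar>B (s0, t0) w j\<bar> <= N * (norm w * et)" if j: "j \<in> Basis" for j
  proof -
   define ph where "ph ta = pd C (0, j) ((s, t) + ta *\<^sub>R (w, 0))" for ta
   have "(ph has_real_derivative B (s + ta *\<^sub>R w, t) w j) (at ta)" if ta: "0 <= ta" "ta <= 1" for ta
   proof -
    have eqp: "(s, t) + ta *\<^sub>R (w, 0) = (s + ta *\<^sub>R w, t)" by simp
    have "(s, t) + ta *\<^sub>R (w, 0) \<in> S" unfolding eqp using ep(2)[OF near[OF seg[OF ta] s(3)]] by blast
    from has_derivative_along_line[OF C1[OF this, of "(0, j)"]] show ?thesis unfolding ph_def B_def eqp .
   qed
   then have "\<exists>ta>0. ta < 1 \<and> ph 1 - ph 0 = (1 - 0) * B (s + ta *\<^sub>R w, t) w j"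
    by (intro MVT2) auto
   then obtain ta where ta: "0 < ta" "ta < 1" "ph 1 - ph 0 = B (s + ta *\<^sub>R w, t) w j" by auto
   have "ph 1 - ph 0 = 0" using eq[of j] by (simp add: ph_def w_def)
   then have B0: "B (s + ta *\<^sub>R w, t) w j = 0" using ta by simp
   note z = ep(2)[OF near[OF seg s(3)], of ta]
   have zS: "(s + ta *\<^sub>R w, t) \<in> S" using z ta by auto
   have e: "h w j = (\<Sum>i\<in>Basis. (w \<bullet> i) * h i j)" if "bilinear h" for h :: "'e => 'e => real"
    by (rule linear_expand) (use that in \<open>simp add: bilinear_def\<close>)
   have "B (s0, t0) w j = - (\<Sum>i\<in>Basis. (w \<bullet> i) * (B (s + ta *\<^sub>R w, t) i j - B (s0, t0) i j))"
    using B0 e[OF bil[OF S(2)]] e[OF bil[OF zS]] by (simp add: sum_subtractf right_diff_distrib)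
   also have "\<bar>\<dots>\<bar> <= (\<Sum>i\<in>(Basis::'e set). norm w * et)"
    unfolding abs_minus_cancel
   proof (intro order_trans[OF sum_abs] sum_mono)
    fix i :: 'e assume i: "i \<in> Basis"
    show "\<bar>(w \<bullet> i) * (B (s + ta *\<^sub>R w, t) i j - B (s0, t0) i j)\<bar> <= norm w * et"
     unfolding abs_mult using z ta i j by (intro mult_mono Basis_le_norm) (auto intro: less_imp_le)
   qed
   also have "\<dots> = N * (norm w * et)" by (simp add: N_def)
   finally show ?thesis .
  qed
  have "norm w <= K * (\<Sum>i\<in>Basis. \<bar>B (s0, t0) w i\<bar>)" using ep(2)[of "(s0, t0)"] ep(1) by simp
  also have "\<dots> <= K * (\<Sum>i\<in>(Basis::'e set). N * (norm w * et))" using Bj K(1) by (intro mult_left_mono sum_mono) auto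
  also have "\<dots> = (K * N * N * et) * norm w" by (simp add: N_def algebra_simps)
  also have "K * N * N * et = 1 / 2" using K N by (simp add: et_def)
  finally have "w = 0" by simp
  then show ?thesis by (simp add: w_def)
 qed
 show ?thesis
 proof (intro exI[of _ r] conjI r ballI impI allI)
  show "ball s0 r \<times> ball t0 r \<subseteq> S" using ep(2) near by blast
  show "s = s'" if "s \<in> ball s0 r" "s' \<in> ball s0 r" "t \<in> ball t0 r" "\<forall>v. pd C (0, v) (s, t) = pd C (0, v) (s', t)" for s s' t
   using inj[OF that(1-3)] that(4) by blast
  show "u = 0" if "s \<in> ball s0 r" "t \<in> ball t0 r" "\<forall>v. mixed_deriv C (s, t) u v = 0" for s t u
  proof -
   note z = ep(2)[OF near[OF that(1,2)]]
   have "norm u <= K * (\<Sum>i\<in>Basis. \<bar>B (s, t) u i\<bar>)" using z by blast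
   also have "\<dots> = 0" using that(3) BM[of "(s, t)"] z by simp
   finally show ?thesis by simp
  qed
 qed
qed

section \<open>Distance costs and non-branching\<close>

locale convex_profile =
 fixes f :: "real => real"
 assumes f_smooth: "smooth_on f UNIV" and f_convex: "strictly_convex f" and f_mono: "strict_mono_on {0..} f"
begin

lemma f_deriv: "(f has_real_derivative deriv f t) (at t)"
proof -
 have "(f has_derivative frechet_derivative f (at t)) (at t)" by (rule smooth_on_has_derivative[OF f_smooth UNIV_I])
 then have "f differentiable (at t)" unfolding differentiable_def by blast
 then show ?thesis using DERIV_deriv_iff_real_differentiable by blast
qed

lemma f_deriv_cont: "isCont (deriv f) t"
proof -
 have eq: "deriv f = (pd f 1)"
 proof
  fix t
  have "(f has_derivative (*) (deriv f t)) (at t)" using f_deriv[of t] by (simp add: has_field_derivative_def)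
  from frechet_derivative_at[OF this] show "deriv f t = pd f 1 t" by (metis mult.right_neutral)
 qed
 have "continuous_on UNIV (pd f 1)" by (rule smooth_on_continuous_derivative[OF f_smooth])
 then show ?thesis unfolding eq by (simp add: continuous_on_eq_continuous_at)
qed

lemma f_tangent: "f s \<ge> f t + deriv f t * (s - t)"
proof -
 have "convex_on UNIV f"
 proof (rule convex_onI)
  fix ta x y :: real assume ta: "ta > 0" "ta < 1"
  show "f ((1 - ta) *\<^sub>R x + ta *\<^sub>R y) <= (1 - ta) * f x + ta * f y"
  proof (cases "x = y")
   case True
   then show ?thesis by (simp add: algebra_simps flip: distrib_right)
  next
   case False
   then show ?thesis using f_convex ta unfolding strictly_convex_def real_scaleR_def by (meson less_imp_le)
  qed
 qed simp
 from convex_on_imp_above_tangent[OF this, of t s "deriv f t"] f_deriv[of t] show ?thesis by simp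
qed

lemma f_less: "0 <= a ==> a < b ==> f a < f b"
 using f_mono by (auto simp: strict_mono_on_def)

lemma f_le: "0 <= a ==> a <= b ==> f a <= f b"
 using f_less[of a b] by (cases "a = b") auto

text \<open>Strict monotonicity alone would allow a zero derivative. The tangent at t lies below f
  at 0, where f is smaller than at t, so its slope is positive.\<close>

lemma f_deriv_pos: "t > 0 ==> deriv f t > 0"
proof -
 assume t: "t > 0"
 have "f 0 < f t" using f_less[of 0 t] t by simp
 then have "0 < deriv f t * t" using f_tangent[of t 0] by simp
 then show ?thesis using t by (simp add: zero_less_mult_iff)
qed

end

section \<open>Derivatives of the distance off the cut locus, and non-branching\<close>

locale cost_manifold = cmanifold A g + convex_profile f
 for A :: "('a::{t2_space,second_countable_topology}, 'e::euclidean_space) chart set"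
  and g :: "'a => 'e => 'e => real" and f :: "real => real" +
 assumes cost_C4: "C_k_cost 4 A (- cut_locus A g) (dist_cost A g f)"
  and cost_nondeg: "nondegenerate_cost A (- cut_locus A g) (dist_cost A g f)"
begin

abbreviation c where "c \<equiv> dist_cost A g f"

lemma c_eq: "c (x, y) = f (d x y)" by (simp add: dist_cost_def)

text \<open>Symmetry of second derivatives needs an open domain, and the complement of the cut locus
  is not yet known to be one. By \<open>not_cut_imp_N0\<close> nothing is lost in the
  interior.\<close>

definition N0 :: "('a \<times> 'a) set" where "N0 = interior (- cut_locus A g)"

definition SS :: "('a, 'e) chart => ('a, 'e) chart => ('e \<times> 'e) set" where
 "SS ka ka' = {z \<in> chart_image ka \<times> chart_image ka'. (chart_inv ka (fst z), chart_inv ka' (snd z)) \<in> N0}"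

lemma SS_open: assumes "ka \<in> A" "ka' \<in> A" shows "open (SS ka ka')"
proof -
 let ?O = "chart_image ka \<times> chart_image ka'"
 have "continuous_on ?O (\<lambda>z. (chart_inv ka (fst z), chart_inv ka' (snd z)))"
  by (intro continuous_on_Pair continuous_on_compose2[OF chart_cont(2)[OF assms(1)]] continuous_on_compose2[OF chart_cont(2)[OF assms(2)]])
   (auto intro!: continuous_intros)
 moreover have "open ?O" by (intro open_Times chart_open assms)
 moreover have "open N0" unfolding N0_def by simp
 ultimately have "open (?O \<inter> (\<lambda>z. (chart_inv ka (fst z), chart_inv ka' (snd z))) -` N0)"
  by (rule continuous_open_preimage)
 moreover have "?O \<inter> (\<lambda>z. (chart_inv ka (fst z), chart_inv ka' (snd z))) -` N0 = SS ka ka'"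
  unfolding SS_def by blast
 ultimately show ?thesis by simp
qed

lemma CC_C4: assumes "ka \<in> A" "ka' \<in> A" shows "C_k_on 4 (coord_cost ka ka' c) (SS ka ka')"
proof (rule C_k_on_subset)
 show "C_k_on 4 (coord_cost ka ka' c) (map_prod (snd ka) (snd ka') ` (- cut_locus A g \<inter> fst ka \<times> fst ka'))"
  using cost_C4 assms unfolding C_k_cost_def by blast
 show "SS ka ka' \<subseteq> map_prod (snd ka) (snd ka') ` (- cut_locus A g \<inter> fst ka \<times> fst ka')"
 proof
  fix z assume "z \<in> SS ka ka'"
  then have z: "fst z \<in> chart_image ka" "snd z \<in> chart_image ka'" "(chart_inv ka (fst z), chart_inv ka' (snd z)) \<in> N0"
   unfolding SS_def by auto
  have "z = map_prod (snd ka) (snd ka') (chart_inv ka (fst z), chart_inv ka' (snd z))"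
   using chart_eq[OF assms(1) z(1)] chart_eq[OF assms(2) z(2)] by simp
  moreover have "(chart_inv ka (fst z), chart_inv ka' (snd z)) \<in> - cut_locus A g \<inter> fst ka \<times> fst ka'"
   using z(3) interior_subset chart_inv_in[OF assms(1) z(1)] chart_inv_in[OF assms(2) z(2)] unfolding N0_def by blast
  ultimately show "z \<in> map_prod (snd ka) (snd ka') ` (- cut_locus A g \<inter> fst ka \<times> fst ka')" by (rule image_eqI)
 qed
qed

lemma CC_C2: assumes "ka \<in> A" "ka' \<in> A" shows "C_k_on 2 (coord_cost ka ka' c) (SS ka ka')"
 by (rule C_k_on_le[OF CC_C4[OF assms]]) simp

lemma CC_has_derivative: assumes "ka \<in> A" "ka' \<in> A" "z \<in> SS ka ka'"
 shows "(coord_cost ka ka' c has_derivative frechet_derivative (coord_cost ka ka' c) (at z)) (at z)"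
 using C_k_on_has_derivative[of 3 "coord_cost ka ka' c" "SS ka ka'" z] CC_C4[OF assms(1,2)] assms(3)
 by (simp add: numeral_eq_Suc)

lemma SS_in: "ka \<in> A ==> ka' \<in> A ==> x \<in> fst ka ==> y \<in> fst ka' ==> (x, y) \<in> N0 ==> (snd ka x, snd ka' y) \<in> SS ka ka'"
 unfolding SS_def by (auto simp: chart_inv_eq)

lemma coord_cost_eq: "coord_cost ka ka' c (s, t) = f (d (chart_inv ka s) (chart_inv ka' t))"
 by (simp add: coord_cost_def c_eq)

text \<open>The diagonal lies in the open domain. This makes nondegeneracy on the diagonal usable,
  and it starts the propagation along minimizing paths in \<open>N0_along\<close>.\<close>

lemma near_N0: "\<exists>rh>0. \<forall>x y. d p x < rh \<and> d p y < rh --> (x, y) \<in> N0"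
proof -
 obtain rh where rh: "rh > 0" "!!x y. d p x < rh ==> d p y < rh ==> (x, y) \<notin> cut_locus A g"
  using near_diagonal_not_cut[of p] by blast
 have op: "open {x. d p x < rh}" by (intro open_Collect_less continuous_on_d continuous_intros)
 have "{x. d p x < rh} \<times> {x. d p x < rh} \<subseteq> N0"
  unfolding N0_def by (rule interior_maximal) (use rh(2) op in \<open>auto intro: open_Times\<close>)
 then show ?thesis using rh(1) by blast
qed

lemma mixed_form_nondegenerate:
 assumes X: "(x, y) \<in> N0"
 shows "(!!v. mixed_form A c (x, y) u v = 0) ==> u = 0" "(!!u. mixed_form A c (x, y) u v = 0) ==> v = 0"
  and mixed_form_bilinear: "bilinear (mixed_form A c (x, y))"
proof -
 let ?ka = "chart_at A x" and ?ka' = "chart_at A y"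
 let ?C = "coord_cost ?ka ?ka' c"
 have zS: "(coords A x, coords A y) \<in> SS ?ka ?ka'"
  unfolding coords_def by (rule SS_in) (use chart_at X in auto)
 note M = mixed_deriv_eq[OF CC_C2[OF chart_at(1) chart_at(1)] SS_open[OF chart_at(1) chart_at(1)] zS]
 note b = frechet_second_bilinear[OF CC_C2[OF chart_at(1) chart_at(1)] SS_open[OF chart_at(1) chart_at(1)] zS]
 have mf: "mixed_form A c (x, y) u v = pd (pd ?C (0, v)) (u, 0) (coords A x, coords A y)" for u v
  unfolding mixed_form_def using M by simp
 show bil: "bilinear (mixed_form A c (x, y))"
  unfolding bilinear_def
 proof (intro conjI allI linearI)
  fix w a b' :: 'e and r :: real
  show "mixed_form A c (x, y) w (a + b') = mixed_form A c (x, y) w a + mixed_form A c (x, y) w b'"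
   unfolding mf using bilinear_ladd[OF b, of "(0, a)" "(0, b')" "(w, 0)"] by simp
  show "mixed_form A c (x, y) w (r *\<^sub>R a) = r *\<^sub>R mixed_form A c (x, y) w a"
   unfolding mf using bilinear_lmul[OF b, of r "(0, a)" "(w, 0)"] by simp
  show "mixed_form A c (x, y) (a + b') w = mixed_form A c (x, y) a w + mixed_form A c (x, y) b' w"
   unfolding mf using bilinear_radd[OF b, of "(0, w)" "(a, 0)" "(b', 0)"] by simp
  show "mixed_form A c (x, y) (r *\<^sub>R a) w = r *\<^sub>R mixed_form A c (x, y) a w"
   unfolding mf using bilinear_rmul[OF b, of "(0, w)" r "(a, 0)"] by simp
 qed
 have "(x, y) \<in> - cut_locus A g" using X interior_subset unfolding N0_def by blast
 from cost_nondeg[unfolded nondegenerate_cost_def, THEN bspec, OF this]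
 obtain e :: "'e => 'e => real" where e0: "\<forall>i\<in>Basis. \<forall>j\<in>Basis. (\<Sum>k\<in>Basis. mixed_form A c (x, y) i k * e k j) = (if i = j then 1 else 0) \<and>
   (\<Sum>k\<in>Basis. e i k * mixed_form A c (x, y) k j) = (if i = j then 1 else 0)" by (rule exE)
 have e: "(\<Sum>k\<in>Basis. mixed_form A c (x, y) i k * e k j) = (if i = j then 1 else 0)"
   "(\<Sum>k\<in>Basis. e i k * mixed_form A c (x, y) k j) = (if i = j then 1 else 0)" if "i \<in> Basis" "j \<in> Basis" for i j
  using bspec[OF bspec[OF e0 that(1)] that(2)] by auto
 have lin: "linear (\<lambda>u. mixed_form A c (x, y) u v)" "linear (mixed_form A c (x, y) u)" for u v using bil by (auto simp: bilinear_def)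
 show "u = 0" if "!!v. mixed_form A c (x, y) u v = 0"
 proof (rule euclidean_eqI)
  fix j :: 'e assume j: "j \<in> Basis"
  have "0 = (\<Sum>k\<in>Basis. mixed_form A c (x, y) u k * e k j)" using that by simp
  also have "\<dots> = (\<Sum>k\<in>Basis. \<Sum>i\<in>Basis. (u \<bullet> i) * (mixed_form A c (x, y) i k * e k j))"
   by (subst linear_expand[OF lin(1), of u]) (simp add: sum_distrib_right mult.assoc)
  also have "\<dots> = (\<Sum>i\<in>Basis. (u \<bullet> i) * (\<Sum>k\<in>Basis. mixed_form A c (x, y) i k * e k j))"
   by (subst sum.swap) (simp add: sum_distrib_left)
  also have "\<dots> = (\<Sum>i\<in>Basis. (u \<bullet> i) * (if i = j then 1 else 0))" by (rule sum.cong) (use e(1) j in auto)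
  also have "\<dots> = u \<bullet> j" using j by (simp add: if_distrib sum.delta cong: if_cong)
  finally show "u \<bullet> j = 0 \<bullet> j" by simp
 qed
 show "v = 0" if "!!u. mixed_form A c (x, y) u v = 0"
 proof (rule euclidean_eqI)
  fix i :: 'e assume i: "i \<in> Basis"
  have "0 = (\<Sum>k\<in>Basis. e i k * mixed_form A c (x, y) k v)" using that by simp
  also have "\<dots> = (\<Sum>k\<in>Basis. \<Sum>j\<in>Basis. (v \<bullet> j) * (e i k * mixed_form A c (x, y) k j))"
   by (subst linear_expand[OF lin(2), of _ v]) (simp add: sum_distrib_left mult.left_commute)
  also have "\<dots> = (\<Sum>j\<in>Basis. (v \<bullet> j) * (\<Sum>k\<in>Basis. e i k * mixed_form A c (x, y) k j))"
   by (subst sum.swap) (simp add: sum_distrib_left)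
  also have "\<dots> = (\<Sum>j\<in>Basis. (v \<bullet> j) * (if i = j then 1 else 0))" by (rule sum.cong) (use e(2) i in auto)
  also have "\<dots> = v \<bullet> i" using i by (simp add: if_distrib sum.delta cong: if_cong)
  finally show "v \<bullet> i = 0 \<bullet> i" by simp
 qed
qed

lemma dist_has_derivative:
 assumes am: "(a, m) \<in> N0" "a ~= m" and ka: "ka \<in> A" "m \<in> fst ka" and ka': "ka' \<in> A" "a \<in> fst ka'"
 shows "((\<lambda>z. d a (chart_inv ka z)) has_derivative
   (\<lambda>h. pd (coord_cost ka' ka c) (0, h) (snd ka' a, snd ka m) / deriv f (d a m))) (at (snd ka m))"
proof -
 have z: "(snd ka' a, snd ka m) \<in> SS ka' ka" by (rule SS_in) (use assms in auto)
 have "((\<lambda>t. coord_cost ka' ka c (snd ka' a, t)) has_derivative (\<lambda>h. pd (coord_cost ka' ka c) (0, h) (snd ka' a, snd ka m))) (at (snd ka m))"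
  by (rule partial_has_derivative(1)[OF CC_has_derivative[OF ka'(1) ka(1) z]])
 then have 1: "((\<lambda>t. f (d a (chart_inv ka t))) has_derivative (\<lambda>h. pd (coord_cost ka' ka c) (0, h) (snd ka' a, snd ka m))) (at (snd ka m))"
  by (simp add: coord_cost_eq chart_inv_eq[OF ka'])
 have m: "chart_inv ka (snd ka m) = m" by (rule chart_inv_eq[OF ka])
 have pos: "d a m > 0" using am(2) d_nonneg[of a m] d_eq_0_iff[of a m] by linarith
 have cont: "isCont (\<lambda>z. d a (chart_inv ka z)) (snd ka m)"
  unfolding isCont_def
  by (rule tendsto_d[OF tendsto_const]) (use chart_isCont(2)[OF ka(1) imageI[OF ka(2)]] in \<open>simp add: isCont_def\<close>)
 show ?thesis
  using differentiable_of_comp[OF 1 _ _ cont, of "deriv f (d a m)"] f_deriv[of "d a m"] f_deriv_pos[OF pos] m by simp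
qed

lemma dist_has_derivative_fst:
 assumes mb: "(m, b) \<in> N0" "m ~= b" and ka: "ka \<in> A" "m \<in> fst ka" and ka': "ka' \<in> A" "b \<in> fst ka'"
 shows "((\<lambda>z. d (chart_inv ka z) b) has_derivative
   (\<lambda>h. pd (coord_cost ka ka' c) (h, 0) (snd ka m, snd ka' b) / deriv f (d m b))) (at (snd ka m))"
proof -
 have z: "(snd ka m, snd ka' b) \<in> SS ka ka'" by (rule SS_in) (use assms in auto)
 have "((\<lambda>t. coord_cost ka ka' c (t, snd ka' b)) has_derivative (\<lambda>h. pd (coord_cost ka ka' c) (h, 0) (snd ka m, snd ka' b))) (at (snd ka m))"
  by (rule partial_has_derivative(2)[OF CC_has_derivative[OF ka(1) ka'(1) z]])
 then have 1: "((\<lambda>t. f (d (chart_inv ka t) b)) has_derivative (\<lambda>h. pd (coord_cost ka ka' c) (h, 0) (snd ka m, snd ka' b))) (at (snd ka m))"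
  by (simp add: coord_cost_eq chart_inv_eq[OF ka'])
 have m: "chart_inv ka (snd ka m) = m" by (rule chart_inv_eq[OF ka])
 have pos: "d m b > 0" using mb(2) d_nonneg[of m b] d_eq_0_iff[of m b] by linarith
 have cont: "isCont (\<lambda>z. d (chart_inv ka z) b) (snd ka m)"
  unfolding isCont_def
  by (rule tendsto_d[OF _ tendsto_const]) (use chart_isCont(2)[OF ka(1) imageI[OF ka(2)]] in \<open>simp add: isCont_def\<close>)
 show ?thesis
  using differentiable_of_comp[OF 1 _ _ cont, of "deriv f (d m b)"] f_deriv[of "d m b"] f_deriv_pos[OF pos] m by simp
qed

lemma dist_differentiable:
 assumes "(a, m) \<in> N0" "a ~= m"
 shows "(\<lambda>z. d a (chart_inv (chart_at A m) z)) differentiable (at (coords A m))"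
 using dist_has_derivative[OF assms chart_at(1,2) chart_at(1,2)] unfolding differentiable_def coords_def by blast

text \<open>Minimality at q makes the derivatives at q of the distances from m and from m' both
  equal to minus the derivative of e. The two distances are equal and positive, so the derivatives
  of the costs in the second variable agree too, and local injectivity around (q, q) identifies the
  points.\<close>

lemma no_branch:
 "\<exists>rh>0. \<forall>m m' e. d q m < rh \<and> d q m' < rh \<and> d m q = d m' q \<and> d m q > 0 \<and>
   (\<lambda>z. e (chart_inv (chart_at A q) z)) differentiable (at (coords A q)) \<and>
   (\<forall>z. d m z + e z \<ge> d m q + e q) \<and> (\<forall>z. d m' z + e z \<ge> d m' q + e q) --> m = m'"
proof -
 define ka where "ka = chart_at A q"
 have ka: "ka \<in> A" "q \<in> fst ka" using chart_at unfolding ka_def by auto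
 let ?s = "snd ka q"
 let ?C = "coord_cost ka ka c"
 have qq: "(q, q) \<in> N0" using near_N0[of q] by force
 have qS: "(?s, ?s) \<in> SS ka ka" by (rule SS_in[OF ka(1) ka(1) ka(2) ka(2) qq])
 have nd: "u = 0" if "!!v. mixed_deriv ?C (?s, ?s) u v = 0" for u
  using mixed_form_nondegenerate(1)[OF qq, of u] that unfolding mixed_form_def coords_def ka_def by simp
 obtain r where r: "r > 0" "ball ?s r \<times> ball ?s r \<subseteq> SS ka ka"
  "!!s s' t. s \<in> ball ?s r ==> s' \<in> ball ?s r ==> t \<in> ball ?s r ==>
   (!!v. pd ?C (0, v) (s, t) = pd ?C (0, v) (s', t)) ==> s = s'"
  using twist_injective[OF CC_C2[OF ka(1) ka(1)] SS_open[OF ka(1) ka(1)] qS nd] by blast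
 have bI: "ball ?s r \<subseteq> chart_image ka" using r(1,2) unfolding SS_def by (auto dest!: subsetD)
 have op: "open (chart_inv ka ` ball ?s r)" by (rule chart_inv_image_open[OF ka(1) open_ball bI])
 have in0: "q \<in> chart_inv ka ` ball ?s r" using chart_inv_eq[OF ka] r(1) by (intro image_eqI[of _ _ ?s]) auto
 obtain rh where rh: "rh > 0" "!!m. d q m < rh ==> m \<in> chart_inv ka ` ball ?s r" using d_near_open[OF op in0] by metis
 have "m = m'" if m: "d q m < rh" "d q m' < rh" "d m q = d m' q" "d m q > 0"
  and e: "(\<lambda>z. e (chart_inv (chart_at A q) z)) differentiable (at (coords A q))"
  and min: "!!z. d m z + e z \<ge> d m q + e q" "!!z. d m' z + e z \<ge> d m' q + e q" for m m' e
 proof -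
  obtain E where E: "((\<lambda>z. e (chart_inv ka z)) has_derivative E) (at ?s)"
   using e unfolding differentiable_def ka_def coords_def by blast
  have D: "pd ?C (0, v) (s, ?s) = - E v * deriv f (d m q)"
   if s: "s \<in> ball ?s r" "chart_inv ka s = m" and pos: "d m q > 0" and min: "!!z. d m z + e z \<ge> d m q + e q" for m s v
  proof -
   have "s \<in> chart_image ka" using s bI by blast
   then have sm: "snd ka m = s" "m \<in> fst ka" using chart_eq[OF ka(1)] chart_inv_in[OF ka(1)] s(2) by auto
   have "(s, ?s) \<in> SS ka ka" using r(1,2) s by auto
   then have "(m, q) \<in> N0" unfolding SS_def using s(2) chart_inv_eq[OF ka] by auto
   moreover have "m ~= q" using pos by auto
   ultimately have 1: "((\<lambda>z. d m (chart_inv ka z)) has_derivative (\<lambda>h. pd ?C (0, h) (s, ?s) / deriv f (d m q))) (at ?s)"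
    using dist_has_derivative[OF _ _ ka ka(1) sm(2)] sm(1) by simp
   have "(\<lambda>h. pd ?C (0, h) (s, ?s) / deriv f (d m q) + E h) = (\<lambda>h. 0)"
    by (rule has_derivative_local_min[OF has_derivative_add[OF 1 E]])
     (use min chart_inv_eq[OF ka] in \<open>auto intro!: always_eventually\<close>)
   then have "pd ?C (0, v) (s, ?s) / deriv f (d m q) + E v = 0" by meson
   then show ?thesis using f_deriv_pos[OF pos] by (simp add: field_simps)
  qed
  obtain s s' where s: "s \<in> ball ?s r" "chart_inv ka s = m" "s' \<in> ball ?s r" "chart_inv ka s' = m'"
   using rh(2)[OF m(1)] rh(2)[OF m(2)] by blast
  have "s = s'"
  proof (rule r(3)[OF s(1,3), of ?s])
   show "?s \<in> ball ?s r" using r(1) by simp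
   show "pd ?C (0, v) (s, ?s) = pd ?C (0, v) (s', ?s)" for v
    using D[OF s(1,2) m(4) min(1)] D[OF s(3,4) _ min(2)] m(3,4) by simp
  qed
  then show ?thesis using s by simp
 qed
 then show ?thesis using rh(1) by (intro exI[of _ rh]) blast
qed

text \<open>The function e calibrates both paths at their common start, so that they cannot split
  there. At a later time of agreement the distance from an earlier common point takes over this
  role.\<close>

lemma geodesic_unique_continuation:
 assumes L: "L \<ge> 0" and si: "!!s t. s \<in> {0..L} ==> t \<in> {0..L} ==> d (si s) (si t) = \<bar>s - t\<bar>"
  and ta: "!!s t. s \<in> {0..L} ==> t \<in> {0..L} ==> d (ta s) (ta t) = \<bar>s - t\<bar>" and eq0: "si 0 = ta 0"
  and e: "(\<lambda>z. e (chart_inv (chart_at A (si 0)) z)) differentiable (at (coords A (si 0)))"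
  and min: "!!s z. s \<in> {0..L} ==> d (si s) z + e z \<ge> d (si s) (si 0) + e (si 0)"
   "!!s z. s \<in> {0..L} ==> d (ta s) z + e z \<ge> d (ta s) (si 0) + e (si 0)"
 shows "si L = ta L"
proof -
 define S where "S = {t \<in> {0..L}. \<forall>u\<in>{0..t}. si u = ta u}"
 have S0: "0 \<in> S" unfolding S_def using L eq0 by auto
 have bdd: "bdd_above S" unfolding S_def by (auto intro: bdd_aboveI[of _ L])
 define T where "T = Sup S"
 have T: "0 <= T" unfolding T_def by (rule cSup_upper[OF S0 bdd])
 have SL: "t <= L" if "t \<in> S" for t using that unfolding S_def by simp
 have "T <= L" unfolding T_def by (rule cSup_least) (use S0 SL in auto)
 note T = T this
 have below: "si u = ta u" if u: "0 <= u" "u < T" for u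
 proof -
  obtain t where "t \<in> S" "u < t" using u(2) less_cSup_iff[of S u, OF _ bdd] S0 unfolding T_def by blast
  then show ?thesis unfolding S_def using u by auto
 qed
 have eqT: "si T = ta T"
 proof (rule ccontr)
  assume ne: "si T ~= ta T"
  then have pos: "d (si T) (ta T) > 0" using d_nonneg[of "si T" "ta T"] d_eq_0_iff[of "si T" "ta T"] by linarith
  have T0: "T > 0" using ne eq0 T by (cases "T = 0") auto
  define u where "u = max 0 (T - d (si T) (ta T) / 4)"
  have u: "0 <= u" "u < T" "T - u <= d (si T) (ta T) / 4" using T0 pos max.cobounded2[of "T - d (si T) (ta T) / 4" 0] unfolding u_def by linarith+
  have "d (si T) (si u) = T - u" "d (ta T) (ta u) = T - u" using si[of T u] ta[of T u] u T by auto
  then have "d (si T) (ta T) <= 2 * (T - u)"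
   using d_triangle[of "si T" "ta T" "si u"] below[OF u(1,2)] d_sym[of "ta u" "ta T"] by simp
  then show False using u pos by simp
 qed
 have agree: "si u = ta u" if "0 <= u" "u <= T" for u using below eqT that by (cases "u = T") auto
 show ?thesis
 proof (cases "T = L")
  case True then show ?thesis using eqT by simp
 next
  case False
  then have TL: "T < L" using T by simp
  let ?q = "si T"
  obtain rh where rh: "rh > 0" "!!m m' e. d ?q m < rh ==> d ?q m' < rh ==> d m ?q = d m' ?q ==> d m ?q > 0 ==>
   (\<lambda>z. e (chart_inv (chart_at A ?q) z)) differentiable (at (coords A ?q)) ==>
   (!!z. d m z + e z \<ge> d m ?q + e ?q) ==> (!!z. d m' z + e z \<ge> d m' ?q + e ?q) ==> m = m'"
   using no_branch[of ?q] by blast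
  obtain rh' where rh': "rh' > 0" "!!x y. d ?q x < rh' ==> d ?q y < rh' ==> (x, y) \<in> N0" using near_N0[of ?q] by blast
  \<comment> \<open>The earlier point is at most rh' / 2 away, so that the pair lies in
    \<open>N0\<close> and the distance from it is differentiable at \<open>?q\<close>.\<close>
  define E where "E = (if T = 0 then e else (\<lambda>z. d (si (T - min T (rh' / 2))) z))"
  have E: "(\<lambda>z. E (chart_inv (chart_at A ?q) z)) differentiable (at (coords A ?q))"
  proof (cases "T = 0")
   case True then show ?thesis using e by (simp add: E_def)
  next
   case F: False
   define b where "b = si (T - min T (rh' / 2))"
   have "d b ?q = min T (rh' / 2)" unfolding b_def using si[of "T - min T (rh' / 2)" T] T rh'(1) by (auto simp: min_def)
   then have "0 < d b ?q" "d ?q b < rh'" using F T rh'(1) d_sym[of ?q b] by auto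
   then have "(b, ?q) \<in> N0" "b ~= ?q" using rh' by auto
   from dist_differentiable[OF this] show ?thesis using F by (simp add: E_def b_def)
  qed
  have minE: "d (si (T + s)) z + E z \<ge> d (si (T + s)) ?q + E ?q" "d (ta (T + s)) z + E z \<ge> d (ta (T + s)) ?q + E ?q"
   if s: "0 < s" "s <= L - T" for s z
  proof -
   show "d (si (T + s)) z + E z \<ge> d (si (T + s)) ?q + E ?q"
   proof (cases "T = 0")
    case True then show ?thesis using min(1)[of s z] s by (simp add: E_def)
   next
    case F: False
    define de where "de = min T (rh' / 2)"
    have de: "0 < de" "de <= T" using F T rh'(1) by (auto simp: de_def)
    have "d (si (T + s)) (si (T - de)) = s + de" "d (si (T + s)) ?q = s" "d (si (T - de)) ?q = de"
     using si[of "T + s" "T - de"] si[of "T + s" T] si[of "T - de" T] s de T by auto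
    then show ?thesis using F d_triangle[of "si (T + s)" "si (T - de)" z] d_sym[of z "si (T - de)"] by (simp add: E_def de_def)
   qed
   show "d (ta (T + s)) z + E z \<ge> d (ta (T + s)) ?q + E ?q"
   proof (cases "T = 0")
    case True then show ?thesis using min(2)[of s z] s by (simp add: E_def)
   next
    case F: False
    define de where "de = min T (rh' / 2)"
    have de: "0 < de" "de <= T" using F T rh'(1) by (auto simp: de_def)
    have ag: "si (T - de) = ta (T - de)" using agree[of "T - de"] de by simp
    have "d (ta (T + s)) (ta (T - de)) = s + de" "d (ta (T + s)) (ta T) = s" "d (ta (T - de)) (ta T) = de"
     using ta[of "T + s" "T - de"] ta[of "T + s" T] ta[of "T - de" T] s de T by auto
    then show ?thesis using F d_triangle[of "ta (T + s)" "ta (T - de)" z] d_sym[of z "ta (T - de)"] ag eqT by (simp add: E_def de_def)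
   qed
  qed
  define s0 where "s0 = min (L - T) (rh / 2)"
  have s0: "0 < s0" "s0 <= L - T" "s0 < rh" using TL rh(1) by (auto simp: s0_def)
  have step: "si (T + s) = ta (T + s)" if s: "0 < s" "s <= s0" for s
  proof -
   have ds: "d (si (T + s)) ?q = s" "d (ta (T + s)) ?q = s"
    using si[of "T + s" T] ta[of "T + s" T] s s0 T eqT by auto
   show ?thesis
    by (rule rh(2)[OF _ _ _ _ E minE(1) minE(2)]) (use ds s s0 d_sym[of ?q] in auto)
  qed
  have "T + s0 \<in> S" unfolding S_def
  proof (intro CollectI conjI ballI)
   show "T + s0 \<in> {0..L}" using s0 T by auto
   fix u assume "u \<in> {0..T + s0}"
   then show "si u = ta u" using agree[of u] step[of "u - T"] by (cases "u <= T") auto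
  qed
  then have "T + s0 <= T" unfolding T_def using bdd by (rule cSup_upper)
  then show ?thesis using s0 by simp
 qed
qed

end

section \<open>The complement of the cut locus is open\<close>

text \<open>A sequence that is eventually in a compact set converges once all cluster points of its
  subsequences coincide; filters appear because \<open>pointwise_cluster\<close> produces limits
  along them.\<close>

lemma tendsto_unique_cluster:
 fixes m :: "nat => 'a::topological_space"
 assumes K: "compact K" "\<forall>\<^sub>F n in sequentially. m n \<in> K"
  and l: "!!r G l. strict_mono r ==> G ~= bot ==> G <= sequentially ==> ((\<lambda>n. m (r n)) \<longlongrightarrow> l) G ==> l = p"
 shows "m \<longlonglongrightarrow> p"
proof (rule ccontr)
 assume "\<not> m \<longlonglongrightarrow> p"
 then obtain U where U: "open U" "p \<in> U" "\<not> (\<forall>\<^sub>F n in sequentially. m n \<in> U)" unfolding tendsto_def by blast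
 have "infinite {n. m n \<notin> U \<and> m n \<in> K}"
 proof
  assume fin: "finite {n. m n \<notin> U \<and> m n \<in> K}"
  then have "\<forall>\<^sub>F n in sequentially. n \<notin> {n. m n \<notin> U \<and> m n \<in> K}"
   by (simp add: eventually_cofinite flip: cofinite_eq_sequentially)
  with K(2) have "\<forall>\<^sub>F n in sequentially. m n \<in> U" by eventually_elim auto
  then show False using U(3) by blast
 qed
 then have "\<exists>r::nat => nat. strict_mono r \<and> (\<forall>n. r n \<in> {n. m n \<notin> U \<and> m n \<in> K})" by (rule infinite_enumerate)
 then obtain r :: "nat => nat" where r: "strict_mono r" "!!n. r n \<in> {n. m n \<notin> U \<and> m n \<in> K}" by auto
 obtain G l where G: "G ~= bot" "G <= sequentially" "!!t::unit. ((\<lambda>n. m (r n)) \<longlongrightarrow> l t) G"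
  by (rule pointwise_cluster[of "\<lambda>_::unit. K" "\<lambda>n _. m (r n)"]) (use K(1) r(2) in auto)
 have "l () = p" by (rule assms(3)[OF r(1) G])
 then have "\<forall>\<^sub>F n in G. m (r n) \<in> U" using topological_tendstoD[OF G(3)[of "()"] U(1)] U(2) by simp
 then obtain n where "m (r n) \<in> U" using eventually_happens'[OF G(1)] by blast
 then show False using r(2)[of n] by blast
qed

lemma tendsto_subseq_filter:
 assumes "X \<longlonglongrightarrow> L" "strict_mono r" "G <= sequentially"
 shows "((\<lambda>n. X (r n)) \<longlongrightarrow> L) G"
proof -
 have "(\<lambda>n. X (r n)) \<longlonglongrightarrow> L" using LIMSEQ_subseq_LIMSEQ[OF assms(1,2)] by (simp add: comp_def)
 then show ?thesis using assms(3) by (rule tendsto_mono[rotated])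
qed

context cost_manifold
begin

lemma N0_sequence:
 assumes "(x, q) \<notin> N0"
 obtains a b where "a \<longlonglongrightarrow> x" "b \<longlonglongrightarrow> q" "!!n. (a n, b n) \<in> cut_locus A g" "!!n. d x (a n) < 1" "!!n. d q (b n) < 1"
proof -
 have "\<exists>a b. (a, b) \<in> cut_locus A g \<and> d x a < 1 / (real n + 1) \<and> d q b < 1 / (real n + 1)" for n
 proof (rule ccontr)
  assume no: "\<not> ?thesis"
  let ?U = "\<lambda>x. {z. d x z < 1 / (real n + 1)}"
  have op: "open (?U x)" for x by (intro open_Collect_less continuous_on_d continuous_intros)
  have "?U x \<times> ?U q \<subseteq> N0" unfolding N0_def
   by (rule interior_maximal) (use no op in \<open>auto intro: open_Times\<close>)
  moreover have "(x, q) \<in> ?U x \<times> ?U q" by (simp add: d_self)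
  ultimately show False using assms by (metis subsetD)
 qed
 then obtain a b where ab: "!!n. (a n, b n) \<in> cut_locus A g" "!!n. d x (a n) < 1 / (real n + 1)" "!!n. d q (b n) < 1 / (real n + 1)" by metis
 have lim: "h \<longlonglongrightarrow> l" if "!!n. d l (h n) < 1 / (real n + 1)" for h l
  unfolding tendsto_iff_d
 proof (rule Lim_null_comparison[OF _ LIMSEQ_inverse_real_of_nat])
  show "\<forall>\<^sub>F n in sequentially. norm (d (h n) l) <= inverse (real (Suc n))"
   using that by (intro always_eventually allI) (auto simp: d_sym[of _ l] d_nonneg inverse_eq_divide less_imp_le add.commute)
 qed
 have le1: "1 / (real n + 1) <= 1" for n by simp
 show ?thesis
  by (rule that[OF lim lim, OF ab(2,3,1)]) (use ab(2,3) le1 in \<open>meson less_le_trans\<close>)+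
qed

text \<open>With these weights the tangent inequality of f bounds the change of the weighted sum of
  three costs below by the change of the total distance, which is nonnegative by the triangle
  inequality. So the sum is minimal at (p, q) and its Hessian is semidefinite. A null vector in the
  variable p alone would annihilate the mixed derivative against every v, contrary to nondegeneracy
  at (p, q). Strictness thus comes from moving q as well, which is why the path continues to
  q'.\<close>

lemma chain_Hessian_pos:
 assumes kax: "kax \<in> A" "x \<in> fst kax" and ka: "ka \<in> A" "p \<in> fst ka" "q \<in> fst ka" "q' \<in> fst ka"
  and N: "(x, p) \<in> N0" "(p, q) \<in> N0" "(q, q') \<in> N0"
  and d: "d x p > 0" "d p q > 0" "d q q' > 0" "d x q' = d x p + d p q + d q q'"
  and nd: "!!u. (!!v. mixed_deriv (coord_cost ka ka c) (snd ka p, snd ka q) u v = 0) ==> u = 0" and u: "u ~= 0"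
 shows "1 / deriv f (d x p) * pd (pd (coord_cost kax ka c) (0, u)) (0, u) (snd kax x, snd ka p)
  + 1 / deriv f (d p q) * pd (pd (coord_cost ka ka c) (u, 0)) (u, 0) (snd ka p, snd ka q) > 0"
proof -
 let ?C1 = "coord_cost kax ka c" and ?C2 = "coord_cost ka ka c"
 define z1 where "z1 = (snd kax x, snd ka p)"
 define z2 where "z2 = (snd ka p, snd ka q)"
 define z3 where "z3 = (snd ka q, snd ka q')"
 define al where "al = 1 / deriv f (d x p)"
 define be where "be = 1 / deriv f (d p q)"
 define be' where "be' = 1 / deriv f (d q q')"
 have pos: "al > 0" "be > 0" "be' > 0" using f_deriv_pos d by (auto simp: al_def be_def be'_def)
 have one: "al * deriv f (d x p) = 1" "be * deriv f (d p q) = 1" "be' * deriv f (d q q') = 1"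
  using f_deriv_pos[OF d(1)] f_deriv_pos[OF d(2)] f_deriv_pos[OF d(3)] by (auto simp: al_def be_def be'_def)
 have zS: "z1 \<in> SS kax ka" "z2 \<in> SS ka ka" "z3 \<in> SS ka ka"
  unfolding z1_def z2_def z3_def using kax ka N by (auto intro: SS_in)
 define D2 where "D2 C z u v = pd (pd C u) v z" for C :: "'e \<times> 'e => real" and z u v
 note S1 = SS_open[OF kax(1) ka(1)] and S2 = SS_open[OF ka(1) ka(1)]
 note C1 = CC_C2[OF kax(1) ka(1)] and C2 = CC_C2[OF ka(1) ka(1)]
 have psd: "0 <= al * D2 ?C1 z1 (0, u) (0, u) + be * D2 ?C2 z2 (u, v) (u, v) + be' * D2 ?C2 z3 (v, 0) (v, 0)" for u v
 proof -
  define h where "h ta = al * ?C1 (z1 + ta *\<^sub>R (0, u)) + be * ?C2 (z2 + ta *\<^sub>R (u, v)) + be' * ?C2 (z3 + ta *\<^sub>R (v, 0))" for ta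
  define h' where "h' ta = al * pd ?C1 (0, u) (z1 + ta *\<^sub>R (0, u)) + be * pd ?C2 (u, v) (z2 + ta *\<^sub>R (u, v)) + be' * pd ?C2 (v, 0) (z3 + ta *\<^sub>R (v, 0))" for ta
  have ev: "\<forall>\<^sub>F ta in nhds 0. z + ta *\<^sub>R w \<in> S" if "open S" "z \<in> S" for z w :: "'e \<times> 'e" and S
  proof -
   have "open ((\<lambda>ta. z + ta *\<^sub>R w) -` S)" by (intro open_vimage that continuous_intros)
   from eventually_nhds_in_open[OF this, of 0] show ?thesis using that(2) by (auto simp: vimage_def)
  qed
  have "\<forall>\<^sub>F ta in nhds 0. z1 + ta *\<^sub>R (0, u) \<in> SS kax ka \<and> z2 + ta *\<^sub>R (u, v) \<in> SS ka ka \<and> z3 + ta *\<^sub>R (v, 0) \<in> SS ka ka"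
   using ev[OF S1 zS(1), of "(0, u)"] ev[OF S2 zS(2), of "(u, v)"] ev[OF S2 zS(3), of "(v, 0)"] by eventually_elim blast
  then obtain e where e: "e > 0" "!!ta. \<bar>ta\<bar> < e ==> z1 + ta *\<^sub>R (0, u) \<in> SS kax ka" "!!ta. \<bar>ta\<bar> < e ==> z2 + ta *\<^sub>R (u, v) \<in> SS ka ka" "!!ta. \<bar>ta\<bar> < e ==> z3 + ta *\<^sub>R (v, 0) \<in> SS ka ka"
   unfolding eventually_nhds_metric by (auto simp: dist_real_def)
  have dh: "(h has_real_derivative h' ta) (at ta)" if "\<bar>ta\<bar> < e" for ta
   unfolding h_def h'_def
   by (rule DERIV_add[OF DERIV_add[OF DERIV_cmult DERIV_cmult] DERIV_cmult])
    (rule has_derivative_along_line[OF CC_has_derivative[OF kax(1) ka(1) e(2)[OF that]]]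
      has_derivative_along_line[OF CC_has_derivative[OF ka(1) ka(1) e(3)[OF that]]]
      has_derivative_along_line[OF CC_has_derivative[OF ka(1) ka(1) e(4)[OF that]]])+
  have dh': "(h' has_real_derivative (al * D2 ?C1 z1 (0, u) (0, u) + be * D2 ?C2 z2 (u, v) (u, v) + be' * D2 ?C2 z3 (v, 0) (v, 0))) (at 0)"
  proof -
   have dd: "((\<lambda>ta. pd C w (z + ta *\<^sub>R w)) has_real_derivative D2 C z w w) (at 0)"
    if "C_k_on 2 C S" "z \<in> S" for C :: "'e \<times> 'e => real" and S z w
   proof -
    have "C_k_on (Suc 0) (pd C w) S" using that(1) by (simp only: numeral_2_eq_2 C_k_on_frechet)
    from C_k_on_has_derivative[OF this that(2)]
    show ?thesis unfolding D2_def by (intro has_derivative_along_line) simp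
   qed
   show ?thesis unfolding h'_def by (rule DERIV_add[OF DERIV_add[OF DERIV_cmult[OF dd[OF C1 zS(1)]] DERIV_cmult[OF dd[OF C2 zS(2)]]] DERIV_cmult[OF dd[OF C2 zS(3)]]])
  qed
  show ?thesis
  proof (rule second_derivative_at_min(2)[OF e(1) dh dh'])
   fix ta assume ta: "\<bar>ta\<bar> < e"
   define m where "m = chart_inv ka (snd ka p + ta *\<^sub>R u)"
   define b where "b = chart_inv ka (snd ka q + ta *\<^sub>R v)"
   have h: "h ta = al * f (d x m) + be * f (d m b) + be' * f (d b q')"
    unfolding h_def z1_def z2_def z3_def m_def b_def using chart_inv_eq[OF kax] chart_inv_eq[OF ka(1,4)] by (simp add: coord_cost_eq)
   have h0: "h 0 = al * f (d x p) + be * f (d p q) + be' * f (d q q')"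
    unfolding h_def z1_def z2_def z3_def using chart_inv_eq[OF kax] chart_inv_eq[OF ka(1,2)] chart_inv_eq[OF ka(1,3)] chart_inv_eq[OF ka(1,4)] by (simp add: coord_cost_eq)
   have tl: "w * f d' \<ge> w * f d0 + (d' - d0)" if "w > 0" "w * deriv f d0 = 1" for w d' d0
   proof -
    have "w * f d' \<ge> w * (f d0 + deriv f d0 * (d' - d0))" using f_tangent[of d0 d'] that(1) by (intro mult_left_mono) auto
    also have "w * (f d0 + deriv f d0 * (d' - d0)) = w * f d0 + (w * deriv f d0) * (d' - d0)" by (simp add: algebra_simps)
    finally show ?thesis using that(2) by simp
   qed
   have "d x q' <= d x m + d m b + d b q'" using d_triangle[of x q' m] d_triangle[of m q' b] by simp
   then show "h ta \<ge> h 0" unfolding h h0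
    using tl[OF pos(1) one(1), of "d x m"] tl[OF pos(2) one(2), of "d m b"] tl[OF pos(3) one(3), of "d b q'"] d(4) by linarith
  qed
 qed
 have b1: "bilinear (D2 ?C2 z2)" "bilinear (D2 ?C2 z3)" "bilinear (D2 ?C1 z1)"
  unfolding D2_def by (rule frechet_second_bilinear[OF C2 S2 zS(2)] frechet_second_bilinear[OF C2 S2 zS(3)] frechet_second_bilinear[OF C1 S1 zS(1)])+
 define G where "G = al * D2 ?C1 z1 (0, u) (0, u) + be * D2 ?C2 z2 (u, 0) (u, 0)"
 have G0: "G \<ge> 0"
 proof -
  have "D2 ?C2 z3 (0, 0) (0, 0) = 0" using bilinear_lzero[OF b1(2), of "(0,0)"] by (simp add: zero_prod_def)
  then show ?thesis using psd[of u 0] unfolding G_def by simp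
 qed
 moreover have "G ~= 0"
 proof
  assume Gz: "G = 0"
  have "mixed_deriv ?C2 z2 u v = 0" for v
  proof -
   define M where "M = D2 ?C2 z2 (0, v) (u, 0)"
   define R where "R = be * D2 ?C2 z2 (0, v) (0, v) + be' * D2 ?C2 z3 (v, 0) (v, 0)"
   have sym: "D2 ?C2 z2 (u, 0) (0, v) = M" unfolding M_def D2_def by (rule frechet_derivative_commute[OF C2 S2 zS(2)])
   \<comment> \<open>In the direction (u, ta v) the vanishing value at (u, 0) leaves a nonnegative
     polynomial in ta without constant term, so its linear coefficient is zero.\<close>
   have q: "0 <= 2 * be * M * ta + R * ta\<^sup>2" for ta
   proof -
    have e: "(u, ta *\<^sub>R v) = (u, 0) + ta *\<^sub>R (0, v)" "(ta *\<^sub>R v, 0) = ta *\<^sub>R (v, 0::'e)" by simp_all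
    have "D2 ?C2 z2 (u, ta *\<^sub>R v) (u, ta *\<^sub>R v) = D2 ?C2 z2 (u, 0) (u, 0) + 2 * ta * M + ta\<^sup>2 * D2 ?C2 z2 (0, v) (0, v)"
     unfolding e bilinear_ladd[OF b1(1)] bilinear_radd[OF b1(1)] bilinear_lmul[OF b1(1)] bilinear_rmul[OF b1(1)] sym M_def[symmetric]
     by (simp add: power2_eq_square algebra_simps)
    moreover have "D2 ?C2 z3 (ta *\<^sub>R v, 0) (ta *\<^sub>R v, 0) = ta\<^sup>2 * D2 ?C2 z3 (v, 0) (v, 0)"
     unfolding e bilinear_lmul[OF b1(2)] bilinear_rmul[OF b1(2)] by (simp add: power2_eq_square)
    ultimately show ?thesis using psd[of u "ta *\<^sub>R v"] Gz unfolding G_def R_def by (simp add: algebra_simps)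
   qed
   have "2 * be * M = 0"
   proof -
    have "(\<lambda>ta. 2 * be * M + 2 * R * ta) 0 = 0"
    proof (rule second_derivative_at_min(1)[of 1 "\<lambda>ta. 2 * be * M * ta + R * ta\<^sup>2" _ "2 * R"])
     show "((\<lambda>ta. 2 * be * M * ta + R * ta\<^sup>2) has_real_derivative 2 * be * M + 2 * R * ta) (at ta)" for ta
      by (rule derivative_eq_intros refl | simp)+
     show "((\<lambda>ta. 2 * be * M + 2 * R * ta) has_real_derivative 2 * R) (at 0)"
      by (rule derivative_eq_intros refl | simp)+
    qed (use q in simp_all)
    then show ?thesis by simp
   qed
   then show ?thesis unfolding mixed_deriv_eq[OF C2 S2 zS(2)] using pos by (simp add: M_def D2_def)
  qed
  then show False using nd[of u] u unfolding z2_def by blast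
 qed
 ultimately have "G > 0" by simp
 then show ?thesis unfolding G_def D2_def al_def be_def z1_def z2_def .
qed

text \<open>If (x, q) were a limit of cut pairs, follow the rays slightly beyond their cut points to
  \<open>b' n\<close>. Then \<open>a n\<close> and \<open>b' n\<close> are joined through
  \<open>m n\<close> on the ray and, by a shorter path, through \<open>m'' n\<close>, both at
  distance \<open>de\<close> from \<open>b' n\<close> and both tending to p. But \<open>m n\<close>
  is critical for a weighted sum of two costs that is convex near p by
  \<open>chain_Hessian_pos\<close>, so \<open>m'' n\<close> cannot give a smaller value.\<close>

lemma N0_step:
 assumes ga: "!!u v. u \<in> {0..t'} ==> v \<in> {0..t'} ==> d (ga u) (ga v) = \<bar>u - v\<bar>"
  and s: "0 < s" "s < t'" and prev: "!!u. 0 < u ==> u < s ==> (ga 0, ga u) \<in> N0"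
 shows "(ga 0, ga s) \<in> N0"
proof (rule ccontr)
 define x where "x = ga 0"
 define q where "q = ga s"
 define ka where "ka = chart_at A q"
 define kax where "kax = chart_at A x"
 have ka: "ka \<in> A" "q \<in> fst ka" and kax: "kax \<in> A" "x \<in> fst kax" using chart_at unfolding ka_def kax_def by auto
 assume "(ga 0, ga s) \<notin> N0"
 then have "(x, q) \<notin> N0" by (simp add: x_def q_def)
 then obtain a b where ab: "a \<longlonglongrightarrow> x" "b \<longlonglongrightarrow> q" "!!n. (a n, b n) \<in> cut_locus A g"
  using N0_sequence by metis
 let ?C1 = "coord_cost kax ka c" and ?C2 = "coord_cost ka ka c"
 obtain rh1 where rh1: "rh1 > 0" "!!m m' e. d q m < rh1 ==> d q m' < rh1 ==> d m q = d m' q ==> d m q > 0 ==>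
   (\<lambda>z. e (chart_inv (chart_at A q) z)) differentiable (at (coords A q)) ==>
   (!!z. d m z + e z \<ge> d m q + e q) ==> (!!z. d m' z + e z \<ge> d m' q + e q) ==> m = m'"
  using no_branch[of q] by blast
 obtain rh2 where rh2: "rh2 > 0" "!!x y. d q x < rh2 ==> d q y < rh2 ==> (x, y) \<in> N0" using near_N0[of q] by blast
 have qq: "(q, q) \<in> N0" using rh2 by simp
 have qS: "(snd ka q, snd ka q) \<in> SS ka ka" by (rule SS_in[OF ka(1) ka(1) ka(2) ka(2) qq])
 have nd: "u = 0" if "!!v. mixed_deriv ?C2 (snd ka q, snd ka q) u v = 0" for u
  using mixed_form_nondegenerate(1)[OF qq, of u] that unfolding mixed_form_def coords_def ka_def by simp
 obtain r where r: "r > 0" "ball (snd ka q) r \<times> ball (snd ka q) r \<subseteq> SS ka ka"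
  "!!s t u. s \<in> ball (snd ka q) r ==> t \<in> ball (snd ka q) r ==> (!!v. mixed_deriv ?C2 (s, t) u v = 0) ==> u = 0"
  using twist_injective[OF CC_C2[OF ka(1) ka(1)] SS_open[OF ka(1) ka(1)] qS nd] by blast
 have bI: "ball (snd ka q) r \<subseteq> chart_image ka" using r(1,2) unfolding SS_def by (auto dest!: subsetD)
 have op: "open (chart_inv ka ` ball (snd ka q) r)" by (rule chart_inv_image_open[OF ka(1) open_ball bI])
 have in0: "q \<in> chart_inv ka ` ball (snd ka q) r" using chart_inv_eq[OF ka] r(1) by (intro image_eqI[of _ _ "snd ka q"]) auto
 obtain rh3 where rh3: "rh3 > 0" "!!m. d q m < rh3 ==> m \<in> chart_inv ka ` ball (snd ka q) r" using d_near_open[OF op in0] by metis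
 have near: "m \<in> fst ka \<and> snd ka m \<in> ball (snd ka q) r" if dm: "d q m < rh3" for m
 proof -
  obtain z where z: "z \<in> ball (snd ka q) r" "m = chart_inv ka z" using rh3(2)[OF dm] by blast
  have "z \<in> chart_image ka" using z(1) bI by blast
  then show ?thesis using z chart_eq[OF ka(1)] chart_inv_in[OF ka(1)] by simp
 qed
 obtain rh4 r4 where rh4: "rh4 > 0" "r4 > 0" "!!ga t s. uray ga ==> t \<ge> 0 ==> d q (ga t) < rh4 ==> 0 <= s ==> s <= r4 ==> d (ga t) (ga (t + s)) = s"
  using uray_locally_minimizing[of q] by blast
 \<comment> \<open>Small against all local radii: p and q' lie in the chart, p and its competitors
   are in the range of \<open>no_branch\<close>, and arcs of the rays near q of length up to 3 de /
   2 minimize.\<close>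
 define de where "de = Min {s / 2, (t' - s) / 2, rh1 / 2, rh2 / 4, rh3 / 4, rh4 / 8, r4 / 4}"
 have de: "de <= s / 2" "de <= (t' - s) / 2" "de <= rh1 / 2" "de <= rh2 / 4" "de <= rh3 / 4" "de <= rh4 / 8" "de <= r4 / 4"
  unfolding de_def by (rule Min_le; simp)+
 have de0: "de > 0" unfolding de_def using s rh1(1) rh2(1) rh3(1) rh4(1,2) by (subst Min_gr_iff) auto
 define p where "p = ga (s - de)"
 define q' where "q' = ga (s + de)"
 have dist: "d x p = s - de" "d p q = de" "d q q' = de" "d p q' = 2 * de" "d x q' = s + de" "d x q = s" "d q p = de" "d q' q = de"
  unfolding x_def p_def q_def q'_def using ga de de0 s by auto
 have pka: "p \<in> fst ka" "snd ka p \<in> ball (snd ka q) r" "q' \<in> fst ka" "snd ka q' \<in> ball (snd ka q) r"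
  using near[of p] near[of q'] dist de de0 rh3(1) by auto
 have N: "(x, p) \<in> N0" "(p, q) \<in> N0" "(q, q') \<in> N0" "(q', q) \<in> N0"
  using prev[of "s - de"] rh2(2)[of p q] rh2(2)[of q q'] rh2(2)[of q' q] dist de de0 s rh2(1) by (auto simp: x_def p_def)
 have eq': "(\<lambda>z. d (chart_inv (chart_at A q) z) q') differentiable (at (coords A q))"
  using dist_differentiable[OF N(4)] dist(8) de0 d_eq_0_iff[of q' q] by (simp add: d_sym[of _ q'])
 \<comment> \<open>A cluster point l has the distances of p to x and to q, so x, l, q, q' also lie
   on a minimizing path; non-branching at q, calibrated by the distance to q', gives l = p.\<close>
 have conv: "m \<longlonglongrightarrow> p" if m: "b' \<longlonglongrightarrow> q" "(\<lambda>n. d (a n) (m n)) \<longlonglongrightarrow> s - de" "(\<lambda>n. d (m n) (b' n)) \<longlonglongrightarrow> de" for m b'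
 proof (rule tendsto_unique_cluster[OF compact_cb])
  have "\<forall>\<^sub>F n in sequentially. d (m n) (b' n) < de + 1" using order_tendstoD(2)[OF m(3)] de0 by simp
  moreover have "\<forall>\<^sub>F n in sequentially. d (b' n) q < 1" using order_tendstoD(2)[OF m(1)[unfolded tendsto_iff_d]] by simp
  ultimately show "\<forall>\<^sub>F n in sequentially. m n \<in> cb q (de + 2)"
  proof eventually_elim
   case (elim n)
   then show ?case using d_triangle[of q "m n" "b' n"] d_sym[of q "b' n"] d_sym[of "b' n" "m n"] by (simp add: cb_def)
  qed
  fix r :: "nat => nat" and G l assume r: "strict_mono r" "G ~= bot" "G <= sequentially" "((\<lambda>n. m (r n)) \<longlongrightarrow> l) G"
  have "d x l = s - de"
   by (rule tendsto_unique[OF r(2) tendsto_d[OF tendsto_subseq_filter[OF ab(1) r(1,3)] r(4)] tendsto_subseq_filter[OF m(2) r(1,3)]])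
  moreover have "d l q = de"
   by (rule tendsto_unique[OF r(2) tendsto_d[OF r(4) tendsto_subseq_filter[OF m(1) r(1,3)]] tendsto_subseq_filter[OF m(3) r(1,3)]])
  ultimately have l: "d x l = s - de" "d l q = de" "d q l = de" using d_sym by metis+
  have "p = l"
  proof (rule rh1(2)[OF _ _ _ _ eq'])
   show "d p z + d z q' \<ge> d p q + d q q'" for z using d_triangle[of p q' z] dist by simp
   show "d l z + d z q' \<ge> d l q + d q q'" for z using d_triangle[of l q' z] d_triangle[of x q' l] dist l by simp
  qed (use dist l de de0 rh1(1) in auto)
  then show "l = p" by simp
 qed
 have "\<exists>ga t0. uray ga \<and> ga 0 = a n \<and> t0 > 0 \<and> ga t0 = b n \<and> (\<forall>t\<in>{0..t0}. d (a n) (ga t) = t) \<and> (\<forall>t>t0. d (a n) (ga t) < t)" for n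
  using ab(3)[of n] unfolding cut_locus_iff .
 then obtain Ga T where Ga: "!!n. uray (Ga n)" "!!n. Ga n 0 = a n" "!!n. T n > 0" "!!n. Ga n (T n) = b n"
  "!!n t. t \<in> {0..T n} ==> d (a n) (Ga n t) = t" "!!n t. t > T n ==> d (a n) (Ga n t) < t" by metis
 have Tlim: "T \<longlonglongrightarrow> s"
 proof -
  have "(\<lambda>n. d (a n) (b n)) \<longlonglongrightarrow> s" using tendsto_d[OF ab(1,2)] dist(6) by simp
  moreover have "d (a n) (b n) = T n" for n using Ga(4)[of n] Ga(5)[of "T n" n] Ga(3)[of n] by simp
  ultimately show ?thesis by simp
 qed
 define ep where "ep n = 1 / (real n + 1)" for n
 have eps: "ep n > 0" for n by (simp add: ep_def)
 have epslim: "ep \<longlonglongrightarrow> 0" unfolding ep_def using LIMSEQ_inverse_real_of_nat by (simp add: inverse_eq_divide add.commute)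
 \<comment> \<open>Beyond its cut time T n the ray no longer minimizes, whence the strict inequality
   \<open>Delt\<close>; as ep n tends to 0, the points still tend to q.\<close>
 define b' where "b' n = Ga n (T n + ep n)" for n
 define th where "th n = T n + ep n - de" for n
 define m where "m n = Ga n (th n)" for n
 \<comment> \<open>An auxiliary point on the ray half a step before \<open>m n\<close>: the arc from
   it through \<open>m n\<close> to \<open>b' n\<close> is minimizing, which expresses in terms of
   distances that the ray has no corner at \<open>m n\<close>.\<close>
 define w where "w n = Ga n (th n - de / 2)" for n
 define De where "De n = d (a n) (b' n)" for n
 have Delt: "De n < T n + ep n" for n unfolding De_def b'_def using Ga(6)[of n "T n + ep n"] eps[of n] by simp
 have thlim: "th \<longlonglongrightarrow> s - de" unfolding th_def using tendsto_diff[OF tendsto_add[OF Tlim epslim] tendsto_const[of de]] by simp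
 have b'lim: "b' \<longlonglongrightarrow> q"
  unfolding tendsto_iff_d
 proof (rule Lim_null_comparison)
  show "\<forall>\<^sub>F n in sequentially. norm (d (b' n) q) <= ep n + d (b n) q"
  proof (intro always_eventually allI)
   fix n
   have "d (b' n) (b n) <= \<bar>ep n\<bar>" unfolding b'_def Ga(4)[symmetric]
    using uray_lipschitz_abs[OF Ga(1), of "T n + ep n" "T n" n] Ga(3)[of n] eps[of n] by simp
   then show "norm (d (b' n) q) <= ep n + d (b n) q" using d_triangle[of "b' n" q "b n"] eps[of n] by (simp add: d_nonneg)
  qed
  show "(\<lambda>n. ep n + d (b n) q) \<longlonglongrightarrow> 0" using tendsto_add[OF epslim ab(2)[unfolded tendsto_iff_d]] by simp
 qed
 have Delim: "De \<longlonglongrightarrow> s" unfolding De_def using tendsto_d[OF ab(1) b'lim] dist(6) by simp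
 have ev1: "\<forall>\<^sub>F n in sequentially. ep n < de / 2 \<and> th n > de / 2 \<and> De n > de \<and> d (b n) q < de"
 proof (intro eventually_conj)
  show "\<forall>\<^sub>F n in sequentially. ep n < de / 2" using order_tendstoD(2)[OF epslim, of "de/2"] de0 by simp
  show "\<forall>\<^sub>F n in sequentially. th n > de / 2" using order_tendstoD(1)[OF thlim, of "de/2"] de0 de(1) by simp
  show "\<forall>\<^sub>F n in sequentially. De n > de" using order_tendstoD(1)[OF Delim, of de] de0 de(1) by simp
  show "\<forall>\<^sub>F n in sequentially. d (b n) q < de" using order_tendstoD(2)[OF ab(2)[unfolded tendsto_iff_d], of de] de0 by simp
 qed
 have geo: "d (a n) (m n) = th n \<and> d (m n) (b' n) = de \<and> d (w n) (m n) = de / 2 \<and> d (w n) (b' n) = 3 * de / 2 \<and> d (a n) (w n) = th n - de / 2 \<and>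
   d q (m n) < rh2 \<and> d q (w n) < rh2 \<and> d q (b' n) < rh2 \<and> d q (b' n) < rh3 \<and> d q (m n) < rh3"
  if n: "ep n < de / 2 \<and> th n > de / 2 \<and> De n > de \<and> d (b n) q < de" for n
 proof -
  have near_q: "d q (Ga n t) < 4 * de" if "t \<ge> 0" "\<bar>t - T n\<bar> <= 2 * de" for t
  proof -
   have "d (b n) (Ga n t) <= \<bar>T n - t\<bar>" unfolding Ga(4)[symmetric] using uray_lipschitz_abs[OF Ga(1)] Ga(3)[of n] that by simp
   then show ?thesis using d_triangle[of q "Ga n t" "b n"] d_sym[of q "b n"] n that(2) abs_minus_commute[of t "T n"] de0 by simp
  qed
  have tt: "th n \<ge> 0" "th n - de / 2 \<ge> 0" "th n <= T n" "\<bar>th n - T n\<bar> <= 2 * de" "\<bar>th n - de / 2 - T n\<bar> <= 2 * de" "\<bar>T n + ep n - T n\<bar> <= 2 * de" "T n + ep n \<ge> 0"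
   using n de0 eps[of n] Ga(3)[of n] by (auto simp: th_def)
  have "d (m n) (Ga n (th n + de)) = de" unfolding m_def
   using rh4(3)[OF Ga(1) tt(1), of n de] near_q[OF tt(1,4)] de de0 by simp
  moreover have "d (w n) (Ga n (th n - de / 2 + de / 2)) = de / 2" unfolding w_def
   using rh4(3)[OF Ga(1) tt(2), of n "de / 2"] near_q[OF tt(2,5)] de de0 by simp
  moreover have "d (w n) (Ga n (th n - de / 2 + 3 * de / 2)) = 3 * de / 2" unfolding w_def
   using rh4(3)[OF Ga(1) tt(2), of n "3 * de / 2"] near_q[OF tt(2,5)] de de0 by simp
  moreover have "th n + de = T n + ep n" "th n - de / 2 + de / 2 = th n" "th n - de / 2 + 3 * de / 2 = T n + ep n" by (auto simp: th_def)
  moreover have "d (a n) (m n) = th n" "d (a n) (w n) = th n - de / 2" unfolding m_def w_def using Ga(5)[of _ n] tt de0 by auto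
  moreover have "d q (m n) < 4 * de" "d q (w n) < 4 * de" "d q (b' n) < 4 * de" unfolding m_def w_def b'_def using near_q tt by auto
  ultimately show ?thesis using de by (simp add: b'_def m_def[symmetric])
 qed
 have mlim: "m \<longlonglongrightarrow> p"
 proof (rule conv[OF b'lim])
  show "(\<lambda>n. d (a n) (m n)) \<longlonglongrightarrow> s - de" by (rule Lim_transform_eventually[OF thlim]) (use ev1 in eventually_elim, use geo in simp)
  show "(\<lambda>n. d (m n) (b' n)) \<longlonglongrightarrow> de" by (rule Lim_transform_eventually[OF tendsto_const]) (use ev1 in eventually_elim, use geo in simp)
 qed
 have "\<exists>m''. De n > de --> d (a n) m'' = De n - de \<and> d m'' (b' n) = de" for n
 proof (cases "De n > de")
  case True
  then have "0 <= De n - de" "De n - de <= d (a n) (b' n)" using de0 by (auto simp: De_def)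
  from between_point[OF this] obtain z where "d (a n) z = De n - de" "d z (b' n) = d (a n) (b' n) - (De n - de)" by blast
  then show ?thesis by (intro exI[of _ z]) (simp add: De_def)
 qed simp
 then obtain m'' where m'': "!!n. De n > de ==> d (a n) (m'' n) = De n - de" "!!n. De n > de ==> d (m'' n) (b' n) = de" by metis
 have m''lim: "m'' \<longlonglongrightarrow> p"
 proof (rule conv[OF b'lim])
  have "(\<lambda>n. De n - de) \<longlonglongrightarrow> s - de" by (intro tendsto_intros Delim)
  then show "(\<lambda>n. d (a n) (m'' n)) \<longlonglongrightarrow> s - de" by (rule Lim_transform_eventually) (use ev1 in eventually_elim, use m'' in simp)
  show "(\<lambda>n. d (m'' n) (b' n)) \<longlonglongrightarrow> de" by (rule Lim_transform_eventually[OF tendsto_const]) (use ev1 in eventually_elim, use m'' in simp)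
 qed
 define D2 where "D2 C z u v = pd (pd C u) v z" for C :: "'e \<times> 'e => real" and z u v
 \<comment> \<open>Weights and points are bundled into one parameter, so that the Hessian is a
   single continuous family of bilinear forms and \<open>bilinear_form_ratio\<close> gives one ball
   on which it stays nonnegative.\<close>
 define S where "S = {P :: real \<times> real \<times> 'e \<times> 'e \<times> 'e. (fst (snd (snd P)), fst (snd (snd (snd P)))) \<in> SS kax ka \<and> (fst (snd (snd (snd P))), snd (snd (snd (snd P)))) \<in> SS ka ka}"
 define H where "H P u v = fst P * D2 ?C1 (fst (snd (snd P)), fst (snd (snd (snd P)))) (0, u) (0, v)
   + fst (snd P) * D2 ?C2 (fst (snd (snd (snd P))), snd (snd (snd (snd P)))) (u, 0) (v, 0)" for P :: "real \<times> real \<times> 'e \<times> 'e \<times> 'e" and u v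
 define P0 where "P0 = (1 / deriv f (d x p), 1 / deriv f (d p q), snd kax x, snd ka p, snd ka q)"
 have Sop: "open S"
 proof -
  have "S = (\<lambda>P. (fst (snd (snd P)), fst (snd (snd (snd P))))) -` SS kax ka \<inter> (\<lambda>P. (fst (snd (snd (snd P))), snd (snd (snd (snd P))))) -` SS ka ka"
   unfolding S_def by auto
  moreover have "open ((\<lambda>P :: real \<times> real \<times> 'e \<times> 'e \<times> 'e. (fst (snd (snd P)), fst (snd (snd (snd P))))) -` SS kax ka)"
   by (rule open_vimage[OF SS_open[OF kax(1) ka(1)]]) (intro continuous_intros)
  moreover have "open ((\<lambda>P :: real \<times> real \<times> 'e \<times> 'e \<times> 'e. (fst (snd (snd (snd P))), snd (snd (snd (snd P))))) -` SS ka ka)"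
   by (rule open_vimage[OF SS_open[OF ka(1) ka(1)]]) (intro continuous_intros)
  ultimately show ?thesis by (simp add: open_Int)
 qed
 have P0S: "P0 \<in> S" unfolding S_def P0_def using SS_in[OF kax(1) ka(1) kax(2) pka(1) N(1)] SS_in[OF ka(1) ka(1) pka(1) ka(2) N(2)] by simp
 have Hbil: "bilinear (H P)" if "P \<in> S" for P
 proof -
  have b: "bilinear (D2 ?C1 (fst (snd (snd P)), fst (snd (snd (snd P)))))" "bilinear (D2 ?C2 (fst (snd (snd (snd P))), snd (snd (snd (snd P)))))"
   unfolding D2_def using that unfolding S_def
   by (auto intro!: frechet_second_bilinear[OF CC_C2[OF kax(1) ka(1)] SS_open[OF kax(1) ka(1)]] frechet_second_bilinear[OF CC_C2[OF ka(1) ka(1)] SS_open[OF ka(1) ka(1)]])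
  have e: "(0, u + v) = (0, u) + (0::'e, v)" "(u + v, 0) = (u, 0) + (v, 0::'e)" "(0, k *\<^sub>R u) = k *\<^sub>R (0::'e, u)" "(k *\<^sub>R u, 0) = k *\<^sub>R (u, 0::'e)" for u v :: 'e and k by simp_all
  show ?thesis unfolding bilinear_def H_def
   by (intro conjI allI linearI; simp only: e bilinear_ladd[OF b(1)] bilinear_ladd[OF b(2)] bilinear_radd[OF b(1)] bilinear_radd[OF b(2)]
    bilinear_lmul[OF b(1)] bilinear_lmul[OF b(2)] bilinear_rmul[OF b(1)] bilinear_rmul[OF b(2)]; simp add: algebra_simps)
 qed
 have D2cont: "continuous_on (SS k ka) (\<lambda>z. D2 (coord_cost k ka c) z u v)" if "k \<in> A" for k u v
 proof -
  have "C_k_on (Suc (Suc 0)) (coord_cost k ka c) (SS k ka)" using CC_C2[OF that ka(1)] by (simp only: numeral_2_eq_2)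
  from C_k_on_continuous[OF C_k_on_frechet[OF C_k_on_frechet[OF this]]] show ?thesis unfolding D2_def .
 qed
 have Hcont: "continuous_on S (\<lambda>P. H P u v)" for u v
  unfolding H_def
  by (intro continuous_intros continuous_on_compose2[OF D2cont[OF kax(1)]] continuous_on_compose2[OF D2cont[OF ka(1)]]) (auto simp: S_def)
 have Hpos: "H P0 u u > 0" if "u ~= 0" for u
 proof -
  have nd': "w = 0" if "!!v. mixed_deriv ?C2 (snd ka p, snd ka q) w v = 0" for w
   by (rule r(3)[OF pka(2) _ that]) (use r(1) in simp)
  show ?thesis using chain_Hessian_pos[OF kax ka(1) pka(1) ka(2) pka(3) N(1-3) _ _ _ _ nd' that] dist de de0 s unfolding H_def D2_def P0_def by simp
 qed
 obtain R where R: "R > 0" "ball P0 R \<subseteq> S" "!!P u. P \<in> ball P0 R ==> (1 - 1/2) * H P0 u u <= H P u u"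
  using bilinear_form_ratio[OF Sop P0S Hbil Hcont Hpos, of "1/2"] by auto
 have H0: "H P u u \<ge> 0" if "P \<in> ball P0 R" for P u
 proof -
  have "H P0 u u \<ge> 0" using Hpos[of u] bilinear_lzero[OF Hbil[OF P0S]] by (cases "u = 0") (auto intro: less_imp_le)
  then show ?thesis using R(3)[OF that, of u] by simp
 qed
 define Q where "Q n z = (1 / deriv f (th n), 1 / deriv f de, snd kax (a n), z, snd ka (b' n))" for n and z :: 'e
 have P0eq: "P0 = (1 / deriv f (s - de), 1 / deriv f de, snd kax x, snd ka p, snd ka q)" unfolding P0_def dist ..
 have Qlim: "(\<lambda>n. Q n (snd ka (h n))) \<longlonglongrightarrow> P0" if "h \<longlonglongrightarrow> p" for h
  unfolding Q_def P0eq
 proof (intro tendsto_intros)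
  show "(\<lambda>n. deriv f (th n)) \<longlonglongrightarrow> deriv f (s - de)" by (rule isCont_tendsto_compose[OF f_deriv_cont thlim])
  show "deriv f (s - de) ~= 0" using f_deriv_pos[of "s - de"] de(1) s(1) by simp
  show "(\<lambda>n. snd kax (a n)) \<longlonglongrightarrow> snd kax x" by (rule isCont_tendsto_compose[OF chart_isCont(1)[OF kax] ab(1)])
  show "(\<lambda>n. snd ka (h n)) \<longlonglongrightarrow> snd ka p" by (rule isCont_tendsto_compose[OF chart_isCont(1)[OF ka(1) pka(1)] that])
  show "(\<lambda>n. snd ka (b' n)) \<longlonglongrightarrow> snd ka q" by (rule isCont_tendsto_compose[OF chart_isCont(1)[OF ka] b'lim])
 qed
 have evQ: "\<forall>\<^sub>F n in sequentially. Q n (snd ka (h n)) \<in> ball P0 R" if "h \<longlonglongrightarrow> p" for h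
  using tendstoD[OF Qlim[OF that] R(1)] by eventually_elim (simp add: dist_commute)
 have evka: "\<forall>\<^sub>F n in sequentially. h n \<in> fst k" if "h \<longlonglongrightarrow> l" "k \<in> A" "l \<in> fst k" for h l k
  by (rule topological_tendstoD[OF that(1) chart_open(1)[OF that(2)] that(3)])
 have evN: "\<forall>\<^sub>F n in sequentially. (a n, m n) \<in> N0"
  by (rule topological_tendstoD[OF tendsto_Pair[OF ab(1) mlim]]) (use N(1) in \<open>auto simp: N0_def\<close>)
 from eventually_happens'[OF sequentially_bot eventually_conj[OF ev1 eventually_conj[OF evQ[OF mlim] eventually_conj[OF evQ[OF m''lim]
  eventually_conj[OF evka[OF mlim ka(1) pka(1)] eventually_conj[OF evka[OF m''lim ka(1) pka(1)] eventually_conj[OF evka[OF ab(1) kax] evN]]]]]]]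
 obtain n where n: "ep n < de / 2 \<and> th n > de / 2 \<and> De n > de \<and> d (b n) q < de" "Q n (snd ka (m n)) \<in> ball P0 R" "Q n (snd ka (m'' n)) \<in> ball P0 R"
  "m n \<in> fst ka" "m'' n \<in> fst ka" "a n \<in> fst kax" "(a n, m n) \<in> N0" by auto
 note gn = geo[OF n(1)]
 have b'ka: "b' n \<in> fst ka" using near[of "b' n"] gn by blast
 define al where "al = 1 / deriv f (th n)"
 define be where "be = 1 / deriv f de"
 have thpos: "th n > 0" using n(1) de0 by simp
 have pos: "al > 0" "be > 0" using f_deriv_pos[OF thpos] f_deriv_pos[OF de0] by (auto simp: al_def be_def)
 define z where "z = snd ka (m n)"
 define v where "v = snd ka (m'' n) - z"
 define y1 where "y1 = (snd kax (a n), z)"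
 define y2 where "y2 = (z, snd ka (b' n))"
 define h where "h ta = al * ?C1 (y1 + ta *\<^sub>R (0, v)) + be * ?C2 (y2 + ta *\<^sub>R (v, 0))" for ta
 define h' where "h' ta = al * pd ?C1 (0, v) (y1 + ta *\<^sub>R (0, v)) + be * pd ?C2 (v, 0) (y2 + ta *\<^sub>R (v, 0))" for ta
 \<comment> \<open>For fixed n the parameter \<open>Q n z\<close> is affine in z and balls are
   convex; so the Hessian is nonnegative on the whole coordinate segment from \<open>m n\<close> to
   \<open>m'' n\<close>.\<close>
 have segQ: "Q n (z + ta *\<^sub>R v) \<in> ball P0 R" if "0 <= ta" "ta <= 1" for ta
 proof -
  have "(1 - ta) *\<^sub>R Q n z + ta *\<^sub>R Q n (snd ka (m'' n)) \<in> ball P0 R"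
   by (rule convexD_alt[OF convex_ball]) (use n(2,3) that in \<open>auto simp: z_def\<close>)
  moreover have "(1 - ta) *\<^sub>R Q n z + ta *\<^sub>R Q n (snd ka (m'' n)) = Q n (z + ta *\<^sub>R v)"
   unfolding Q_def v_def by (simp add: algebra_simps flip: add_divide_distrib)
  ultimately show ?thesis by simp
 qed
 have yS: "y1 + ta *\<^sub>R (0, v) \<in> SS kax ka" "y2 + ta *\<^sub>R (v, 0) \<in> SS ka ka" if "0 <= ta" "ta <= 1" for ta
  using subsetD[OF R(2) segQ[OF that]] by (auto simp: S_def Q_def y1_def y2_def)
 have dh: "(h has_real_derivative h' ta) (at ta)" if "0 <= ta" "ta <= 1" for ta
  unfolding h_def h'_def
  by (rule DERIV_add[OF DERIV_cmult[OF has_derivative_along_line[OF CC_has_derivative[OF kax(1) ka(1) yS(1)[OF that]]]]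
   DERIV_cmult[OF has_derivative_along_line[OF CC_has_derivative[OF ka(1) ka(1) yS(2)[OF that]]]]])
 have dh': "(h' has_real_derivative H (Q n (z + ta *\<^sub>R v)) v v) (at ta)" if t: "0 <= ta" "ta <= 1" for ta
 proof -
  have dd: "((\<lambda>ta. pd (coord_cost k ka c) w (y + ta *\<^sub>R w)) has_real_derivative D2 (coord_cost k ka c) (y + ta *\<^sub>R w) w w) (at ta)"
   if "k \<in> A" "y + ta *\<^sub>R w \<in> SS k ka" for k y w
  proof -
   have "C_k_on (Suc (Suc 0)) (coord_cost k ka c) (SS k ka)" using CC_C2[OF that(1) ka(1)] by (simp only: numeral_2_eq_2)
   from C_k_on_has_derivative[OF C_k_on_frechet[OF this] that(2)]
   show ?thesis unfolding D2_def by (rule has_derivative_along_line)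
  qed
  have "(h' has_real_derivative al * D2 ?C1 (y1 + ta *\<^sub>R (0, v)) (0, v) (0, v) + be * D2 ?C2 (y2 + ta *\<^sub>R (v, 0)) (v, 0) (v, 0)) (at ta)"
   unfolding h'_def by (rule DERIV_add[OF DERIV_cmult[OF dd[OF kax(1) yS(1)[OF t]]] DERIV_cmult[OF dd[OF ka(1) yS(2)[OF t]]]])
  then show ?thesis by (simp add: H_def Q_def y1_def y2_def al_def be_def)
 qed
 \<comment> \<open>Criticality of \<open>m n\<close>: the distance from \<open>w n\<close> plus that
   to \<open>b' n\<close> is minimal there, and so is the distance from \<open>w n\<close> minus
   that from \<open>a n\<close>. Eliminating the derivative of the distance from \<open>w n\<close>
   makes the derivatives of the other two cancel, and the weights translate this to costs.\<close>
 have h'0: "h' 0 = 0"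
 proof -
  have ne: "a n ~= m n" "m n ~= b' n" "w n ~= m n" using gn thpos de0 by auto
  have N': "(m n, b' n) \<in> N0" "(w n, m n) \<in> N0" using rh2(2) gn by auto
  note e1 = dist_has_derivative[OF n(7) ne(1) ka(1) n(4) kax(1) n(6)]
  note e2 = dist_has_derivative_fst[OF N'(1) ne(2) ka(1) n(4) ka(1) b'ka]
  note e0 = dist_has_derivative[OF N'(2) ne(3) ka(1) n(4) chart_at(1,2)]
  have inv: "chart_inv ka (snd ka (m n)) = m n" by (rule chart_inv_eq[OF ka(1) n(4)])
  define E0 where "E0 h = pd (coord_cost (chart_at A (w n)) ka c) (0, h) (snd (chart_at A (w n)) (w n), snd ka (m n)) / deriv f (d (w n) (m n))" for h
  have s1: "(\<lambda>h. E0 h + pd ?C2 (h, 0) (snd ka (m n), snd ka (b' n)) / deriv f (d (m n) (b' n))) = (\<lambda>h. 0)"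
   unfolding E0_def
  proof (rule has_derivative_local_min[OF has_derivative_add[OF e0 e2]])
   show "\<forall>\<^sub>F y in at (snd ka (m n)). d (w n) (chart_inv ka (snd ka (m n))) + d (chart_inv ka (snd ka (m n))) (b' n) <= d (w n) (chart_inv ka y) + d (chart_inv ka y) (b' n)"
   proof (intro always_eventually allI)
    fix y show "d (w n) (chart_inv ka (snd ka (m n))) + d (chart_inv ka (snd ka (m n))) (b' n) <= d (w n) (chart_inv ka y) + d (chart_inv ka y) (b' n)"
     unfolding inv using gn d_triangle[of "w n" "b' n" "chart_inv ka y"] by linarith
   qed
  qed
  have s2: "(\<lambda>h. E0 h - pd ?C1 (0, h) (snd kax (a n), snd ka (m n)) / deriv f (d (a n) (m n))) = (\<lambda>h. 0)"
   unfolding E0_def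
  proof (rule has_derivative_local_min[OF has_derivative_diff[OF e0 e1]])
   show "\<forall>\<^sub>F y in at (snd ka (m n)). d (w n) (chart_inv ka (snd ka (m n))) - d (a n) (chart_inv ka (snd ka (m n))) <= d (w n) (chart_inv ka y) - d (a n) (chart_inv ka y)"
   proof (intro always_eventually allI)
    fix y show "d (w n) (chart_inv ka (snd ka (m n))) - d (a n) (chart_inv ka (snd ka (m n))) <= d (w n) (chart_inv ka y) - d (a n) (chart_inv ka y)"
     unfolding inv using gn d_triangle[of "a n" "chart_inv ka y" "w n"] by linarith
   qed
  qed
  have "pd ?C1 (0, v) (snd kax (a n), snd ka (m n)) / deriv f (d (a n) (m n)) + pd ?C2 (v, 0) (snd ka (m n), snd ka (b' n)) / deriv f (d (m n) (b' n)) = 0"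
   using fun_cong[OF s1, of v] fun_cong[OF s2, of v] by simp
  then show ?thesis unfolding h'_def y1_def y2_def al_def be_def z_def using gn by simp
 qed
 have h'nn: "h' ta \<ge> 0" if t: "0 <= ta" "ta <= 1" for ta
 proof -
  have "h' 0 <= h' ta"
  proof (rule DERIV_nonneg_imp_nondecreasing[OF t(1)])
   fix y assume "0 <= y" "y <= ta"
   then show "\<exists>l. (h' has_real_derivative l) (at y) \<and> 0 <= l"
    using dh'[of y] H0[OF segQ[of y], of v] t by auto
  qed
  then show ?thesis using h'0 by simp
 qed
 have "h 0 <= h 1"
 proof (rule DERIV_nonneg_imp_nondecreasing[of 0 1 h])
  fix ta :: real assume t: "0 <= ta" "ta <= 1"
  show "\<exists>l. (h has_real_derivative l) (at ta) \<and> 0 <= l" using dh[OF t] h'nn[OF t] by blast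
 qed simp
 moreover have "h 0 = al * f (th n) + be * f de"
  unfolding h_def y1_def y2_def z_def
  by (simp add: coord_cost_eq chart_inv_eq[OF kax(1) n(6)] chart_inv_eq[OF ka(1) n(4)] chart_inv_eq[OF ka(1) b'ka] gn)
 moreover have "h 1 = al * f (De n - de) + be * f de"
 proof -
  have "De n > de" using n(1) by blast
  note mm = m''[OF this]
  show ?thesis unfolding h_def y1_def y2_def v_def
   by (simp add: coord_cost_eq chart_inv_eq[OF kax(1) n(6)] chart_inv_eq[OF ka(1) n(5)] chart_inv_eq[OF ka(1) b'ka] mm)
 qed
 moreover have "al * f (De n - de) < al * f (th n)"
 proof (rule mult_strict_left_mono[OF f_less pos(1)])
  show "0 <= De n - de" "De n - de < th n" using n(1) Delt[of n] by (auto simp: th_def)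
 qed
 ultimately show False by linarith
qed

text \<open>The bad times form a closed set because \<open>N0\<close> is open, and times near 0 are
  good. There would thus be a first bad time, which \<open>N0_step\<close> excludes.\<close>

lemma N0_along:
 assumes ga: "!!u v. u \<in> {0..t'} ==> v \<in> {0..t'} ==> d (ga u) (ga v) = \<bar>u - v\<bar>" and L: "0 < L" "L < t'"
 shows "(ga 0, ga L) \<in> N0"
proof (rule ccontr)
 assume bad: "(ga 0, ga L) \<notin> N0"
 obtain rh where rh: "rh > 0" "!!x y. d (ga 0) x < rh ==> d (ga 0) y < rh ==> (x, y) \<in> N0" using near_N0[of "ga 0"] by blast
 have small: "(ga 0, ga u) \<in> N0" if "0 <= u" "u < rh" "u <= L" for u
  using rh(2)[of "ga 0" "ga u"] ga[of 0 u] that L rh(1) by simp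
 let ?B = "{rh/2..L} \<inter> (\<lambda>s. (ga 0, ga s)) -` (- N0)"
 have cont: "continuous_on {rh/2..L} (\<lambda>s. (ga 0, ga s))"
 proof (intro continuous_on_Pair continuous_on_const)
  show "continuous_on {rh/2..L} ga"
   unfolding continuous_on_def tendsto_iff_d
  proof
   fix t assume t: "t \<in> {rh/2..L}"
   show "((\<lambda>s. d (ga s) (ga t)) \<longlongrightarrow> 0) (at t within {rh/2..L})"
   proof (rule Lim_null_comparison)
    show "\<forall>\<^sub>F s in at t within {rh/2..L}. norm (d (ga s) (ga t)) <= \<bar>s - t\<bar>"
     unfolding eventually_at_filter using ga t L rh(1) by (intro always_eventually) auto
    have "((\<lambda>s. \<bar>s - t\<bar>) \<longlongrightarrow> \<bar>t - t\<bar>) (at t within {rh/2..L})" by (intro tendsto_intros)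
    then show "((\<lambda>s. \<bar>s - t\<bar>) \<longlongrightarrow> 0) (at t within {rh/2..L})" by simp
   qed
  qed
 qed
 have "closed ?B" by (rule continuous_closed_preimage[OF cont]) (auto simp: N0_def)
 then have "compact ?B" by (metis compact_Icc compact_Int_closed inf.absorb_iff2 inf_le1)
 moreover have "L \<in> ?B" using bad small[of L] L rh(1) by force
 ultimately obtain s where s: "s \<in> ?B" "!!u. u \<in> ?B ==> s <= u" using compact_attains_inf[of ?B] by blast
 have "(ga 0, ga s) \<in> N0"
 proof (rule N0_step[OF ga])
  show "0 < s" "s < t'" using s(1) rh(1) L by auto
  fix u assume u: "0 < u" "u < s"
  show "(ga 0, ga u) \<in> N0"
  proof (cases "u < rh/2")
   case True then show ?thesis using small[of u] u s(1) rh(1) by auto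
  next
   case False
   then have "u \<in> {rh/2..L}" using u s(1) by auto
   then show ?thesis using s(2)[of u] u by auto
  qed
 qed
 then show False using s(1) by blast
qed

text \<open>If (x, y) were not interior, rays through cut pairs tending to (x, y) would have a limit
  ray from x that minimizes up to y. Since (x, y) is not a cut pair, it minimizes beyond y, and
  \<open>N0_along\<close> gives the contradiction.\<close>

theorem not_cut_imp_N0:
 assumes nc: "(x, y) \<notin> cut_locus A g"
 shows "(x, y) \<in> N0"
proof (rule ccontr)
 assume n0: "(x, y) \<notin> N0"
 have "x ~= y" using n0 near_N0[of x] by force
 define L where "L = d x y"
 have L: "L > 0" unfolding L_def using \<open>x ~= y\<close> d_nonneg[of x y] d_eq_0_iff[of x y] by linarith
 obtain a b where ab: "a \<longlonglongrightarrow> x" "b \<longlonglongrightarrow> y" "!!n. (a n, b n) \<in> cut_locus A g" "!!n. d x (a n) < 1"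
  using N0_sequence[OF n0] by metis
 have "\<exists>ga t0. uray ga \<and> ga 0 = a n \<and> t0 > 0 \<and> ga t0 = b n \<and> (\<forall>t\<in>{0..t0}. d (a n) (ga t) = t) \<and> (\<forall>t>t0. d (a n) (ga t) < t)" for n
  using ab(3)[of n] unfolding cut_locus_iff .
 then obtain Ga T where Ga: "!!n. uray (Ga n)" "!!n. Ga n 0 = a n" "!!n. T n > 0" "!!n. Ga n (T n) = b n"
  "!!n t. t \<in> {0..T n} ==> d (a n) (Ga n t) = t" by metis
 have Tlim: "T \<longlonglongrightarrow> L"
 proof -
  have "(\<lambda>n. d (a n) (b n)) \<longlonglongrightarrow> L" using tendsto_d[OF ab(1,2)] by (simp add: L_def)
  moreover have "d (a n) (b n) = T n" for n using Ga(4)[of n] Ga(5)[of "T n" n] Ga(3)[of n] by simp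
  ultimately show ?thesis by simp
 qed
 \<comment> \<open>The ray property speaks of nonnegative times only, so negative parameters are
   frozen at 0 before the limit in the product is taken.\<close>
 obtain G ga where G: "G ~= bot" "G <= sequentially" "!!t. ((\<lambda>n. Ga n (max 0 t)) \<longlongrightarrow> ga t) G"
 proof (rule pointwise_cluster[of "\<lambda>t. cb x (1 + max 0 t)" "\<lambda>n t. Ga n (max 0 t)"])
  show "compact (cb x (1 + max 0 t))" for t by (rule compact_cb)
  show "Ga n (max 0 t) \<in> cb x (1 + max 0 t)" for n t
   using uray_lipschitz[OF Ga(1)[of n], of 0 "max 0 t"] Ga(2)[of n] ab(4)[of n] d_triangle[of x "Ga n (max 0 t)" "a n"] by (simp add: cb_def)
 qed (rule that)
 have lim: "((\<lambda>n. Ga n t) \<longlongrightarrow> ga t) G" if "t \<ge> 0" for t using G(3)[of t] that by (simp add: max_def)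
 have ray: "uray ga" by (rule uray_limit[OF Ga(1) G(1) lim])
 have g0: "ga 0 = x"
  using tendsto_unique[OF G(1) lim[of 0]] tendsto_mono[OF G(2) ab(1)] Ga(2) by simp
 have gL: "ga L = y"
 proof -
  have "d (ga L) y = 0"
  proof (rule tendsto_unique[OF G(1) tendsto_d[OF lim tendsto_mono[OF G(2) ab(2)]]])
   show "L \<ge> 0" using L by simp
   show "((\<lambda>n. d (Ga n L) (b n)) \<longlongrightarrow> 0) G"
   proof (rule Lim_null_comparison)
    show "\<forall>\<^sub>F n in G. norm (d (Ga n L) (b n)) <= \<bar>L - T n\<bar>"
    proof (intro always_eventually allI)
     fix n show "norm (d (Ga n L) (b n)) <= \<bar>L - T n\<bar>"
      using uray_lipschitz_abs[OF Ga(1)[of n], of L "T n"] L Ga(3)[of n] Ga(4)[of n] by (simp add: d_nonneg)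
    qed
    have "((\<lambda>n. \<bar>L - T n\<bar>) \<longlongrightarrow> \<bar>L - L\<bar>) G" by (intro tendsto_intros tendsto_mono[OF G(2) Tlim])
    then show "((\<lambda>n. \<bar>L - T n\<bar>) \<longlongrightarrow> 0) G" by simp
   qed
  qed
  then show ?thesis by (simp add: d_eq_0_iff)
 qed
 have min: "d x (ga t) = t" if "t \<in> {0..L}" for t
  using uray_lipschitz[OF ray, of 0 t] uray_lipschitz[OF ray, of t L] that g0 gL d_triangle[of x y "ga t"] L_def by simp
 obtain t' where t': "t' > L" "d x (ga t') \<ge> t'"
  using nc ray g0 L gL min unfolding cut_locus_iff by (metis not_less)
 have eq: "d x (ga t') = t'" using t' uray_lipschitz[OF ray, of 0 t'] g0 L by simp
 have "d (ga u) (ga v) = \<bar>u - v\<bar>" if uv: "u \<in> {0..t'}" "v \<in> {0..t'}" for u v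
 proof -
  have le: "d (ga u) (ga v) = v - u" if "0 <= u" "u <= v" "v <= t'" for u v
   using uray_lipschitz[OF ray, of 0 u] uray_lipschitz[OF ray, of u v] uray_lipschitz[OF ray, of v t'] that g0 eq
    d_triangle[of x "ga t'" "ga u"] d_triangle[of "ga u" "ga t'" "ga v"] by simp
  show ?thesis using le[of u v] le[of v u] uv d_sym[of "ga u" "ga v"] by (cases "u <= v") auto
 qed
 from N0_along[OF this L t'(1)] show False using n0 g0 gL by simp
qed

end

section \<open>Distances under a Riemannian submersion\<close>

locale submersion_manifolds = M: cmanifold AM gM + B: cmanifold AB gB
 for AM :: "('m::{t2_space,second_countable_topology}, 'e::euclidean_space) chart set"
  and gM :: "'m => 'e => 'e => real"
  and AB :: "('b::{t2_space,second_countable_topology}, 'f::euclidean_space) chart set"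
  and gB :: "'b => 'f => 'f => real" +
 fixes \<pi> :: "'m => 'b"
 assumes submersion: "riemannian_submersion AM gM AB gB \<pi>"
begin

definition \<pi>c :: "'m => 'e => 'f" where
 "\<pi>c y = snd (chart_at AB (\<pi> y)) \<circ> \<pi> \<circ> chart_inv (chart_at AM y)"

definition \<pi>c_dom :: "'m => 'e set" where
 "\<pi>c_dom y = snd (chart_at AM y) ` (fst (chart_at AM y) \<inter> \<pi> -` fst (chart_at AB (\<pi> y)))"

abbreviation D where "D \<equiv> differential AM AB \<pi>"

lemma \<pi>_cont: "isCont \<pi> y"
 using submersion unfolding riemannian_submersion_def smooth_map_def
 by (simp add: continuous_on_eq_continuous_at)

lemma \<pi>c_dom_open: "open (\<pi>c_dom y)"
 unfolding \<pi>c_dom_def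
proof (rule M.chart_image_open[OF M.chart_at(1)])
 have "open (\<pi> -` fst (chart_at AB (\<pi> y)))"
  by (rule open_vimage[OF B.chart_open(1)[OF B.chart_at(1)]])
   (use \<pi>_cont in \<open>simp add: continuous_on_eq_continuous_at\<close>)
 then show "open (fst (chart_at AM y) \<inter> \<pi> -` fst (chart_at AB (\<pi> y)))"
  by (intro open_Int M.chart_open(1)[OF M.chart_at(1)])
qed simp

lemma coords_in_\<pi>c_dom: "coords AM y \<in> \<pi>c_dom y"
 using M.chart_at(2)[of y] B.chart_at(2)[of "\<pi> y"] by (auto simp: \<pi>c_dom_def coords_def)

lemma \<pi>c_coords: "\<pi>c y (coords AM y) = coords AB (\<pi> y)"
 using M.chart_inv_eq[OF M.chart_at] by (simp add: \<pi>c_def coords_def)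

lemma \<pi>c_eq:
 assumes "s \<in> \<pi>c_dom y"
 shows "s \<in> chart_image (chart_at AM y)" "\<pi>c y s \<in> chart_image (chart_at AB (\<pi> y))"
  "chart_inv (chart_at AB (\<pi> y)) (\<pi>c y s) = \<pi> (chart_inv (chart_at AM y) s)"
 using assms M.chart_inv_eq[OF M.chart_at(1)] B.chart_inv_eq[OF B.chart_at(1)]
 by (auto simp: \<pi>c_dom_def \<pi>c_def)

lemma \<pi>c_smooth: "smooth_on (\<pi>c y) (\<pi>c_dom y)"
 using submersion M.chart_at(1)[of y] B.chart_at(1)[of "\<pi> y"]
 unfolding riemannian_submersion_def smooth_map_def \<pi>c_def \<pi>c_dom_def by blast

lemma differential_eq: "D y = frechet_derivative (\<pi>c y) (at (coords AM y))"
 by (simp add: differential_def \<pi>c_def fun_eq_iff)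

lemma \<pi>c_has_derivative: "(\<pi>c y has_derivative D y) (at (coords AM y))"
 unfolding differential_eq by (rule smooth_on_has_derivative[OF \<pi>c_smooth coords_in_\<pi>c_dom])

lemma D_linear: "linear (D y)"
 using \<pi>c_has_derivative by (rule has_derivative_linear)

lemma hlift_exists: "\<exists>u. horizontal_lift_vector AM gM AB \<pi> y v u"
 using submersion unfolding riemannian_submersion_def horizontal_lift_vector_def bij_betw_def by (metis UNIV_I imageE)

lemma hlift_D: "horizontal_lift_vector AM gM AB \<pi> y v u ==> D y u = v"
 by (simp add: horizontal_lift_vector_def)

lemma horizontal_isometry:
 "u \<in> horizontal_space AM gM AB \<pi> y ==> w \<in> horizontal_space AM gM AB \<pi> y ==> gM y u w = gB (\<pi> y) (D y u) (D y w)"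
 using submersion unfolding riemannian_submersion_def by simp

text \<open>The vertical part of \<open>w\<close> is orthogonal to \<open>u\<close>.\<close>

lemma hlift_inner:
 assumes "horizontal_lift_vector AM gM AB \<pi> y v u"
 shows "gM y u w = gB (\<pi> y) v (D y w)"
proof -
 obtain h where h: "horizontal_lift_vector AM gM AB \<pi> y (D y w) h" using hlift_exists by blast
 have "D y (w - h) = 0" using h by (simp add: horizontal_lift_vector_def linear_diff[OF D_linear])
 then have "gM y u (w - h) = 0" using assms unfolding horizontal_lift_vector_def horizontal_space_def by blast
 then have "gM y u w = gM y u h" by (simp add: bilinear_rsub[OF M.g_bilinear])
 also have "\<dots> = gB (\<pi> y) v (D y w)"
  using assms h horizontal_isometry[of u y h] by (simp add: horizontal_lift_vector_def)
 finally show ?thesis .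
qed

text \<open>The horizontal lift h of the image of u is the orthogonal projection of u, so what is
  lost is the square of the vertical part u - h.\<close>

lemma D_contraction: "gB (\<pi> y) (D y u) (D y u) <= gM y u u"
proof -
 obtain h where h: "horizontal_lift_vector AM gM AB \<pi> y (D y u) h" using hlift_exists by blast
 have hu: "gM y h u = gB (\<pi> y) (D y u) (D y u)" and hh: "gM y h h = gB (\<pi> y) (D y u) (D y u)"
  using hlift_inner[OF h, of u] hlift_inner[OF h, of h] hlift_D[OF h] by simp_all
 have "0 <= gM y (u - h) (u - h)"
  using M.g_pos[of "u - h" y] bilinear_lzero[OF M.g_bilinear] by (cases "u = h") (auto intro: less_imp_le)
 also have "\<dots> = gM y u u - gM y h u"
  using hu hh by (simp add: bilinear_lsub[OF M.g_bilinear] bilinear_rsub[OF M.g_bilinear] M.g_sym[of y u h])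
 finally show ?thesis using hu by simp
qed

lemma cnorm_at: "M.cnorm (chart_at AM y) (coords AM y) u = sqrt (gM y u u)"
 "B.cnorm (chart_at AB x) (coords AB x) v = sqrt (gB x v v)"
 by (simp_all add: M.cnorm_def B.cnorm_def M.coord_metric_at B.coord_metric_at)

lemma \<pi>c_expansion:
 assumes et: "et > 0"
 obtains r where "r > 0" "ball (coords AM y) r \<subseteq> \<pi>c_dom y"
  "!!z. z \<in> ball (coords AM y) r ==> sqrt (let w = \<pi>c y z - coords AB (\<pi> y) - D y (z - coords AM y) in gB (\<pi> y) w w)
    <= et * sqrt (gM y (z - coords AM y) (z - coords AM y))"
proof -
 obtain cM CM where cM: "cM > 0" "!!u. cM * norm u <= sqrt (gM y u u)"
  using M.cnorm_bounds[OF M.chart_at(1) M.coords_in, of y] unfolding cnorm_at by metis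
 obtain cB CB where CB: "CB > 0" "!!u. sqrt (gB (\<pi> y) u u) <= CB * norm u"
  using B.cnorm_bounds[OF B.chart_at(1) B.coords_in, of "\<pi> y"] unfolding cnorm_at by metis
 obtain r1 where r1: "r1 > 0" "ball (coords AM y) r1 \<subseteq> \<pi>c_dom y"
  using \<pi>c_dom_open[of y] coords_in_\<pi>c_dom[of y] unfolding open_contains_ball by blast
 have "et * cM / CB > 0" using et cM CB by simp
 then obtain r2 where r2: "r2 > 0" "!!z. norm (z - coords AM y) < r2 ==>
   norm (\<pi>c y z - \<pi>c y (coords AM y) - D y (z - coords AM y)) <= et * cM / CB * norm (z - coords AM y)"
  using \<pi>c_has_derivative[of y] unfolding has_derivative_at_alt by blast
 show ?thesis
 proof (rule that[of "min r1 r2"])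
  fix z assume z: "z \<in> ball (coords AM y) (min r1 r2)"
  let ?w = "\<pi>c y z - coords AB (\<pi> y) - D y (z - coords AM y)"
  have "sqrt (gB (\<pi> y) ?w ?w) <= CB * norm ?w" by (rule CB)
  also have "\<dots> <= CB * (et * cM / CB * norm (z - coords AM y))"
   by (intro mult_left_mono) (use r2(2)[of z] z CB in \<open>auto simp: dist_norm norm_minus_commute \<pi>c_coords\<close>)
  also have "\<dots> = et * (cM * norm (z - coords AM y))" using CB by simp
  also have "\<dots> <= et * sqrt (gM y (z - coords AM y) (z - coords AM y))"
   by (intro mult_left_mono cM) (use et in simp)
  finally show "sqrt (let w = ?w in gB (\<pi> y) w w) <= et * sqrt (gM y (z - coords AM y) (z - coords AM y))" by (simp add: Let_def)
 qed (use r1 r2 in auto)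
qed

text \<open>To first order \<pi> is its differential, which does not increase norms. Three factors
  near 1 enter: the expansion of \<pi>, the upper comparison of distance and norm in the base, and
  the lower one in the total space.\<close>

lemma \<pi>_local_Lipschitz:
 assumes e: "0 < e" "e < 1"
 shows "\<exists>de>0. \<forall>q. M.d y q < de --> B.d (\<pi> y) (\<pi> q) <= (1 + e) * M.d y q"
proof -
 \<comment> \<open>One eighth suffices, since (1 + et)^2 \<le> (1 + 8 et) (1 - et) for et below
   1/8.\<close>
 define et where "et = e / 8"
 have et: "0 < et" "et < 1" using e by (auto simp: et_def)
 let ?k = "chart_at AM y" and ?l = "chart_at AB (\<pi> y)"
 obtain r where r: "r > 0" "ball (coords AM y) r \<subseteq> \<pi>c_dom y"
  "!!z. z \<in> ball (coords AM y) r ==> sqrt (let w = \<pi>c y z - coords AB (\<pi> y) - D y (z - coords AM y) in gB (\<pi> y) w w)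
    <= et * sqrt (gM y (z - coords AM y) (z - coords AM y))"
  using \<pi>c_expansion[OF et(1)] by blast
 obtain rB where rB: "rB > 0" "!!z z'. z \<in> ball (coords AB (\<pi> y)) rB ==> z' \<in> ball (coords AB (\<pi> y)) rB ==>
   B.d (chart_inv ?l z) (chart_inv ?l z') <= (1 + et) * sqrt (gB (\<pi> y) (z' - z) (z' - z))"
  using B.asy[OF B.chart_at et open_UNIV UNIV_I, folded coords_def, unfolded cnorm_at] by metis
 have cont: "isCont (\<pi>c y) (coords AM y)" using \<pi>c_has_derivative by (rule has_derivative_continuous)
 obtain r2 where r2: "r2 > 0" "!!z. z \<in> ball (coords AM y) r2 ==> \<pi>c y z \<in> ball (coords AB (\<pi> y)) rB"
  using cont[unfolded continuous_at_eps_delta, rule_format, OF rB(1)] unfolding \<pi>c_coords by (auto simp: dist_commute)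
 define U where "U = chart_inv ?k ` (ball (coords AM y) (min r r2) \<inter> chart_image ?k)"
 have U: "open U" "y \<in> U" unfolding U_def
 proof -
  show "open (chart_inv ?k ` (ball (coords AM y) (min r r2) \<inter> chart_image ?k))"
   by (rule M.chart_inv_image_open[OF M.chart_at(1)]) (auto intro: M.chart_open(2)[OF M.chart_at(1)])
  show "y \<in> chart_inv ?k ` (ball (coords AM y) (min r r2) \<inter> chart_image ?k)"
   by (rule image_eqI[of _ _ "coords AM y"]) (use r r2 M.coords_in M.chart_inv_eq[OF M.chart_at] in \<open>auto simp: coords_def\<close>)
 qed
 obtain rM de where rM: "rM > 0" "de > 0" "ball (coords AM y) rM \<subseteq> chart_image ?k" "chart_inv ?k ` ball (coords AM y) rM \<subseteq> U"
   "!!z z'. z \<in> ball (coords AM y) rM ==> z' \<in> ball (coords AM y) rM ==>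
   (1 - et) * sqrt (gM y (z' - z) (z' - z)) <= M.d (chart_inv ?k z) (chart_inv ?k z')"
   "!!q. M.d y q < de ==> q \<in> chart_inv ?k ` ball (coords AM y) rM"
  using M.asy[OF M.chart_at et U, folded coords_def, unfolded cnorm_at] by metis
 show ?thesis
 proof (intro exI[of _ de] conjI allI impI rM(2))
  fix q assume "M.d y q < de"
  from rM(6)[OF this] obtain z where z: "z \<in> ball (coords AM y) rM" "q = chart_inv ?k z" by blast
  have zim: "z \<in> chart_image ?k" using z(1) rM(3) by blast
  have "q \<in> U" using z rM(4) by blast
  then obtain z' where z': "z' \<in> ball (coords AM y) (min r r2)" "z' \<in> chart_image ?k" "chart_inv ?k z' = chart_inv ?k z" using z(2) by (auto simp: U_def)
  have "z' = z" using M.chart_eq[OF M.chart_at(1) zim] M.chart_eq[OF M.chart_at(1) z'(2)] z'(3) by simp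
  then have zr: "z \<in> ball (coords AM y) r" "z \<in> ball (coords AM y) r2" using z'(1) by auto
  define h where "h = z - coords AM y"
  define N where "N = sqrt (gM y h h)"
  have inv: "chart_inv ?k (coords AM y) = y" "chart_inv ?l (coords AB (\<pi> y)) = \<pi> y"
   unfolding coords_def by (rule M.chart_inv_eq[OF M.chart_at] B.chart_inv_eq[OF B.chart_at])+
  have N0: "N \<ge> 0" unfolding N_def cnorm_at[symmetric] by (rule M.cnorm_nonneg[OF M.chart_at(1) M.coords_in])
  define w where "w = \<pi>c y z - coords AB (\<pi> y) - D y h"
  have "sqrt (gB (\<pi> y) (w + D y h) (w + D y h)) <= sqrt (gB (\<pi> y) w w) + sqrt (gB (\<pi> y) (D y h) (D y h))"
   unfolding cnorm_at(2)[symmetric] by (rule B.cnorm_triangle[OF B.chart_at(1) B.coords_in])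
  also have "\<dots> <= et * N + N"
   using r(3)[OF zr(1)] D_contraction[of y h] by (simp add: N_def Let_def w_def h_def add_mono)
  finally have b1: "sqrt (gB (\<pi> y) (\<pi>c y z - coords AB (\<pi> y)) (\<pi>c y z - coords AB (\<pi> y))) <= (1 + et) * N"
   by (simp add: w_def algebra_simps)
  have "B.d (\<pi> y) (\<pi> q) = B.d (chart_inv ?l (coords AB (\<pi> y))) (chart_inv ?l (\<pi>c y z))"
   using \<pi>c_eq(3)[of z y] r(2) zr(1) inv z(2) by auto
  also have "\<dots> <= (1 + et) * sqrt (gB (\<pi> y) (\<pi>c y z - coords AB (\<pi> y)) (\<pi>c y z - coords AB (\<pi> y)))"
   by (rule rB(2)) (use rB(1) r2(2)[OF zr(2)] in auto)
  also have "\<dots> <= (1 + et) * ((1 + et) * N)" by (intro mult_left_mono b1) (use et in simp)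
  finally have b2: "B.d (\<pi> y) (\<pi> q) <= (1 + et)\<^sup>2 * N" by (simp add: power2_eq_square algebra_simps)
  have b3: "(1 - et) * N <= M.d y q" using rM(5)[of "coords AM y" z] z rM(1) inv by (simp add: N_def h_def)
  have e8: "e = 8 * et" by (simp add: et_def)
  have "et * et <= et * (1/8)" by (intro mult_left_mono) (use e in \<open>auto simp: et_def\<close>)
  then have "(1 + et)\<^sup>2 <= (1 + e) * (1 - et)" unfolding e8 using et by (simp add: power2_eq_square algebra_simps)
  then have "(1 + et)\<^sup>2 * N <= (1 + e) * ((1 - et) * N)" using N0 by (metis mult.assoc mult_right_mono)
  also have "\<dots> <= (1 + e) * M.d y q" by (intro mult_left_mono b3) (use e in simp)
  finally show "B.d (\<pi> y) (\<pi> q) <= (1 + e) * M.d y q" using b2 by simp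
 qed
qed

lemma le_from_factor:
 fixes a b :: real
 assumes "b \<ge> 0" "!!e. 0 < e ==> e < 1 ==> a <= (1 + e) * b"
 shows "a <= b"
proof -
 have "((\<lambda>e. (1 + e) * b) \<longlongrightarrow> (1 + 0) * b) (at_right 0)" by (intro tendsto_intros)
 moreover have "\<forall>\<^sub>F e in at_right 0. a <= (1 + e) * b"
  using eventually_at_right_real[of 0 "1::real"] by (rule eventually_mono) (use assms(2) in auto)
 ultimately show ?thesis by (intro tendsto_lowerbound[of "\<lambda>e. (1 + e) * b" b "at_right 0"]) auto
qed

text \<open>The local estimate is added up by bisection along a minimizing path of the total space,
  and the factor 1 + e is removed at the end.\<close>

lemma \<pi>_dist_le: "B.d (\<pi> a) (\<pi> b) <= M.d a b"
proof (rule le_from_factor[OF M.d_nonneg])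
 fix e :: real assume e: "0 < e" "e < 1"
 obtain si where si: "si 0 = a" "si (M.d a b) = b"
  "!!s t. s \<in> {0..M.d a b} ==> t \<in> {0..M.d a b} ==> M.d (si s) (si t) = \<bar>s - t\<bar>"
  using M.metric_geodesic_exists by blast
 define L where "L = M.d a b"
 have L: "L \<ge> 0" unfolding L_def by (rule M.d_nonneg)
 \<comment> \<open>Clamping the parameters to the interval makes the estimate meaningful at all real
   times, so that the bisection carries no side conditions.\<close>
 define cl where "cl t = max 0 (min L t)" for t
 have cl: "cl t \<in> {0..L}" "\<bar>cl t - cl s\<bar> <= \<bar>t - s\<bar>" for s t using L by (auto simp: cl_def)
 have dcl: "M.d (si (cl s)) (si (cl t)) <= \<bar>s - t\<bar>" for s t
  using si(3)[folded L_def, OF cl(1)[of s] cl(1)[of t]] cl(2)[of s t] by simp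
 have "B.d (\<pi> (si (cl 0))) (\<pi> (si (cl L))) <= (1 + e) * (L - 0)"
 proof (rule Bolzano[of 0 L "\<lambda>u v. B.d (\<pi> (si (cl u))) (\<pi> (si (cl v))) <= (1 + e) * (v - u)"])
  fix u v w :: real
  assume "B.d (\<pi> (si (cl u))) (\<pi> (si (cl v))) <= (1 + e) * (v - u)" "B.d (\<pi> (si (cl v))) (\<pi> (si (cl w))) <= (1 + e) * (w - v)"
  then show "B.d (\<pi> (si (cl u))) (\<pi> (si (cl w))) <= (1 + e) * (w - u)"
   using B.d_triangle[of "\<pi> (si (cl u))" "\<pi> (si (cl w))" "\<pi> (si (cl v))"] by (simp add: algebra_simps)
 next
  fix t :: real
  obtain de where de: "de > 0" "!!q. M.d (si (cl t)) q < de ==> B.d (\<pi> (si (cl t))) (\<pi> q) <= (1 + e) * M.d (si (cl t)) q"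
   using \<pi>_local_Lipschitz[OF e] by metis
  have near: "B.d (\<pi> (si (cl t))) (\<pi> (si (cl u))) <= (1 + e) * \<bar>t - u\<bar>" if "\<bar>t - u\<bar> < de" for u
  proof -
   have "B.d (\<pi> (si (cl t))) (\<pi> (si (cl u))) <= (1 + e) * M.d (si (cl t)) (si (cl u))"
    by (rule de(2)) (use dcl[of t u] that in simp)
   also have "\<dots> <= (1 + e) * \<bar>t - u\<bar>" by (intro mult_left_mono dcl) (use e in simp)
   finally show ?thesis .
  qed
  show "\<exists>d>0. \<forall>u v. u <= t \<and> t <= v \<and> v - u < d --> B.d (\<pi> (si (cl u))) (\<pi> (si (cl v))) <= (1 + e) * (v - u)"
  proof (intro exI[of _ de] conjI allI impI de(1))
   fix u v :: real assume uv: "u <= t \<and> t <= v \<and> v - u < de"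
   have "B.d (\<pi> (si (cl t))) (\<pi> (si (cl u))) <= (1 + e) * (t - u)" "B.d (\<pi> (si (cl t))) (\<pi> (si (cl v))) <= (1 + e) * (v - t)"
    using near[of u] near[of v] uv by auto
   then show "B.d (\<pi> (si (cl u))) (\<pi> (si (cl v))) <= (1 + e) * (v - u)"
    using B.d_triangle[of "\<pi> (si (cl u))" "\<pi> (si (cl v))" "\<pi> (si (cl t))"] B.d_sym[of "\<pi> (si (cl u))" "\<pi> (si (cl t))"]
    by (simp add: algebra_simps)
  qed
 qed (use L in auto)
 moreover have "cl 0 = 0" "cl L = L" using L by (auto simp: cl_def)
 ultimately show "B.d (\<pi> a) (\<pi> b) <= (1 + e) * M.d a b" using si(1,2) by (simp add: L_def)
qed

text \<open>A short step along the horizontal lift of the direction from \<pi> z towards x' is about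
  as long as its projection, so it lowers the distance to x' at a rate arbitrarily close to
  1.\<close>

lemma horizontal_descent:
 assumes e: "0 < e" "e < 1" and ne: "\<pi> z ~= x'"
 shows "\<exists>z1. B.d (\<pi> z1) x' + (1 - e) * M.d z z1 < B.d (\<pi> z) x'"
proof -
 define et where "et = e / 8"
 have et: "0 < et" "et < 1" using e by (auto simp: et_def)
 let ?k = "chart_at AM z" and ?l = "chart_at AB (\<pi> z)"
 have inv: "chart_inv ?k (coords AM z) = z" "chart_inv ?l (coords AB (\<pi> z)) = \<pi> z"
  unfolding coords_def by (rule M.chart_inv_eq[OF M.chart_at] B.chart_inv_eq[OF B.chart_at])+
 obtain r where r: "r > 0" "ball (coords AM z) r \<subseteq> \<pi>c_dom z"
  "!!s. s \<in> ball (coords AM z) r ==> sqrt (let w = \<pi>c z s - coords AB (\<pi> z) - D z (s - coords AM z) in gB (\<pi> z) w w)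
    <= et * sqrt (gM z (s - coords AM z) (s - coords AM z))"
  using \<pi>c_expansion[OF et(1)] by blast
 \<comment> \<open>One minus this parameter is 1 / (1 + et), so the lower comparison in the base can
   be solved for the norm with the factor 1 + et.\<close>
 have et2: "0 < 1 - 1 / (1 + et)" "1 - 1 / (1 + et) < 1" using et by (auto simp: field_simps)
 obtain rB deB where rB: "rB > 0" "deB > 0" "!!s s'. s \<in> ball (coords AB (\<pi> z)) rB ==> s' \<in> ball (coords AB (\<pi> z)) rB ==>
   (1 - (1 - 1 / (1 + et))) * sqrt (gB (\<pi> z) (s' - s) (s' - s)) <= B.d (chart_inv ?l s) (chart_inv ?l s')"
   "!!q. B.d (\<pi> z) q < deB ==> q \<in> chart_inv ?l ` ball (coords AB (\<pi> z)) rB" "ball (coords AB (\<pi> z)) rB \<subseteq> chart_image ?l"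
  using B.asy[OF B.chart_at et2 open_UNIV UNIV_I, folded coords_def, unfolded cnorm_at] by metis
 obtain rC where rC: "rC > 0" "!!s s'. s \<in> ball (coords AB (\<pi> z)) rC ==> s' \<in> ball (coords AB (\<pi> z)) rC ==>
   B.d (chart_inv ?l s) (chart_inv ?l s') <= (1 + et) * sqrt (gB (\<pi> z) (s' - s) (s' - s))"
  using B.asy[OF B.chart_at et open_UNIV UNIV_I, folded coords_def, unfolded cnorm_at] by metis
 obtain rM where rM: "rM > 0" "!!s s'. s \<in> ball (coords AM z) rM ==> s' \<in> ball (coords AM z) rM ==>
   M.d (chart_inv ?k s) (chart_inv ?k s') <= (1 + et) * sqrt (gM z (s' - s) (s' - s))"
  using M.asy[OF M.chart_at et open_UNIV UNIV_I, folded coords_def, unfolded cnorm_at] by metis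
 have cont: "isCont (\<pi>c z) (coords AM z)" using \<pi>c_has_derivative by (rule has_derivative_continuous)
 obtain r2 where r2: "r2 > 0" "!!s. s \<in> ball (coords AM z) r2 ==> \<pi>c z s \<in> ball (coords AB (\<pi> z)) rC"
  using cont[unfolded continuous_at_eps_delta, rule_format, OF rC(1)] unfolding \<pi>c_coords by (auto simp: dist_commute)
 obtain cM CM where cM: "cM > 0" "!!u. cM * norm u <= sqrt (gM z u u)"
  using M.cnorm_bounds[OF M.chart_at(1) M.coords_in, of z] unfolding cnorm_at by metis
 obtain cB CB where cB: "cB > 0" "!!u. cB * norm u <= sqrt (gB (\<pi> z) u u)"
  using B.cnorm_bounds[OF B.chart_at(1) B.coords_in, of "\<pi> z"] unfolding cnorm_at by metis
 define L where "L = B.d (\<pi> z) x'"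
 have L: "L > 0" unfolding L_def using ne B.d_nonneg[of "\<pi> z" x'] B.d_eq_0_iff[of "\<pi> z" x'] by linarith
 define m where "m = Min {r, r2, rM, L, deB, rC}"
 have m: "m > 0" "m <= r" "m <= r2" "m <= rM" "m <= L" "m <= deB" "m <= rC" unfolding m_def using r r2 rM L rB rC by auto
 \<comment> \<open>The norm N of the direction will be below 2 t; with the factor 4 and the two norm
   bounds, the coordinate vectors upstairs and downstairs are then shorter than m and stay inside
   all balls.\<close>
 define t where "t = m * min 1 (min cM cB) / 4"
 have mm: "m * min 1 (min cM cB) <= m * 1" "m * min 1 (min cM cB) <= m * cM" "m * min 1 (min cM cB) <= m * cB" using m by (intro mult_left_mono; simp)+
 have t: "t > 0" "4 * t <= m" "4 * t <= m * cM" "4 * t <= m * cB" using mm m cM cB by (auto simp: t_def)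
 obtain b where b: "B.d (\<pi> z) b = t" "B.d b x' = L - t"
 proof (rule B.between_point)
  show "0 <= t" "t <= B.d (\<pi> z) x'" using t(1,2) m(5) by (simp_all add: L_def)
 qed (use that in \<open>simp add: L_def\<close>)
 obtain s where s: "s \<in> ball (coords AB (\<pi> z)) rB" "b = chart_inv ?l s"
  using rB(4)[of b] b(1) t m by auto
 define xs where "xs = s - coords AB (\<pi> z)"
 define N where "N = sqrt (gB (\<pi> z) xs xs)"
 have N: "N <= (1 + et) * t"
  using rB(3)[of "coords AB (\<pi> z)" s] s rB(1) inv b et by (simp add: N_def xs_def field_simps)
 obtain u where u: "horizontal_lift_vector AM gM AB \<pi> z xs u" using hlift_exists by blast
 have Nu: "sqrt (gM z u u) = N" using hlift_inner[OF u, of u] hlift_D[OF u] by (simp add: N_def)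
 have N2: "N < 2 * t" using N mult_strict_right_mono[OF et(2) t(1)] by (simp add: algebra_simps)
 have nu: "norm u < m"
 proof -
  have "cM * norm u < cM * m" using cM(2)[of u] Nu N2 t(1,3) mult.commute[of m cM] by linarith
  then show ?thesis using cM(1) by simp
 qed
 have nxs: "norm xs < m"
 proof -
  have "cB * norm xs < cB * m" using cB(2)[of xs] N2 t(1,4) mult.commute[of m cB] unfolding N_def by linarith
  then show ?thesis using cB(1) by simp
 qed
 define s1 where "s1 = coords AM z + u"
 define z1 where "z1 = chart_inv ?k s1"
 have s1: "s1 \<in> ball (coords AM z) r" "s1 \<in> ball (coords AM z) r2" "s1 \<in> ball (coords AM z) rM"
  using nu m by (auto simp: s1_def dist_norm)
 have sC: "s \<in> ball (coords AB (\<pi> z)) rC" using nxs m by (auto simp: xs_def dist_norm norm_minus_commute)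
 have dz: "M.d z z1 <= (1 + et) * N"
  using rM(2)[of "coords AM z" s1] s1(3) rM(1) inv(1) Nu by (simp add: z1_def s1_def)
 have "B.d (\<pi> z1) b <= (1 + et) * sqrt (gB (\<pi> z) (\<pi>c z s1 - s) (\<pi>c z s1 - s))"
  using rC(2)[OF sC r2(2)[OF s1(2)]] \<pi>c_eq(3)[of s1 z] r(2) s1(1) s(2) B.d_sym[of "\<pi> z1" b] by (auto simp: z1_def)
 also have "\<dots> <= (1 + et) * (et * N)"
  using r(3)[OF s1(1)] hlift_D[OF u] Nu et by (intro mult_left_mono) (auto simp: Let_def s1_def xs_def)
 finally have db: "B.d (\<pi> z1) b <= (1 + et) * (et * N)" .
 have "B.d (\<pi> z1) x' + (1 - e) * M.d z z1 <= (1 + et) * (et * N) + (L - t) + (1 - e) * ((1 + et) * N)"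
  using B.d_triangle[of "\<pi> z1" x' b] db b(2) mult_left_mono[OF dz, of "1 - e"] e by linarith
 also have "\<dots> = L - t + (1 + et) * (et + 1 - e) * N" by (simp add: algebra_simps)
 also have "\<dots> <= L - t + (1 + et) * (et + 1 - e) * ((1 + et) * t)"
  by (intro add_left_mono mult_left_mono N mult_nonneg_nonneg) (use et e in auto)
 \<comment> \<open>With e = 8 et the product (1 + et)^2 (1 + et - e) is at most 1 - 4 et - 21 et^2,
   hence below 1, and less than t is added back.\<close>
 also have "\<dots> < L"
 proof -
  have "et\<^sup>2 <= et * 1" unfolding power2_eq_square by (intro mult_left_mono) (use et in auto)
  then have "(1 + et)\<^sup>2 <= 1 + 3 * et" by (simp add: power2_sum)
  then have "(1 + et)\<^sup>2 * (et + 1 - e) <= (1 + 3 * et) * (et + 1 - e)" by (intro mult_right_mono) (use et e in auto)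
  also have "\<dots> = 1 - 4 * et - 21 * et\<^sup>2" by (simp add: et_def power2_eq_square algebra_simps)
  also have "\<dots> < 1" using et by (smt (verit) zero_le_power2)
  finally have "(1 + et)\<^sup>2 * (et + 1 - e) * t < 1 * t" by (intro mult_strict_right_mono t(1))
  then show ?thesis by (simp add: power2_eq_square algebra_simps)
 qed
 finally show ?thesis unfolding L_def by blast
qed

text \<open>Minimizing \<open>B.d (\<pi> z) x' + (1 - e) * M.d y z\<close> over \<open>z\<close> replaces the horizontal lift of a
 minimizing geodesic from \<open>\<pi> y\<close> to \<open>x'\<close>.\<close>

lemma equidistant:
 obtains y' where "\<pi> y' = x'" "M.d y y' = B.d (\<pi> y) x'"
proof -
 define L where "L = B.d (\<pi> y) x'"
 have L: "L \<ge> 0" unfolding L_def by (rule B.d_nonneg)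
 \<comment> \<open>A minimizer of the penalized function lies over x', because otherwise
   \<open>horizontal_descent\<close> would lower the function; comparison with its value L at y
   bounds the distance. Only points within L / (1 - e) of y can compete, so a minimum over a compact
   ball suffices.\<close>
 have ex: "\<exists>z. \<pi> z = x' \<and> (1 - e) * M.d y z <= L" if e: "0 < e" "e < 1" for e
 proof -
  define u where "u z = B.d (\<pi> z) x' + (1 - e) * M.d y z" for z
  have cont: "continuous_on (M.cb y (L / (1 - e))) u" unfolding u_def
   by (intro continuous_intros B.continuous_on_d M.continuous_on_d continuous_at_imp_continuous_on ballI \<pi>_cont)
  have "y \<in> M.cb y (L / (1 - e))" using L e by (simp add: M.cb_def)
  then obtain z where z: "z \<in> M.cb y (L / (1 - e))" "!!w. w \<in> M.cb y (L / (1 - e)) ==> u z <= u w"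
   using continuous_attains_inf[OF M.compact_cb _ cont] by blast
  have uy: "u y = L" by (simp add: u_def L_def)
  have "u z <= L" using z(2)[OF \<open>y \<in> _\<close>] uy by simp
  have "\<pi> z = x'"
  proof (rule ccontr)
   assume "\<pi> z ~= x'"
   from horizontal_descent[OF e this] obtain z1 where z1: "B.d (\<pi> z1) x' + (1 - e) * M.d z z1 < B.d (\<pi> z) x'" by blast
   have "(1 - e) * M.d y z1 <= (1 - e) * (M.d y z + M.d z z1)" by (intro mult_left_mono M.d_triangle) (use e in simp)
   then have lt: "u z1 < u z" using z1 by (simp add: u_def algebra_simps)
   then have "(1 - e) * M.d y z1 <= L" using \<open>u z <= L\<close> B.d_nonneg[of "\<pi> z1" x'] unfolding u_def by linarith
   then have "z1 \<in> M.cb y (L / (1 - e))" using e by (simp add: M.cb_def field_simps)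
   from z(2)[OF this] lt show False by simp
  qed
  then show ?thesis using \<open>u z <= L\<close> by (intro exI[of _ z]) (simp add: u_def)
 qed
 \<comment> \<open>The shift by 2 keeps 1 - e n at least 1/2, so that all the points lie in the ball
   of radius 2 L.\<close>
 define e where "e n = 1 / (real n + 2)" for n
 have e: "0 < e n" "e n < 1" "e n <= 1/2" for n by (auto simp: e_def field_simps)
 have "\<exists>z. \<pi> z = x' \<and> (1 - e n) * M.d y z <= L" for n by (rule ex[OF e(1,2)])
 then obtain z where z: "!!n. \<pi> (z n) = x'" "!!n. (1 - e n) * M.d y (z n) <= L" by metis
 have zb: "z n \<in> M.cb y (2 * L)" for n
 proof -
  have "1/2 * M.d y (z n) <= (1 - e n) * M.d y (z n)" by (intro mult_right_mono M.d_nonneg) (use e(3)[of n] in simp)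
  then show ?thesis using z(2)[of n] by (simp add: M.cb_def)
 qed
 obtain G l where G: "G ~= bot" "G <= sequentially" "!!t::unit. ((\<lambda>n. z n) \<longlongrightarrow> l t) G"
  by (rule pointwise_cluster[of "\<lambda>_::unit. M.cb y (2 * L)" "\<lambda>n _. z n"]) (use M.compact_cb zb in auto)
 have "((\<lambda>n. \<pi> (z n)) \<longlongrightarrow> \<pi> (l ())) G" by (rule isCont_tendsto_compose[OF \<pi>_cont G(3)])
 then have pl: "\<pi> (l ()) = x'" using z(1) tendsto_unique[OF G(1) _ tendsto_const] by simp
 have elim: "e \<longlonglongrightarrow> 0" unfolding e_def by real_asymp
 have "((\<lambda>n. (1 - e n) * M.d y (z n)) \<longlongrightarrow> (1 - 0) * M.d y (l ())) G"
  by (intro tendsto_intros M.tendsto_d G(3) tendsto_mono[OF G(2) elim])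
 then have "M.d y (l ()) <= L" using tendsto_upperbound[OF _ always_eventually[of "\<lambda>n. (1 - e n) * M.d y (z n) <= L"] G(1)] z(2) by simp
 moreover have "L <= M.d y (l ())" using \<pi>_dist_le[of y "l ()"] pl by (simp add: L_def)
 ultimately show ?thesis using that[OF pl] by (simp add: L_def)
qed

section \<open>Horizontal lifts of minimizing geodesics realize the base distance\<close>

lemma C1_curve_on_subset:
 assumes "C1_curve_on AM I et" "J \<subseteq> I"
 shows "C1_curve_on AM J et"
 unfolding C1_curve_on_def
proof (intro conjI ballI)
 show "continuous_on J et" using assms continuous_on_subset unfolding C1_curve_on_def by blast
 fix ka assume "ka \<in> AM"
 then obtain y' where y': "continuous_on {t\<in>I. et t \<in> fst ka} y'"
  "!!t. t \<in> I ==> et t \<in> fst ka ==> (snd ka \<circ> et has_vector_derivative y' t) (at t within I)"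
  using assms(1) unfolding C1_curve_on_def by fast
 show "\<exists>y'. continuous_on {t\<in>J. et t \<in> fst ka} y' \<and>
    (\<forall>t\<in>{t\<in>J. et t \<in> fst ka}. (snd ka \<circ> et has_vector_derivative y' t) (at t within J))"
  using assms(2) by (intro exI[of _ y'] conjI continuous_on_subset[OF y'(1)] ballI has_vector_derivative_within_subset[OF y'(2)]) auto
qed

lemma velocity_projection:
 assumes et: "C1_curve_on AM {0..1} et" and ga: "!!t. t \<in> {0..1} ==> \<pi> (et t) = ga t" and t: "t \<in> {0..1}"
 shows "velocity AB {0..1} ga t = D (et t) (velocity AM {0..1} et t)"
proof -
 let ?k = "chart_at AM (et t)" and ?l = "chart_at AB (\<pi> (et t))"
 have cont: "continuous (at t within {0..1}) et" using et t unfolding C1_curve_on_def continuous_on_eq_continuous_within by blast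
 obtain y' where y': "(snd ?k \<circ> et has_vector_derivative y') (at t within {0..1})"
  using et M.chart_at[of "et t"] t unfolding C1_curve_on_def by fast
 have nb: "at t within {0..1} ~= bot" using t by (simp add: trivial_limit_within islimpt_Icc)
 have vel: "velocity AM {0..1} et t = y'" unfolding velocity_def by (rule vector_derivative_within[OF nb y'])
 have "(\<pi>c (et t) has_derivative D (et t)) (at ((snd ?k \<circ> et) t) within (snd ?k \<circ> et) ` {0..1})"
  using \<pi>c_has_derivative[of "et t"] by (simp add: coords_def has_derivative_at_withinI)
 from has_derivative_in_compose[OF y'[unfolded has_vector_derivative_def] this]
 have "((\<lambda>s. \<pi>c (et t) ((snd ?k \<circ> et) s)) has_vector_derivative D (et t) y') (at t within {0..1})"
  unfolding has_vector_derivative_def by (simp add: linear_scale[OF D_linear])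
 moreover have "\<forall>\<^sub>F s in at t within {0..1}. \<pi>c (et t) ((snd ?k \<circ> et) s) = (snd ?l \<circ> ga) s"
 proof -
  have "\<forall>\<^sub>F s in at t within {0..1}. et s \<in> fst ?k"
   using cont[unfolded continuous_within] by (rule topological_tendstoD[OF _ M.chart_open(1)[OF M.chart_at(1)] M.chart_at(2)])
  moreover have "\<forall>\<^sub>F s in at t within {0..1}. s \<in> {0..1}" by (simp add: eventually_at_filter)
  ultimately show ?thesis
   by eventually_elim (use ga M.chart_inv_eq[OF M.chart_at(1)] in \<open>auto simp: \<pi>c_def\<close>)
 qed
 ultimately have "(snd ?l \<circ> ga has_vector_derivative D (et t) y') (at t within {0..1})"
  unfolding has_vector_derivative_def
  by (rule has_derivative_transform_eventually) (use ga[OF t] t M.chart_inv_eq[OF M.chart_at] in \<open>auto simp: \<pi>c_def\<close>)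
 from vector_derivative_within[OF nb this] show ?thesis unfolding velocity_def[of AB] vel using ga[OF t] by simp
qed

text \<open>A horizontal lift has the speed of its projection, so the length of the minimizing
  geodesic bounds the distance from above; the bound from below is that \<pi> does not increase
  distances.\<close>

lemma lift_pair_dist:
 assumes "horizontal_lift_pair AM gM AB gB \<pi> (x, xb) (y, yb)"
 shows "\<pi> y = x" "\<pi> yb = xb" "M.d y yb = B.d x xb"
proof -
 obtain ga et where g: "minimizing_geodesic AB gB ga" "ga 0 = x" "ga 1 = xb" "horizontal_lift_curve AM gM AB \<pi> ga et" "et 0 = y" "et 1 = yb"
  using assms unfolding horizontal_lift_pair_def by auto
 have et: "C1_curve_on AM {0..1} et" "!!t. t \<in> {0..1} ==> \<pi> (et t) = ga t"
  "!!t. t \<in> {0..1} ==> velocity AM {0..1} et t \<in> horizontal_space AM gM AB \<pi> (et t)"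
  using g(4) unfolding horizontal_lift_curve_def by auto
 show xy: "\<pi> y = x" "\<pi> yb = xb" using et(2)[of 0] et(2)[of 1] g by auto
 have "continuous_on {0..1} et" using et(1) by (simp add: C1_curve_on_def)
 then have "M.pw {} et 0 1" unfolding M.pw_def using C1_curve_on_subset[OF et(1)] by simp
 from M.dist_le_speed[OF this] have "M.d y yb <= curve_length AM gM et" using g by (simp add: M.curve_length_speed)
 also have "\<dots> = curve_length AB gB ga" unfolding curve_length_def
 proof (rule integral_cong)
  fix t :: real assume t: "t \<in> {0..1}"
  show "sqrt (gM (et t) (velocity AM {0..1} et t) (velocity AM {0..1} et t)) = sqrt (gB (ga t) (velocity AB {0..1} ga t) (velocity AB {0..1} ga t))"
   using horizontal_isometry[OF et(3)[OF t] et(3)[OF t]] velocity_projection[OF et(1,2) t] et(2)[OF t] by simp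
 qed
 also have "\<dots> = B.d x xb" using g unfolding minimizing_geodesic_def by simp
 finally show "M.d y yb = B.d x xb" using \<pi>_dist_le[of y yb] xy by simp
qed

end

section \<open>Cross-curvature in coordinates\<close>

lemma has_derivative_local_cong:
 assumes "open S" "z \<in> S" "!!y. y \<in> S ==> F y = H y"
 shows "(F has_derivative D) (at z) \<longleftrightarrow> (H has_derivative D) (at z)"
 using has_derivative_transform_within_open[of F D z UNIV S H] has_derivative_transform_within_open[of H D z UNIV S F] assms by auto

lemma pd_local_cong:
 assumes "open S" "z \<in> S" "!!y. y \<in> S ==> F y = H y"
 shows "pd F u z = pd H u z"
 by (simp add: frechet_derivative_def has_derivative_local_cong[OF assms])

text \<open>The direction depends on the step because it will be the difference quotient of a
  section that is differentiable just once. Therefore the first order term is subtracted along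
  \<open>u h\<close> itself and not along its limit.\<close>

lemma second_order_limit:
 fixes F :: "'e::euclidean_space => real"
 assumes F: "C_k_on 2 F S" and S: "open S" "z0 \<in> S" and u: "(u \<longlongrightarrow> u0) (at_right (0::real))"
 shows "((\<lambda>h. (F (z0 + h *\<^sub>R u h) - F z0 - h * pd F (u h) z0) / h\<^sup>2) \<longlongrightarrow> pd (pd F u0) u0 z0 / 2) (at_right 0)"
proof -
 have F2: "C_k_on (Suc (Suc 0)) F S" using F by (simp only: numeral_2_eq_2)
 define D2 where "D2 z v w = pd (pd F v) w z" for z v w
 have bil: "bilinear (D2 z)" if "z \<in> S" for z using frechet_second_bilinear[OF F S(1) that] unfolding D2_def .
 have cont: "continuous_on S (\<lambda>z. D2 z v w)" for v w
  unfolding D2_def by (rule C_k_on_continuous[OF C_k_on_frechet[OF C_k_on_frechet[OF F2]]])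
 obtain r where r: "r > 0" "ball z0 r \<subseteq> S" using S open_contains_ball by blast
 have "((\<lambda>h. h *\<^sub>R u h) \<longlongrightarrow> 0 *\<^sub>R u0) (at_right 0)" by (intro tendsto_intros u)
 then have hu: "\<forall>\<^sub>F h in at_right 0. norm (h *\<^sub>R u h) < r" using tendstoD[of "\<lambda>h. h *\<^sub>R u h" 0 "at_right 0" r] r(1) by (simp add: dist_norm)
 have "\<exists>xs. 0 < h \<and> norm (h *\<^sub>R u h) < r --> 0 < xs \<and> xs < h \<and> (F (z0 + h *\<^sub>R u h) - F z0 - h * pd F (u h) z0) / h\<^sup>2 = D2 (z0 + xs *\<^sub>R u h) (u h) (u h) / 2" for h
 proof (cases "0 < h \<and> norm (h *\<^sub>R u h) < r")
  case True
  have inS: "z0 + ta *\<^sub>R u h \<in> S" if "0 <= ta" "ta <= h" for ta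
  proof -
   have "norm (ta *\<^sub>R u h) <= norm (h *\<^sub>R u h)" using that by (simp add: mult_right_mono)
   also have "\<dots> < r" using True by blast
   finally show ?thesis by (intro subsetD[OF r(2)]) (simp add: dist_norm)
  qed
  define df where "df m ta = (if m = 0 then F (z0 + ta *\<^sub>R u h) else if m = 1 then pd F (u h) (z0 + ta *\<^sub>R u h) else D2 (z0 + ta *\<^sub>R u h) (u h) (u h))" for m :: nat and ta
  have df: "df 0 = (\<lambda>ta. F (z0 + ta *\<^sub>R u h))" "df 1 = (\<lambda>ta. pd F (u h) (z0 + ta *\<^sub>R u h))" "df 2 = (\<lambda>ta. D2 (z0 + ta *\<^sub>R u h) (u h) (u h))"
   by (simp_all add: df_def fun_eq_iff)
  have "\<exists>t>0. t < h \<and> F (z0 + h *\<^sub>R u h) = (\<Sum>m<2. df m 0 / fact m * h ^ m) + df 2 t / fact 2 * h ^ 2"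
  proof (rule Maclaurin[of h 2 df "\<lambda>ta. F (z0 + ta *\<^sub>R u h)"])
   show "df 0 = (\<lambda>ta. F (z0 + ta *\<^sub>R u h))" by (rule df(1))
   show "\<forall>m t. m < 2 \<and> 0 <= t \<and> t <= h --> (df m has_real_derivative df (Suc m) t) (at t)"
   proof (intro allI impI)
    fix m :: nat and t assume mt: "m < 2 \<and> 0 <= t \<and> t <= h"
    then have zS: "z0 + t *\<^sub>R u h \<in> S" using inS by blast
    have "(df 0 has_real_derivative df 1 t) (at t)"
     unfolding df by (rule has_derivative_along_line[OF C_k_on_has_derivative[OF F2 zS]])
    moreover have "(df 1 has_real_derivative df 2 t) (at t)"
     unfolding df D2_def by (rule has_derivative_along_line[OF C_k_on_has_derivative[OF C_k_on_frechet[OF F2, of "u h"] zS]])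
    ultimately show "(df m has_real_derivative df (Suc m) t) (at t)"
     using mt by (cases "m = 0") (auto simp: numeral_2_eq_2 less_Suc_eq)
   qed
  qed (use True in auto)
  then obtain t where "0 < t" "t < h" "F (z0 + h *\<^sub>R u h) = F z0 + pd F (u h) z0 * h + D2 (z0 + t *\<^sub>R u h) (u h) (u h) / 2 * h\<^sup>2"
   by (auto simp: numeral_2_eq_2 df_def)
  then show ?thesis using True by (intro exI[of _ t]) (simp add: field_simps)
 qed auto
 then obtain xs where xs: "!!h. 0 < h ==> norm (h *\<^sub>R u h) < r ==> 0 < xs h"
  "!!h. 0 < h ==> norm (h *\<^sub>R u h) < r ==> xs h < h"
  "!!h. 0 < h ==> norm (h *\<^sub>R u h) < r ==> (F (z0 + h *\<^sub>R u h) - F z0 - h * pd F (u h) z0) / h\<^sup>2 = D2 (z0 + xs h *\<^sub>R u h) (u h) (u h) / 2"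
  by metis
 have ev: "\<forall>\<^sub>F h in at_right 0. 0 < h \<and> norm (h *\<^sub>R u h) < r"
  using hu eventually_at_right_less[of "0::real"] by eventually_elim auto
 have "((\<lambda>h. xs h) \<longlongrightarrow> 0) (at_right 0)"
 proof (rule tendsto_sandwich)
  show "\<forall>\<^sub>F h in at_right 0. 0 <= xs h" "\<forall>\<^sub>F h in at_right 0. xs h <= h"
   using ev by (eventually_elim, use xs less_imp_le in blast)+
 qed (auto intro: tendsto_intros)
 then have "((\<lambda>h. z0 + xs h *\<^sub>R u h) \<longlongrightarrow> z0 + 0 *\<^sub>R u0) (at_right 0)" by (intro tendsto_intros u)
 then have lim: "((\<lambda>h. (z0 + xs h *\<^sub>R u h, u h, u h)) \<longlongrightarrow> (z0, u0, u0)) (at_right 0)" by (intro tendsto_Pair u) simp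
 have "isCont (\<lambda>(s, v, w). D2 s v w) (z0, u0, u0)"
  using bilinear_family_continuous[OF bil cont] S
  by (intro continuous_on_interior[of "S \<times> UNIV"]) (auto simp: interior_Times interior_open)
 from isCont_tendsto_compose[OF this lim]
 have "((\<lambda>h. D2 (z0 + xs h *\<^sub>R u h) (u h) (u h) / 2) \<longlongrightarrow> D2 z0 u0 u0 / 2) (at_right 0)" by (intro tendsto_intros) auto
 then show ?thesis unfolding D2_def[of z0, symmetric]
  by (rule Lim_transform_eventually) (use ev in eventually_elim, rule xs(3)[symmetric], blast+)
qed

text \<open>A continuous map inherits differentiability from its composition with a map of injective
  derivative: continuity allows the remainder of \<open>Ph\<close> to be absorbed by the lower bound
  of its derivative.\<close>

lemma has_derivative_left_cancel:
 fixes Ph :: "'e::euclidean_space => 'd::euclidean_space" and si :: "'f::euclidean_space => 'e"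
 assumes si: "isCont si x" and Ph: "(Ph has_derivative Ph') (at (si x))" and inj: "!!u. Ph' u = 0 ==> u = 0"
  and comp: "((\<lambda>x. Ph (si x)) has_derivative (\<lambda>h. Ph' (si' h))) (at x)" and lin: "linear si'"
 shows "(si has_derivative si') (at x)"
proof -
 have l: "linear Ph'" by (rule has_derivative_linear[OF Ph])
 have "inj Ph'" using inj by (simp add: linear_injective_0[OF l])
 then obtain B where B: "B > 0" "!!u. B * norm u <= norm (Ph' u)" using linear_inj_bounded_below_pos[OF l] by blast
 have bl: "bounded_linear si'" using lin by (rule linear_conv_bounded_linear[THEN iffD1])
 obtain K where K: "K > 0" "!!h. norm (si' h) <= norm h * K" using bounded_linear.pos_bounded[OF bl] by blast
 show ?thesis
  unfolding has_derivative_at_alt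
 proof (intro conjI bl allI impI)
  fix e :: real assume e: "e > 0"
  \<comment> \<open>The first bound absorbs the remainder in the unknown increment of
    \<open>si\<close>; the second leaves at most e times the step.\<close>
  define ep where "ep = min (B / 2) (e * B / (2 * (K + 1)))"
  have ep: "ep > 0" "ep <= B / 2" "ep <= e * B / (2 * (K + 1))"
   unfolding ep_def using e B(1) K(1) by (simp_all only: min.cobounded1 min.cobounded2) simp
  obtain d1 where d1: "d1 > 0" "!!s. norm (s - si x) < d1 ==> norm (Ph s - Ph (si x) - Ph' (s - si x)) <= ep * norm (s - si x)"
   using Ph ep(1) unfolding has_derivative_at_alt by blast
  obtain d2 where d2: "d2 > 0" "!!y. norm (y - x) < d2 ==> norm (Ph (si y) - Ph (si x) - Ph' (si' (y - x))) <= ep * norm (y - x)"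
   using comp ep(1) unfolding has_derivative_at_alt by blast
  obtain d3 where d3: "d3 > 0" "!!y. norm (y - x) < d3 ==> norm (si y - si x) < d1"
   using si[unfolded continuous_at_eps_delta, rule_format, OF d1(1)] by (auto simp: dist_norm)
  show "\<exists>d>0. \<forall>y. norm (y - x) < d --> norm (si y - si x - si' (y - x)) <= e * norm (y - x)"
  proof (intro exI[of _ "min d2 d3"] conjI allI impI)
   fix y assume y: "norm (y - x) < min d2 d3"
   define De where "De = si y - si x"
   define h where "h = y - x"
   have n1: "norm (Ph (si y) - Ph (si x) - Ph' De) <= ep * norm De" unfolding De_def by (rule d1(2)) (use d3(2)[of y] y in auto)
   have n2: "norm (Ph (si y) - Ph (si x) - Ph' (si' h)) <= ep * norm h" unfolding h_def by (rule d2(2)) (use y in auto)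
   have eq: "Ph' (De - si' h) = (Ph (si y) - Ph (si x) - Ph' (si' h)) - (Ph (si y) - Ph (si x) - Ph' De)" by (simp add: linear_diff[OF l])
   have n3: "B * norm (De - si' h) <= ep * norm h + ep * norm De"
    using B(2)[of "De - si' h", unfolded eq] n1 n2 norm_triangle_ineq4[of "Ph (si y) - Ph (si x) - Ph' (si' h)" "Ph (si y) - Ph (si x) - Ph' De"] by linarith
   have "norm De <= norm (De - si' h) + norm (si' h)" using norm_triangle_ineq[of "De - si' h" "si' h"] by simp
   then have "norm De <= norm (De - si' h) + norm h * K" using K(2)[of h] by linarith
   from mult_left_mono[OF this, of ep] have n4: "ep * norm De <= ep * norm (De - si' h) + ep * (norm h * K)" using ep(1) by (simp add: algebra_simps)
   have n5: "ep * norm (De - si' h) <= B / 2 * norm (De - si' h)" by (intro mult_right_mono ep(2)) simp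
   have "B / 2 * norm (De - si' h) <= ep * ((K + 1) * norm h)" using n3 n4 n5 by (simp add: algebra_simps)
   also have "\<dots> <= e * B / (2 * (K + 1)) * ((K + 1) * norm h)" by (intro mult_right_mono ep(3)) (use K in simp)
   also have "\<dots> = B / 2 * (e * norm h)" using K by (simp add: field_simps)
   finally show "norm (si y - si x - si' (y - x)) <= e * norm (y - x)" using B(1) by (simp add: De_def h_def)
  qed (use d2 d3 in auto)
 qed
qed

locale mixed_nondegenerate =
 fixes C :: "'e::euclidean_space \<times> 'e => real" and S :: "('e \<times> 'e) set"
 assumes C4: "C_k_on 4 C S" and S_open: "open S"
  and nd1: "!!z u. z \<in> S ==> (!!v. mixed_deriv C z u v = 0) ==> u = 0"
  and nd2: "!!z v. z \<in> S ==> (!!u. mixed_deriv C z u v = 0) ==> v = 0"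
begin

lemma CSuc: "C_k_on (Suc (Suc (Suc (Suc 0)))) C S"
proof -
 have "(4::nat) = Suc (Suc (Suc (Suc 0)))" by simp
 with C4 show ?thesis by (simp only:)
qed

lemma C2: "C_k_on 2 C S" by (rule C_k_on_le[OF C4]) simp

lemma pdC2: "C_k_on 2 (pd C u) S"
 by (rule C_k_on_le[OF C_k_on_frechet[OF CSuc]]) simp

lemma pdpdC2: "C_k_on 2 (pd (pd C u) v) S"
 using C_k_on_frechet[OF C_k_on_frechet[OF CSuc]] by (simp only: numeral_2_eq_2)

lemma mixed_eq: "z \<in> S ==> mixed_deriv C z p q = pd (pd C (0, q)) (p, 0) z"
 by (rule mixed_deriv_eq[OF C2 S_open])

lemma mixed_bilinear: assumes z: "z \<in> S" shows "bilinear (mixed_deriv C z)"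
proof -
 note b = frechet_second_bilinear[OF C2 S_open z]
 have e: "(0, u + v) = (0, u) + (0::'e, v)" "(u + v, 0) = (u, 0) + (v, 0::'e)" "(0, k *\<^sub>R u) = k *\<^sub>R (0::'e, u)" "(k *\<^sub>R u, 0) = k *\<^sub>R (u, 0::'e)" for u v :: 'e and k by simp_all
 show ?thesis unfolding bilinear_def mixed_eq[OF z]
  by (intro conjI allI linearI; simp only: e bilinear_ladd[OF b] bilinear_radd[OF b] bilinear_lmul[OF b] bilinear_rmul[OF b])
qed

lemma mixed_has_derivative:
 assumes z: "z \<in> S"
 shows "((\<lambda>y. mixed_deriv C y p q) has_derivative (\<lambda>w. pd (\<lambda>y. mixed_deriv C y p q) w z)) (at z)"
proof -
 have "C_k_on (Suc (Suc 0)) (pd (pd C (0, q)) (p, 0)) S" using pdpdC2 by (simp only: numeral_2_eq_2)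
 from C_k_on_has_derivative[OF this z]
 have "\<exists>D. ((\<lambda>y. mixed_deriv C y p q) has_derivative D) (at z)"
  using has_derivative_local_cong[OF S_open z, of "\<lambda>y. mixed_deriv C y p q" "pd (pd C (0, q)) (p, 0)"] mixed_eq by blast
 then show ?thesis using frechet_derivative_at by (metis (full_types))
qed

lemma pd_mixed: "z \<in> S ==> pd (\<lambda>y. mixed_deriv C y p q) w z = pd (pd (pd C (0, q)) (p, 0)) w z"
 by (rule pd_local_cong[OF S_open]) (auto simp: mixed_eq)

lemma pd_mixed_linear: "z \<in> S ==> linear (\<lambda>w. pd (\<lambda>y. mixed_deriv C y p q) w z)"
 using has_derivative_linear[OF mixed_has_derivative] .

lemma pd_mixed_commute:
 assumes z: "z \<in> S"
 shows "pd (\<lambda>y. mixed_deriv C y p r) (q, 0) z = pd (\<lambda>y. mixed_deriv C y q r) (p, 0) z"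
  and "pd (\<lambda>y. mixed_deriv C y p r) (0, q) z = pd (\<lambda>y. mixed_deriv C y p q) (0, r) z"
proof -
 note comm = frechet_derivative_commute[OF pdC2 S_open z]
 show "pd (\<lambda>y. mixed_deriv C y p r) (q, 0) z = pd (\<lambda>y. mixed_deriv C y q r) (p, 0) z"
  unfolding pd_mixed[OF z] by (rule comm)
 have "pd (pd (pd C (0, r)) (p, 0)) (0, q) z = pd (pd (pd C (0, r)) (0, q)) (p, 0) z" by (rule comm)
 also have "\<dots> = pd (pd (pd C (0, q)) (0, r)) (p, 0) z"
  by (rule pd_local_cong[OF S_open z frechet_derivative_commute[OF C2 S_open]])
 also have "\<dots> = pd (pd (pd C (0, q)) (p, 0)) (0, r) z" by (rule comm)
 finally show "pd (\<lambda>y. mixed_deriv C y p r) (0, q) z = pd (\<lambda>y. mixed_deriv C y p q) (0, r) z"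
  unfolding pd_mixed[OF z] .
qed

lemma coord_h_eq: "coord_h C z u v = (- 1 / 2) * (mixed_deriv C z (fst u) (snd v) + mixed_deriv C z (fst v) (snd u))"
 by (simp add: coord_h_def case_prod_beta field_simps)

lemma coord_h_bilinear: assumes z: "z \<in> S" shows "bilinear (coord_h C z)"
proof -
 note b = mixed_bilinear[OF z]
 show ?thesis unfolding bilinear_def coord_h_eq
  by (intro conjI allI linearI; simp only: fst_add snd_add fst_scaleR snd_scaleR bilinear_ladd[OF b] bilinear_radd[OF b] bilinear_lmul[OF b] bilinear_rmul[OF b]; simp add: field_simps)
qed

lemma coord_h_has_derivative:
 assumes z: "z \<in> S"
 shows "((\<lambda>y. coord_h C y u v) has_derivative (\<lambda>w. (- 1 / 2) * (pd (\<lambda>y. mixed_deriv C y (fst u) (snd v)) w z + pd (\<lambda>y. mixed_deriv C y (fst v) (snd u)) w z))) (at z)"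
 unfolding coord_h_eq by (intro has_derivative_mult_right has_derivative_add mixed_has_derivative z)

lemma pd_coord_h: "z \<in> S ==> pd (\<lambda>y. coord_h C y u v) w z =
  (- 1 / 2) * (pd (\<lambda>y. mixed_deriv C y (fst u) (snd v)) w z + pd (\<lambda>y. mixed_deriv C y (fst v) (snd u)) w z)"
 using fun_cong[OF frechet_derivative_at[OF coord_h_has_derivative], of z u v w] by simp

lemma coord_h_nondegenerate:
 assumes z: "z \<in> S" and 0: "!!q. coord_h C z u q = 0"
 shows "u = 0"
proof -
 note b = mixed_bilinear[OF z]
 have "mixed_deriv C z (fst u) q = 0" for q using 0[of "(0, q)"] by (simp add: coord_h_eq bilinear_lzero[OF b])
 moreover have "mixed_deriv C z q (snd u) = 0" for q using 0[of "(q, 0)"] by (simp add: coord_h_eq bilinear_rzero[OF b])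
 ultimately show ?thesis using nd1[OF z, of "fst u"] nd2[OF z, of "snd u"] by (simp add: prod_eq_iff)
qed

lemma christoffel_h:
 assumes z: "z \<in> S"
 shows "coord_h C z (christoffel (coord_h C) z u v) q = (pd (\<lambda>y. coord_h C y v q) u z + pd (\<lambda>y. coord_h C y u q) v z - pd (\<lambda>y. coord_h C y u v) q z) / 2"
 by (rule christoffel_eq[OF S_open z coord_h_bilinear differentiableI[OF coord_h_has_derivative[OF z]] coord_h_nondegenerate[OF z]])

lemma pd_mixed_zero: "z \<in> S ==> pd (\<lambda>y. mixed_deriv C y 0 q) w z = 0" "z \<in> S ==> pd (\<lambda>y. mixed_deriv C y p 0) w z = 0"
 using pd_local_cong[OF S_open, of z "\<lambda>y. mixed_deriv C y 0 q" "\<lambda>_. 0" w] pd_local_cong[OF S_open, of z "\<lambda>y. mixed_deriv C y p 0" "\<lambda>_. 0" w]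
  bilinear_lzero[OF mixed_bilinear] bilinear_rzero[OF mixed_bilinear] by auto

lemma pd_mixed_split:
 assumes "z \<in> S"
 shows "pd (\<lambda>y. mixed_deriv C y p r) (a, b) z = pd (\<lambda>y. mixed_deriv C y p r) (a, 0) z + pd (\<lambda>y. mixed_deriv C y p r) (0, b) z"
 using linear_add[OF pd_mixed_linear[OF assms], of p r "(a, 0)" "(0, b)"] by simp

text \<open>In product coordinates h has only its mixed block, and this block is itself a mixed
  Hessian; by symmetry of third derivatives the terms of the Koszul formula cancel.\<close>

lemma christoffel_mixed_zero:
 assumes z: "z \<in> S"
 shows "christoffel (coord_h C) z (p, 0) (0, r) = 0"
proof (rule coord_h_nondegenerate[OF z])
 fix q :: "'e \<times> 'e"
 obtain a b where q: "q = (a, b)" by (cases q)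
 show "coord_h C z (christoffel (coord_h C) z (p, 0) (0, r)) q = 0"
  unfolding christoffel_h[OF z] pd_coord_h[OF z] q
  using pd_mixed_commute(1)[OF z, of p r a] pd_mixed_commute(2)[OF z, of p r b] pd_mixed_split[OF z, of p r a b]
  by (simp add: pd_mixed_zero[OF z] add_divide_distrib)
qed

lemma christoffel_zero:
 assumes z: "z \<in> S"
 shows "christoffel (coord_h C) z u 0 = 0"
proof (rule coord_h_nondegenerate[OF z])
 fix q :: "'e \<times> 'e"
 show "coord_h C z (christoffel (coord_h C) z u 0) q = 0"
  unfolding christoffel_h[OF z] pd_coord_h[OF z]
  by (simp add: pd_mixed_zero[OF z] linear_0[OF pd_mixed_linear[OF z]])
qed

text \<open>The covariant derivative of a constant barred field along itself is again barred: it is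
  the vector that represents, through the mixed form, the derivative of C taken once in the first
  variable and twice along the field.\<close>

lemma christoffel_second:
 assumes z: "z \<in> S"
 shows "fst (christoffel (coord_h C) z (0, r) (0, r)) = 0"
  and "mixed_deriv C z q (snd (christoffel (coord_h C) z (0, r) (0, r))) = pd (pd (pd C (0, r)) (0, r)) (q, 0) z"
proof -
 let ?G = "christoffel (coord_h C) z (0, r) (0, r)"
 have G: "coord_h C z ?G (a, b) = - pd (\<lambda>y. mixed_deriv C y a r) (0, r) z / 2" for a b
  unfolding christoffel_h[OF z] pd_coord_h[OF z] by (simp add: pd_mixed_zero[OF z])
 have "mixed_deriv C z (fst ?G) b = 0" for b
  using G[of 0 b] by (simp add: coord_h_eq pd_mixed_zero[OF z] bilinear_lzero[OF mixed_bilinear[OF z]])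
 then show f: "fst ?G = 0" by (rule nd1[OF z])
 have "mixed_deriv C z q (snd ?G) = pd (\<lambda>y. mixed_deriv C y q r) (0, r) z"
  using G[of q 0] by (simp add: coord_h_eq bilinear_rzero[OF mixed_bilinear[OF z]])
 then show "mixed_deriv C z q (snd ?G) = pd (pd (pd C (0, r)) (0, r)) (q, 0) z"
  unfolding pd_mixed[OF z] frechet_derivative_commute[OF pdC2 S_open z, of "(0, r)" "(q, 0)"] .
qed

text \<open>As the mixed Christoffel symbols vanish, the curvature reduces to the derivative along p
  of the barred vector b. Differentiating the equation that defines b expresses this by a fourth
  derivative minus a third derivative with b frozen; -2 is the 4 of
  \<open>curvature_operator\<close> times the -1/2 of \<open>coord_h\<close>. In this form it is the
  second derivative along p of a single function whose first derivative vanishes in the first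
  variable.\<close>

lemma cross_curvature_formula:
 assumes z0: "z0 \<in> S"
 obtains b where "!!q. mixed_deriv C z0 q b = pd (pd (pd C (0, r)) (0, r)) (q, 0) z0"
  "!!p. curvature_operator (coord_h C) z0 ((p, 0), (0, r)) ((p, 0), (0, r)) =
   - 2 * (pd (pd (pd (pd C (0, r)) (0, r)) (p, 0)) (p, 0) z0 - pd (pd (pd C (0, b)) (p, 0)) (p, 0) z0)"
proof -
 define b where "b z = snd (christoffel (coord_h C) z (0, r) (0, r))" for z
 define E where "E q = pd (pd (pd C (0, r)) (0, r)) (q, 0)" for q
 have bE: "mixed_deriv C z q (b z) = E q z" if "z \<in> S" for z q unfolding b_def E_def by (rule christoffel_second(2)[OF that])
 have chr: "christoffel (coord_h C) z (0, r) (0, r) = (0, b z)" if "z \<in> S" for z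
  using christoffel_second(1)[OF that, of r] by (simp add: b_def prod_eq_iff)
 have evS: "\<forall>\<^sub>F z in nhds z0. z \<in> S" by (rule eventually_nhds_in_open[OF S_open z0])
 have Ed: "(E q has_derivative (\<lambda>w. pd (E q) w z0)) (at z0)" for q
  unfolding E_def by (rule C_k_on_has_derivative[OF _ z0, of 0]) (rule C_k_on_frechet, use pdpdC2 in \<open>simp only: numeral_2_eq_2\<close>)
 have "b differentiable (at z0)"
 proof (rule form_solution_differentiable[where B = "\<lambda>z u q. mixed_deriv C z q u" and l = "\<lambda>z q. E q z"])
  show "\<forall>\<^sub>F z in nhds z0. bilinear (\<lambda>u q. mixed_deriv C z q u)"
   using evS by eventually_elim (use mixed_bilinear in \<open>simp add: bilinear_def\<close>)
  show "(\<lambda>z. mixed_deriv C z v u) differentiable at z0" for u v using mixed_has_derivative[OF z0] by (auto simp: differentiable_def)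
  show "u = 0" if "!!q. mixed_deriv C z0 q u = 0" for u by (rule nd2[OF z0 that])
  show "\<forall>\<^sub>F z in nhds z0. \<forall>q. mixed_deriv C z q (b z) = E q z" using evS by eventually_elim (simp add: bE)
  show "(\<lambda>z. E q z) differentiable at z0" for q using Ed by (auto simp: differentiable_def)
 qed
 then have bd: "(b has_derivative frechet_derivative b (at z0)) (at z0)" by (simp add: frechet_derivative_works)
 have main: "curvature_operator (coord_h C) z0 ((p, 0), (0, r)) ((p, 0), (0, r)) =
   - 2 * (pd (E p) (p, 0) z0 - pd (pd (pd C (0, b z0)) (p, 0)) (p, 0) z0)" for p
 proof -
  define b' where "b' = pd b (p, 0) z0"
  have d1: "pd (\<lambda>y. christoffel (coord_h C) y (0, r) (0, r)) (p, 0) z0 = (0, b')"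
  proof -
   have "pd (\<lambda>y. christoffel (coord_h C) y (0, r) (0, r)) (p, 0) z0 = pd (\<lambda>y. (0::'e, b y)) (p, 0) z0"
    by (rule pd_local_cong[OF S_open z0 chr])
   also have "\<dots> = (0, b')"
    unfolding frechet_derivative_at[OF has_derivative_Pair[OF has_derivative_const bd], symmetric] b'_def ..
   finally show ?thesis .
  qed
  have d2: "pd (\<lambda>y. christoffel (coord_h C) y (p, 0) (0, r)) (0, r) z0 = 0"
  proof -
   have "pd (\<lambda>y. christoffel (coord_h C) y (p, 0) (0, r)) (0, r) z0 = pd (\<lambda>y. 0::'e \<times> 'e) (0, r) z0"
    by (rule pd_local_cong[OF S_open z0 christoffel_mixed_zero])
   then show ?thesis by simp
  qed
  have R: "curvature (coord_h C) z0 (p, 0) (0, r) (0, r) = (0, b')"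
   unfolding curvature_def d1 d2 christoffel_mixed_zero[OF z0] chr[OF z0] christoffel_zero[OF z0] by simp
  have op: "curvature_operator (coord_h C) z0 ((p, 0), (0, r)) ((p, 0), (0, r)) = - 2 * mixed_deriv C z0 p b'"
   unfolding curvature_operator_def by (simp add: R coord_h_eq bilinear_lzero[OF mixed_bilinear[OF z0]])
  \<comment> \<open>Expanding b in a basis turns the mixed form, in which both the base point and
    the vector vary, into a finite sum of products that can be differentiated.\<close>
  have exp: "mixed_deriv C z p v = (\<Sum>j\<in>Basis. (v \<bullet> j) * mixed_deriv C z p j)" if "z \<in> S" for z v
  proof (rule linear_expand)
   show "linear (mixed_deriv C z p)" using mixed_bilinear[OF that] by (simp add: bilinear_def)
  qed
  have "((\<lambda>z. \<Sum>j\<in>Basis. (b z \<bullet> j) * mixed_deriv C z p j) has_derivative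
    (\<lambda>w. \<Sum>j\<in>Basis. (b z0 \<bullet> j) * pd (\<lambda>y. mixed_deriv C y p j) w z0 + (pd b w z0 \<bullet> j) * mixed_deriv C z0 p j)) (at z0)"
   by (intro has_derivative_sum has_derivative_mult has_derivative_inner_left bd mixed_has_derivative z0)
  then have "((\<lambda>z. E p z) has_derivative
    (\<lambda>w. \<Sum>j\<in>Basis. (b z0 \<bullet> j) * pd (\<lambda>y. mixed_deriv C y p j) w z0 + (pd b w z0 \<bullet> j) * mixed_deriv C z0 p j)) (at z0)"
   by (rule has_derivative_transform_within_open[OF _ S_open z0]) (simp flip: exp bE)
  from fun_cong[OF frechet_derivative_at[OF this], of "(p, 0)"]
  have e1: "pd (E p) (p, 0) z0 = (\<Sum>j\<in>Basis. (b z0 \<bullet> j) * pd (\<lambda>y. mixed_deriv C y p j) (p, 0) z0) + mixed_deriv C z0 p b'"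
   unfolding exp[OF z0, of b'] by (simp add: sum.distrib b'_def)
  have "((\<lambda>z. \<Sum>j\<in>Basis. (b z0 \<bullet> j) * mixed_deriv C z p j) has_derivative
    (\<lambda>w. \<Sum>j\<in>Basis. (b z0 \<bullet> j) * pd (\<lambda>y. mixed_deriv C y p j) w z0)) (at z0)"
   by (intro has_derivative_sum has_derivative_mult_right mixed_has_derivative z0)
  then have "((\<lambda>z. mixed_deriv C z p (b z0)) has_derivative
    (\<lambda>w. \<Sum>j\<in>Basis. (b z0 \<bullet> j) * pd (\<lambda>y. mixed_deriv C y p j) w z0)) (at z0)"
   by (rule has_derivative_transform_within_open[OF _ S_open z0]) (simp flip: exp)
  from fun_cong[OF frechet_derivative_at[OF this], of "(p, 0)"]
  have e2: "pd (\<lambda>z. mixed_deriv C z p (b z0)) (p, 0) z0 = (\<Sum>j\<in>Basis. (b z0 \<bullet> j) * pd (\<lambda>y. mixed_deriv C y p j) (p, 0) z0)" by simp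
  show ?thesis unfolding op pd_mixed[OF z0, symmetric] using e1 e2 by simp
 qed
 show ?thesis by (rule that[of "b z0", OF bE[OF z0, unfolded E_def] main[unfolded E_def]])
qed

end

text \<open>Christoffel symbols have to be differentiated, so nondegeneracy is needed on a
  neighbourhood and not just at the base point; the uniform bounds of
  \<open>form_lower_bound\<close> in both arguments provide it.\<close>

lemma nondegenerate_near:
 fixes C :: "'e::euclidean_space \<times> 'e => real"
 assumes C: "C_k_on 4 C S" and S: "open S" "z0 \<in> S"
  and nd1: "!!u. (!!v. mixed_deriv C z0 u v = 0) ==> u = 0"
  and nd2: "!!v. (!!u. mixed_deriv C z0 u v = 0) ==> v = 0"
 obtains T where "T \<subseteq> S" "z0 \<in> T" "mixed_nondegenerate C T"
proof -
 have C2: "C_k_on 2 C S" by (rule C_k_on_le[OF C]) simp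
 have bil: "bilinear (mixed_deriv C z)" if z: "z \<in> S" for z
 proof -
  note b = frechet_second_bilinear[OF C2 S(1) z]
  have e: "(0, u + v) = (0, u) + (0::'e, v)" "(u + v, 0) = (u, 0) + (v, 0::'e)" "(0, k *\<^sub>R u) = k *\<^sub>R (0::'e, u)" "(k *\<^sub>R u, 0) = k *\<^sub>R (u, 0::'e)" for u v :: 'e and k by simp_all
  show ?thesis unfolding bilinear_def mixed_deriv_eq[OF C2 S(1) z]
   by (intro conjI allI linearI; simp only: e bilinear_ladd[OF b] bilinear_radd[OF b] bilinear_lmul[OF b] bilinear_rmul[OF b])
 qed
 have evS: "\<forall>\<^sub>F z in nhds z0. z \<in> S" by (rule eventually_nhds_in_open[OF S])
 have lim: "((\<lambda>z. mixed_deriv C z u v) \<longlongrightarrow> mixed_deriv C z0 u v) (nhds z0)" for u v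
 proof -
  have "C_k_on (Suc (Suc 0)) C S" using C2 by (simp only: numeral_2_eq_2)
  then have "continuous_on S (pd (pd C (0, v)) (u, 0))" by (intro C_k_on_continuous[OF C_k_on_frechet] C_k_on_frechet)
  then have "continuous_on S (\<lambda>z. mixed_deriv C z u v)" by (rule continuous_on_eq) (simp add: mixed_deriv_eq[OF C2 S(1)])
  then have "isCont (\<lambda>z. mixed_deriv C z u v) z0" using S by (simp add: continuous_on_eq_continuous_at)
  then show ?thesis using tendsto_at_iff_tendsto_nhds[of "\<lambda>z. mixed_deriv C z u v" z0] by (simp add: isCont_def)
 qed
 have b1: "\<forall>\<^sub>F z in nhds z0. bilinear (mixed_deriv C z)" using evS by eventually_elim (rule bil)
 have b2: "\<forall>\<^sub>F z in nhds z0. bilinear (\<lambda>v u. mixed_deriv C z u v)" using b1 by eventually_elim (simp add: bilinear_def)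
 obtain K1 where K1: "\<forall>\<^sub>F z in nhds z0. \<forall>w. norm w <= K1 * (\<Sum>i\<in>Basis. \<bar>mixed_deriv C z w i\<bar>)"
  using form_lower_bound[OF b1 lim nd1] by blast
 obtain K2 where K2: "\<forall>\<^sub>F z in nhds z0. \<forall>w. norm w <= K2 * (\<Sum>i\<in>Basis. \<bar>mixed_deriv C z i w\<bar>)"
  using form_lower_bound[OF b2 lim nd2] by blast
 from evS K1 K2 have "\<forall>\<^sub>F z in nhds z0. z \<in> S \<and> (\<forall>u. (\<forall>v. mixed_deriv C z u v = 0) --> u = 0) \<and> (\<forall>v. (\<forall>u. mixed_deriv C z u v = 0) --> v = 0)"
  by eventually_elim (metis (no_types, lifting) abs_zero mult_zero_right norm_le_zero_iff sum.neutral)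
 then obtain T where T: "open T" "z0 \<in> T" "!!z. z \<in> T ==> z \<in> S \<and> (\<forall>u. (\<forall>v. mixed_deriv C z u v = 0) --> u = 0) \<and> (\<forall>v. (\<forall>u. mixed_deriv C z u v = 0) --> v = 0)"
  unfolding eventually_nhds by blast
 show ?thesis
 proof (rule that[of T])
  show TS: "T \<subseteq> S" using T(3) by blast
  show "mixed_nondegenerate C T" by unfold_locales (use T C_k_on_subset[OF C TS] in auto)
 qed (rule T(2))
qed

section \<open>Second order contact of two costs\<close>

lemma eventually_nhds_imp_at: "eventually R (nhds a) ==> eventually R (at a within T)"
 unfolding eventually_at_filter by (erule eventually_mono) blast

text \<open>The section is given only as a continuous map, but it satisfies equations that are
  nondegenerate in the unknown. Comparing their linearizations determines the derivative, and the
  relation \<open>P (si x) = x\<close> makes it a right inverse of \<open>P'\<close>.\<close>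

lemma section_derivative:
 fixes si :: "'f::euclidean_space => 'e::euclidean_space" and N :: "'e => 'e => real"
 assumes si: "isCont si x0" and N: "bilinear N" and nd: "!!u. (!!q. N u q = 0) ==> u = 0"
  and E: "!!q. (E q has_derivative (\<lambda>u. N u q)) (at (si x0))"
  and K: "!!q. (L q has_derivative (\<lambda>v. K v q)) (at x0)" "!!v. linear (K v)"
  and eq: "\<forall>\<^sub>F x in nhds x0. \<forall>q. E q (si x) = L q x"
  and P: "(P has_derivative P') (at (si x0))" "\<forall>\<^sub>F x in nhds x0. P (si x) = x"
 obtains S where "(si has_derivative S) (at x0)" "!!v q. N (S v) q = K v q" "!!v. P' (S v) = v"
proof -
 have "\<exists>!w. \<forall>q. N w q = K v q" for v by (rule form_represent[OF N nd K(2)])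
 then obtain S where S: "!!v q. N (S v) q = K v q" by metis
 have uniq: "w = w'" if "!!q. N w q = N w' q" for w w'
  using nd[of "w - w'"] that by (simp add: bilinear_lsub[OF N])
 have Klin: "linear (\<lambda>v. K v q)" for q by (rule has_derivative_linear[OF K(1)])
 have Slin: "linear S"
 proof (rule linearI)
  show "S (a + b) = S a + S b" for a b
   by (rule uniq) (simp add: S bilinear_ladd[OF N] linear_add[OF Klin])
  show "S (r *\<^sub>R b) = r *\<^sub>R S b" for r b
   by (rule uniq) (simp add: S bilinear_lmul[OF N] linear_scale[OF Klin])
 qed
 define Ph where "Ph s = (\<Sum>i\<in>Basis. E i s *\<^sub>R i)" for s
 have Ph: "(Ph has_derivative (\<lambda>u. \<Sum>i\<in>Basis. N u i *\<^sub>R i)) (at (si x0))"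
  unfolding Ph_def by (intro has_derivative_sum has_derivative_scaleR_left E)
 have S': "(si has_derivative S) (at x0)"
 proof (rule has_derivative_left_cancel[OF si Ph _ _ Slin])
  fix u assume 0: "(\<Sum>i\<in>Basis. N u i *\<^sub>R i) = 0"
  have "N u i = 0" if "i \<in> Basis" for i
   using arg_cong[OF 0, of "\<lambda>z. z \<bullet> i"] that by (simp add: inner_sum_left inner_Basis if_distrib sum.delta cong: if_cong)
  moreover have "linear (N u)" using N by (simp add: bilinear_def)
  ultimately have "N u q = 0" for q using linear_expand[of "N u" q] by simp
  then show "u = 0" by (rule nd)
 next
  have "((\<lambda>x. \<Sum>i\<in>Basis. L i x *\<^sub>R i) has_derivative (\<lambda>h. \<Sum>i\<in>Basis. N (S h) i *\<^sub>R i)) (at x0)"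
   unfolding S by (intro has_derivative_sum has_derivative_scaleR_left K)
  then show "((\<lambda>x. Ph (si x)) has_derivative (\<lambda>h. \<Sum>i\<in>Basis. N (S h) i *\<^sub>R i)) (at x0)"
  proof (rule has_derivative_transform_eventually)
   show "\<forall>\<^sub>F x in at x0. (\<Sum>i\<in>Basis. L i x *\<^sub>R i) = Ph (si x)"
    using eventually_nhds_imp_at[OF eq] by eventually_elim (simp add: Ph_def)
   show "(\<Sum>i\<in>Basis. L i x0 *\<^sub>R i) = Ph (si x0)" using eventually_nhds_x_imp_x[OF eq] by (simp add: Ph_def)
  qed simp
 qed
 have "((\<lambda>x. P (si x)) has_derivative (\<lambda>v. P' (S v))) (at x0)" by (rule has_derivative_compose[OF S' P(1)])
 then have "((\<lambda>x. x) has_derivative (\<lambda>v. P' (S v))) (at x0)"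
 proof (rule has_derivative_transform_eventually)
  show "\<forall>\<^sub>F x in at x0. P (si x) = x" by (rule eventually_nhds_imp_at[OF P(2)])
  show "P (si x0) = x0" by (rule eventually_nhds_x_imp_x[OF P(2)])
 qed simp
 then have "P' (S v) = v" for v using has_derivative_unique[OF _ has_derivative_ident] by metis
 then show ?thesis by (rule that[OF S' S])
qed

context mixed_nondegenerate
begin

lemma C_has_derivative: "z \<in> S ==> (C has_derivative (\<lambda>w. pd C w z)) (at z)"
 by (rule C_k_on_has_derivative[OF CSuc])

lemma pdC_has_derivative: "z \<in> S ==> (pd C u has_derivative (\<lambda>w. pd (pd C u) w z)) (at z)"
 by (rule C_k_on_has_derivative[OF C_k_on_frechet[OF CSuc]])

lemma pdpdC_has_derivative: "z \<in> S ==> (pd (pd C u) v has_derivative (\<lambda>w. pd (pd (pd C u) v) w z)) (at z)"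
 by (rule C_k_on_has_derivative[OF C_k_on_frechet[OF C_k_on_frechet[OF CSuc]]])

lemma pdC_linear: "z \<in> S ==> linear (\<lambda>w. pd C w z)" by (rule has_derivative_linear[OF C_has_derivative])

lemma pdpdC_bilinear: "z \<in> S ==> bilinear (\<lambda>u v. pd (pd C u) v z)" by (rule frechet_second_bilinear[OF C2 S_open])

text \<open>The chain rule when the point and the direction of differentiation both move: the
  direction enters linearly and contributes a first derivative of C.\<close>

lemma moving_pd_derivative:
 fixes k y :: "real => 'e"
 assumes X: "(x, y 0) \<in> S" and k: "(k has_vector_derivative k') (at 0)" and y: "(y has_vector_derivative y') (at 0)"
 shows "((\<lambda>rh. pd C (0, k rh) (x, y rh)) has_real_derivative
   pd C (0, k') (x, y 0) + pd (pd C (0, k 0)) (0, y') (x, y 0)) (at 0)"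
proof -
 have lin2: "linear (\<lambda>v. pd C (0, v) z)" if "z \<in> S" for z
  by (rule linear_compose[of "\<lambda>v. (0, v)" "\<lambda>w. pd C w z", unfolded comp_def, OF _ pdC_linear[OF that]]) (simp add: linear_iff)
 have exp: "pd C (0, v) z = (\<Sum>j\<in>Basis. (v \<bullet> j) * pd C (0, j) z)" if "z \<in> S" for v z by (rule linear_expand[OF lin2[OF that]])
 have lin3: "linear (\<lambda>v. pd (pd C (0, v)) (0, y') (x, y 0))"
  using linear_compose[of "\<lambda>v. (0::'e, v)" "\<lambda>u. pd (pd C u) (0, y') (x, y 0)"] pdpdC_bilinear[OF X] by (simp add: bilinear_def comp_def linear_iff)
 have z: "((\<lambda>rh. (x, y rh)) has_derivative (\<lambda>h. (0, h *\<^sub>R y'))) (at 0)"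
  using y unfolding has_vector_derivative_def by (intro has_derivative_Pair has_derivative_const)
 have kj: "((\<lambda>rh. k rh \<bullet> j) has_real_derivative k' \<bullet> j) (at 0)" for j
  using has_derivative_inner_left[OF k[unfolded has_vector_derivative_def], of j] by (simp add: has_field_derivative_def mult.commute[of _ "k' \<bullet> j"])
 have Ej: "((\<lambda>rh. pd C (0, j) (x, y rh)) has_real_derivative pd (pd C (0, j)) (0, y') (x, y 0)) (at 0)" for j
 proof -
  have "((\<lambda>rh. pd C (0, j) (x, y rh)) has_derivative (\<lambda>h. pd (pd C (0, j)) (0, h *\<^sub>R y') (x, y 0))) (at 0)"
   by (rule has_derivative_compose[OF z pdC_has_derivative[OF X]])
  moreover have "pd (pd C (0, j)) (0, h *\<^sub>R y') (x, y 0) = pd (pd C (0, j)) (0, y') (x, y 0) * h" for h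
   using linear_scale[OF has_derivative_linear[OF pdC_has_derivative[OF X, of "(0, j)"]], of h "(0, y')"] by simp
  ultimately show ?thesis by (simp add: has_field_derivative_def)
 qed
 have "((\<lambda>rh. \<Sum>j\<in>Basis. (k rh \<bullet> j) * pd C (0, j) (x, y rh)) has_real_derivative
   (\<Sum>j\<in>Basis. k' \<bullet> j * pd C (0, j) (x, y 0) + pd (pd C (0, j)) (0, y') (x, y 0) * (k 0 \<bullet> j))) (at 0)"
  by (intro DERIV_sum DERIV_mult kj Ej)
 also have "(\<Sum>j\<in>Basis. k' \<bullet> j * pd C (0, j) (x, y 0) + pd (pd C (0, j)) (0, y') (x, y 0) * (k 0 \<bullet> j)) =
   pd C (0, k') (x, y 0) + pd (pd C (0, k 0)) (0, y') (x, y 0)"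
  unfolding exp[OF X, of k'] linear_expand[OF lin3, of "k 0"] by (simp add: sum.distrib mult.commute)
 finally have D: "((\<lambda>rh. \<Sum>j\<in>Basis. (k rh \<bullet> j) * pd C (0, j) (x, y rh)) has_real_derivative
   pd C (0, k') (x, y 0) + pd (pd C (0, k 0)) (0, y') (x, y 0)) (at 0)" .
 have "isCont (\<lambda>rh. (x, y rh)) 0" using z by (rule has_derivative_continuous)
 then have "\<forall>\<^sub>F rh in nhds 0. (x, y rh) \<in> S"
  using S_open X topological_tendstoD[of "\<lambda>rh. (x, y rh)" "(x, y 0)" "nhds 0" S] tendsto_at_iff_tendsto_nhds[of "\<lambda>rh. (x, y rh)" 0] by (auto simp: isCont_def)
 then have "\<forall>\<^sub>F rh in nhds 0. (\<Sum>j\<in>Basis. (k rh \<bullet> j) * pd C (0, j) (x, y rh)) = pd C (0, k rh) (x, y rh)"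
  by eventually_elim (simp flip: exp)
 from DERIV_cong_ev[OF refl this refl] D show ?thesis by simp
qed

end

lemma isCont_eventually_in:
 assumes "isCont h a" "open T" "h a \<in> T"
 shows "\<forall>\<^sub>F x in nhds a. h x \<in> T"
 using topological_tendstoD[of h "h a" "nhds a" T] assms tendsto_at_iff_tendsto_nhds[of h a] by (simp add: isCont_def)

lemma local_min_derivative_zero:
 assumes "(h has_derivative h') (at a)" "\<forall>\<^sub>F x in nhds a. h a <= h x"
 shows "h' = (\<lambda>_. 0 :: real)"
 by (rule has_derivative_local_min[OF assms(1)]) (rule eventually_nhds_imp_at[OF assms(2)])

text \<open>What the comparison takes from the submersion, in coordinates: domination of one cost by
  the other, and contact along one section in each variable. Of the sections only continuity at the
  base point is demanded; their derivatives follow from the contact.\<close>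

locale cost_contact = M: mixed_nondegenerate CM SM + B: mixed_nondegenerate CB SB
 for CM :: "'e::euclidean_space \<times> 'e => real" and SM and CB :: "'f::euclidean_space \<times> 'f => real" and SB +
 fixes P Q :: "'e => 'f" and U V :: "'e set" and P' and s0 t0 :: 'e and x0 xb0 :: 'f and si ta :: "'f => 'e"
 assumes P_der: "(P has_derivative P') (at s0)" and U: "open U" "s0 \<in> U" and P0: "P s0 = x0"
  and Q_smooth: "smooth_on Q V" and V: "open V" "t0 \<in> V" and Q0: "Q t0 = xb0"
  and base: "(s0, t0) \<in> SM" "(x0, xb0) \<in> SB"
  and le: "!!s t. s \<in> U ==> t \<in> V ==> CB (P s, Q t) <= CM (s, t)"
  and si: "isCont si x0" "si x0 = s0" "\<forall>\<^sub>F x in nhds x0. P (si x) = x \<and> CM (si x, t0) = CB (x, xb0)"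
  and ta: "isCont ta xb0" "ta xb0 = t0" "\<forall>\<^sub>F x in nhds xb0. Q (ta x) = x \<and> CM (s0, ta x) = CB (x0, x)"
begin

abbreviation Q' where "Q' \<equiv> frechet_derivative Q (at t0)"

lemma Q_has_derivative: "t \<in> V ==> (Q has_derivative frechet_derivative Q (at t)) (at t)"
 by (rule smooth_on_has_derivative[OF Q_smooth])

lemma pdQ_has_derivative: "t \<in> V ==> (pd Q u has_derivative (\<lambda>w. pd (pd Q u) w t)) (at t)"
 using C_k_on_has_derivative[OF C_k_on_frechet, of 0 Q V t u] Q_smooth unfolding smooth_on_def by blast

lemma section_near:
 "\<forall>\<^sub>F x in nhds x0. P (si x) = x \<and> CM (si x, t0) = CB (x, xb0) \<and> si x \<in> U \<and> (si x, t0) \<in> SM \<and> (x, xb0) \<in> SB"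
 "\<forall>\<^sub>F x in nhds xb0. Q (ta x) = x \<and> CM (s0, ta x) = CB (x0, x) \<and> ta x \<in> V \<and> (s0, ta x) \<in> SM \<and> (x0, x) \<in> SB"
proof -
 have "\<forall>\<^sub>F x in nhds x0. si x \<in> U" "\<forall>\<^sub>F x in nhds x0. (si x, t0) \<in> SM" "\<forall>\<^sub>F x in nhds x0. (x, xb0) \<in> SB"
  by (rule isCont_eventually_in; use U V si base M.S_open B.S_open in \<open>auto intro!: continuous_intros\<close>)+
 with si(3) show "\<forall>\<^sub>F x in nhds x0. P (si x) = x \<and> CM (si x, t0) = CB (x, xb0) \<and> si x \<in> U \<and> (si x, t0) \<in> SM \<and> (x, xb0) \<in> SB"
  by eventually_elim blast
 have "\<forall>\<^sub>F x in nhds xb0. ta x \<in> V" "\<forall>\<^sub>F x in nhds xb0. (s0, ta x) \<in> SM" "\<forall>\<^sub>F x in nhds xb0. (x0, x) \<in> SB"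
  by (rule isCont_eventually_in; use U V ta base M.S_open B.S_open in \<open>auto intro!: continuous_intros\<close>)+
 with ta(3) show "\<forall>\<^sub>F x in nhds xb0. Q (ta x) = x \<and> CM (s0, ta x) = CB (x0, x) \<and> ta x \<in> V \<and> (s0, ta x) \<in> SM \<and> (x0, x) \<in> SB"
  by eventually_elim blast
qed

text \<open>A nonnegative difference is stationary where it vanishes. The statement covers every
  contact point, not just the base point, so that the resulting identities can be differentiated
  along the sections.\<close>

lemma contact_derivative_snd:
 assumes st: "s \<in> U" "t \<in> V" "(s, t) \<in> SM" "(P s, Q t) \<in> SB" "CM (s, t) = CB (P s, Q t)"
 shows "pd CM (0, q) (s, t) = pd CB (0, pd Q q t) (P s, Q t)"
proof -
 have 1: "((\<lambda>t. CM (s, t)) has_derivative (\<lambda>h. pd CM (0, h) (s, t))) (at t)" by (rule partial_has_derivative(1)[OF M.C_has_derivative[OF st(3)]])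
 have 2: "((\<lambda>t. CB (P s, Q t)) has_derivative (\<lambda>h. pd CB (0, pd Q h t) (P s, Q t))) (at t)"
  by (rule has_derivative_compose[OF Q_has_derivative[OF st(2)] partial_has_derivative(1)[OF B.C_has_derivative[OF st(4)]]])
 have "(\<lambda>h. pd CM (0, h) (s, t) - pd CB (0, pd Q h t) (P s, Q t)) = (\<lambda>_. 0)"
 proof (rule local_min_derivative_zero[OF has_derivative_diff[OF 1 2]])
  show "\<forall>\<^sub>F t' in nhds t. CM (s, t) - CB (P s, Q t) <= CM (s, t') - CB (P s, Q t')"
   using eventually_nhds_in_open[OF V(1) st(2)] by eventually_elim (use le[OF st(1)] st(5) in simp)
 qed
 from fun_cong[OF this, of q] show ?thesis by simp
qed

lemma contact_derivative_fst:
 assumes t: "t \<in> V" "(s0, t) \<in> SM" "(x0, Q t) \<in> SB" "CM (s0, t) = CB (x0, Q t)"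
 shows "pd CM (p, 0) (s0, t) = pd CB (P' p, 0) (x0, Q t)"
proof -
 have 1: "((\<lambda>s. CM (s, t)) has_derivative (\<lambda>h. pd CM (h, 0) (s0, t))) (at s0)" by (rule partial_has_derivative(2)[OF M.C_has_derivative[OF t(2)]])
 have 2: "((\<lambda>s. CB (P s, Q t)) has_derivative (\<lambda>h. pd CB (P' h, 0) (x0, Q t))) (at s0)"
  by (rule has_derivative_compose[OF P_der]) (unfold P0, rule partial_has_derivative(2)[OF B.C_has_derivative[OF t(3)]])
 have "(\<lambda>h. pd CM (h, 0) (s0, t) - pd CB (P' h, 0) (x0, Q t)) = (\<lambda>_. 0)"
 proof (rule local_min_derivative_zero[OF has_derivative_diff[OF 1 2]])
  show "\<forall>\<^sub>F s in nhds s0. CM (s0, t) - CB (P s0, Q t) <= CM (s, t) - CB (P s, Q t)"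
   using eventually_nhds_in_open[OF U] by eventually_elim (use le[OF _ t(1)] t(4) P0 in simp)
 qed
 from fun_cong[OF this, of p] show ?thesis by simp
qed

lemma P'_linear: "linear P'" by (rule has_derivative_linear[OF P_der])

lemma Q'_linear: "linear Q'" by (rule has_derivative_linear[OF Q_has_derivative[OF V(2)]])

lemma section1_derivative:
 obtains S where "(si has_derivative S) (at x0)" "!!v q. mixed_deriv CM (s0, t0) (S v) q = mixed_deriv CB (x0, xb0) v (Q' q)" "!!v. P' (S v) = v"
proof (rule section_derivative[where si = si and N = "mixed_deriv CM (s0, t0)" and E = "\<lambda>q s. pd CM (0, q) (s, t0)" and L = "\<lambda>q x. pd CB (0, Q' q) (x, xb0)"
  and K = "\<lambda>v q. mixed_deriv CB (x0, xb0) v (Q' q)" and P = P and P' = P'])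
 show "((\<lambda>s. pd CM (0, q) (s, t0)) has_derivative (\<lambda>u. mixed_deriv CM (s0, t0) u q)) (at (si x0))" for q
  unfolding M.mixed_eq[OF base(1)] si(2) by (rule partial_has_derivative(2)[OF M.pdC_has_derivative[OF base(1)]])
 show "((\<lambda>x. pd CB (0, Q' q) (x, xb0)) has_derivative (\<lambda>v. mixed_deriv CB (x0, xb0) v (Q' q))) (at x0)" for q
  unfolding B.mixed_eq[OF base(2)] by (rule partial_has_derivative(2)[OF B.pdC_has_derivative[OF base(2)]])
 show "linear (\<lambda>q. mixed_deriv CB (x0, xb0) v (Q' q))" for v
  using linear_compose[OF Q'_linear, of "mixed_deriv CB (x0, xb0) v"] B.mixed_bilinear[OF base(2)] by (simp add: bilinear_def comp_def)
 show "\<forall>\<^sub>F x in nhds x0. \<forall>q. pd CM (0, q) (si x, t0) = pd CB (0, Q' q) (x, xb0)"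
  using section_near(1)
 proof eventually_elim
  case (elim x)
  then show ?case using contact_derivative_snd[of "si x" t0] V(2) Q0 by simp
 qed
 show "(P has_derivative P') (at (si x0))" using P_der si(2) by simp
 show "\<forall>\<^sub>F x in nhds x0. P (si x) = x" using si(3) by eventually_elim blast
qed (use si(1) M.mixed_bilinear[OF base(1)] M.nd1[OF base(1)] in \<open>auto intro: that\<close>)

lemma section2_derivative:
 obtains T where "(ta has_derivative T) (at xb0)" "!!v p. mixed_deriv CM (s0, t0) p (T v) = mixed_deriv CB (x0, xb0) (P' p) v" "!!v. Q' (T v) = v"
proof (rule section_derivative[where si = ta and N = "\<lambda>u p. mixed_deriv CM (s0, t0) p u" and E = "\<lambda>p t. pd CM (p, 0) (s0, t)" and L = "\<lambda>p x. pd CB (P' p, 0) (x0, x)"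
  and K = "\<lambda>v p. mixed_deriv CB (x0, xb0) (P' p) v" and P = Q and P' = Q'])
 show "((\<lambda>t. pd CM (p, 0) (s0, t)) has_derivative (\<lambda>u. mixed_deriv CM (s0, t0) p u)) (at (ta xb0))" for p
  unfolding M.mixed_eq[OF base(1)] ta(2) frechet_derivative_commute[OF M.C2 M.S_open base(1), of "(0, _)" "(p, 0)"]
  by (rule partial_has_derivative(1)[OF M.pdC_has_derivative[OF base(1)]])
 show "((\<lambda>x. pd CB (P' p, 0) (x0, x)) has_derivative (\<lambda>v. mixed_deriv CB (x0, xb0) (P' p) v)) (at xb0)" for p
  unfolding B.mixed_eq[OF base(2)] frechet_derivative_commute[OF B.C2 B.S_open base(2), of "(0, _)" "(P' p, 0)"]
  by (rule partial_has_derivative(1)[OF B.pdC_has_derivative[OF base(2)]])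
 show "linear (\<lambda>p. mixed_deriv CB (x0, xb0) (P' p) v)" for v
  using linear_compose[OF P'_linear, of "\<lambda>p. mixed_deriv CB (x0, xb0) p v"] B.mixed_bilinear[OF base(2)] by (simp add: bilinear_def comp_def)
 show "\<forall>\<^sub>F x in nhds xb0. \<forall>p. pd CM (p, 0) (s0, ta x) = pd CB (P' p, 0) (x0, x)"
  using section_near(2)
 proof eventually_elim
  case (elim x)
  then show ?case using contact_derivative_fst[of "ta x"] by simp
 qed
 show "(Q has_derivative Q') (at (ta xb0))" using Q_has_derivative[OF V(2)] ta(2) by simp
 show "\<forall>\<^sub>F x in nhds xb0. Q (ta x) = x" using ta(3) by eventually_elim blast
 show "bilinear (\<lambda>u p. mixed_deriv CM (s0, t0) p u)" using M.mixed_bilinear[OF base(1)] by (simp add: bilinear_def)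
qed (use ta(1) M.nd2[OF base(1)] in \<open>auto intro: that\<close>)

text \<open>The second derivative at t0, in the direction wb of the barred variable, of the
  nonnegative difference of costs over the section point above x. The last term stems from the
  second derivative of Q.\<close>

definition H :: "'e => 'f => real" where
 "H wb x = pd (pd CM (0, wb)) (0, wb) (si x, t0) - pd (pd CB (0, Q' wb)) (0, Q' wb) (x, xb0) - pd CB (0, pd (pd Q wb) wb t0) (x, xb0)"

lemma Q_along:
 assumes "t0 + rh *\<^sub>R w \<in> V"
 shows "((\<lambda>rh. Q (t0 + rh *\<^sub>R w)) has_vector_derivative pd Q w (t0 + rh *\<^sub>R w)) (at rh)"
  "((\<lambda>rh. pd Q w (t0 + rh *\<^sub>R w)) has_vector_derivative pd (pd Q w) w (t0 + rh *\<^sub>R w)) (at rh)"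
proof -
 have l: "((\<lambda>rh. t0 + rh *\<^sub>R w) has_derivative (\<lambda>h. h *\<^sub>R w)) (at rh)" by (auto intro!: derivative_eq_intros)
 show "((\<lambda>rh. Q (t0 + rh *\<^sub>R w)) has_vector_derivative pd Q w (t0 + rh *\<^sub>R w)) (at rh)"
  using has_derivative_compose[OF l Q_has_derivative[OF assms]] linear_scale[OF has_derivative_linear[OF Q_has_derivative[OF assms]]]
  by (simp add: has_vector_derivative_def)
 show "((\<lambda>rh. pd Q w (t0 + rh *\<^sub>R w)) has_vector_derivative pd (pd Q w) w (t0 + rh *\<^sub>R w)) (at rh)"
  using has_derivative_compose[OF l pdQ_has_derivative[OF assms]] linear_scale[OF has_derivative_linear[OF pdQ_has_derivative[OF assms]]]
  by (simp add: has_vector_derivative_def)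
qed

lemma H_nonneg: "\<forall>\<^sub>F x in nhds x0. 0 <= H wb x"
 using section_near(1)
proof eventually_elim
 case (elim x)
 define t where "t rh = t0 + rh *\<^sub>R wb" for rh :: real
 have tcont: "isCont t rh" for rh unfolding t_def by (intro continuous_intros)
 have t00: "t 0 = t0" by (simp add: t_def)
 have Qc: "isCont (\<lambda>rh. Q (t rh)) 0"
  using Q_along(1)[of 0 wb] V(2) unfolding t_def by (auto intro: has_vector_derivative_continuous)
 have "\<forall>\<^sub>F rh in nhds 0. t rh \<in> V" "\<forall>\<^sub>F rh in nhds 0. (si x, t rh) \<in> SM" "\<forall>\<^sub>F rh in nhds 0. (x, Q (t rh)) \<in> SB"
  by (rule isCont_eventually_in; use V elim t00 Q0 tcont Qc M.S_open B.S_open in \<open>auto intro!: continuous_intros\<close>)+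
 then have "\<forall>\<^sub>F rh in nhds 0. t rh \<in> V \<and> (si x, t rh) \<in> SM \<and> (x, Q (t rh)) \<in> SB" by eventually_elim blast
 then obtain de where de: "de > 0" "!!rh. \<bar>rh\<bar> < de ==> t rh \<in> V \<and> (si x, t rh) \<in> SM \<and> (x, Q (t rh)) \<in> SB"
  unfolding eventually_nhds_metric by (auto simp: dist_real_def)
 define h where "h rh = CM (si x, t rh) - CB (x, Q (t rh))" for rh
 define h' where "h' rh = pd CM (0, wb) (si x, t rh) - pd CB (0, pd Q wb (t rh)) (x, Q (t rh))" for rh
 have zl: "(si x, t rh) = (si x, t0) + rh *\<^sub>R (0, wb)" for rh by (simp add: t_def)
 show ?case
 proof (rule second_derivative_at_min(2)[OF de(1)])
  fix rh assume rh: "\<bar>rh\<bar> < de"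
  have 1: "((\<lambda>rh. CM (si x, t rh)) has_real_derivative pd CM (0, wb) (si x, t rh)) (at rh)"
   unfolding zl by (rule has_derivative_along_line, unfold zl[symmetric], rule M.C_has_derivative) (use de(2)[OF rh] in blast)
  have "((\<lambda>rh. CB (x, Q (t rh))) has_derivative (\<lambda>h. pd CB (0, h *\<^sub>R pd Q wb (t rh)) (x, Q (t rh)))) (at rh)"
   using has_derivative_compose[OF Q_along(1)[of rh wb, unfolded has_vector_derivative_def] partial_has_derivative(1)[OF B.C_has_derivative]] de(2)[OF rh] by (simp add: t_def)
  moreover have "pd CB (0, h *\<^sub>R pd Q wb (t rh)) (x, Q (t rh)) = pd CB (0, pd Q wb (t rh)) (x, Q (t rh)) * h" for h
   using linear_scale[OF B.pdC_linear, of "(x, Q (t rh))" h "(0, pd Q wb (t rh))"] de(2)[OF rh] by simp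
  ultimately have 2: "((\<lambda>rh. CB (x, Q (t rh))) has_real_derivative pd CB (0, pd Q wb (t rh)) (x, Q (t rh))) (at rh)"
   by (simp add: has_field_derivative_def)
  show "(h has_real_derivative h' rh) (at rh)" unfolding h_def h'_def by (rule DERIV_diff[OF 1 2])
  show "h 0 <= h rh" using le[of "si x" "t rh"] de(2)[OF rh] elim t00 Q0 by (simp add: h_def)
 next
  have 1: "((\<lambda>rh. pd CM (0, wb) (si x, t rh)) has_real_derivative pd (pd CM (0, wb)) (0, wb) (si x, t0)) (at 0)"
   unfolding zl by (rule has_derivative_along_line) (use M.pdC_has_derivative[of "(si x, t0)"] elim in simp)
  have 2: "((\<lambda>rh. pd CB (0, pd Q wb (t rh)) (x, Q (t rh))) has_real_derivative
    pd CB (0, pd (pd Q wb) wb t0) (x, xb0) + pd (pd CB (0, Q' wb)) (0, Q' wb) (x, xb0)) (at 0)"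
   using B.moving_pd_derivative[of x "\<lambda>rh. Q (t rh)" "\<lambda>rh. pd Q wb (t rh)" "pd (pd Q wb) wb t0" "Q' wb"] Q_along[of 0 wb] V(2) elim
   by (simp add: t_def Q0)
  show "(h' has_real_derivative H wb x) (at 0)" unfolding h'_def H_def
   using DERIV_diff[OF 1 2] by (simp add: algebra_simps)
 qed
qed

text \<open>At x0 the section in the barred variable is available too. The first order condition in
  direction wb holds along it; differentiating the condition in direction \<open>Q' wb\<close>,
  which that section lifts to wb, gives the vanishing of H.\<close>

lemma H_zero:
 assumes wb: "!!p. mixed_deriv CM (s0, t0) p wb = mixed_deriv CB (x0, xb0) (P' p) (Q' wb)"
 shows "H wb x0 = 0"
proof -
 obtain T where T: "(ta has_derivative T) (at xb0)" "!!v p. mixed_deriv CM (s0, t0) p (T v) = mixed_deriv CB (x0, xb0) (P' p) v"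
  using section2_derivative by metis
 define vb where "vb = Q' wb"
 have Tv: "T vb = wb"
 proof -
  have "mixed_deriv CM (s0, t0) p (T vb - wb) = 0" for p
   by (simp add: bilinear_rsub[OF M.mixed_bilinear[OF base(1)]] T(2) wb vb_def)
  from M.nd2[OF base(1) this] show ?thesis by simp
 qed
 define xi where "xi rh = xb0 + rh *\<^sub>R vb" for rh :: real
 have xi: "(xi has_vector_derivative vb) (at 0)" unfolding xi_def has_vector_derivative_def by (auto intro!: derivative_eq_intros)
 have xi0: "xi 0 = xb0" by (simp add: xi_def)
 have taxi: "((\<lambda>rh. ta (xi rh)) has_derivative (\<lambda>h. h *\<^sub>R wb)) (at 0)"
  using has_derivative_compose[OF xi[unfolded has_vector_derivative_def], of ta T] T(1) linear_scale[OF has_derivative_linear[OF T(1)]] by (simp add: xi0 Tv)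
 have k: "((\<lambda>rh. pd Q wb (ta (xi rh))) has_vector_derivative pd (pd Q wb) wb t0) (at 0)"
  using has_derivative_compose[OF taxi, of "pd Q wb" "\<lambda>w. pd (pd Q wb) w t0"] pdQ_has_derivative[OF V(2)] linear_scale[OF has_derivative_linear[OF pdQ_has_derivative[OF V(2)]]]
  by (simp add: xi0 ta(2) has_vector_derivative_def)
 have R: "((\<lambda>rh. pd CB (0, pd Q wb (ta (xi rh))) (x0, xi rh)) has_real_derivative
   pd CB (0, pd (pd Q wb) wb t0) (x0, xb0) + pd (pd CB (0, vb)) (0, vb) (x0, xb0)) (at 0)"
  using B.moving_pd_derivative[of x0 xi, OF _ k xi] base(2) by (simp add: xi0 ta(2) vb_def)
 have "((\<lambda>rh. (s0, ta (xi rh))) has_derivative (\<lambda>h. (0, h *\<^sub>R wb))) (at 0)"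
  by (intro has_derivative_Pair has_derivative_const taxi)
 from has_derivative_compose[OF this, of "pd CM (0, wb)" "\<lambda>w. pd (pd CM (0, wb)) w (s0, t0)"]
 have "((\<lambda>rh. pd CM (0, wb) (s0, ta (xi rh))) has_derivative (\<lambda>h. pd (pd CM (0, wb)) (0, h *\<^sub>R wb) (s0, t0))) (at 0)"
  using M.pdC_has_derivative[OF base(1)] by (simp add: xi0 ta(2))
 moreover have "pd (pd CM (0, wb)) (0, h *\<^sub>R wb) (s0, t0) = pd (pd CM (0, wb)) (0, wb) (s0, t0) * h" for h
  using linear_scale[OF has_derivative_linear[OF M.pdC_has_derivative[OF base(1), of "(0, wb)"]], of h "(0, wb)"] by simp
 ultimately have L: "((\<lambda>rh. pd CM (0, wb) (s0, ta (xi rh))) has_real_derivative pd (pd CM (0, wb)) (0, wb) (s0, t0)) (at 0)"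
  by (simp add: has_field_derivative_def)
 have "filterlim xi (nhds xb0) (nhds 0)"
  using tendsto_at_iff_tendsto_nhds[of xi 0] xi[THEN has_vector_derivative_continuous] by (simp add: isCont_def xi0)
 from eventually_compose_filterlim[OF section_near(2) this]
 have "\<forall>\<^sub>F rh in nhds 0. pd CM (0, wb) (s0, ta (xi rh)) = pd CB (0, pd Q wb (ta (xi rh))) (x0, xi rh)"
 proof eventually_elim
  case (elim rh)
  then show ?case using contact_derivative_snd[of s0 "ta (xi rh)" wb] U(2) P0 by simp
 qed
 from DERIV_cong_ev[OF refl this refl] L
 have "((\<lambda>rh. pd CB (0, pd Q wb (ta (xi rh))) (x0, xi rh)) has_real_derivative pd (pd CM (0, wb)) (0, wb) (s0, t0)) (at 0)" by simp
 from DERIV_unique[OF this R] show ?thesis by (simp add: H_def si(2) vb_def)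
qed

text \<open>H is nonnegative near x0 and zero there, so its gradient vanishes. This identifies the
  second derivative of Q with \<open>Q' bM - bB\<close> and makes H the difference of the two
  functions from \<open>cross_curvature_formula\<close>, taken along the section. Minimality of H
  then orders their second derivatives, and the factor -2 reverses the order.\<close>

theorem cross_comparison:
 assumes w: "!!q. mixed_deriv CM (s0, t0) w q = mixed_deriv CB (x0, xb0) v (Q' q)"
  and wb: "!!p. mixed_deriv CM (s0, t0) p wb = mixed_deriv CB (x0, xb0) (P' p) vb"
 shows "P' w = v" "Q' wb = vb"
  "curvature_operator (coord_h CM) (s0, t0) ((w, 0), (0, wb)) ((w, 0), (0, wb))
   <= curvature_operator (coord_h CB) (x0, xb0) ((v, 0), (0, vb)) ((v, 0), (0, vb))"
proof -
 obtain T where T: "!!v p. mixed_deriv CM (s0, t0) p (T v) = mixed_deriv CB (x0, xb0) (P' p) v" "!!v. Q' (T v) = v"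
  using section2_derivative by metis
 obtain S where S: "(si has_derivative S) (at x0)" "!!v q. mixed_deriv CM (s0, t0) (S v) q = mixed_deriv CB (x0, xb0) v (Q' q)" "!!v. P' (S v) = v"
  using section1_derivative by metis
 have Sv: "S v = w"
 proof -
  have "mixed_deriv CM (s0, t0) (S v - w) q = 0" for q
   by (simp add: bilinear_lsub[OF M.mixed_bilinear[OF base(1)]] S(2) w)
  from M.nd1[OF base(1) this] show ?thesis by simp
 qed
 have Tv: "T vb = wb"
 proof -
  have "mixed_deriv CM (s0, t0) p (T vb - wb) = 0" for p
   by (simp add: bilinear_rsub[OF M.mixed_bilinear[OF base(1)]] T(1) wb)
  from M.nd2[OF base(1) this] show ?thesis by simp
 qed
 show Pw: "P' w = v" and Qwb: "Q' wb = vb" using S(3)[of v] T(2)[of vb] Sv Tv by simp_all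
 obtain bM where bM: "!!q. mixed_deriv CM (s0, t0) q bM = pd (pd (pd CM (0, wb)) (0, wb)) (q, 0) (s0, t0)"
  "!!p. curvature_operator (coord_h CM) (s0, t0) ((p, 0), (0, wb)) ((p, 0), (0, wb)) =
   - 2 * (pd (pd (pd (pd CM (0, wb)) (0, wb)) (p, 0)) (p, 0) (s0, t0) - pd (pd (pd CM (0, bM)) (p, 0)) (p, 0) (s0, t0))"
  using M.cross_curvature_formula[OF base(1), of wb] by blast
 obtain bB where bB: "!!q. mixed_deriv CB (x0, xb0) q bB = pd (pd (pd CB (0, vb)) (0, vb)) (q, 0) (x0, xb0)"
  "!!p. curvature_operator (coord_h CB) (x0, xb0) ((p, 0), (0, vb)) ((p, 0), (0, vb)) =
   - 2 * (pd (pd (pd (pd CB (0, vb)) (0, vb)) (p, 0)) (p, 0) (x0, xb0) - pd (pd (pd CB (0, bB)) (p, 0)) (p, 0) (x0, xb0))"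
  using B.cross_curvature_formula[OF base(2), of vb] by blast
 define Q2 where "Q2 = pd (pd Q wb) wb t0"
 have Hx: "H wb x = pd (pd CM (0, wb)) (0, wb) (si x, t0) - pd (pd CB (0, vb)) (0, vb) (x, xb0) - pd CB (0, Q2) (x, xb0)" for x
  by (simp add: H_def Q2_def Qwb)
 have H0: "H wb x0 = 0" by (rule H_zero) (simp add: wb Qwb)
 note mB = bilinear_radd[OF B.mixed_bilinear[OF base(2)]] bilinear_rsub[OF B.mixed_bilinear[OF base(2)]]
 \<comment> \<open>The vanishing gradient of H, read through the mixed form of CB: every direction v
   pairs to zero with \<open>Q' bM - bB - Q2\<close>.\<close>
 have e: "Q2 = Q' bM - bB"
 proof -
  have d1: "((\<lambda>x. pd (pd CM (0, wb)) (0, wb) (si x, t0)) has_derivative (\<lambda>v. pd (pd (pd CM (0, wb)) (0, wb)) (S v, 0) (s0, t0))) (at x0)"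
   using has_derivative_compose[OF S(1) partial_has_derivative(2)[of "pd (pd CM (0, wb)) (0, wb)" "\<lambda>w. pd (pd (pd CM (0, wb)) (0, wb)) w (s0, t0)" "si x0" t0]]
    M.pdpdC_has_derivative[OF base(1)] si(2) by simp
  have d2: "((\<lambda>x. pd (pd CB (0, vb)) (0, vb) (x, xb0)) has_derivative (\<lambda>v. pd (pd (pd CB (0, vb)) (0, vb)) (v, 0) (x0, xb0))) (at x0)"
   by (rule partial_has_derivative(2)[OF B.pdpdC_has_derivative[OF base(2)]])
  have d3: "((\<lambda>x. pd CB (0, Q2) (x, xb0)) has_derivative (\<lambda>v. pd (pd CB (0, Q2)) (v, 0) (x0, xb0))) (at x0)"
   by (rule partial_has_derivative(2)[OF B.pdC_has_derivative[OF base(2)]])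
  have hd: "(H wb has_derivative (\<lambda>v. pd (pd (pd CM (0, wb)) (0, wb)) (S v, 0) (s0, t0) - pd (pd (pd CB (0, vb)) (0, vb)) (v, 0) (x0, xb0) - pd (pd CB (0, Q2)) (v, 0) (x0, xb0))) (at x0)"
   by (rule has_derivative_transform_within_open[OF has_derivative_diff[OF has_derivative_diff[OF d1 d2] d3] open_UNIV UNIV_I]) (simp add: Hx)
  have z: "pd (pd (pd CM (0, wb)) (0, wb)) (S v, 0) (s0, t0) - pd (pd (pd CB (0, vb)) (0, vb)) (v, 0) (x0, xb0) - pd (pd CB (0, Q2)) (v, 0) (x0, xb0) = 0" for v
   by (rule fun_cong[OF local_min_derivative_zero[OF hd]]) (use H_nonneg[of wb] H0 in simp)
  have "mixed_deriv CB (x0, xb0) v (Q' bM - bB - Q2) = 0" for v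
   using z[of v] unfolding mB bM(1)[symmetric] bB(1)[symmetric] S(2) B.mixed_eq[OF base(2), of v Q2] by simp
  from B.nd2[OF base(2) this] show ?thesis by simp
 qed
 \<comment> \<open>The section is known to be differentiable once, so the second derivative of H is
   replaced by a second order difference along this quotient, which tends to w.\<close>
 define u where "u h = (si (x0 + h *\<^sub>R v) - s0) /\<^sub>R h" for h :: real
 have ulim: "(u \<longlongrightarrow> w) (at_right 0)"
 proof -
  have "((\<lambda>h. si (x0 + h *\<^sub>R v)) has_derivative (\<lambda>h. S (h *\<^sub>R v))) (at 0)"
   by (rule has_derivative_compose[of "\<lambda>h. x0 + h *\<^sub>R v" "\<lambda>h. h *\<^sub>R v"]) (use S(1) in \<open>auto intro!: derivative_eq_intros\<close>)
  then have "((\<lambda>h. si (x0 + h *\<^sub>R v)) has_vector_derivative w) (at 0)"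
   by (simp add: has_vector_derivative_def linear_scale[OF has_derivative_linear[OF S(1)]] Sv)
  then have "((\<lambda>h. norm (si (x0 + h *\<^sub>R v) - s0 - h *\<^sub>R w) / norm h) \<longlongrightarrow> 0) (at 0)"
   unfolding has_vector_derivative_def has_derivative_at by (simp add: si(2))
  then have "((\<lambda>h. norm (si (x0 + h *\<^sub>R v) - s0 - h *\<^sub>R w) / norm h) \<longlongrightarrow> 0) (at_right 0)"
   by (rule tendsto_within_subset) simp
  then have "((\<lambda>h. norm (u h - w)) \<longlongrightarrow> 0) (at_right 0)"
  proof (rule Lim_transform_eventually)
   show "\<forall>\<^sub>F h in at_right 0. norm (si (x0 + h *\<^sub>R v) - s0 - h *\<^sub>R w) / norm h = norm (u h - w)"
    using eventually_at_right_less[of "0::real"]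
   proof eventually_elim
    case (elim h)
    have "u h - w = (si (x0 + h *\<^sub>R v) - s0 - h *\<^sub>R w) /\<^sub>R h" using elim by (simp add: u_def scaleR_diff_right)
    then show ?case using elim by (simp add: divide_inverse mult.commute)
   qed
  qed
  then show ?thesis by (rule LIM_zero_cancel[OF tendsto_norm_zero_cancel])
 qed
 have su: "si (x0 + h *\<^sub>R v) = s0 + h *\<^sub>R u h" if "h > 0" for h using that by (simp add: u_def)
 let ?AM = "pd (pd CM (0, wb)) (0, wb)" and ?BM = "pd CM (0, bM)" and ?AB = "pd (pd CB (0, vb)) (0, vb)" and ?BB = "pd CB (0, bB)"
 have uM: "((\<lambda>h. (u h, 0::'e)) \<longlongrightarrow> (w, 0)) (at_right 0)" by (intro tendsto_Pair ulim tendsto_const)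
 have uB: "((\<lambda>h::real. (v, 0::'f)) \<longlongrightarrow> (v, 0)) (at_right 0)" by (rule tendsto_const)
 note l1 = second_order_limit[OF M.pdpdC2[of "(0, wb)" "(0, wb)"] M.S_open base(1) uM]
 note l2 = second_order_limit[OF M.pdC2[of "(0, bM)"] M.S_open base(1) uM]
 note l3 = second_order_limit[OF B.pdpdC2[of "(0, vb)" "(0, vb)"] B.S_open base(2) uB]
 note l4 = second_order_limit[OF B.pdC2[of "(0, bB)"] B.S_open base(2) uB]
 note lim = tendsto_diff[OF tendsto_diff[OF l1 l2] tendsto_diff[OF l3 l4]]
 have "filterlim (\<lambda>h. x0 + h *\<^sub>R v) (nhds x0) (at_right 0)"
 proof -
  have "((\<lambda>h. x0 + h *\<^sub>R v) \<longlongrightarrow> x0 + 0 *\<^sub>R v) (at_right 0)" by (intro tendsto_intros)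
  then show ?thesis by simp
 qed
 note ev = eventually_compose_filterlim[OF eventually_conj[OF section_near(1) H_nonneg[of wb]] this]
 have lin: "linear (\<lambda>v. pd CB (0, v) (x, xb0))" if "(x, xb0) \<in> SB" for x
  using linear_compose[of "\<lambda>v. (0::'f, v)" "\<lambda>w. pd CB w (x, xb0)"] B.pdC_linear[OF that] by (simp add: comp_def linear_iff)
 \<comment> \<open>The contact condition in direction bM holds at every point of the section; it
   trades the derivative of CB along \<open>Q' bM\<close> for that of CM along bM.\<close>
 have HH: "H wb x = ?AM (si x, t0) - ?BM (si x, t0) - (?AB (x, xb0) - ?BB (x, xb0))"
  if "P (si x) = x \<and> CM (si x, t0) = CB (x, xb0) \<and> si x \<in> U \<and> (si x, t0) \<in> SM \<and> (x, xb0) \<in> SB" for x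
  using contact_derivative_snd[of "si x" t0 bM] V(2) Q0 that linear_diff[OF lin, of x "Q' bM" bB] unfolding Hx e by simp
 have H00: "?AM (s0, t0) - ?BM (s0, t0) - (?AB (x0, xb0) - ?BB (x0, xb0)) = 0"
  using HH[OF eventually_nhds_x_imp_x[OF section_near(1)]] H0 si(2) by simp
 have pos: "0 <= (pd (pd ?AM (w, 0)) (w, 0) (s0, t0) / 2 - pd (pd ?BM (w, 0)) (w, 0) (s0, t0) / 2) - (pd (pd ?AB (v, 0)) (v, 0) (x0, xb0) / 2 - pd (pd ?BB (v, 0)) (v, 0) (x0, xb0) / 2)"
 proof (rule tendsto_lowerbound[OF lim])
  show "\<forall>\<^sub>F h in at_right 0. 0 <= (?AM ((s0, t0) + h *\<^sub>R (u h, 0)) - ?AM (s0, t0) - h * pd ?AM (u h, 0) (s0, t0)) / h\<^sup>2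
    - (?BM ((s0, t0) + h *\<^sub>R (u h, 0)) - ?BM (s0, t0) - h * pd ?BM (u h, 0) (s0, t0)) / h\<^sup>2
    - ((?AB ((x0, xb0) + h *\<^sub>R (v, 0)) - ?AB (x0, xb0) - h * pd ?AB (v, 0) (x0, xb0)) / h\<^sup>2
     - (?BB ((x0, xb0) + h *\<^sub>R (v, 0)) - ?BB (x0, xb0) - h * pd ?BB (v, 0) (x0, xb0)) / h\<^sup>2)"
   using ev eventually_at_right_less[of "0::real"]
  proof eventually_elim
   case (elim h)
   \<comment> \<open>The first order terms, including the one along the step-dependent
     \<open>u h\<close>, cancel exactly by the defining equations of bM and bB.\<close>
   have e1: "pd ?AM (u h, 0) (s0, t0) = pd ?BM (u h, 0) (s0, t0)" unfolding bM(1)[symmetric] M.mixed_eq[OF base(1)] ..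
   have e2: "pd ?AB (v, 0) (x0, xb0) = pd ?BB (v, 0) (x0, xb0)" unfolding bB(1)[symmetric] B.mixed_eq[OF base(2)] ..
   have "0 <= ?AM ((s0, t0) + h *\<^sub>R (u h, 0)) - ?BM ((s0, t0) + h *\<^sub>R (u h, 0)) - (?AB ((x0, xb0) + h *\<^sub>R (v, 0)) - ?BB ((x0, xb0) + h *\<^sub>R (v, 0)))"
    using elim(1) HH[of "x0 + h *\<^sub>R v"] su[OF elim(2)] by simp
   then have "0 <= ((?AM ((s0, t0) + h *\<^sub>R (u h, 0)) - ?AM (s0, t0) - h * pd ?AM (u h, 0) (s0, t0))
    - (?BM ((s0, t0) + h *\<^sub>R (u h, 0)) - ?BM (s0, t0) - h * pd ?BM (u h, 0) (s0, t0))
    - ((?AB ((x0, xb0) + h *\<^sub>R (v, 0)) - ?AB (x0, xb0) - h * pd ?AB (v, 0) (x0, xb0))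
     - (?BB ((x0, xb0) + h *\<^sub>R (v, 0)) - ?BB (x0, xb0) - h * pd ?BB (v, 0) (x0, xb0))))"
    using H00 unfolding e1 e2 by linarith
   from divide_nonneg_nonneg[OF this zero_le_power2[of h]] show ?case by (simp only: diff_divide_distrib)
  qed
 qed simp
 have half: "- 2 * (a - b) <= - 2 * (c - d)" if "0 <= (a / 2 - b / 2) - (c / 2 - d / 2)" for a b c d :: real
  using that by simp
 show "curvature_operator (coord_h CM) (s0, t0) ((w, 0), (0, wb)) ((w, 0), (0, wb))
   <= curvature_operator (coord_h CB) (x0, xb0) ((v, 0), (0, vb)) ((v, 0), (0, vb))"
  unfolding bM(2) bB(2) by (rule half[OF pos])
qed

end

section \<open>Sections of a submersion and the comparison\<close>

locale submersion_costs = submersion_manifolds AM gM AB gB \<pi> + M: cost_manifold AM gM f + B: cost_manifold AB gB f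
 for AM :: "('m::{t2_space,second_countable_topology}, 'e::euclidean_space) chart set"
  and gM :: "'m => 'e => 'e => real"
  and AB :: "('b::{t2_space,second_countable_topology}, 'f::euclidean_space) chart set"
  and gB :: "'b => 'f => 'f => real"
  and \<pi> :: "'m => 'b" and f :: "real => real"
begin

text \<open>Minimizing paths from yb to y and to l both end in the fibre over x. Minus the distance
  of the projection from x calibrates them, because \<pi> does not increase distances, and this
  function is differentiable at yb; so the paths cannot branch at yb. For x = xb both points are yb
  itself.\<close>

lemma equidistant_unique:
 assumes y: "\<pi> y = x" "\<pi> yb = xb" "M.d y yb = B.d x xb"
  and diff: "x ~= xb ==> (\<lambda>z. B.d x (chart_inv (chart_at AB xb) z)) differentiable (at (coords AB xb))"
  and l: "\<pi> l = x" "M.d l yb = B.d x xb"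
 shows "l = y"
proof (cases "x = xb")
 case True
 then have "M.d y yb = 0" "M.d l yb = 0" unfolding y(3) l(2) by (simp_all only: B.d_self)
 then have "y = yb" "l = yb" by (simp_all only: M.d_eq_0_iff)
 then show ?thesis by simp
next
 case False
 define L where "L = B.d x xb"
 have L: "M.d yb y = L" "M.d yb l = L" "L \<ge> 0"
  unfolding L_def M.d_sym[of yb y] M.d_sym[of yb l] by (rule y(3) l(2) B.d_nonneg)+
 obtain al where al: "al 0 = yb" "al L = y" "!!s t. s \<in> {0..L} ==> t \<in> {0..L} ==> M.d (al s) (al t) = \<bar>s - t\<bar>"
  using M.metric_geodesic_exists[of yb y] unfolding L(1) by metis
 obtain be where be: "be 0 = yb" "be L = l" "!!s t. s \<in> {0..L} ==> t \<in> {0..L} ==> M.d (be s) (be t) = \<bar>s - t\<bar>"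
  using M.metric_geodesic_exists[of yb l] unfolding L(2) by metis
 define e where "e z = - B.d x (\<pi> z)" for z
 have min: "M.d (ga s) z + e z \<ge> M.d (ga s) (ga 0) + e (ga 0)"
  if ga: "ga 0 = yb" "\<pi> (ga L) = x" "!!s t. s \<in> {0..L} ==> t \<in> {0..L} ==> M.d (ga s) (ga t) = \<bar>s - t\<bar>" and s: "s \<in> {0..L}" for ga s z
 proof -
  have "M.d (ga s) (ga 0) = s" "M.d (ga L) (ga s) = L - s" using ga(3)[OF s, of 0] ga(3)[of L s] s by auto
  moreover have "B.d x (\<pi> z) <= M.d (ga L) (ga s) + M.d (ga s) z"
   using B.d_triangle[of x "\<pi> z" "\<pi> (ga s)"] \<pi>_dist_le[of "ga L" "ga s", unfolded ga(2)] \<pi>_dist_le[of "ga s" z] by linarith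
  moreover have "e (ga 0) = - L" using ga(1) y(2) by (simp add: e_def L_def)
  ultimately show ?thesis unfolding e_def[of z] by linarith
 qed
 have dif: "(\<lambda>z. e (chart_inv (chart_at AM yb) z)) differentiable (at (coords AM yb))"
 proof -
  obtain E where E: "((\<lambda>z. B.d x (chart_inv (chart_at AB xb) z)) has_derivative E) (at (coords AB xb))"
   using diff[OF False] unfolding differentiable_def by blast
  have "((\<lambda>z. - B.d x (chart_inv (chart_at AB xb) (\<pi>c yb z))) has_derivative (\<lambda>h. - E (D yb h))) (at (coords AM yb))"
   by (rule has_derivative_minus[OF has_derivative_compose[OF \<pi>c_has_derivative]]) (use E y(2) in \<open>simp add: \<pi>c_coords\<close>)
  then have "((\<lambda>z. e (chart_inv (chart_at AM yb) z)) has_derivative (\<lambda>h. - E (D yb h))) (at (coords AM yb))"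
   by (rule has_derivative_transform_within_open[OF _ \<pi>c_dom_open coords_in_\<pi>c_dom]) (use \<pi>c_eq(3)[of _ yb] y(2) in \<open>simp add: e_def\<close>)
  then show ?thesis by (rule differentiableI)
 qed
 have "al L = be L"
 proof (rule M.geodesic_unique_continuation[OF L(3) al(3) be(3)])
  show "al 0 = be 0" using al(1) be(1) by simp
  show "(\<lambda>z. e (chart_inv (chart_at AM (al 0)) z)) differentiable (at (coords AM (al 0)))" using dif al(1) by simp
  show "M.d (al s) (al 0) + e (al 0) <= M.d (al s) z + e z" if "s \<in> {0..L}" for s z
   by (rule min[OF al(1) _ al(3) that]) (simp_all add: al(2) y(1))
  show "M.d (be s) (al 0) + e (al 0) <= M.d (be s) z + e z" if "s \<in> {0..L}" for s z
   unfolding al(1) be(1)[symmetric] by (rule min[OF be(1) _ be(3) that]) (simp_all add: be(2) l(1))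
 qed
 then show ?thesis using al(2) be(2) by simp
qed

text \<open>Only the value over x is prescribed; the others are arbitrary choices from
  \<open>equidistant\<close>. They are continuous at x because every cluster point lies over x at
  the right distance from yb and so equals y by \<open>equidistant_unique\<close>.\<close>

lemma section_exists:
 assumes y: "\<pi> y = x" "\<pi> yb = xb" "M.d y yb = B.d x xb"
  and diff: "x ~= xb ==> (\<lambda>z. B.d x (chart_inv (chart_at AB xb) z)) differentiable (at (coords AB xb))"
 obtains si where "!!x'. \<pi> (si x') = x'" "!!x'. M.d (si x') yb = B.d x' xb" "si x = y" "isCont si x"
proof -
 have "\<exists>y'. \<pi> y' = x' \<and> M.d y' yb = B.d x' xb \<and> (x' = x --> y' = y)" for x'
 proof (cases "x' = x")
  case True then show ?thesis using y by (intro exI[of _ y]) simp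
 next
  case False
  obtain y' where "\<pi> y' = x'" "M.d yb y' = B.d (\<pi> yb) x'" using equidistant by blast
  then show ?thesis using False y(2) by (intro exI[of _ y']) (simp add: M.d_sym[of y' yb] B.d_sym[of x' xb])
 qed
 then obtain si where si: "!!x'. \<pi> (si x') = x'" "!!x'. M.d (si x') yb = B.d x' xb" "si x = y" by metis
 have "isCont si x" unfolding isCont_def tendsto_at_iff_sequentially si(3) comp_def
 proof (intro allI impI)
  fix X assume X: "X \<longlonglongrightarrow> x"
  have dl: "(\<lambda>n. B.d (X n) xb) \<longlonglongrightarrow> B.d x xb" by (rule B.tendsto_d[OF X tendsto_const])
  show "(\<lambda>n. si (X n)) \<longlonglongrightarrow> y"
  proof (rule tendsto_unique_cluster[OF M.compact_cb[of yb "B.d x xb + 1"]])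
   have "\<forall>\<^sub>F n in sequentially. B.d (X n) xb < B.d x xb + 1" by (rule order_tendstoD(2)[OF dl]) simp
   then show "\<forall>\<^sub>F n in sequentially. si (X n) \<in> M.cb yb (B.d x xb + 1)"
    by eventually_elim (simp add: M.cb_def M.d_sym[of yb] si(2))
   fix r G l assume r: "strict_mono (r :: nat => nat)" "G ~= bot" "G <= sequentially" "((\<lambda>n. si (X (r n))) \<longlongrightarrow> l) G"
   have Xr: "((\<lambda>n. X (r n)) \<longlongrightarrow> x) G" by (rule tendsto_subseq_filter[OF X r(1,3)])
   show "l = y"
   proof (rule equidistant_unique[OF y diff])
    have "((\<lambda>n. \<pi> (si (X (r n)))) \<longlongrightarrow> \<pi> l) G" by (rule isCont_tendsto_compose[OF \<pi>_cont r(4)])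
    then show "\<pi> l = x" using tendsto_unique[OF r(2) _ Xr] by (simp add: si(1))
    have "((\<lambda>n. M.d (si (X (r n))) yb) \<longlongrightarrow> M.d l yb) G" by (rule M.tendsto_d[OF r(4) tendsto_const])
    then show "M.d l yb = B.d x xb" using tendsto_unique[OF r(2) _ B.tendsto_d[OF Xr tendsto_const]] by (simp add: si(2))
   qed
  qed
 qed
 with si that show ?thesis by blast
qed

lemma coord_section:
 assumes si: "!!x'. \<pi> (si x') = x'" "si (\<pi> y) = y" "isCont si (\<pi> y)"
 defines "s \<equiv> \<lambda>z. snd (chart_at AM y) (si (chart_inv (chart_at AB (\<pi> y)) z))"
 shows "isCont s (coords AB (\<pi> y))" "s (coords AB (\<pi> y)) = coords AM y"
  "\<forall>\<^sub>F z in nhds (coords AB (\<pi> y)). \<pi>c y (s z) = z \<and> chart_inv (chart_at AM y) (s z) = si (chart_inv (chart_at AB (\<pi> y)) z)"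
proof -
 let ?l = "chart_at AB (\<pi> y)" and ?k = "chart_at AM y"
 have inv: "chart_inv ?l (coords AB (\<pi> y)) = \<pi> y" unfolding coords_def by (rule B.chart_inv_eq[OF B.chart_at])
 have c1: "isCont (chart_inv ?l) (coords AB (\<pi> y))" by (rule B.chart_isCont(2)[OF B.chart_at(1) B.coords_in])
 have c2: "isCont (\<lambda>z. si (chart_inv ?l z)) (coords AB (\<pi> y))" by (rule isCont_o2[OF c1]) (simp add: inv si(3))
 show "isCont s (coords AB (\<pi> y))" unfolding s_def
  by (rule isCont_o2[OF c2]) (simp add: inv si(2) M.chart_isCont(1)[OF M.chart_at])
 show "s (coords AB (\<pi> y)) = coords AM y" unfolding s_def inv si(2) by (simp add: coords_def)
 have "\<forall>\<^sub>F z in nhds (coords AB (\<pi> y)). z \<in> chart_image ?l"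
  by (rule eventually_nhds_in_open[OF B.chart_open(2)[OF B.chart_at(1)] B.coords_in])
 moreover have "\<forall>\<^sub>F z in nhds (coords AB (\<pi> y)). si (chart_inv ?l z) \<in> fst ?k"
  by (rule isCont_eventually_in[OF c2 M.chart_open(1)[OF M.chart_at(1)]]) (simp add: inv si(2) M.chart_at(2))
 ultimately show "\<forall>\<^sub>F z in nhds (coords AB (\<pi> y)). \<pi>c y (s z) = z \<and> chart_inv ?k (s z) = si (chart_inv ?l z)"
 proof eventually_elim
  case (elim z)
  have "chart_inv ?k (s z) = si (chart_inv ?l z)" unfolding s_def by (rule M.chart_inv_eq[OF M.chart_at(1) elim(2)])
  then show ?case using B.chart_eq[OF B.chart_at(1) elim(1)] by (simp add: \<pi>c_def si(1))
 qed
qed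

lemma cross_curvature_comparison:
 assumes dist: "M.d y yb = B.d (\<pi> y) (\<pi> yb)" and NB: "(\<pi> y, \<pi> yb) \<notin> cut_locus AB gB" and NM: "(y, yb) \<notin> cut_locus AM gM"
  and w: "!!q. mixed_form AM M.c (y, yb) w q = mixed_form AB B.c (\<pi> y, \<pi> yb) v (D yb q)"
  and wb: "!!p. mixed_form AM M.c (y, yb) p wb = mixed_form AB B.c (\<pi> y, \<pi> yb) (D y p) vb"
 shows "D y w = v" "D yb wb = vb"
  "cross_curvature AM M.c (y, yb) w wb <= cross_curvature AB B.c (\<pi> y, \<pi> yb) v vb"
proof -
 have N0M: "(y, yb) \<in> M.N0" and N0B: "(\<pi> y, \<pi> yb) \<in> B.N0" by (rule M.not_cut_imp_N0[OF NM] B.not_cut_imp_N0[OF NB])+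
 let ?k = "chart_at AM y" and ?kb = "chart_at AM yb" and ?l = "chart_at AB (\<pi> y)" and ?lb = "chart_at AB (\<pi> yb)"
 let ?CM = "coord_cost ?k ?kb M.c" and ?CB = "coord_cost ?l ?lb B.c"
 let ?s0 = "coords AM y" and ?t0 = "coords AM yb" and ?x0 = "coords AB (\<pi> y)" and ?xb0 = "coords AB (\<pi> yb)"
 have mfM: "mixed_form AM M.c (y, yb) = mixed_deriv ?CM (?s0, ?t0)" and mfB: "mixed_form AB B.c (\<pi> y, \<pi> yb) = mixed_deriv ?CB (?x0, ?xb0)"
  by (simp_all add: mixed_form_def)
 have inM: "(?s0, ?t0) \<in> M.SS ?k ?kb" unfolding coords_def by (rule M.SS_in[OF M.chart_at(1) M.chart_at(1) M.chart_at(2) M.chart_at(2) N0M])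
 have inB: "(?x0, ?xb0) \<in> B.SS ?l ?lb" unfolding coords_def by (rule B.SS_in[OF B.chart_at(1) B.chart_at(1) B.chart_at(2) B.chart_at(2) N0B])
 obtain SM where SM: "(?s0, ?t0) \<in> SM" "mixed_nondegenerate ?CM SM"
  using nondegenerate_near[OF M.CC_C4[OF M.chart_at(1) M.chart_at(1)] M.SS_open[OF M.chart_at(1) M.chart_at(1)] inM]
   M.mixed_form_nondegenerate(1,2)[OF N0M] unfolding mfM by metis
 obtain SB where SB: "(?x0, ?xb0) \<in> SB" "mixed_nondegenerate ?CB SB"
  using nondegenerate_near[OF B.CC_C4[OF B.chart_at(1) B.chart_at(1)] B.SS_open[OF B.chart_at(1) B.chart_at(1)] inB]
   B.mixed_form_nondegenerate(1,2)[OF N0B] unfolding mfB by metis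
 have inv: "chart_inv ?k ?s0 = y" "chart_inv ?kb ?t0 = yb" "chart_inv ?l ?x0 = \<pi> y" "chart_inv ?lb ?xb0 = \<pi> yb"
  unfolding coords_def by (rule M.chart_inv_eq[OF M.chart_at] B.chart_inv_eq[OF B.chart_at])+
 obtain si where si: "!!x'. \<pi> (si x') = x'" "!!x'. M.d (si x') yb = B.d x' (\<pi> yb)" "si (\<pi> y) = y" "isCont si (\<pi> y)"
  using section_exists[OF refl refl dist B.dist_differentiable[OF N0B]] by blast
 \<comment> \<open>The section in the second variable arises by exchanging the two points; then the
   distance from \<pi> yb has to be differentiable at \<pi> y.\<close>
 have diff2: "(\<lambda>z. B.d (\<pi> yb) (chart_inv ?l z)) differentiable (at ?x0)" if "\<pi> yb ~= \<pi> y"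
  using differentiableI[OF B.dist_has_derivative_fst[OF N0B that[symmetric] B.chart_at B.chart_at]] by (simp add: B.d_sym coords_def)
 have dist2: "M.d yb y = B.d (\<pi> yb) (\<pi> y)" using dist M.d_sym[of yb y] B.d_sym[of "\<pi> yb" "\<pi> y"] by linarith
 obtain ta where ta: "!!x'. \<pi> (ta x') = x'" "!!x'. M.d (ta x') y = B.d x' (\<pi> y)" "ta (\<pi> yb) = yb" "isCont ta (\<pi> yb)"
  using section_exists[OF refl refl dist2 diff2] by blast
 define s where "s z = snd ?k (si (chart_inv ?l z))" for z
 define t where "t z = snd ?kb (ta (chart_inv ?lb z))" for z
 note cs = coord_section[OF si(1,3,4), folded s_def] and ct = coord_section[OF ta(1,3,4), folded t_def]
 interpret K: cost_contact ?CM SM ?CB SB "\<pi>c y" "\<pi>c yb" "\<pi>c_dom y" "\<pi>c_dom yb" "D y" ?s0 ?t0 ?x0 ?xb0 s t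
 proof (intro cost_contact.intro SM(2) SB(2) cost_contact_axioms.intro \<pi>c_has_derivative \<pi>c_dom_open coords_in_\<pi>c_dom \<pi>c_coords \<pi>c_smooth SM(1) SB(1) cs(1,2) ct(1,2))
  fix a b assume a: "a \<in> \<pi>c_dom y" and b: "b \<in> \<pi>c_dom yb"
  show "?CB (\<pi>c y a, \<pi>c yb b) <= ?CM (a, b)"
   unfolding M.coord_cost_eq B.coord_cost_eq \<pi>c_eq(3)[OF a] \<pi>c_eq(3)[OF b] by (rule M.f_le[OF B.d_nonneg \<pi>_dist_le])
 next
  show "\<forall>\<^sub>F z in nhds ?x0. \<pi>c y (s z) = z \<and> ?CM (s z, ?t0) = ?CB (z, ?xb0)"
   using cs(3) by eventually_elim (simp add: M.coord_cost_eq B.coord_cost_eq inv si(2))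
  show "\<forall>\<^sub>F z in nhds ?xb0. \<pi>c yb (t z) = z \<and> ?CM (?s0, t z) = ?CB (?x0, z)"
   using ct(3) by eventually_elim (simp add: M.coord_cost_eq B.coord_cost_eq inv ta(2) M.d_sym[of y] B.d_sym[of "\<pi> y"])
 qed
 note K = K.cross_comparison[OF w[unfolded mfM mfB differential_eq[of yb]] wb[unfolded mfM mfB]]
 show "D y w = v" by (rule K(1))
 show "D yb wb = vb" unfolding differential_eq by (rule K(2))
 show "cross_curvature AM M.c (y, yb) w wb <= cross_curvature AB B.c (\<pi> y, \<pi> yb) v vb"
  using K(3) by (simp add: cross_curvature_def)
qed

end

text \<open>Pairing with a horizontal vector sees only the projection, by
  \<open>hlift_inner\<close>; so the lift of a covector is its pullback under the differential. The
  lifting conditions of the theorem thereby become equations between mixed forms.\<close>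

lemma (in submersion_manifolds) horizontal_lift_covector_iff:
 assumes al: "linear al"
 shows "horizontal_lift_covector AM gM AB gB \<pi> y al be \<longleftrightarrow> (\<forall>p. be p = al (D y p))"
proof
 assume "horizontal_lift_covector AM gM AB gB \<pi> y al be"
 then show "\<forall>p. be p = al (D y p)" unfolding horizontal_lift_covector_def using hlift_inner by blast
next
 assume be: "\<forall>p. be p = al (D y p)"
 have "u = 0" if "!!q. gB (\<pi> y) u q = 0" for u using B.g_pos[of u "\<pi> y"] that[of u] by force
 from form_represent[OF B.g_bilinear this al] obtain v where v: "!!q. gB (\<pi> y) v q = al q" by blast
 obtain u where u: "horizontal_lift_vector AM gM AB \<pi> y v u" using hlift_exists by blast
 show "horizontal_lift_covector AM gM AB gB \<pi> y al be" unfolding horizontal_lift_covector_def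
  by (intro exI[of _ v] exI[of _ u] conjI u) (auto simp: fun_eq_iff v be hlift_inner[OF u])
qed

theorem theorem4p5:
  fixes AM :: "('m::{t2_space,second_countable_topology}, 'e::euclidean_space) chart set"
    and gM :: "'m \<Rightarrow> 'e \<Rightarrow> 'e \<Rightarrow> real"
    and AB :: "('b::{t2_space,second_countable_topology}, 'f::euclidean_space) chart set"
    and gB :: "'b \<Rightarrow> 'f \<Rightarrow> 'f \<Rightarrow> real"
    and \<pi> :: "'m \<Rightarrow> 'b"
    and f :: "real \<Rightarrow> real"
    and cM :: "'m \<times> 'm \<Rightarrow> real" and cB :: "'b \<times> 'b \<Rightarrow> real"
    and NM :: "('m \<times> 'm) set" and NB :: "('b \<times> 'b) set"
    and x xb :: 'b and y yb :: 'm and v vb :: 'f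
  assumes "complete_riemannian_manifold AM gM"
    and "complete_riemannian_manifold AB gB"
    and "riemannian_submersion AM gM AB gB \<pi>"
    and "smooth_on f UNIV" and "strictly_convex f" and "strict_mono_on {0..} f"
    and "cM = dist_cost AM gM f" and "cB = dist_cost AB gB f"
    and "NM = - cut_locus AM gM" and "NB = - cut_locus AB gB"
    and "C_k_cost 4 AM NM cM" and "nondegenerate_cost AM NM cM"
    and "C_k_cost 4 AB NB cB" and "nondegenerate_cost AB NB cB"
    and "(x, xb) \<in> NB" and "(y, yb) \<in> NM"
    and "horizontal_lift_pair AM gM AB gB \<pi> (x, xb) (y, yb)"
  shows "(\<exists>w wb.
      differential AM AB \<pi> y w = v \<and> differential AM AB \<pi> yb wb = vb \<and>
      cost_metric AB cB (x, xb) (v, vb) (v, vb) = cost_metric AM cM (y, yb) (w, wb) (w, wb) \<and>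
      cross_curvature AB cB (x, xb) v vb \<ge> cross_curvature AM cM (y, yb) w wb) \<and>
    (\<exists>w wb.
      horizontal_lift_covector AM gM AB gB \<pi> y
        (\<lambda>p. - DbarD AB cB (x, xb) vb p) (\<lambda>p. - DbarD AM cM (y, yb) wb p) \<and>
      horizontal_lift_covector AM gM AB gB \<pi> yb
        (\<lambda>p. - DDbar AB cB (x, xb) v p) (\<lambda>p. - DDbar AM cM (y, yb) w p)) \<and>
    (\<forall>w wb.
      horizontal_lift_covector AM gM AB gB \<pi> y
        (\<lambda>p. - DbarD AB cB (x, xb) vb p) (\<lambda>p. - DbarD AM cM (y, yb) wb p) \<and>
      horizontal_lift_covector AM gM AB gB \<pi> yb
        (\<lambda>p. - DDbar AB cB (x, xb) v p) (\<lambda>p. - DDbar AM cM (y, yb) w p) \<longrightarrow>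
      differential AM AB \<pi> y w = v \<and> differential AM AB \<pi> yb wb = vb \<and>
      cost_metric AB cB (x, xb) (v, vb) (v, vb) = cost_metric AM cM (y, yb) (w, wb) (w, wb) \<and>
      cross_curvature AB cB (x, xb) v vb \<ge> cross_curvature AM cM (y, yb) w wb)"
proof -
  note c = assms(7,8)
  interpret S: submersion_costs AM gM AB gB \<pi> f
    by unfold_locales (use assms in \<open>auto simp: complete_riemannian_manifold_def\<close>)
  note lift = S.lift_pair_dist[OF assms(17)]
  have NM: "(y, yb) \<notin> cut_locus AM gM" and NB: "(\<pi> y, \<pi> yb) \<notin> cut_locus AB gB" using assms(9,10,15,16) lift(1,2) by auto
  have dist: "S.M.d y yb = S.B.d (\<pi> y) (\<pi> yb)" using lift by simp
  have N0M: "(y, yb) \<in> S.M.N0" and N0B: "(\<pi> y, \<pi> yb) \<in> S.B.N0" by (rule S.M.not_cut_imp_N0[OF NM] S.B.not_cut_imp_N0[OF NB])+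
  have x: "x = \<pi> y" "xb = \<pi> yb" using lift by simp_all
  let ?mM = "mixed_form AM cM (y, yb)" and ?mB = "mixed_form AB cB (x, xb)"
  have bM: "bilinear ?mM" and bB: "bilinear ?mB"
    unfolding c x by (rule S.M.mixed_form_bilinear[OF N0M] S.B.mixed_form_bilinear[OF N0B])+
  have linB: "linear (?mB u)" "linear (\<lambda>p. ?mB p u)" for u using bB by (auto simp: bilinear_def)
  have cov1: "horizontal_lift_covector AM gM AB gB \<pi> y (\<lambda>p. - DbarD AB cB (x, xb) vb p) (\<lambda>p. - DbarD AM cM (y, yb) wb p)
      \<longleftrightarrow> (\<forall>p. ?mM p wb = ?mB (S.D y p) vb)" for wb
    using S.horizontal_lift_covector_iff[OF linear_compose_neg[OF linB(2)], of y vb] by (simp add: DbarD_def)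
  have cov2: "horizontal_lift_covector AM gM AB gB \<pi> yb (\<lambda>p. - DDbar AB cB (x, xb) v p) (\<lambda>p. - DDbar AM cM (y, yb) w p)
      \<longleftrightarrow> (\<forall>q. ?mM w q = ?mB v (S.D yb q))" for w
    using S.horizontal_lift_covector_iff[OF linear_compose_neg[OF linB(1)], of yb v] by (simp add: DDbar_def)
  have main: "S.D y w = v \<and> S.D yb wb = vb \<and>
      cost_metric AB cB (x, xb) (v, vb) (v, vb) = cost_metric AM cM (y, yb) (w, wb) (w, wb) \<and>
      cross_curvature AB cB (x, xb) v vb \<ge> cross_curvature AM cM (y, yb) w wb"
    if wb: "\<forall>p. ?mM p wb = ?mB (S.D y p) vb" and w: "\<forall>q. ?mM w q = ?mB v (S.D yb q)" for w wb
  proof -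
    note K = S.cross_curvature_comparison[OF dist NB NM, folded c x, OF w[rule_format] wb[rule_format]]
    \<comment> \<open>Both metrics evaluate to minus a mixed form. Inserting wb into the equation
      for w gives \<open>?mM w wb = ?mB v (S.D yb wb)\<close>, and \<open>S.D yb wb\<close> is
      vb.\<close>
    have "cost_metric AB cB (x, xb) (v, vb) (v, vb) = - ?mB v vb" "cost_metric AM cM (y, yb) (w, wb) (w, wb) = - ?mM w wb"
      by (simp_all add: cost_metric_def coord_h_def mixed_form_def)
    then show ?thesis using K w by simp
  qed
  \<comment> \<open>The two lifting equations decouple, one determining w and the other wb; each is
    uniquely solvable because the mixed form of cM is nondegenerate in the corresponding
    argument.\<close>
  have "\<exists>!w. \<forall>q. ?mM w q = ?mB v (S.D yb q)"
    using form_represent[OF bM S.M.mixed_form_nondegenerate(1)[OF N0M, folded c] linear_compose[OF S.D_linear linB(1), unfolded comp_def]] by blast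
  then obtain w where w: "\<forall>q. ?mM w q = ?mB v (S.D yb q)" by blast
  have bM': "bilinear (\<lambda>u p. ?mM p u)" using bM by (simp add: bilinear_def)
  have "\<exists>!wb. \<forall>p. ?mM p wb = ?mB (S.D y p) vb"
    using form_represent[OF bM' S.M.mixed_form_nondegenerate(2)[OF N0M, folded c] linear_compose[OF S.D_linear linB(2), unfolded comp_def]] by blast
  then obtain wb where wb: "\<forall>p. ?mM p wb = ?mB (S.D y p) vb" by blast
  show ?thesis unfolding cov1 cov2 using main w wb by blast
qed

end
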